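(* Let $(\mathbb{X},\lambda)$ be a $\sigma$-finite measure space and let $\eta$ be a Poisson measure on $\mathbb{X}$ with intensity measure $\lambda$. Let $m\ge 1$ and let $F=(F_1,\dots,F_m)$ be an $\mathbb{R}^m$-valued random vector such that for each $1\le i\le m$, $F_i\in L^2(\mathbb{P}_\eta)\cap \operatorname{dom} D$ and $\mathbb{E}F_i=0$. Let $C=(C_{ij})_{1\le i,j\le m}$ be a symmetric positive-semidefinite real matrix and let $X\sim\mathcal{N}(0,C)$. For $p,q\in[1,2]$ define (as elements of $[0,\infty]$) \begin{align*} \zeta_1^{(p)} &:= \sum_{i,j=1}^m \left|C_{ij}-\operatorname{Cov}(F_i,F_j)\right|,\\ \zeta_2^{(p)} &:= 2^{2/p-1}\sum_{i,j=1}^m\left(\int_{\mathbb{X}}\left(\int_{\mathbb{X}}\mathbb{E}\left[|D^{(2)}_{x,y}F_i|^{2p}\right]^{1/(2p)}\mathbb{E}\left[|D^{(2)}_{x,y}F_j|^{2p}\right]^{1/(2p)}\lambda(dx)\right)^p\lambda(dy)\right)^{1/p},\\ \zeta_3^{(p)} &:= 2^{2/p}\sum_{i,j=1}^m\left(\int_{\mathbb{X}}\left(\int_{\mathbb{X}}\mathbb{E}\left[|D_{x}F_i|^{2p}\right]^{1/(2p)}\mathbb{E}\left[|D^{(2)}_{x,y}F_j|^{2p}\right]^{1/(2p)}\lambda(dx)\right)^p\lambda(dy)\right)^{1/p},\\ \zeta_4^{(q)} &:= m^{q-1}\sum_{i,j=1}^m\int_{\mathbb{X}}\mathbb{E}\left[|D_xF_i|^{q+1}\right]^{1/(q+1)}\mathbb{E}\left[|D_xF_j|^{q+1}\right]^{1-1/(q+1)}\lambda(dx).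 \end{align*} Then for all $p,q\in[1,2]$, $$d_3(F,X)\le \tfrac12\left(\zeta_1^{(p)}+\zeta_2^{(p)}+\zeta_3^{(p)}\right)+\zeta_4^{(q)}.$$ If moreover $C$ is positive-definite, then for all $p,q\in[1,2]$, $$d_2(F,X)\le \|C^{-1}\|_{op}\|C\|_{op}^{1/2}\left(\zeta_1^{(p)}+\zeta_2^{(p)}+\zeta_3^{(p)}\right)+\left(2\|C^{-1}\|_{op}\|C\|_{op}^{1/2}\vee\tfrac{\sqrt{2\pi}}{8}\|C^{-1}\|_{op}^{3/2}\|C\|_{op}\right)\zeta_4^{(q)}.$$
   Context: Poisson functionals: a measurable functional of $\eta$ is a real random variable $F=F(\eta)$ that is a measurable function of $\eta$. $L^2(\mathbb{P}_\eta)$ is the set of measurable functionals $F$ of $\eta$ with $\mathbb{E}F^2<\infty$. The add-one cost operator is $D_xF:=F(\eta+\delta_x)-F(\eta)$ for $x\in\mathbb{X}$ ($\delta_x$ the Dirac measure at $x$), and $D^{(2)}_{x,y}F:=D_y(D_xF)$. One writes $F\in\operatorname{dom}D$ if $F\in L^2(\mathbb{P}_\eta)$ and $\int_{\mathbb{X}}\mathbb{E}(D_xF)^2\,\lambda(dx)<\infty$. Distances: for $\phi:\mathbb{R}^m\to\mathbb{R}$ of class $\mathcal{C}^k$, $\|\phi^{(k)}\|_\infty:=\max_{1\le i_1,\dots,i_k\le m}\sup_{x\in\mathbb{R}^m}\left|\frac{\partial^k\phi}{\partial x_{i_1}\cdots\partial x_{i_k}}(x)\right|$. $\|x\|$ is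 the Euclidean norm of a vector $x$, and $\|\cdot\|_{op}$ is the operator norm of a matrix. $\mathcal{H}^{(2)}_m$ is the set of $\mathcal{C}^2$ functions $h:\mathbb{R}^m\to\mathbb{R}$ with $|h(x)-h(y)|\le\|x-y\|$ for all $x,y\in\mathbb{R}^m$ and $\sup_{x}\|\operatorname{Hess}h(x)\|_{op}\le1$. $\mathcal{H}^{(3)}_m$ is the set of $\mathcal{C}^3$ functions $h:\mathbb{R}^m\to\mathbb{R}$ with $\|h^{(2)}\|_\infty\le1$ and $\|h^{(3)}\|_\infty\le 1$. For $m$-dimensional random vectors $X,Y$: $d_2(X,Y):=\sup_{h\in\mathcal{H}^{(2)}_m}|\mathbb{E}h(X)-\mathbb{E}h(Y)|$ (if $\mathbb{E}\|X\|,\mathbb{E}\|Y\|<\infty$) and $d_3(X,Y):=\sup_{h\in\mathcal{H}^{(3)}_m}|\mathbb{E}h(X)-\mathbb{E}h(Y)|$ (if $\mathbb{E}\|X\|^2,\mathbb{E}\|Y\|^2<\infty$). $a\vee b=\max(a,b)$. *)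

theory Defs
  imports "HOL-Probability.Probability"
begin

section \<open>Poisson measures\<close>

definition counting_measure :: "'a measure \<Rightarrow> 'a measure \<Rightarrow> bool" where
  "counting_measure L \<mu> \<longleftrightarrow>
     sets \<mu> = sets L \<and> (\<forall>A\<in>sets L. emeasure \<mu> A \<in> \<nat> \<union> {\<infinity>})"

text \<open>The space of counting measures on the measurable space underlying \<open>L\<close>, with the
  \<open>\<sigma>\<close>-algebra generated by the evaluation maps \<open>\<mu> \<mapsto> \<mu>(A)\<close>.\<close>

definition counting_space :: "'a measure \<Rightarrow> 'a measure measure" where
  "counting_space L = sigma {\<mu>. counting_measure L \<mu>}
     {{\<mu>. counting_measure L \<mu> \<and> emeasure \<mu> A \<in> B} | A B. A \<in> sets L \<and> B \<in> sets borel}"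

text \<open>If \<open>L(A) = t < \<infinity>\<close> then \<open>\<eta>(A)\<close> is Poisson distributed with parameter \<open>t\<close> (the case
  \<open>t = 0\<close> is included since \<open>0 ^ 0 = 1\<close>); a Poisson variable of infinite mean is almost surely
  infinite.\<close>

definition poisson_measure :: "'w measure \<Rightarrow> 'a measure \<Rightarrow> ('w \<Rightarrow> 'a measure) \<Rightarrow> bool" where
  "poisson_measure M L \<eta> \<longleftrightarrow>
     \<eta> \<in> M \<rightarrow>\<^sub>M counting_space L \<and>
     (\<forall>A\<in>sets L. emeasure L A < \<infinity> \<longrightarrow>
        (\<forall>k::nat. measure M {\<omega>\<in>space M. emeasure (\<eta> \<omega>) A = of_nat k}
                = measure L A ^ k / fact k * exp (- measure L A))) \<and>
     (\<forall>A\<in>sets L. emeasure L A = \<infinity> \<longrightarrow> (AE \<omega> in M. emeasure (\<eta> \<omega>) A = \<infinity>)) \<and>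
     (\<forall>(n::nat) A. (\<forall>k<n. A k \<in> sets L) \<and> disjoint_family_on A {..<n} \<longrightarrow>
        prob_space.indep_vars M (\<lambda>_. borel) (\<lambda>k \<omega>. emeasure (\<eta> \<omega>) (A k)) {..<n})"

section \<open>Poisson functionals and the add-one cost operator\<close>

definition add_dirac :: "'a measure \<Rightarrow> 'a \<Rightarrow> 'a measure" where
  "add_dirac \<mu> x = measure_of (space \<mu>) (sets \<mu>) (\<lambda>A. emeasure \<mu> A + indicator A x)"

lemma sets_add_dirac [simp]: "sets (add_dirac \<mu> x) = sets \<mu>"
  by (simp add: add_dirac_def)

lemma space_add_dirac [simp]: "space (add_dirac \<mu> x) = space \<mu>"
  by (simp add: add_dirac_def)

lemma emeasure_add_dirac:
  assumes "A \<in> sets \<mu>"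
  shows "emeasure (add_dirac \<mu> x) A = emeasure \<mu> A + indicator A x"
proof (rule emeasure_measure_of[OF add_dirac_def])
  show "sets \<mu> \<subseteq> Pow (space \<mu>)"
    by (rule sets.space_closed)
  show "A \<in> sets (add_dirac \<mu> x)"
    using assms by simp
  show "positive (sets (add_dirac \<mu> x)) (\<lambda>A. emeasure \<mu> A + indicator A x)"
    by (simp add: positive_def)
  show "countably_additive (sets (add_dirac \<mu> x)) (\<lambda>A. emeasure \<mu> A + indicator A x)"
    unfolding countably_additive_def
    by (auto simp: suminf_add[symmetric] suminf_emeasure suminf_indicator)
qed

lemma counting_measure_add_dirac:
  assumes "counting_measure L \<mu>"
  shows "counting_measure L (add_dirac \<mu> x)"
  using assms
  by (auto simp: counting_measure_def emeasure_add_dirac indicator_def)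

text \<open>A functional \<open>F = f(\<eta>)\<close> is represented by \<open>f\<close>.\<close>

definition add_one_cost :: "'a \<Rightarrow> ('a measure \<Rightarrow> real) \<Rightarrow> 'a measure \<Rightarrow> real" where
  "add_one_cost x f \<mu> = f (add_dirac \<mu> x) - f \<mu>"

definition add_one_cost2 :: "'a \<Rightarrow> 'a \<Rightarrow> ('a measure \<Rightarrow> real) \<Rightarrow> 'a measure \<Rightarrow> real" where
  "add_one_cost2 x y f = add_one_cost y (add_one_cost x f)"

definition L2_functional ::
  "'w measure \<Rightarrow> 'a measure \<Rightarrow> ('w \<Rightarrow> 'a measure) \<Rightarrow> ('a measure \<Rightarrow> real) \<Rightarrow> bool" where
  "L2_functional M L \<eta> f \<longleftrightarrow>
     f \<in> borel_measurable (counting_space L) \<and> (\<integral>\<^sup>+\<omega>. ennreal ((f (\<eta> \<omega>))\<^sup>2) \<partial>M) < \<infinity>"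

definition dom_D ::
  "'w measure \<Rightarrow> 'a measure \<Rightarrow> ('w \<Rightarrow> 'a measure) \<Rightarrow> ('a measure \<Rightarrow> real) \<Rightarrow> bool" where
  "dom_D M L \<eta> f \<longleftrightarrow>
     L2_functional M L \<eta> f \<and>
     (\<integral>\<^sup>+x. (\<integral>\<^sup>+\<omega>. ennreal ((add_one_cost x f (\<eta> \<omega>))\<^sup>2) \<partial>M) \<partial>L) < \<infinity>"

section \<open>Smooth test functions and distances\<close>

text \<open>Only applied to Frechet differentiable functions, where it is the usual partial
  derivative; see \<open>has_real_derivative_partial\<close>.\<close>

definition partial :: "'m::finite \<Rightarrow> (real^'m \<Rightarrow> real) \<Rightarrow> real^'m \<Rightarrow> real" where
  "partial i h x = frechet_derivative h (at x) (axis i 1)"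

lemma has_real_derivative_partial:
  fixes h :: "real^'m::finite \<Rightarrow> real"
  assumes "h differentiable (at x)"
  shows "((\<lambda>t. h (x + t *\<^sub>R axis i 1)) has_real_derivative partial i h x) (at 0)"
proof -
  let ?D = "frechet_derivative h (at x)"
  have D: "(h has_derivative ?D) (at x)"
    using assms by (simp add: frechet_derivative_works)
  then have "(h has_derivative ?D) (at (x + (0::real) *\<^sub>R axis i 1))"
    by simp
  moreover have "((\<lambda>t::real. x + t *\<^sub>R axis i 1) has_derivative (\<lambda>t. t *\<^sub>R axis i 1)) (at 0)"
    by (auto intro!: derivative_eq_intros)
  ultimately have "((\<lambda>t::real. h (x + t *\<^sub>R axis i 1)) has_derivative (\<lambda>t. ?D (t *\<^sub>R axis i 1))) (at 0)"
    using has_derivative_compose by blast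
  moreover have "?D (t *\<^sub>R axis i 1) = partial i h x * t" for t :: real
    using linear_scale[OF has_derivative_linear[OF D]] by (simp add: partial_def)
  ultimately show ?thesis
    by (simp add: has_field_derivative_def)
qed

primrec partials :: "'m::finite list \<Rightarrow> (real^'m \<Rightarrow> real) \<Rightarrow> real^'m \<Rightarrow> real" where
  "partials [] h = h"
| "partials (i # is) h = partial i (partials is h)"

primrec class_C :: "nat \<Rightarrow> (real^'m::finite \<Rightarrow> real) \<Rightarrow> bool" where
  "class_C 0 h \<longleftrightarrow> continuous_on UNIV h"
| "class_C (Suc k) h \<longleftrightarrow> h differentiable_on UNIV \<and> (\<forall>i. class_C k (partial i h))"

definition deriv_sup_norm :: "nat \<Rightarrow> (real^'m::finite \<Rightarrow> real) \<Rightarrow> ennreal" where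
  "deriv_sup_norm k h = (SUP is\<in>{is. length is = k}. SUP x. ennreal \<bar>partials is h x\<bar>)"

definition Hess :: "(real^'m::finite \<Rightarrow> real) \<Rightarrow> real^'m \<Rightarrow> real^'m^'m" where
  "Hess h x = (\<chi> i j. partials [i, j] h x)"

definition mat_op_norm :: "real^'m^'m::finite \<Rightarrow> real" where
  "mat_op_norm A = onorm ((*v) A)"

definition test_fun2 :: "(real^'m::finite \<Rightarrow> real) set" where
  "test_fun2 = {h. class_C 2 h \<and> (\<forall>x y. \<bar>h x - h y\<bar> \<le> norm (x - y)) \<and>
     (SUP x. ennreal (mat_op_norm (Hess h x))) \<le> 1}"

definition test_fun3 :: "(real^'m::finite \<Rightarrow> real) set" where
  "test_fun3 = {h. class_C 3 h \<and> deriv_sup_norm 2 h \<le> 1 \<and> deriv_sup_norm 3 h \<le> 1}"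

text \<open>Intended for random vectors with finite first (\<open>dist_d2\<close>) respectively second (\<open>dist_d3\<close>)
  moments, so that all the expectations exist. The two vectors may live on different
  probability spaces.\<close>

definition dist_d2 ::
  "'w measure \<Rightarrow> ('w \<Rightarrow> real^'m::finite) \<Rightarrow> 'v measure \<Rightarrow> ('v \<Rightarrow> real^'m) \<Rightarrow> ennreal" where
  "dist_d2 M X N Y =
     (SUP h\<in>test_fun2. ennreal \<bar>(\<integral>\<omega>. h (X \<omega>) \<partial>M) - (\<integral>\<omega>. h (Y \<omega>) \<partial>N)\<bar>)"

definition dist_d3 ::
  "'w measure \<Rightarrow> ('w \<Rightarrow> real^'m::finite) \<Rightarrow> 'v measure \<Rightarrow> ('v \<Rightarrow> real^'m) \<Rightarrow> ennreal" where
  "dist_d3 M X N Y =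
     (SUP h\<in>test_fun3. ennreal \<bar>(\<integral>\<omega>. h (X \<omega>) \<partial>M) - (\<integral>\<omega>. h (Y \<omega>) \<partial>N)\<bar>)"

section \<open>Gaussian vectors\<close>

definition pos_semidef :: "real^'m^'m::finite \<Rightarrow> bool" where
  "pos_semidef C \<longleftrightarrow> transpose C = C \<and> (\<forall>v. 0 \<le> v \<bullet> (C *v v))"

definition pos_def :: "real^'m^'m::finite \<Rightarrow> bool" where
  "pos_def C \<longleftrightarrow> transpose C = C \<and> (\<forall>v. v \<noteq> 0 \<longrightarrow> 0 < v \<bullet> (C *v v))"

text \<open>\<open>X\<close> has law \<open>N(0, C)\<close>: every linear combination \<open>t \<bullet> X\<close> is centred normal with variance
  \<open>t \<bullet> C t\<close>, a normal law of variance \<open>0\<close> being the Dirac measure at its mean. Singular \<open>C\<close> is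
  thus allowed.\<close>

definition gaussian_vector :: "'v measure \<Rightarrow> ('v \<Rightarrow> real^'m) \<Rightarrow> real^'m^'m::finite \<Rightarrow> bool" where
  "gaussian_vector N X C \<longleftrightarrow>
     X \<in> borel_measurable N \<and>
     (\<forall>t. distr N borel (\<lambda>\<omega>. t \<bullet> X \<omega>) =
        (if t \<bullet> (C *v t) = 0 then return borel 0
         else density lborel (\<lambda>u. ennreal (normal_density 0 (sqrt (t \<bullet> (C *v t))) u))))"

section \<open>The quantities in the bound\<close>

definition covariance :: "'w measure \<Rightarrow> ('w \<Rightarrow> real) \<Rightarrow> ('w \<Rightarrow> real) \<Rightarrow> real" where
  "covariance M X Y =
     (\<integral>\<omega>. (X \<omega> - (\<integral>\<omega>'. X \<omega>' \<partial>M)) * (Y \<omega> - (\<integral>\<omega>'. Y \<omega>' \<partial>M)) \<partial>M)"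

text \<open>Real powers on \<open>[0, \<infinity>]\<close>, for exponents \<open>r > 0\<close> only.\<close>

definition epow :: "ennreal \<Rightarrow> real \<Rightarrow> ennreal" where
  "epow x r = (if x = \<infinity> then \<infinity> else ennreal (enn2real x powr r))"

definition abs_moment :: "'w measure \<Rightarrow> real \<Rightarrow> ('w \<Rightarrow> real) \<Rightarrow> ennreal" where
  "abs_moment M r Y = (\<integral>\<^sup>+\<omega>. ennreal (\<bar>Y \<omega>\<bar> powr r) \<partial>M)"

definition zeta1 ::
  "'w measure \<Rightarrow> ('w \<Rightarrow> 'a measure) \<Rightarrow> ('m::finite \<Rightarrow> 'a measure \<Rightarrow> real) \<Rightarrow> real^'m^'m \<Rightarrow> ennreal" where
  "zeta1 M \<eta> F C =
     (\<Sum>i\<in>UNIV. \<Sum>j\<in>UNIV.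
        ennreal \<bar>C $ i $ j - covariance M (\<lambda>\<omega>. F i (\<eta> \<omega>)) (\<lambda>\<omega>. F j (\<eta> \<omega>))\<bar>)"

definition zeta2 ::
  "'w measure \<Rightarrow> 'a measure \<Rightarrow> ('w \<Rightarrow> 'a measure) \<Rightarrow> ('m::finite \<Rightarrow> 'a measure \<Rightarrow> real) \<Rightarrow> real \<Rightarrow> ennreal"
  where
  "zeta2 M L \<eta> F p = ennreal (2 powr (2 / p - 1)) *
     (\<Sum>i\<in>UNIV. \<Sum>j\<in>UNIV.
        epow (\<integral>\<^sup>+y. epow (\<integral>\<^sup>+x.
            epow (abs_moment M (2 * p) (\<lambda>\<omega>. add_one_cost2 x y (F i) (\<eta> \<omega>))) (1 / (2 * p)) *
            epow (abs_moment M (2 * p) (\<lambda>\<omega>. add_one_cost2 x y (F j) (\<eta> \<omega>))) (1 / (2 * p))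
          \<partial>L) p \<partial>L) (1 / p))"

definition zeta3 ::
  "'w measure \<Rightarrow> 'a measure \<Rightarrow> ('w \<Rightarrow> 'a measure) \<Rightarrow> ('m::finite \<Rightarrow> 'a measure \<Rightarrow> real) \<Rightarrow> real \<Rightarrow> ennreal"
  where
  "zeta3 M L \<eta> F p = ennreal (2 powr (2 / p)) *
     (\<Sum>i\<in>UNIV. \<Sum>j\<in>UNIV.
        epow (\<integral>\<^sup>+y. epow (\<integral>\<^sup>+x.
            epow (abs_moment M (2 * p) (\<lambda>\<omega>. add_one_cost x (F i) (\<eta> \<omega>))) (1 / (2 * p)) *
            epow (abs_moment M (2 * p) (\<lambda>\<omega>. add_one_cost2 x y (F j) (\<eta> \<omega>))) (1 / (2 * p))
          \<partial>L) p \<partial>L) (1 / p))"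

definition zeta4 ::
  "'w measure \<Rightarrow> 'a measure \<Rightarrow> ('w \<Rightarrow> 'a measure) \<Rightarrow> ('m::finite \<Rightarrow> 'a measure \<Rightarrow> real) \<Rightarrow> real \<Rightarrow> ennreal"
  where
  "zeta4 M L \<eta> F q = ennreal (real CARD('m) powr (q - 1)) *
     (\<Sum>i\<in>UNIV. \<Sum>j\<in>UNIV.
        (\<integral>\<^sup>+x.
            epow (abs_moment M (q + 1) (\<lambda>\<omega>. add_one_cost x (F i) (\<eta> \<omega>))) (1 / (q + 1)) *
            epow (abs_moment M (q + 1) (\<lambda>\<omega>. add_one_cost x (F j) (\<eta> \<omega>))) (1 - 1 / (q + 1))
          \<partial>L))"

end

theory Submission
 imports Defs
begin

text \<open>
 The bounds come from Stein's method on the Poisson space. Along the path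
 \<open>cos \<theta> F + sin \<theta> X\<close>, \<open>0 \<le> \<theta> \<le> \<pi>/2\<close>, the derivative of \<open>E h\<close> is treated on the Gaussian side by
 integration by parts and on the Poisson side by the covariance formula
 \<open>Cov(F, G) = \<integral>\<^sub>0\<^sup>1 E \<integral> D\<^sub>x F(\<alpha>\<^sub>t) D\<^sub>x G(\<beta>\<^sub>t) \<lambda>(dx) dt\<close>,
 in which \<open>(\<alpha>\<^sub>t, \<beta>\<^sub>t)\<close> is a coupling of two copies of \<open>\<eta>\<close> sharing a proportion \<open>t\<close> of their points.
 For Laplace functionals this formula is an explicit computation, and a multiplicative-system
 argument extends it to all square-integrable functionals. What is left of the first-order term is the
 fluctuation of \<open>\<integral> D\<^sub>x F\<^sub>j(\<alpha>\<^sub>t) D\<^sub>x F\<^sub>i(\<beta>\<^sub>t) \<lambda>(dx)\<close>; since the pair of copies is itself a functional of a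
 Poisson process of marked points, an \<open>L\<^sup>p\<close> Poincare inequality and Minkowski's inequality control it
 by \<open>\<zeta>\<^sub>2\<close> and \<open>\<zeta>\<^sub>3\<close>. The Taylor remainder, interpolated between its first- and second-order estimates,
 gives \<open>\<zeta>\<^sub>4\<close>. For the \<open>d\<^sub>2\<close> bound the missing third derivative of \<open>h\<close> is recovered by Gaussian smoothing.
\<close>


text \<open>The two factors of the covariance formula sit on dependent configurations of which only
  the marginal laws are usable. Products \<open>D F(m) D G(n)\<close> are therefore bounded by a
  term in \<open>m\<close> plus a term in \<open>n\<close>, or separated by Hoelder. For infinite
  intensity the integral over \<open>x\<close> may diverge even for bounded functionals, so the
  formula is first proved for a factor that sees only a set of finite intensity; resampling the
  complement removes this restriction. Constants: \<open>2 powr (2 - p)\<close> is the Hoelder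
  constant of the signed power of order \<open>p - 1\<close>, and its \<open>p\<close>-th root is
  the factor in \<open>\<zeta>\<^sub>2\<close>. \<open>\<zeta>\<^sub>3\<close> has twice that factor
  since the products of a first and a second difference occur in both orders.
  \<open>CARD('m) powr (q - 1)\<close> is a power-mean constant, and 1/2 is the integral of sin cos
  over the path. In the \<open>d\<^sub>2\<close> bound, smoothing gives
  \<open>sqrt (2 / pi)\<close>, the first absolute moment of a standard normal variable, times the
  square root of the norm of the inverse of \<open>C\<close>; the product of the norms of
  \<open>C\<close> and its inverse is at least 1, which brings this into the stated form.\<close>

notation counting_space ("\<N>") and counting_measure ("\<C>")
 and add_one_cost ("\<D>") and add_one_cost2 ("\<D>\<^sub>2") and borel_measurable ("\<B>")

abbreviation functionals ("\<F>") where "\<F> L \<equiv> \<B> (\<N> L)"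

lemmas m_comp = measurable_compose
lemmas B_integrable_bound = Bochner_Integration.integrable_bound
lemmas B_integral_cong = Bochner_Integration.integral_cong
lemmas B_integral_add = Bochner_Integration.integral_add
lemmas B_integral_diff = Bochner_Integration.integral_diff
lemmas B_integral_sum = Bochner_Integration.integral_sum
lemmas B_integrable_add = Bochner_Integration.integrable_add
lemmas B_integrable_diff = Bochner_Integration.integrable_diff

section \<open>Multiplicative systems: from generators to all bounded measurable functions\<close>

lemma power_indicator_approx:
 fixes u \<tau> :: real
 assumes u: "0 \<le> u" "u \<le> 1" and \<tau>: "0 < \<tau>" "\<tau> \<le> 1"
 shows "(\<lambda>n. 1 - (1 - u ^ n) ^ (n * nat \<lceil>1 / \<tau> ^ n\<rceil>)) \<longlonglongrightarrow> (if u \<ge> \<tau> then 1 else 0)"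
proof (cases "u \<ge> \<tau>")
 case True
 \<comment> \<open>The exponent is at least \<open>n / \<tau> ^ n\<close>, so for
   \<open>u \<ge> \<tau>\<close> its product with \<open>u ^ n\<close> is at least \<open>n\<close>,
   and \<open>1 - x \<le> exp (- x)\<close> leaves at most \<open>exp (- n)\<close>.\<close>
 have ub: "(1 - u ^ n) ^ (n * nat \<lceil>1 / \<tau> ^ n\<rceil>) \<le> exp (- real n)" for n
 proof -
  let ?N = "n * nat \<lceil>1 / \<tau> ^ n\<rceil>"
  have un: "0 \<le> u ^ n" "u ^ n \<le> 1" using u by (auto intro: power_le_one)
  have "(1 - u ^ n) ^ ?N \<le> exp (- (u ^ n)) ^ ?N"
   using un exp_ge_add_one_self[of "- (u ^ n)"] by (intro power_mono) auto
  also have "\<dots> = exp (- (real ?N * u ^ n))" by (simp add: exp_of_nat_mult[symmetric])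
  also have "real n * 1 \<le> real ?N * u ^ n"
  proof -
   have "1 = (1 / \<tau> ^ n) * \<tau> ^ n" using \<tau> by simp
   also have "\<dots> \<le> real (nat \<lceil>1 / \<tau> ^ n\<rceil>) * u ^ n"
   proof (intro mult_mono power_mono)
    show "1 / \<tau> ^ n \<le> real (nat \<lceil>1 / \<tau> ^ n\<rceil>)" by linarith
    show "0 \<le> real (nat \<lceil>1 / \<tau> ^ n\<rceil>)" by (rule of_nat_0_le_iff)
   qed (use \<tau> True in simp_all)
   finally have "real n * 1 \<le> real n * (real (nat \<lceil>1 / \<tau> ^ n\<rceil>) * u ^ n)"
    by (intro mult_left_mono) auto
   then show ?thesis by (simp add: mult.assoc)
  qed
  then have "exp (- (real ?N * u ^ n)) \<le> exp (- real n)" by simp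
  finally show ?thesis .
 qed
 have lb: "0 \<le> (1 - u ^ n) ^ (n * nat \<lceil>1 / \<tau> ^ n\<rceil>)" for n
  using u by (simp add: power_le_one)
 have lim: "(\<lambda>n. exp (- real n)) \<longlonglongrightarrow> 0"
  using LIMSEQ_power_zero[of "exp (- 1 :: real)"] by (simp add: exp_of_nat_mult[symmetric])
 have "(\<lambda>n. (1 - u ^ n) ^ (n * nat \<lceil>1 / \<tau> ^ n\<rceil>)) \<longlonglongrightarrow> 0"
  by (rule tendsto_sandwich[OF _ _ tendsto_const lim]) (intro always_eventually allI lb ub)+
 from tendsto_diff[OF tendsto_const[of 1] this] True show ?thesis by simp
next
 case False
 then have ut: "u < \<tau>" by simp
 \<comment> \<open>Below the threshold Bernoulli bounds the expression by exponent times
   \<open>u ^ n\<close>. Rounding up costs the second summand, and the factor \<open>n\<close> loses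
   against both geometric sequences.\<close>
 have ub: "1 - (1 - u ^ n) ^ (n * nat \<lceil>1 / \<tau> ^ n\<rceil>) \<le> real n * (u / \<tau>) ^ n + real n * u ^ n" for n
 proof -
  let ?N = "n * nat \<lceil>1 / \<tau> ^ n\<rceil>"
  have un: "0 \<le> u ^ n" "u ^ n \<le> 1" using u by (auto intro: power_le_one)
  have "1 + real ?N * (- (u ^ n)) \<le> (1 + (- (u ^ n))) ^ ?N"
   using un by (intro Bernoulli_inequality) auto
  then have "1 - (1 - u ^ n) ^ ?N \<le> real ?N * u ^ n" by simp
  also have "\<dots> \<le> (real n * (1 / \<tau> ^ n + 1)) * u ^ n"
  proof (intro mult_right_mono un)
   have "0 \<le> 1 / \<tau> ^ n" using \<tau> by simp
   then have "real (nat \<lceil>1 / \<tau> ^ n\<rceil>) \<le> 1 / \<tau> ^ n + 1" by linarith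
   then show "real ?N \<le> real n * (1 / \<tau> ^ n + 1)"
    by (simp add: mult_left_mono)
  qed
  also have "\<dots> = real n * (u / \<tau>) ^ n + real n * u ^ n" by (simp add: algebra_simps power_divide)
  finally show ?thesis .
 qed
 have lim: "(\<lambda>n. real n * x ^ n) \<longlonglongrightarrow> 0" if "0 \<le> x" "x < 1" for x :: real
  using powser_times_n_limit_0[of x] that by simp
 have lim0: "(\<lambda>n. real n * (u / \<tau>) ^ n + real n * u ^ n) \<longlonglongrightarrow> 0 + 0"
  using u \<tau> ut by (intro tendsto_add lim) auto
 have lb: "0 \<le> 1 - (1 - u ^ n) ^ (n * nat \<lceil>1 / \<tau> ^ n\<rceil>)" for n
  using u by (simp add: power_le_one)
 have "(\<lambda>n. 1 - (1 - u ^ n) ^ (n * nat \<lceil>1 / \<tau> ^ n\<rceil>)) \<longlonglongrightarrow> 0"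
  by (rule tendsto_sandwich[OF _ _ tendsto_const lim0[simplified]]) (intro always_eventually allI lb ub)+
 then show ?thesis using False by simp
qed

text \<open>The powers of the generators are turned into indicators of
 their superlevel sets, so no lattice operations or uniform approximation are involved.\<close>

locale bounded_class =
 fixes M :: "'a measure" and \<Psi> :: "('a \<Rightarrow> real) set" and H :: "('a \<Rightarrow> real) \<Rightarrow> bool"
 assumes meas: "\<psi> \<in> \<Psi> \<Longrightarrow> \<psi> \<in> \<B> M"
  and bound: "\<psi> \<in> \<Psi> \<Longrightarrow> x \<in> space M \<Longrightarrow> \<bar>\<psi> x\<bar> \<le> 1"
  and one: "(\<lambda>_. 1) \<in> \<Psi>"
  and mult: "\<psi> \<in> \<Psi> \<Longrightarrow> \<psi>' \<in> \<Psi> \<Longrightarrow> (\<lambda>x. \<psi> x * \<psi>' x) \<in> \<Psi>"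
  and gen: "sets M \<subseteq> sigma_sets (space M) {{x\<in>space M. \<psi> x \<ge> \<tau>} | \<psi> \<tau>. \<psi> \<in> \<Psi>}"
  and H_gen: "\<psi> \<in> \<Psi> \<Longrightarrow> H \<psi>"
  and H_lin: "f \<in> \<B> M \<Longrightarrow> (\<And>x. x \<in> space M \<Longrightarrow> \<bar>f x\<bar> \<le> B) \<Longrightarrow> H f \<Longrightarrow>
    g \<in> \<B> M \<Longrightarrow> (\<And>x. x \<in> space M \<Longrightarrow> \<bar>g x\<bar> \<le> B) \<Longrightarrow> H g \<Longrightarrow> H (\<lambda>x. c * f x + d * g x)"
  and H_lim: "(\<And>n. h n \<in> \<B> M) \<Longrightarrow> (\<And>n x. x \<in> space M \<Longrightarrow> \<bar>h n x\<bar> \<le> B) \<Longrightarrow>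
    (\<And>n. H (h n)) \<Longrightarrow> g \<in> \<B> M \<Longrightarrow>
    (\<And>x. x \<in> space M \<Longrightarrow> (\<lambda>n. h n x) \<longlonglongrightarrow> g x) \<Longrightarrow> H g"
begin

text \<open>Multipliers of the class. \<open>H\<close> is only linear and closed under bounded
  limits, so products are built in by demanding \<open>H\<close> of \<phi> times every generator. As
  the generators are closed under products, \<open>K\<close> is stable under multiplication by them,
  and the generator 1 recovers \<open>H \<phi>\<close>.\<close>

definition K :: "real \<Rightarrow> ('a \<Rightarrow> real) \<Rightarrow> bool" where
 "K B \<phi> \<longleftrightarrow> \<phi> \<in> \<B> M \<and> (\<forall>x\<in>space M. \<bar>\<phi> x\<bar> \<le> B) \<and> (\<forall>\<psi>\<in>\<Psi>. H (\<lambda>x. \<phi> x * \<psi> x))"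

lemma K_one: "K 1 (\<lambda>_. 1)"
 using H_gen by (auto simp: K_def)

lemma K_lin:
 assumes "K B f" "K B g" "\<And>x. x \<in> space M \<Longrightarrow> \<bar>c * f x + d * g x\<bar> \<le> B'"
 shows "K B' (\<lambda>x. c * f x + d * g x)"
proof -
 have "H (\<lambda>x. (c * f x + d * g x) * \<psi> x)" if \<psi>: "\<psi> \<in> \<Psi>" for \<psi>
 proof -
  have *: "\<bar>h x * \<psi> x\<bar> \<le> B" if "K B h" "x \<in> space M" for h x
   using bound[OF \<psi>, of x] that mult_mono[of "\<bar>h x\<bar>" B "\<bar>\<psi> x\<bar>" 1]
   by (force simp: K_def abs_mult)
  have "H (\<lambda>x. c * (f x * \<psi> x) + d * (g x * \<psi> x))"
   using assms(1,2) \<psi> meas[OF \<psi>] by (intro H_lin[where B=B] *) (auto simp: K_def)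
  then show ?thesis by (simp add: algebra_simps)
 qed
 then show ?thesis using assms by (auto simp: K_def)
qed

lemma K_lim:
 assumes "\<And>n. K B (h n)" "g \<in> \<B> M" "\<And>x. x \<in> space M \<Longrightarrow> (\<lambda>n. h n x) \<longlonglongrightarrow> g x"
 shows "K B g"
proof -
 have b: "\<bar>g x\<bar> \<le> B" if "x \<in> space M" for x
  using tendsto_rabs[OF assms(3)[OF that]] assms(1) that
  by (intro LIMSEQ_le_const2[where x="\<bar>g x\<bar>"]) (auto simp: K_def)
 have "H (\<lambda>x. g x * \<psi> x)" if \<psi>: "\<psi> \<in> \<Psi>" for \<psi>
 proof (rule H_lim[where h="\<lambda>n x. h n x * \<psi> x" and B=B])
  show "\<bar>h n x * \<psi> x\<bar> \<le> B" if "x \<in> space M" for n x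
   using bound[OF \<psi>, of x] assms(1)[of n] that mult_mono[of "\<bar>h n x\<bar>" B "\<bar>\<psi> x\<bar>" 1]
   by (force simp: K_def abs_mult)
  show "(\<lambda>x. h n x * \<psi> x) \<in> \<B> M" for n
   using assms(1)[of n] meas[OF \<psi>] by (auto simp: K_def)
 qed (use assms \<psi> meas[OF \<psi>] in \<open>auto simp: K_def intro!: tendsto_mult\<close>)
 then show ?thesis using assms b by (auto simp: K_def)
qed

lemma K_mult: "K B \<phi> \<Longrightarrow> \<psi> \<in> \<Psi> \<Longrightarrow> K B (\<lambda>x. \<phi> x * \<psi> x)"
 unfolding K_def
proof (intro conjI ballI)
 assume *: "\<phi> \<in> \<B> M \<and> (\<forall>x\<in>space M. \<bar>\<phi> x\<bar> \<le> B) \<and> (\<forall>\<psi>\<in>\<Psi>. H (\<lambda>x. \<phi> x * \<psi> x))" and \<psi>: "\<psi> \<in> \<Psi>"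
 show "(\<lambda>x. \<phi> x * \<psi> x) \<in> \<B> M" using * meas[OF \<psi>] by auto
 show "\<bar>\<phi> x * \<psi> x\<bar> \<le> B" if "x \<in> space M" for x
  using bound[OF \<psi>, of x] * that mult_mono[of "\<bar>\<phi> x\<bar>" B "\<bar>\<psi> x\<bar>" 1]
  by (force simp: abs_mult)
 show "H (\<lambda>x. \<phi> x * \<psi> x * \<psi>' x)" if "\<psi>' \<in> \<Psi>" for \<psi>'
  using * mult[OF \<psi> that] by (auto simp: mult.assoc)
qed

text \<open>Rescaling the generator to \<open>u = (1 + \<psi>) / 2\<close> puts it in [0,1].
  Multiplying by \<open>u\<close> or by one minus a power of \<open>u\<close> then preserves
  membership in \<open>K\<close> with the same bound \<open>B\<close>, and so does the limit of
  these polynomials given by \<open>power_indicator_approx\<close>.\<close>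

lemma K_superlevel:
 assumes \<phi>: "K B \<phi>" and \<psi>: "\<psi> \<in> \<Psi>"
 shows "K B (\<lambda>x. \<phi> x * indicator {x\<in>space M. \<psi> x \<ge> \<tau>} x)"
proof -
 define u where "u = (\<lambda>x. (1 + \<psi> x) / 2)"
 have u: "0 \<le> u x" "u x \<le> 1" if "x \<in> space M" for x
  using bound[OF \<psi> that] by (auto simp: u_def)
 have B: "0 \<le> B" if "x \<in> space M" for x using \<phi> that by (force simp: K_def)
 have ab: "\<bar>a * v\<bar> \<le> B" if "\<bar>a\<bar> \<le> B" "0 \<le> v" "v \<le> 1" for a v :: real
  using mult_mono[of "\<bar>a\<bar>" B "\<bar>v\<bar>" 1] that by (auto simp: abs_mult)
 have b: "\<bar>\<phi>' x\<bar> \<le> B" if "K B \<phi>'" "x \<in> space M" for \<phi>' x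
  using that by (auto simp: K_def)
 have mu: "K B (\<lambda>x. \<phi>' x * u x)" if \<phi>': "K B \<phi>'" for \<phi>'
 proof -
  have eq: "1/2 * \<phi>' x + 1/2 * (\<phi>' x * \<psi> x) = \<phi>' x * u x" for x by (simp add: u_def field_simps)
  have "K B (\<lambda>x. 1/2 * \<phi>' x + 1/2 * (\<phi>' x * \<psi> x))"
   by (rule K_lin[OF \<phi>' K_mult[OF \<phi>' \<psi>]], subst eq) (intro ab b[OF \<phi>'] u)
  then show ?thesis by (simp only: eq)
 qed
 have mun: "K B (\<lambda>x. \<phi>' x * u x ^ n)" if \<phi>': "K B \<phi>'" for \<phi>' n
 proof (induction n)
  case (Suc n)
  from mu[OF this] show ?case by (simp add: mult_ac)
 qed (use that in simp)
 have sub: "K B (\<lambda>x. \<phi>1 x * (1 - v x))"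
  if "K B \<phi>1" "K B (\<lambda>x. \<phi>1 x * v x)" "\<And>x. x \<in> space M \<Longrightarrow> 0 \<le> v x" "\<And>x. x \<in> space M \<Longrightarrow> v x \<le> 1" for \<phi>1 v
 proof -
  have eq: "1 * \<phi>1 x + (-1) * (\<phi>1 x * v x) = \<phi>1 x * (1 - v x)" for x by (simp add: algebra_simps)
  have "K B (\<lambda>x. 1 * \<phi>1 x + (-1) * (\<phi>1 x * v x))"
   by (rule K_lin[OF that(1,2)], subst eq) (use that(3,4) in \<open>intro ab b[OF that(1)], auto\<close>)
  then show ?thesis by (simp only: eq)
 qed
 have mun1: "K B (\<lambda>x. \<phi>' x * (1 - u x ^ n))" if "K B \<phi>'" for \<phi>' n
  by (rule sub[OF that mun[OF that]]) (use u in \<open>auto intro: power_le_one\<close>)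
 have muN: "K B (\<lambda>x. \<phi> x * (1 - u x ^ n) ^ N)" for n N
 proof (induction N)
  case (Suc N)
  from mun1[OF this, of n] show ?case by (simp add: mult_ac)
 qed (use \<phi> in simp)
 have muN1: "K B (\<lambda>x. \<phi> x * (1 - (1 - u x ^ n) ^ N))" for n N
 proof (rule sub[OF \<phi> muN])
  fix x assume x: "x \<in> space M"
  have "0 \<le> 1 - u x ^ n" "1 - u x ^ n \<le> 1" using u[OF x] by (auto simp: power_le_one)
  then show "0 \<le> (1 - u x ^ n) ^ N" "(1 - u x ^ n) ^ N \<le> 1" by (auto intro: power_le_one)
 qed
 define \<sigma> where "\<sigma> = (1 + \<tau>) / 2"
 have eq: "{x\<in>space M. \<psi> x \<ge> \<tau>} = {x\<in>space M. u x \<ge> \<sigma>}" by (auto simp: u_def \<sigma>_def)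
 have [measurable]: "u \<in> \<B> M" "\<phi> \<in> \<B> M" using meas[OF \<psi>] \<phi> by (auto simp: u_def K_def)
 have b\<phi>: "\<bar>\<phi> x\<bar> \<le> B" if "x \<in> space M" for x using \<phi> that by (auto simp: K_def)
 consider "\<sigma> \<le> 0" | "\<sigma> > 1" | "0 < \<sigma>" "\<sigma> \<le> 1" by linarith
 then have "K B (\<lambda>x. \<phi> x * indicator {x\<in>space M. u x \<ge> \<sigma>} x)"
 proof cases
  case 1
  have i: "indicator {x\<in>space M. u x \<ge> \<sigma>} x = (1::real)" if "x \<in> space M" for x
   using u(1)[OF that] 1 that by (simp add: indicator_def)
  show ?thesis by (rule K_lim[OF \<phi>]) (simp_all add: i)
 next
  case 2
  have z: "K B (\<lambda>x. 1 * \<phi> x + (-1) * \<phi> x)" using B by (intro K_lin[OF \<phi> \<phi>]) auto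
  have i: "\<phi> x * indicator {x\<in>space M. u x \<ge> \<sigma>} x = 0" if "x \<in> space M" for x
   using u(2)[OF that] 2 that by (simp add: indicator_def)
  show ?thesis by (rule K_lim[OF z], measurable) (simp only: i, simp)
 next
  case 3
  show ?thesis
  proof (rule K_lim[OF muN1])
   fix x assume x: "x \<in> space M"
   show "(\<lambda>n. \<phi> x * (1 - (1 - u x ^ n) ^ (n * nat \<lceil>1 / \<sigma> ^ n\<rceil>))) \<longlonglongrightarrow> \<phi> x * indicator {x \<in> space M. \<sigma> \<le> u x} x"
    using tendsto_mult[OF tendsto_const power_indicator_approx[OF u[OF x] 3]] x
    by (auto simp: indicator_def)
  qed measurable
 qed
 then show ?thesis by (simp only: eq)
qed

text \<open>The induction over the generated \<sigma>-algebra quantifies over all multipliers.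
  Indicators can therefore be multiplied in one after another, so intersections come for free and
  the role of the pi-lambda theorem is played by \<open>K\<close> itself.\<close>

lemma K_indicator:
 assumes "E \<in> sets M" "K B \<phi>"
 shows "K B (\<lambda>x. \<phi> x * indicator E x)"
proof -
 have "E \<in> sigma_sets (space M) {{x\<in>space M. \<psi> x \<ge> \<tau>} | \<psi> \<tau>. \<psi> \<in> \<Psi>}" using gen assms(1) by blast
 then have "E \<in> sets M \<and> (\<forall>\<phi>. K B \<phi> \<longrightarrow> K B (\<lambda>x. \<phi> x * indicator E x))"
 proof induction
  case (Basic a)
  then show ?case using K_superlevel meas by fastforce
 next
  case Empty
  have "K B (\<lambda>x. 1 * \<phi> x + (-1) * \<phi> x)" if "K B \<phi>" for \<phi>
   using that by (intro K_lin[OF that that]) (force simp: K_def)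
  then show ?case by auto
 next
  case (Compl a)
  have "K B (\<lambda>x. \<phi> x * indicator (space M - a) x)" if \<phi>: "K B \<phi>" for \<phi>
  proof -
   have "K B (\<lambda>x. 1 * \<phi> x + (-1) * (\<phi> x * indicator a x))"
    using \<phi> Compl by (intro K_lin[OF \<phi>, where g="\<lambda>x. \<phi> x * indicator a x"]) (auto simp: K_def indicator_def)
   then show ?thesis
    by (rule K_lim) (use \<phi> Compl in \<open>auto simp: K_def indicator_def\<close>)
  qed
  then show ?case using Compl by auto
 next
  case (Union a)
  have *: "K B (\<lambda>x. \<phi> x * indicator (\<Union>i<n. a i) x)" if \<phi>: "K B \<phi>" for \<phi> n
  proof (induction n)
   case 0
   have "K B (\<lambda>x. 1 * \<phi> x + (-1) * \<phi> x)"
    using \<phi> by (intro K_lin[OF \<phi> \<phi>]) (force simp: K_def)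
   then show ?case by simp
  next
   case (Suc n)
   let ?i = "\<lambda>x. indicator (\<Union>i<n. a i) x :: real"
   have 1: "K B (\<lambda>x. 1 * \<phi> x + (-1) * (\<phi> x * ?i x))"
    using Suc \<phi> by (intro K_lin[OF \<phi>, where g="\<lambda>x. \<phi> x * ?i x"]) (auto simp: K_def indicator_def)
   \<comment> \<open>The indicator of a union is \<open>i + (1 - i) * j\<close>. The hypothesis for
     \<open>a n\<close> is used with the multiplier \<phi> times \<open>1 - i\<close>, which is
     where the quantification over multipliers pays off.\<close>
   have 2: "K B (\<lambda>x. (1 * \<phi> x + (-1) * (\<phi> x * ?i x)) * indicator (a n) x)"
    using 1 Union by auto
   have "K B (\<lambda>x. 1 * (\<phi> x * ?i x) + 1 * ((1 * \<phi> x + (-1) * (\<phi> x * ?i x)) * indicator (a n) x))"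
    using \<phi> by (intro K_lin[OF Suc 2]) (auto simp: K_def indicator_def)
   also have "(\<lambda>x. 1 * (\<phi> x * ?i x) + 1 * ((1 * \<phi> x + (-1) * (\<phi> x * ?i x)) * indicator (a n) x))
     = (\<lambda>x. \<phi> x * indicator (\<Union>i<Suc n. a i) x)"
    by (auto simp: indicator_def lessThan_Suc fun_eq_iff)
   finally show ?case .
  qed
  have "K B (\<lambda>x. \<phi> x * indicator (\<Union>i. a i) x)" if \<phi>: "K B \<phi>" for \<phi>
  proof (rule K_lim[OF *[OF \<phi>]])
   show "(\<lambda>x. \<phi> x * indicator (\<Union>i. a i) x) \<in> \<B> M"
    using \<phi> Union.IH by (intro borel_measurable_times borel_measurable_indicator sets.countable_UN) (auto simp: K_def)
   show "(\<lambda>n. \<phi> x * indicator (\<Union>i<n. a i) x) \<longlonglongrightarrow> \<phi> x * indicator (\<Union>i. a i) x" for x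
    by (intro tendsto_mult tendsto_const LIMSEQ_indicator_UN)
  qed
  then show ?case using Union by auto
 qed
 then show ?thesis using assms by blast
qed

lemma H_indicator: "E \<in> sets M \<Longrightarrow> H (indicator E)"
 using K_indicator[OF _ K_one, of E] one by (auto simp: K_def)

theorem bounded_measurable:
 assumes f: "f \<in> \<B> M" and B: "\<And>x. x \<in> space M \<Longrightarrow> \<bar>f x\<bar> \<le> B"
 shows "H f"
proof -
 \<comment> \<open>The bound stays inside the induction formula because it changes under scaling. In
   sums and increasing limits nonnegativity passes a bound of the whole on to the pieces.\<close>
 have pos: "(\<exists>B. \<forall>x\<in>space M. u x \<le> B) \<longrightarrow> H u" if "u \<in> \<B> M" "\<And>x. 0 \<le> u x" for u
  using that
 proof (induction rule: borel_measurable_induct_real)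
  case (set A)
  then show ?case using H_indicator by auto
 next
  case (mult u c)
  show ?case
  proof (intro impI, elim exE)
   fix B assume B: "\<forall>x\<in>space M. c * u x \<le> B"
   show "H (\<lambda>x. c * u x)"
   proof (cases "c = 0")
    case True
    have "H (\<lambda>x. 0 * 1 + 0 * 1)" using H_gen[OF one] by (intro H_lin[where B=1]) auto
    then show ?thesis using True by simp
   next
    case False
    then have ub: "\<forall>x\<in>space M. u x \<le> B / c" using B mult(1) by (auto simp: field_simps)
    then have "H u" using mult by blast
    then have "H (\<lambda>x. c * u x + 0 * u x)" using mult ub
     by (intro H_lin[where B="B/c"]) auto
    then show ?thesis by simp
   qed
  qed
 next
  case (add u v)
  show ?case
  proof (intro impI, elim exE)
   fix B assume B: "\<forall>x\<in>space M. v x + u x \<le> B"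
   have ub: "\<forall>x\<in>space M. u x \<le> B" "\<forall>x\<in>space M. v x \<le> B"
   proof -
    have "u x \<le> v x + u x" "v x \<le> v x + u x" for x using add.hyps(2)[of x] add.hyps(4)[of x] by auto
    then show "\<forall>x\<in>space M. u x \<le> B" "\<forall>x\<in>space M. v x \<le> B" using B by (meson order_trans)+
   qed
   then have "H (\<lambda>x. 1 * v x + 1 * u x)" using add
    by (intro H_lin[where B=B]) auto
   then show "H (\<lambda>x. v x + u x)" by simp
  qed
 next
  case (seq U)
  show ?case
  proof (intro impI, elim exE)
   fix B assume B: "\<forall>x\<in>space M. u x \<le> B"
   have Ub: "U i x \<le> B" if "x \<in> space M" for i x
   proof -
    have "incseq (\<lambda>i. U i x)" using seq by (auto simp: incseq_def le_fun_def)
    then have "U i x \<le> u x" using seq that by (intro incseq_le) auto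
    then show ?thesis using B that by force
   qed
   show "H u"
   proof (rule H_lim[where h=U and B=B])
    show "H (U n)" for n using seq.IH Ub by blast
    show "\<bar>U n x\<bar> \<le> B" if "x \<in> space M" for n x using seq.hyps(2)[of n x] Ub[OF that] by simp
   qed (fact seq.hyps that(1))+
  qed
 qed
 have "H (\<lambda>x. max 0 (f x))" "H (\<lambda>x. max 0 (- f x))"
  using pos[of "\<lambda>x. max 0 (f x)"] pos[of "\<lambda>x. max 0 (- f x)"] f B
  by (force intro!: exI[of _ "max 0 B"])+
 then have "H (\<lambda>x. 1 * max 0 (f x) + (-1) * max 0 (- f x))"
  using f by (intro H_lin[where B="max 0 B"]) (use B in \<open>force+\<close>)
 also have "(\<lambda>x. 1 * max 0 (f x) + (-1) * max 0 (- f x)) = f" by (auto simp: max_def fun_eq_iff)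
 finally show ?thesis .
qed

end

section \<open>The space of counting measures\<close>

text \<open>A configuration may have infinite mass. With the value 0 at infinity the function stays
  multiplicative and continuous along increasing sequences, so Laplace functionals are total,
  bounded by 1 and real-valued.\<close>

definition expneg :: "ennreal \<Rightarrow> real" where
 "expneg x = (if x = \<infinity> then 0 else exp (- enn2real x))"

lemma expneg_nonneg [simp]: "0 \<le> expneg x" and expneg_le_1 [simp]: "expneg x \<le> 1"
 by (auto simp: expneg_def)

lemma abs_expneg_le_1 [simp]: "\<bar>expneg x\<bar> \<le> 1"
 by (simp add: abs_le_iff)

lemma expneg_0 [simp]: "expneg 0 = 1" and expneg_infinity: "expneg \<infinity> = 0" and expneg_top [simp]: "expneg \<top> = 0"
 by (auto simp: expneg_def)

lemma expneg_ennreal [simp]: "0 \<le> x \<Longrightarrow> expneg (ennreal x) = exp (- x)"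
 by (auto simp: expneg_def)

lemma expneg_add: "expneg (x + y) = expneg x * expneg y"
 by (cases x; cases y) (auto simp: expneg_def exp_add[symmetric] enn2real_plus)

lemma expneg_sum: "finite I \<Longrightarrow> expneg (\<Sum>i\<in>I. f i) = (\<Prod>i\<in>I. expneg (f i))"
 by (induction I rule: finite_induct) (auto simp: expneg_add)

lemma expneg_mult_nat: "0 \<le> y \<Longrightarrow> expneg (ennreal y * of_nat k) = exp (- y) ^ k"
 by (simp add: ennreal_of_nat_eq_real_of_nat ennreal_mult[symmetric] exp_of_nat_mult[symmetric] mult.commute)

lemma measurable_expneg [measurable]: "expneg \<in> \<B> borel"
 unfolding expneg_def[abs_def] by measurable

lemma tendsto_expneg:
 assumes "incseq a" shows "(\<lambda>n. expneg (a n)) \<longlonglongrightarrow> expneg (SUP n. a n)"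
proof (cases "(SUP n. a n) = \<infinity>")
 case True
 show ?thesis unfolding True expneg_infinity
 proof (rule LIMSEQ_I)
  fix r :: real assume r: "0 < r"
  have "ennreal (max 0 (- ln r)) < (SUP n. a n)" by (subst True) simp
  then obtain N where N: "ennreal (max 0 (- ln r)) < a N" by (auto simp: less_SUP_iff)
  have "expneg (a n) < r" if "n \<ge> N" for n
  proof -
   have *: "ennreal (max 0 (- ln r)) < a n" using N that assms by (meson incseqD order_less_le_trans)
   show ?thesis
   proof (cases "a n")
    case (real x)
    have "max 0 (- ln r) < x" using * unfolding real(2) by (rule ennreal_less_iff[THEN iffD1, rotated]) simp
    then have "- ln r < x" by simp
    then have "exp (- x) < exp (ln r)" by simp
    then show ?thesis using r real by simp
   qed (use r in \<open>simp add: expneg_def\<close>)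
  qed
  then show "\<exists>no. \<forall>n\<ge>no. norm (expneg (a n) - 0) < r" by auto
 qed
next
 case False
 have le: "a n \<le> (SUP n. a n)" for n by (rule SUP_upper) simp
 have fin: "a n \<noteq> \<infinity>" for n
 proof
  assume "a n = \<infinity>"
  with le[of n] have "(SUP n. a n) = \<infinity>" by (simp only: infinity_ennreal_def top_unique)
  with False show False by simp
 qed
 have "(\<lambda>n. exp (- enn2real (a n))) \<longlonglongrightarrow> exp (- enn2real (SUP n. a n))"
 proof (intro tendsto_intros tendsto_enn2real)
  have "ennreal (enn2real (SUP n. a n)) = (SUP n. a n)"
   by (rule ennreal_enn2real) (use False in \<open>simp only: infinity_ennreal_def top.not_eq_extremum\<close>)
  then show "a \<longlonglongrightarrow> ennreal (enn2real (SUP n. a n))" using LIMSEQ_SUP[OF assms] by simp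
 qed simp
 moreover have "expneg (a n) = exp (- enn2real (a n))" for n
  unfolding expneg_def by (rule if_not_P) (rule fin)
 moreover have "expneg (SUP n. a n) = exp (- enn2real (SUP n. a n))"
  unfolding expneg_def by (rule if_not_P) (rule False)
 ultimately show ?thesis by (simp only:)
qed

lemma expneg_suminf: "(\<lambda>n. \<Prod>k<n. expneg (a k)) \<longlonglongrightarrow> expneg (\<Sum>k. a k)"
 using tendsto_expneg[of "\<lambda>n. \<Sum>k<n. a k"]
 by (simp add: expneg_sum suminf_eq_SUP incseq_def sum_mono2)

lemma space_counting_space [simp]: "space (\<N> L) = {m. \<C> L m}"
 unfolding counting_space_def by (rule space_measure_of) auto

lemma counting_measure_sets: "\<C> L m \<Longrightarrow> sets m = sets L"
 by (simp add: counting_measure_def)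

lemma counting_measure_space: "\<C> L m \<Longrightarrow> space m = space L"
 by (rule sets_eq_imp_space_eq) (simp add: counting_measure_def)

lemma sets_counting_space:
 "sets (\<N> L) = sigma_sets {m. \<C> L m}
   {{m. \<C> L m \<and> emeasure m A \<in> B} | A B. A \<in> sets L \<and> B \<in> sets borel}"
 unfolding counting_space_def by (rule sets_measure_of) auto

lemma measurable_emeasure_counting [measurable]:
 assumes "A \<in> sets L"
 shows "(\<lambda>m. emeasure m A) \<in> \<F> L"
proof (rule measurableI)
 fix B :: "ennreal set" assume "B \<in> sets borel"
 then show "(\<lambda>m. emeasure m A) -` B \<inter> space (\<N> L) \<in> sets (\<N> L)"
  unfolding sets_counting_space using assms
  by (intro sigma_sets.Basic) (auto intro!: exI[of _ A] exI[of _ B])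
qed simp

lemma measurable_counting_spaceI:
 assumes "\<And>x. x \<in> space N \<Longrightarrow> \<C> L (f x)"
  and "\<And>A. A \<in> sets L \<Longrightarrow> (\<lambda>x. emeasure (f x) A) \<in> \<B> N"
 shows "f \<in> N \<rightarrow>\<^sub>M \<N> L"
 unfolding counting_space_def
proof (rule measurable_measure_of)
 fix y assume "y \<in> {{m. \<C> L m \<and> emeasure m A \<in> B} | A B. A \<in> sets L \<and> B \<in> sets borel}"
 then obtain A B where y: "y = {m. \<C> L m \<and> emeasure m A \<in> B}" "A \<in> sets L" "B \<in> sets borel" by auto
 have "f -` y \<inter> space N = (\<lambda>x. emeasure (f x) A) -` B \<inter> space N" using y assms(1) by auto
 also have "\<dots> \<in> sets N" by (rule measurable_sets[OF assms(2)]) (use y in auto)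
 finally show "f -` y \<inter> space N \<in> sets N" .
qed (use assms(1) in auto)

lemma counting_space_cong: "sets L = sets L' \<Longrightarrow> \<N> L = \<N> L'"
 by (simp add: counting_space_def counting_measure_def)

lemma measurable_nn_integral_counting:
 assumes "f \<in> \<B> L"
 shows "(\<lambda>m. \<integral>\<^sup>+x. f x \<partial>m) \<in> \<F> L"
 using assms
proof (induction rule: borel_measurable_induct)
 case (cong f g)
 have "(\<integral>\<^sup>+x. f x \<partial>m) = (\<integral>\<^sup>+x. g x \<partial>m)" if "\<C> L m" for m
  using that cong by (intro nn_integral_cong) (auto simp: counting_measure_space)
 then show ?case using cong by (subst measurable_cong[where g="\<lambda>m. \<integral>\<^sup>+x. g x \<partial>m"]) auto
next
 case (set A)
 have "(\<integral>\<^sup>+x. indicator A x \<partial>m) = emeasure m A" if "\<C> L m" for m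
  using that set by (intro nn_integral_indicator) (auto simp: counting_measure_sets)
 then show ?case using set by (subst measurable_cong[where g="\<lambda>m. emeasure m A"]) auto
next
 case (mult u c)
 have "(\<integral>\<^sup>+x. c * u x \<partial>m) = c * (\<integral>\<^sup>+x. u x \<partial>m)" if "\<C> L m" for m
  using mult that by (intro nn_integral_cmult) (auto cong: measurable_cong_sets simp: counting_measure_sets)
 then show ?case using mult by (subst measurable_cong[where g="\<lambda>m. c * (\<integral>\<^sup>+x. u x \<partial>m)"]) auto
next
 case (add u v)
 have "(\<integral>\<^sup>+x. v x + u x \<partial>m) = (\<integral>\<^sup>+x. v x \<partial>m) + (\<integral>\<^sup>+x. u x \<partial>m)" if "\<C> L m" for m
  using add that by (intro nn_integral_add) (auto cong: measurable_cong_sets simp: counting_measure_sets)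
 then show ?case using add by (subst measurable_cong[where g="\<lambda>m. (\<integral>\<^sup>+x. v x \<partial>m) + (\<integral>\<^sup>+x. u x \<partial>m)"]) auto
next
 case (seq U)
 have "(\<integral>\<^sup>+x. (SUP i. U i) x \<partial>m) = (SUP i. (\<integral>\<^sup>+x. U i x \<partial>m))" if "\<C> L m" for m
  unfolding SUP_apply[abs_def]
  using seq that by (intro nn_integral_monotone_convergence_SUP) (auto cong: measurable_cong_sets simp: counting_measure_sets)
 then show ?case using seq by (subst measurable_cong[where g="\<lambda>m. SUP i. (\<integral>\<^sup>+x. U i x \<partial>m)"]) (auto simp: SUP_apply[abs_def])
qed

section \<open>Superposition and restriction of counting measures\<close>

definition add_meas :: "'a measure \<Rightarrow> 'a measure \<Rightarrow> 'a measure" where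
 "add_meas m \<nu> = measure_of (space m) (sets m) (\<lambda>A. emeasure m A + emeasure \<nu> A)"

lemma sets_add_meas [simp]: "sets (add_meas m \<nu>) = sets m"
 and space_add_meas [simp]: "space (add_meas m \<nu>) = space m"
 by (simp_all add: add_meas_def)

lemma emeasure_add_meas:
 assumes "sets \<nu> = sets m" "A \<in> sets m"
 shows "emeasure (add_meas m \<nu>) A = emeasure m A + emeasure \<nu> A"
proof (rule emeasure_measure_of[OF add_meas_def])
 show "countably_additive (sets (add_meas m \<nu>)) (\<lambda>A. emeasure m A + emeasure \<nu> A)"
  unfolding countably_additive_def using assms
  by (auto simp: suminf_add[symmetric] suminf_emeasure)
qed (use assms sets.space_closed in \<open>auto simp: positive_def\<close>)

lemma nn_integral_add_meas:
 assumes s: "sets \<nu> = sets m" and f: "f \<in> \<B> m"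
 shows "(\<integral>\<^sup>+x. f x \<partial>add_meas m \<nu>) = (\<integral>\<^sup>+x. f x \<partial>m) + (\<integral>\<^sup>+x. f x \<partial>\<nu>)"
 using f
proof (induction rule: borel_measurable_induct)
 case (cong f g)
 have "integral\<^sup>N \<kappa> f = integral\<^sup>N \<kappa> g" if "space \<kappa> = space m" for \<kappa>
  by (rule nn_integral_cong) (use cong that in simp)
 then show ?case using cong sets_eq_imp_space_eq[OF s] by simp
next
 case (set A)
 then show ?case using s by (simp add: emeasure_add_meas)
next
 case (mult u c)
 have "u \<in> \<B> \<nu>" "u \<in> \<B> (add_meas m \<nu>)" using mult s by (auto cong: measurable_cong_sets)
 then show ?case using mult by (simp add: nn_integral_cmult distrib_left)
next
 case (add u v)
 have "u \<in> \<B> \<nu>" "u \<in> \<B> (add_meas m \<nu>)"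
  "v \<in> \<B> \<nu>" "v \<in> \<B> (add_meas m \<nu>)" using add s by (auto cong: measurable_cong_sets)
 then show ?case using add by (simp add: nn_integral_add algebra_simps)
next
 case (seq U)
 have m: "U i \<in> \<B> \<nu>" "U i \<in> \<B> (add_meas m \<nu>)" for i using seq s by (auto cong: measurable_cong_sets)
 have inc: "incseq (\<lambda>i. \<integral>\<^sup>+x. U i x \<partial>\<kappa>)" for \<kappa>
  using seq(3) by (auto simp: incseq_def le_fun_def intro!: nn_integral_mono)
 show ?case unfolding SUP_apply
  using seq m inc by (simp add: nn_integral_monotone_convergence_SUP ennreal_SUP_add)
qed

lemma counting_measure_add_meas:
 assumes "\<C> L m" "\<C> L \<nu>"
 shows "\<C> L (add_meas m \<nu>)"
proof -
 have "emeasure m A + emeasure \<nu> A \<in> \<nat> \<union> {\<infinity>}" if "A \<in> sets L" for A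
 proof -
  have "emeasure m A \<in> \<nat> \<union> {\<infinity>}" "emeasure \<nu> A \<in> \<nat> \<union> {\<infinity>}" using assms that by (auto simp: counting_measure_def)
  then show ?thesis by auto
 qed
 then show ?thesis using assms by (auto simp: counting_measure_def emeasure_add_meas)
qed

lemma add_dirac_eq_add_meas:
 assumes "sets m = sets L" "x \<in> space L"
 shows "add_dirac m x = add_meas m (return L x)"
 by (rule measure_eqI) (use assms in \<open>auto simp: emeasure_add_dirac emeasure_add_meas\<close>)

lemma nn_integral_add_dirac:
 assumes "sets m = sets L" "x \<in> space L" "f \<in> \<B> L"
 shows "(\<integral>\<^sup>+z. f z \<partial>add_dirac m x) = (\<integral>\<^sup>+z. f z \<partial>m) + f x"
proof -
 have f: "f \<in> \<B> m" using assms(1,3) by (simp cong: measurable_cong_sets)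
 show ?thesis using nn_integral_add_meas[OF _ f, of "return L x"] assms nn_integral_return[OF assms(2,3)]
  by (simp add: add_dirac_eq_add_meas[OF assms(1,2)])
qed

lemma measurable_add_dirac [measurable]:
 "(\<lambda>(x, m). add_dirac m x) \<in> L \<Otimes>\<^sub>M \<N> L \<rightarrow>\<^sub>M \<N> L"
proof (rule measurable_counting_spaceI)
 fix A assume A[measurable]: "A \<in> sets L"
 have "(\<lambda>z. emeasure (snd z) A + indicator A (fst z)) \<in> \<B> (L \<Otimes>\<^sub>M \<N> L)"
  by measurable
 then show "(\<lambda>x. emeasure (case x of (x, m) \<Rightarrow> add_dirac m x) A) \<in> \<B> (L \<Otimes>\<^sub>M \<N> L)"
  by (rule measurable_cong[THEN iffD1, rotated])
   (auto simp: space_pair_measure emeasure_add_dirac counting_measure_sets)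
qed (auto simp: space_pair_measure counting_measure_add_dirac)

text \<open>Written as a density, the restriction keeps the underlying measurable space, so it
  remains an element of the same space of counting measures.\<close>

definition restr :: "'a set \<Rightarrow> 'a measure \<Rightarrow> 'a measure" where
 "restr B m = density m (indicator B)"

lemma sets_restr [simp]: "sets (restr B m) = sets m"
 by (simp add: restr_def)

lemma emeasure_restr: "A \<in> sets m \<Longrightarrow> B \<in> sets m \<Longrightarrow> emeasure (restr B m) A = emeasure m (A \<inter> B)"
 unfolding restr_def
 by (subst emeasure_density) (auto simp: indicator_inter_arith[symmetric] Int_commute)

lemma counting_measure_restr: "\<C> L m \<Longrightarrow> B \<in> sets L \<Longrightarrow> \<C> L (restr B m)"
 by (auto simp: counting_measure_def emeasure_restr)

lemma nn_integral_restr: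
 "f \<in> \<B> m \<Longrightarrow> B \<in> sets m \<Longrightarrow> (\<integral>\<^sup>+x. f x \<partial>restr B m) = (\<integral>\<^sup>+x. f x * indicator B x \<partial>m)"
 unfolding restr_def by (subst nn_integral_density) (auto simp: mult.commute)

lemma measurable_restr [measurable]:
 assumes [measurable]: "B \<in> sets L"
 shows "restr B \<in> \<N> L \<rightarrow>\<^sub>M \<N> L"
proof (rule measurable_counting_spaceI)
 fix A assume A[measurable]: "A \<in> sets L"
 have "(\<lambda>m. emeasure m (A \<inter> B)) \<in> \<F> L" by measurable
 then show "(\<lambda>m. emeasure (restr B m) A) \<in> \<F> L"
  by (rule measurable_cong[THEN iffD1, rotated]) (auto simp: emeasure_restr counting_measure_sets)
qed (auto simp: counting_measure_restr)

lemma measurable_add_meas [measurable]: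
 "(\<lambda>(m, \<nu>). add_meas m \<nu>) \<in> \<N> L \<Otimes>\<^sub>M \<N> L \<rightarrow>\<^sub>M \<N> L"
proof (rule measurable_counting_spaceI)
 fix A assume A[measurable]: "A \<in> sets L"
 have "(\<lambda>z. emeasure (fst z) A + emeasure (snd z) A) \<in> \<B> (\<N> L \<Otimes>\<^sub>M \<N> L)"
  by measurable
 then show "(\<lambda>x. emeasure (case x of (m, \<nu>) \<Rightarrow> add_meas m \<nu>) A) \<in> \<B> (\<N> L \<Otimes>\<^sub>M \<N> L)"
  by (rule measurable_cong[THEN iffD1, rotated])
   (auto simp: space_pair_measure emeasure_add_meas counting_measure_sets)
qed (auto simp: space_pair_measure counting_measure_add_meas)

lemma restr_add_dirac:
 assumes "B \<in> sets m" "x \<in> B"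
 shows "restr B (add_dirac m x) = add_dirac (restr B m) x"
 by (rule measure_eqI) (use assms in \<open>auto simp: emeasure_restr emeasure_add_dirac indicator_def\<close>)

lemma add_meas_add_dirac:
 assumes "sets \<nu> = sets m"
 shows "add_meas (add_dirac m x) \<nu> = add_dirac (add_meas m \<nu>) x"
 by (rule measure_eqI) (use assms in \<open>auto simp: emeasure_add_meas emeasure_add_dirac algebra_simps\<close>)

section \<open>Laplace functionals and their test functions\<close>

definition laplace :: "('a \<Rightarrow> real) \<Rightarrow> 'a measure \<Rightarrow> real" where
 "laplace f m = expneg (\<integral>\<^sup>+x. ennreal (f x) \<partial>m)"

lemma laplace_bounds [simp]: "0 \<le> laplace f m" "laplace f m \<le> 1" "\<bar>laplace f m\<bar> \<le> 1"
 by (auto simp: laplace_def)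

lemma measurable_laplace [measurable]:
 "f \<in> \<B> L \<Longrightarrow> laplace f \<in> \<F> L"
 unfolding laplace_def[abs_def]
 by (intro m_comp[OF measurable_nn_integral_counting measurable_expneg]) auto

lemma laplace_zero [simp]: "laplace (\<lambda>_. 0) m = 1"
 by (simp add: laplace_def)

lemma laplace_add:
 assumes "f \<in> \<B> L" "g \<in> \<B> L" "\<And>x. 0 \<le> f x" "\<And>x. 0 \<le> g x" "sets m = sets L"
 shows "laplace (\<lambda>x. f x + g x) m = laplace f m * laplace g m"
proof -
 have "f \<in> \<B> m" "g \<in> \<B> m" using assms by (simp_all cong: measurable_cong_sets)
 then show ?thesis using assms(3,4)
  by (simp add: laplace_def expneg_add[symmetric] nn_integral_add[symmetric])
qed

lemma laplace_add_dirac: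
 assumes "f \<in> \<B> L" "\<And>x. 0 \<le> f x" "sets m = sets L" "x \<in> space L"
 shows "laplace f (add_dirac m x) = laplace f m * exp (- f x)"
 using assms by (simp add: laplace_def nn_integral_add_dirac expneg_add)

lemma laplace_add_meas:
 assumes "f \<in> \<B> m" "sets \<nu> = sets m"
 shows "laplace f (add_meas m \<nu>) = laplace f m * laplace f \<nu>"
 using assms by (simp add: laplace_def nn_integral_add_meas expneg_add)

lemma laplace_restr:
 assumes "f \<in> \<B> m" "B \<in> sets m"
 shows "laplace f (restr B m) = laplace (\<lambda>x. f x * indicator B x) m"
 using assms by (auto simp: laplace_def nn_integral_restr indicator_def intro!: arg_cong[of _ _ expneg] nn_integral_cong)

text \<open>Finite measure of the support makes the integral of \<open>1 - exp (- f)\<close> finite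
  and involves only sets whose counts have a prescribed Poisson distribution.\<close>

definition test_simple :: "'a measure \<Rightarrow> ('a \<Rightarrow> real) \<Rightarrow> bool" where
 "test_simple L f \<longleftrightarrow> simple_function L f \<and> (\<forall>x. 0 \<le> f x) \<and> emeasure L {x\<in>space L. f x \<noteq> 0} < \<infinity>"

lemma test_simple_measurable: "test_simple L f \<Longrightarrow> f \<in> \<B> L"
 by (auto simp: test_simple_def intro: borel_measurable_simple_function)

lemma test_simple_add:
 assumes "test_simple L f" "test_simple L g" shows "test_simple L (\<lambda>x. f x + g x)"
proof -
 have [measurable]: "f \<in> \<B> L" "g \<in> \<B> L" using assms test_simple_measurable by auto
 have "emeasure L {x\<in>space L. f x + g x \<noteq> 0} \<le> emeasure L ({x\<in>space L. f x \<noteq> 0} \<union> {x\<in>space L. g x \<noteq> 0})"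
  by (intro emeasure_mono) auto
 also have "\<dots> \<le> emeasure L {x\<in>space L. f x \<noteq> 0} + emeasure L {x\<in>space L. g x \<noteq> 0}"
  by (intro emeasure_subadditive) auto
 also have "\<dots> < \<infinity>" using assms by (auto simp: test_simple_def)
 finally show ?thesis using assms by (auto simp: test_simple_def intro: simple_function_add)
qed

lemma test_simple_mult_indicator:
 assumes "test_simple L f" "B \<in> sets L" shows "test_simple L (\<lambda>x. f x * indicator B x)"
proof -
 have [measurable]: "f \<in> \<B> L" using assms test_simple_measurable by auto
 have "emeasure L {x\<in>space L. f x * indicator B x \<noteq> 0} \<le> emeasure L {x\<in>space L. f x \<noteq> 0}"
  by (intro emeasure_mono) (auto simp: indicator_def)
 also have "\<dots> < \<infinity>" using assms by (auto simp: test_simple_def)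
 finally show ?thesis using assms by (auto simp: test_simple_def intro!: simple_function_mult)
qed

lemma test_simple_zero: "test_simple L (\<lambda>_. 0)"
 by (simp add: test_simple_def)

lemma integrable_test_simple:
 assumes "test_simple L f" shows "integrable L (\<lambda>x. 1 - exp (- f x))"
proof -
 have [measurable]: "f \<in> \<B> L" using assms test_simple_measurable by auto
 show ?thesis
 proof (rule B_integrable_bound)
  show "integrable L (indicator {x\<in>space L. f x \<noteq> 0} :: 'a \<Rightarrow> real)"
   using assms by (intro integrable_real_indicator) (auto simp: test_simple_def)
 qed (use assms in \<open>auto simp: test_simple_def indicator_def\<close>)
qed

text \<open>The mass of \<open>A \<inter> X k\<close> is minus the logarithm of the Laplace
  functional of its indicator, the value 0 standing for infinite mass. The supremum over
  \<open>k\<close> recovers the mass of \<open>A\<close>, so these functionals generate all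
  evaluations.\<close>

lemma sets_counting_space_subset:
 assumes X: "\<And>k. X k \<in> sets L" "incseq X" "(\<Union>k. X k) = space L"
 shows "sets (\<N> L) \<subseteq> sigma_sets (space (\<N> L))
  {{m\<in>space (\<N> L). laplace (indicator (A \<inter> X k)) m \<ge> \<tau>} | A k \<tau>. A \<in> sets L}"
  (is "_ \<subseteq> sigma_sets ?\<Omega> ?G")
proof -
 define N where "N = sigma ?\<Omega> ?G"
 have sN: "space N = {m. \<C> L m}" and setsN: "sets N = sigma_sets ?\<Omega> ?G"
  unfolding N_def by (subst space_measure_of sets_measure_of; auto)+
 have m1: "laplace (indicator (A \<inter> X k)) \<in> \<B> N" if "A \<in> sets L" for A k
 proof (subst borel_measurable_iff_ge, intro allI)
  fix \<tau> :: real
  show "{m \<in> space N. \<tau> \<le> laplace (indicator (A \<inter> X k)) m} \<in> sets N"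
   unfolding setsN sN using that by (intro sigma_sets.Basic) auto
 qed
 have m2: "(\<lambda>m. emeasure m A) \<in> \<B> N" if A: "A \<in> sets L" for A
 proof -
  have eq: "emeasure m (A \<inter> X k) = (if laplace (indicator (A \<inter> X k)) m = 0 then \<infinity> else ennreal (- ln (laplace (indicator (A \<inter> X k)) m)))"
   if "\<C> L m" for m k
  proof -
   have "A \<inter> X k \<in> sets m" using A X(1) that by (auto simp: counting_measure_sets)
   then have "laplace (indicator (A \<inter> X k)) m = expneg (emeasure m (A \<inter> X k))"
    by (simp add: laplace_def ennreal_indicator)
   then show ?thesis by (cases "emeasure m (A \<inter> X k)") (auto simp: expneg_def)
  qed
  have "(\<lambda>m. SUP k. (if laplace (indicator (A \<inter> X k)) m = 0 then \<infinity> else ennreal (- ln (laplace (indicator (A \<inter> X k)) m)))) \<in> \<B> N"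
   using m1[OF A] by measurable
  moreover have "emeasure m A = (SUP k. (if laplace (indicator (A \<inter> X k)) m = 0 then \<infinity> else ennreal (- ln (laplace (indicator (A \<inter> X k)) m))))"
   if "m \<in> space N" for m
  proof -
   have m: "\<C> L m" using that sN by simp
   have "A = (\<Union>k. A \<inter> X k)" using X(3) sets.sets_into_space[OF A] by auto
   then have "emeasure m A = emeasure m (\<Union>k. A \<inter> X k)" by simp
   also have "\<dots> = (SUP k. emeasure m (A \<inter> X k))"
    using X A m by (intro SUP_emeasure_incseq[symmetric]) (auto simp: incseq_def counting_measure_sets)
   finally show ?thesis using eq[OF m] by simp
  qed
  ultimately show ?thesis by (subst measurable_cong) auto
 qed
 have "{m. \<C> L m \<and> emeasure m A \<in> B} \<in> sets N" if "A \<in> sets L" "B \<in> sets borel" for A B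
  using measurable_sets[OF m2[OF that(1)] that(2)] by (auto simp: sN vimage_def Collect_conj_eq Int_commute)
 then show ?thesis
  unfolding setsN[symmetric] sets_counting_space sN[symmetric]
  by (intro sets.sigma_sets_subset) auto
qed

text \<open>This class depends on the measurable space and the exhaustion, not on the values of the
  measure. One and the same class therefore serves all intensities \<open>marked L t\<close> at
  once.\<close>

definition exh_test :: "'a measure \<Rightarrow> (nat \<Rightarrow> 'a set) \<Rightarrow> ('a \<Rightarrow> real) set" where
 "exh_test L X = {f. simple_function L f \<and> (\<forall>x. 0 \<le> f x) \<and> (\<exists>k. \<forall>x. x \<notin> X k \<longrightarrow> f x = 0)}"

lemma exh_test_test_simple:
 assumes f: "f \<in> exh_test L X" and X: "\<And>k. X k \<in> sets L" "\<And>k. emeasure L (X k) < \<infinity>"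
 shows "test_simple L f"
proof -
 obtain k where k: "\<And>x. x \<notin> X k \<Longrightarrow> f x = 0" using f by (auto simp: exh_test_def)
 have "emeasure L {x\<in>space L. f x \<noteq> 0} \<le> emeasure L (X k)" using k X by (intro emeasure_mono) auto
 also have "\<dots> < \<infinity>" by (rule X)
 finally show ?thesis using f by (auto simp: exh_test_def test_simple_def)
qed

text \<open>The Laplace functional of a sum is the product of the Laplace functionals, so over
  \<open>exh_test\<close> they form a multiplicative class, and by the previous lemma it generates
  the \<sigma>-algebra. This is the induction principle behind all identities between
  functionals.\<close>

theorem counting_space_bounded_induct:
 fixes f :: "'a measure \<Rightarrow> real"
 assumes X: "\<And>k. X k \<in> sets L" "incseq X" "(\<Union>k. X k) = space L"
  and f: "f \<in> \<F> L" "\<And>m. \<C> L m \<Longrightarrow> \<bar>f m\<bar> \<le> B"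
  and H_gen: "\<And>f. f \<in> exh_test L X \<Longrightarrow> H (laplace f)"
  and H_lin: "\<And>B c d f g. f \<in> \<F> L \<Longrightarrow> (\<And>m. \<C> L m \<Longrightarrow> \<bar>f m\<bar> \<le> B) \<Longrightarrow> H f \<Longrightarrow>
    g \<in> \<F> L \<Longrightarrow> (\<And>m. \<C> L m \<Longrightarrow> \<bar>g m\<bar> \<le> B) \<Longrightarrow> H g \<Longrightarrow>
    H (\<lambda>m. c * f m + d * g m)"
  and H_lim: "\<And>B h g. (\<And>n. h n \<in> \<F> L) \<Longrightarrow>
    (\<And>n m. \<C> L m \<Longrightarrow> \<bar>h n m\<bar> \<le> B) \<Longrightarrow>
    (\<And>n. H (h n)) \<Longrightarrow> g \<in> \<F> L \<Longrightarrow>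
    (\<And>m. \<C> L m \<Longrightarrow> \<bar>g m\<bar> \<le> B) \<Longrightarrow>
    (\<And>m. \<C> L m \<Longrightarrow> (\<lambda>n. h n m) \<longlonglongrightarrow> g m) \<Longrightarrow> H g"
 shows "H f"
proof -
 \<comment> \<open>Membership is agreement on counting measures: the product rule for
   \<open>laplace\<close> holds only for measures with the right \<sigma>-algebra, so closure under
   products would fail for equality of functions.\<close>
 define \<Psi> where "\<Psi> = {\<psi>. \<exists>f\<in>exh_test L X. \<forall>m. \<C> L m \<longrightarrow> \<psi> m = laplace f m}"
 have mT: "f \<in> \<B> L" if "f \<in> exh_test L X" for f
  using that by (auto simp: exh_test_def intro: borel_measurable_simple_function)
 have m: "\<psi> \<in> \<F> L" if \<psi>: "\<psi> \<in> \<Psi>" for \<psi>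
 proof -
  from \<psi> obtain f where f: "f \<in> exh_test L X" "\<And>m. \<C> L m \<Longrightarrow> \<psi> m = laplace f m"
   by (auto simp: \<Psi>_def)
  from measurable_laplace[OF mT[OF f(1)]] show ?thesis
   by (rule measurable_cong[THEN iffD1, rotated]) (simp add: f(2))
 qed
 interpret bounded_class "\<N> L" \<Psi> H
 proof
  fix \<psi> assume \<psi>: "\<psi> \<in> \<Psi>"
  then obtain f where f: "f \<in> exh_test L X" "\<And>m. \<C> L m \<Longrightarrow> \<psi> m = laplace f m"
   by (auto simp: \<Psi>_def)
  show "\<psi> \<in> \<F> L" by (rule m[OF \<psi>])
  show "\<bar>\<psi> x\<bar> \<le> 1" if "x \<in> space (\<N> L)" for x using f(2)[of x] that by simp
  show "H \<psi>"
   by (rule H_lim[where B=1 and h="\<lambda>_. laplace f"]) (use f m[OF \<psi>] mT in \<open>auto intro: measurable_laplace H_gen\<close>)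
  fix \<psi>' assume "\<psi>' \<in> \<Psi>"
  then obtain g where g: "g \<in> exh_test L X" "\<And>m. \<C> L m \<Longrightarrow> \<psi>' m = laplace g m"
   by (auto simp: \<Psi>_def)
  obtain k k' where k: "\<And>x. x \<notin> X k \<Longrightarrow> f x = 0" "\<And>x. x \<notin> X k' \<Longrightarrow> g x = 0"
   using f(1) g(1) by (auto simp: exh_test_def)
  have "X k \<subseteq> X (max k k')" "X k' \<subseteq> X (max k k')" using X(2) by (auto simp: incseq_def)
  then have "f x + g x = 0" if "x \<notin> X (max k k')" for x
  proof -
   have "x \<notin> X k" "x \<notin> X k'" using \<open>X k \<subseteq> _\<close> \<open>X k' \<subseteq> _\<close> that by blast+
   then show ?thesis by (simp add: k)
  qed
  then have "(\<lambda>x. f x + g x) \<in> exh_test L X" using f(1) g(1)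
   by (auto simp: exh_test_def intro: simple_function_add)
  moreover have "\<psi> m * \<psi>' m = laplace (\<lambda>x. f x + g x) m" if "\<C> L m" for m
   using f g that mT by (simp add: laplace_add[where L=L] exh_test_def counting_measure_sets)
  ultimately show "(\<lambda>x. \<psi> x * \<psi>' x) \<in> \<Psi>" by (auto simp: \<Psi>_def)
 next
  show "(\<lambda>_. 1) \<in> \<Psi>" unfolding \<Psi>_def
   by (rule CollectI, rule bexI[of _ "\<lambda>_. 0"]) (auto simp: exh_test_def)
  have "laplace (indicator (A \<inter> X k)) \<in> \<Psi>" if "A \<in> sets L" for A k
   unfolding \<Psi>_def using that X(1)
   by (intro CollectI bexI[of _ "indicator (A \<inter> X k)"]) (auto simp: exh_test_def indicator_def)
  then show "sets (\<N> L) \<subseteq> sigma_sets (space (\<N> L))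
   {{x \<in> space (\<N> L). \<tau> \<le> \<psi> x} |\<psi> \<tau>. \<psi> \<in> \<Psi>}"
   by (intro order_trans[OF sets_counting_space_subset[OF X]] sigma_sets_mono') blast+
 next
  show "H g" if "\<And>n. h n \<in> \<F> L"
    "\<And>n x. x \<in> space (\<N> L) \<Longrightarrow> \<bar>h n x\<bar> \<le> B" "\<And>n. H (h n)" "g \<in> \<F> L"
    "\<And>x. x \<in> space (\<N> L) \<Longrightarrow> (\<lambda>n. h n x) \<longlonglongrightarrow> g x" for h B g
  proof (rule H_lim[where h=h and B=B])
   show "\<bar>g m\<bar> \<le> B" if "\<C> L m" for m
    using tendsto_rabs[OF \<open>\<And>x. x \<in> space (\<N> L) \<Longrightarrow> (\<lambda>n. h n x) \<longlonglongrightarrow> g x\<close>[of m]] that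
     \<open>\<And>n x. x \<in> space (\<N> L) \<Longrightarrow> \<bar>h n x\<bar> \<le> B\<close>
    by (intro LIMSEQ_le_const2[where x="\<bar>g m\<bar>"]) auto
  qed (use that in auto)
 next
  show "H (\<lambda>x. c * f x + d * g x)" if "f \<in> \<F> L"
    "\<And>x. x \<in> space (\<N> L) \<Longrightarrow> \<bar>f x\<bar> \<le> B" "H f" "g \<in> \<F> L"
    "\<And>x. x \<in> space (\<N> L) \<Longrightarrow> \<bar>g x\<bar> \<le> B" "H g" for f g B c d
   by (rule H_lin[of f B g]) (use that in simp_all)
 qed
 show ?thesis by (rule bounded_measurable[where B=B]) (use f in auto)
qed

section \<open>Poisson laws\<close>

text \<open>A Poisson law is recorded through its Laplace functional. By
  \<open>pois_law_unique\<close> this determines it, and superposition, restriction and marking all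
  act on it by simple formulas.\<close>

definition pois_law :: "'a measure \<Rightarrow> 'a measure measure \<Rightarrow> bool" where
 "pois_law L P \<longleftrightarrow> prob_space P \<and> sets P = sets (\<N> L) \<and>
   (\<forall>f. test_simple L f \<longrightarrow> (\<integral>m. laplace f m \<partial>P) = exp (- (\<integral>x. 1 - exp (- f x) \<partial>L)))"

lemma pois_lawD:
 assumes "pois_law L P"
 shows "prob_space P" "sets P = sets (\<N> L)" "space P = {m. \<C> L m}"
  "\<And>f. test_simple L f \<Longrightarrow> (\<integral>m. laplace f m \<partial>P) = exp (- (\<integral>x. 1 - exp (- f x) \<partial>L))"
 using assms sets_eq_imp_space_eq[of P "\<N> L"] by (auto simp: pois_law_def)

lemma prob_space_eq_counting:
 assumes L: "sigma_finite_measure L"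
  and X: "\<And>k. X k \<in> sets L" "incseq X" "(\<Union>k. X k) = space L"
  and P: "prob_space P" "sets P = sets (\<N> L)"
  and Q: "prob_space Q" "sets Q = sets (\<N> L)"
  and eq: "\<And>f. f \<in> exh_test L X \<Longrightarrow> (\<integral>m. laplace f m \<partial>P) = (\<integral>m. laplace f m \<partial>Q)"
 shows "P = Q"
proof (rule measure_eqI)
 interpret P: prob_space P by (rule P)
 interpret Q: prob_space Q by (rule Q)
 have sp: "space P = {m. \<C> L m}" "space Q = {m. \<C> L m}"
  using P Q sets_eq_imp_space_eq[of _ "\<N> L"] by auto
 have mP: "\<B> P = (\<F> L :: ('a measure \<Rightarrow> real) set)"
  and mQ: "\<B> Q = (\<F> L :: ('a measure \<Rightarrow> real) set)"
  using P Q by (auto intro: measurable_cong_sets)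
 have int: "integrable P f" "integrable Q f" if "f \<in> \<F> L" "\<And>m. \<C> L m \<Longrightarrow> \<bar>f m\<bar> \<le> B" for f :: "'a measure \<Rightarrow> real" and B
  using that by (auto intro!: P.integrable_const_bound[where B=B] Q.integrable_const_bound[where B=B] simp: mP mQ sp)
 fix E assume E: "E \<in> sets P"
 have "(\<integral>m. indicator E m \<partial>P) = (\<integral>m. indicator E m \<partial>Q :: real)"
 proof (rule counting_space_bounded_induct[OF X, where f="indicator E" and B=1])
  show "(\<integral>m. c * f m + d * g m \<partial>P) = (\<integral>m. c * f m + d * g m \<partial>Q)"
   if "f \<in> \<F> L" "\<And>m. \<C> L m \<Longrightarrow> \<bar>f m\<bar> \<le> B" "integral\<^sup>L P f = integral\<^sup>L Q f"
    "g \<in> \<F> L" "\<And>m. \<C> L m \<Longrightarrow> \<bar>g m\<bar> \<le> B" "integral\<^sup>L P g = integral\<^sup>L Q g" for f g :: "'a measure \<Rightarrow> real" and c d B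
   using int[of f B] int[of g B] that by simp
  show "(\<integral>m. g m \<partial>P) = (\<integral>m. g m \<partial>Q)"
   if "\<And>n. h n \<in> \<F> L" "\<And>n m. \<C> L m \<Longrightarrow> \<bar>h n m\<bar> \<le> B"
    "\<And>n. integral\<^sup>L P (h n) = integral\<^sup>L Q (h n)" "g \<in> \<F> L"
    "\<And>m. \<C> L m \<Longrightarrow> (\<lambda>n. h n m) \<longlonglongrightarrow> g m" for h B and g :: "'a measure \<Rightarrow> real"
  proof -
   have "(\<lambda>n. integral\<^sup>L P (h n)) \<longlonglongrightarrow> integral\<^sup>L P g"
    using that by (intro integral_dominated_convergence[where w="\<lambda>_. B"]) (auto simp: mP sp)
   moreover have "(\<lambda>n. integral\<^sup>L Q (h n)) \<longlonglongrightarrow> integral\<^sup>L Q g"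
    using that by (intro integral_dominated_convergence[where w="\<lambda>_. B"]) (auto simp: mQ sp)
   ultimately show ?thesis using that(3) LIMSEQ_unique by auto
  qed
 qed (use eq E P(2) in auto)
 then show "emeasure P E = emeasure Q E"
  using E P(2) Q(2) by (simp add: P.emeasure_eq_measure Q.emeasure_eq_measure)
qed (use P Q in simp)

lemma exhaustion_exists:
 assumes "sigma_finite_measure L"
 obtains X where "\<And>k. X k \<in> sets L" "incseq X" "(\<Union>k. X k) = space L" "\<And>k. emeasure L (X k) < \<infinity>"
proof -
 interpret sigma_finite_measure L by fact
 obtain A where "range A \<subseteq> sets L" "(\<Union>i. A i) = space L" "\<And>i. emeasure L (A i) \<noteq> \<infinity>" "incseq A"
  using sigma_finite_incseq by blast
 then show ?thesis by (intro that[of A]) (auto simp: less_top)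
qed

theorem pois_law_unique:
 assumes L: "sigma_finite_measure L" and "pois_law L P" "pois_law L Q"
 shows "P = Q"
proof -
 obtain X where X: "\<And>k. X k \<in> sets L" "incseq X" "(\<Union>k. X k) = space L" "\<And>k. emeasure L (X k) < \<infinity>"
  using exhaustion_exists[OF L] by metis
 show ?thesis
  by (rule prob_space_eq_counting[OF L X(1-3)])
   (use assms exh_test_test_simple[OF _ X(1,4)] in \<open>auto simp: pois_law_def\<close>)
qed

text \<open>The value 0 is split off because its level set may have infinite measure; subtracting
  \<open>h 0\<close> removes it from the sum.\<close>

lemma simple_function_values:
 fixes f :: "'a \<Rightarrow> real"
 assumes f: "simple_function L f" "\<And>x. 0 \<le> f x" and x: "x \<in> space L"
 defines "V \<equiv> f ` space L - {0}"
 shows "h (f x) = h 0 + (\<Sum>y\<in>V. (h y - h 0) * indicator (f -` {y} \<inter> space L) x :: real)"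
  and "ennreal (f x) = (\<Sum>y\<in>V. ennreal y * indicator (f -` {y} \<inter> space L) x)"
proof -
 have V: "finite V" using f by (auto simp: V_def simple_function_def)
 have i: "indicator (f -` {y} \<inter> space L) x = (if f x = y then 1 else 0 :: 'b :: zero_neq_one)" for y
  using x by (auto simp: indicator_def)
 show "h (f x) = h 0 + (\<Sum>y\<in>V. (h y - h 0) * indicator (f -` {y} \<inter> space L) x :: real)"
  using V x by (simp add: i if_distrib[of "\<lambda>z. _ * z"] cong: if_cong) (auto simp: V_def)
 show "ennreal (f x) = (\<Sum>y\<in>V. ennreal y * indicator (f -` {y} \<inter> space L) x)"
  using V x by (simp add: i if_distrib[of "\<lambda>z. _ * z"] cong: if_cong) (auto simp: V_def)
qed

lemma nn_integral_simple_values: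
 fixes f :: "'a \<Rightarrow> real"
 assumes f: "simple_function L f" "\<And>x. 0 \<le> f x" and m: "sets m = sets L"
 shows "(\<integral>\<^sup>+x. ennreal (f x) \<partial>m) = (\<Sum>y\<in>f ` space L - {0}. ennreal y * emeasure m (f -` {y} \<inter> space L))"
proof -
 have sp: "space m = space L" using m by (rule sets_eq_imp_space_eq)
 have A: "f -` {y} \<inter> space L \<in> sets m" for y using simple_functionD(2)[OF f(1)] m by simp
 have "(\<integral>\<^sup>+x. ennreal (f x) \<partial>m) = (\<integral>\<^sup>+x. (\<Sum>y\<in>f ` space L - {0}. ennreal y * indicator (f -` {y} \<inter> space L) x) \<partial>m)"
  using simple_function_values(2)[OF f] sp by (intro nn_integral_cong) simp
 also have "\<dots> = (\<Sum>y\<in>f ` space L - {0}. ennreal y * emeasure m (f -` {y} \<inter> space L))"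
  using A by (subst nn_integral_sum) (auto simp: nn_integral_cmult_indicator)
 finally show ?thesis .
qed

lemma integral_simple_values:
 assumes f: "test_simple L f"
 shows "(\<integral>x. 1 - exp (- f x) \<partial>L) = (\<Sum>y\<in>f ` space L - {0}. (1 - exp (- y)) * measure L (f -` {y} \<inter> space L))"
proof -
 have s: "simple_function L f" "\<And>x. 0 \<le> f x" using f by (auto simp: test_simple_def)
 have A: "f -` {y} \<inter> space L \<in> sets L" for y using simple_functionD(2)[OF s(1)] by simp
 have [measurable]: "f \<in> \<B> L" using f by (rule test_simple_measurable)
 have fin: "emeasure L (f -` {y} \<inter> space L) < \<infinity>" if "y \<noteq> 0" for y
 proof -
  have "emeasure L (f -` {y} \<inter> space L) \<le> emeasure L {x\<in>space L. f x \<noteq> 0}"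
   using that by (intro emeasure_mono) auto
  also have "\<dots> < \<infinity>" using f by (auto simp: test_simple_def)
  finally show ?thesis .
 qed
 have "(\<integral>x. 1 - exp (- f x) \<partial>L) = (\<integral>x. (\<Sum>y\<in>f ` space L - {0}. (1 - exp (- y)) * indicator (f -` {y} \<inter> space L) x) \<partial>L)"
  using simple_function_values(1)[OF s, of _ "\<lambda>y. 1 - exp (- y)"] by (intro B_integral_cong) auto
 also have "\<dots> = (\<Sum>y\<in>f ` space L - {0}. (1 - exp (- y)) * measure L (f -` {y} \<inter> space L))"
  using A fin by (subst B_integral_sum) auto
 finally show ?thesis .
qed

lemma integral_expneg_poisson:
 assumes M: "prob_space M" and Z: "Z \<in> \<B> M" "\<And>u. u \<in> space M \<Longrightarrow> Z u \<in> \<nat> \<union> {\<infinity>}"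
  and p: "\<And>k. measure M {u\<in>space M. Z u = of_nat k} = t ^ k / fact k * exp (- t)" and t: "0 \<le> t" and y: "0 \<le> y"
 shows "(\<integral>u. expneg (ennreal y * Z u) \<partial>M) = exp (- ((1 - exp (- y)) * t))"
proof -
 interpret prob_space M by fact
 let ?A = "\<lambda>k::nat. {u\<in>space M. Z u = of_nat k}"
 note [measurable] = Z(1)
 have disj: "disjoint_family ?A" by (auto simp: disjoint_family_on_def)
 have z: "expneg (ennreal y * Z u) = exp (- y) ^ k" if "u \<in> ?A k" for u k
  using that y by (simp add: expneg_mult_nat)
 \<comment> \<open>At \<open>Z u = \<infinity>\<close> the series is 0, whereas for
   \<open>y = 0\<close> the left side would be 1 by the convention that 0 times \<infinity> is 0.
   Hence the case \<open>y = 0\<close> is treated apart.\<close>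
 have pw: "ennreal (expneg (ennreal y * Z u)) = (\<Sum>k. ennreal (exp (- y) ^ k) * indicator (?A k) u)" if u: "u \<in> space M" and y0: "y \<noteq> 0" for u
 proof (cases "Z u = \<infinity>")
  case True
  then show ?thesis using y y0 by (simp add: ennreal_mult_top)
 next
  case False
  then obtain k where "Z u = of_nat k" using Z(2)[OF u] by (auto simp: Nats_def)
  then have k: "u \<in> ?A k" using u by simp
  show ?thesis unfolding suminf_cmult_indicator[OF disj k] z[OF k] ..
 qed
 have s: "(\<lambda>k. exp (- y) ^ k * (t ^ k / fact k * exp (- t))) sums (exp (exp (- y) * t) * exp (- t))"
  using sums_mult2[OF exp_converges[of "exp (- y) * t"], of "exp (- t)"]
  by (simp add: power_mult_distrib divide_inverse mult_ac scaleR_conv_of_real)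
 have "(\<integral>\<^sup>+u. ennreal (expneg (ennreal y * Z u)) \<partial>M) = ennreal (exp (- ((1 - exp (- y)) * t)))" if y0: "y \<noteq> 0"
 proof -
  have "(\<integral>\<^sup>+u. ennreal (expneg (ennreal y * Z u)) \<partial>M) = (\<integral>\<^sup>+u. (\<Sum>k. ennreal (exp (- y) ^ k) * indicator (?A k) u) \<partial>M)"
   using pw y0 by (intro nn_integral_cong) auto
  also have "\<dots> = (\<Sum>k. ennreal (exp (- y) ^ k) * emeasure M (?A k))"
   by (subst nn_integral_suminf) (auto simp: nn_integral_cmult_indicator)
  also have "\<dots> = (\<Sum>k. ennreal (exp (- y) ^ k * (t ^ k / fact k * exp (- t))))"
   by (simp only: emeasure_eq_measure p) (simp add: ennreal_mult[symmetric] t)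
  also have "\<dots> = ennreal (exp (exp (- y) * t) * exp (- t))"
   using s t by (intro suminf_ennreal_eq) auto
  finally show ?thesis by (simp add: exp_add[symmetric] algebra_simps)
 qed
 then show ?thesis
  by (cases "y = 0") (auto simp: integral_eq_nn_integral prob_space)
qed

text \<open>A test function has finitely many nonzero values, on disjoint level sets of finite
  measure. The Laplace functional of \<eta> is thus a finite product of independent factors, each
  with the Laplace transform of a Poisson variable.\<close>

theorem pois_law_distr:
 assumes M: "prob_space M" and \<eta>: "poisson_measure M L \<eta>"
 shows "pois_law L (distr M (\<N> L) \<eta>)"
 unfolding pois_law_def
proof (intro conjI allI impI)
 interpret prob_space M by fact
 have m[measurable]: "\<eta> \<in> M \<rightarrow>\<^sub>M \<N> L" using \<eta> by (simp add: poisson_measure_def)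
 then show "prob_space (distr M (\<N> L) \<eta>)" by (rule prob_space_distr)
 have c: "\<C> L (\<eta> u)" if "u \<in> space M" for u
  using measurable_space[OF m that] by simp
 fix f assume f: "test_simple L f"
 have s: "simple_function L f" "\<And>x. 0 \<le> f x" using f by (auto simp: test_simple_def)
 have fm[measurable]: "f \<in> \<B> L" using f by (rule test_simple_measurable)
 let ?V = "f ` space L - {0}"
 let ?A = "\<lambda>y. f -` {y} \<inter> space L"
 have V: "finite ?V" using s by (auto simp: simple_function_def)
 have A: "?A y \<in> sets L" for y using simple_functionD(2)[OF s(1)] by simp
 have fin: "emeasure L (?A y) < \<infinity>" if "y \<noteq> 0" for y
 proof -
  have "emeasure L (?A y) \<le> emeasure L {x\<in>space L. f x \<noteq> 0}"
   using that by (intro emeasure_mono) auto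
  also have "\<dots> < \<infinity>" using f by (auto simp: test_simple_def)
  finally show ?thesis .
 qed
 \<comment> \<open>The values are enumerated by natural numbers because
   \<open>poisson_measure\<close> states independence for sets indexed by an initial
   segment.\<close>
 obtain e where e: "bij_betw e {..<card ?V} ?V"
  using ex_bij_betw_nat_finite[OF V] by (auto simp: atLeast0LessThan)
 define n where "n = card ?V"
 have eV: "e k \<in> ?V" if "k < n" for k using e that by (auto simp: bij_betw_def n_def)
 define Z where "Z = (\<lambda>k u. expneg (ennreal (e k) * emeasure (\<eta> u) (?A (e k))))"
 have "disjoint_family_on (\<lambda>k. ?A (e k)) {..<n}"
  using e by (auto simp: disjoint_family_on_def bij_betw_def inj_on_def n_def)
 then have "indep_vars (\<lambda>_. borel) (\<lambda>k u. emeasure (\<eta> u) (?A (e k))) {..<n}"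
  using \<eta>[unfolded poisson_measure_def, THEN conjunct2, THEN conjunct2, THEN conjunct2, rule_format, of n "\<lambda>k. ?A (e k)"] A by auto
 then have ind: "indep_vars (\<lambda>_. borel) Z {..<n}"
  unfolding Z_def by (rule indep_vars_compose2[where Y="\<lambda>k x. expneg (ennreal (e k) * x)"]) measurable
 have Zm: "Z k \<in> \<B> M" if "k \<in> {..<n}" for k
  using ind that by (auto simp: indep_vars_def2)
 have EZ: "(\<integral>u. Z k u \<partial>M) = exp (- ((1 - exp (- e k)) * measure L (?A (e k))))" if "k < n" for k
  unfolding Z_def
 proof (rule integral_expneg_poisson)
  show "emeasure (\<eta> u) (?A (e k)) \<in> \<nat> \<union> {\<infinity>}" if "u \<in> space M" for u
   using c[OF that] A by (auto simp: counting_measure_def)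
  show "measure M {u \<in> space M. emeasure (\<eta> u) (?A (e k)) = of_nat j} = measure L (?A (e k)) ^ j / fact j * exp (- measure L (?A (e k)))" for j
   using \<eta> A fin[of "e k"] eV[OF that] unfolding poisson_measure_def by blast
  show "0 \<le> e k" using eV[OF that] s(2) by auto
  have "?A (e k) \<in> sets L" by (rule A)
  then show "(\<lambda>u. emeasure (\<eta> u) (?A (e k))) \<in> \<B> M" by measurable
 qed (use M in auto)
 have "(\<integral>m. laplace f m \<partial>distr M (\<N> L) \<eta>) = (\<integral>u. laplace f (\<eta> u) \<partial>M)"
  by (rule integral_distr) measurable
 also have "\<dots> = (\<integral>u. (\<Prod>k<n. Z k u) \<partial>M)"
 proof (rule B_integral_cong[OF refl])
  fix u assume "u \<in> space M"
  then have "laplace f (\<eta> u) = expneg (\<Sum>y\<in>?V. ennreal y * emeasure (\<eta> u) (?A y))"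
   unfolding laplace_def using c by (subst nn_integral_simple_values[OF s]) (auto simp: counting_measure_sets)
  also have "(\<Sum>y\<in>?V. ennreal y * emeasure (\<eta> u) (?A y)) = (\<Sum>k<n. ennreal (e k) * emeasure (\<eta> u) (?A (e k)))"
   unfolding n_def by (rule sum.reindex_bij_betw[OF e, symmetric])
  finally show "laplace f (\<eta> u) = (\<Prod>k<n. Z k u)" by (simp add: expneg_sum Z_def)
 qed
 also have "\<dots> = (\<Prod>k<n. \<integral>u. Z k u \<partial>M)"
  using ind Zm by (intro indep_vars_lebesgue_integral) (auto intro!: integrable_const_bound[where B=1] simp: Z_def)
 also have "\<dots> = exp (- (\<Sum>k<n. (1 - exp (- e k)) * measure L (?A (e k))))"
  by (simp add: EZ exp_sum sum_negf[symmetric])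
 also have "(\<Sum>k<n. (1 - exp (- e k)) * measure L (?A (e k))) = (\<Sum>y\<in>?V. (1 - exp (- y)) * measure L (?A y))"
  unfolding n_def by (rule sum.reindex_bij_betw[OF e])
 finally show "(\<integral>m. laplace f m \<partial>distr M (\<N> L) \<eta>) = exp (- (\<integral>x. 1 - exp (- f x) \<partial>L))"
  by (simp add: integral_simple_values[OF f])
qed simp

subsection \<open>Existence\<close>

lemma integral_PiM_prod_finite:
 fixes h :: "'i \<Rightarrow> 'a \<Rightarrow> real"
 assumes M: "\<And>i. prob_space (M i)" and J: "finite J" "J \<subseteq> I"
  and h: "\<And>i. i \<in> J \<Longrightarrow> integrable (M i) (h i)"
 shows "(\<integral>u. (\<Prod>i\<in>J. h i (u i)) \<partial>PiM I M) = (\<Prod>i\<in>J. \<integral>x. h i x \<partial>M i)"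
proof -
 interpret product_prob_space M I by (rule product_prob_spaceI) (rule M)
 have [measurable]: "h i \<in> \<B> (M i)" if "i \<in> J" for i using h[OF that] by simp
 have "(\<Prod>i\<in>J. \<integral>x. h i x \<partial>M i) = (\<integral>u. (\<Prod>i\<in>J. h i (u i)) \<partial>PiM J M)"
  using J(1) h by (rule product_integral_prod[symmetric])
 also have "PiM J M = distr (PiM I M) (PiM J M) (\<lambda>u. restrict u J)"
  by (rule distr_PiM_restrict_finite[OF J, symmetric])
 also have "(\<integral>u. (\<Prod>i\<in>J. h i (u i)) \<partial>\<dots>) = (\<integral>u. (\<Prod>i\<in>J. h i (restrict u J i)) \<partial>PiM I M)"
  by (rule integral_distr) (use J in \<open>auto intro!: measurable_restrict_subset\<close>)
 also have "\<dots> = (\<integral>u. (\<Prod>i\<in>J. h i (u i)) \<partial>PiM I M)"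
  by (intro B_integral_cong prod.cong) auto
 finally show ?thesis ..
qed

definition sum_meas :: "'a measure \<Rightarrow> (nat \<Rightarrow> 'a measure) \<Rightarrow> 'a measure" where
 "sum_meas L m = measure_of (space L) (sets L) (\<lambda>A. \<Sum>k. emeasure (m k) A)"

lemma sets_sum_meas [simp]: "sets (sum_meas L m) = sets L"
 by (simp add: sum_meas_def)

lemma emeasure_sum_meas:
 assumes s: "\<And>k. sets (m k) = sets L" and A: "A \<in> sets L"
 shows "emeasure (sum_meas L m) A = (\<Sum>k. emeasure (m k) A)"
proof (rule emeasure_measure_of[OF sum_meas_def])
 show "countably_additive (sets (sum_meas L m)) (\<lambda>A. \<Sum>k. emeasure (m k) A)"
  unfolding countably_additive_def
 proof (intro allI impI)
  fix A :: "nat \<Rightarrow> _" assume A: "range A \<subseteq> sets (sum_meas L m)" "disjoint_family A"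
  have "(\<Sum>i. \<Sum>k. emeasure (m k) (A i)) = (\<Sum>k. \<Sum>i. emeasure (m k) (A i))"
  proof -
   have "(\<Sum>i. \<Sum>k. emeasure (m k) (A i)) = (\<Sum>i. \<integral>\<^sup>+k. emeasure (m k) (A i) \<partial>count_space UNIV)"
    by (simp add: nn_integral_count_space_nat)
   also have "\<dots> = (\<integral>\<^sup>+k. (\<Sum>i. emeasure (m k) (A i)) \<partial>count_space UNIV)"
    by (rule nn_integral_suminf[symmetric]) simp
   finally show ?thesis by (simp add: nn_integral_count_space_nat)
  qed
  also have "\<dots> = (\<Sum>k. emeasure (m k) (\<Union> (range A)))"
   using A s by (simp add: suminf_emeasure)
  finally show "(\<Sum>i. \<Sum>k. emeasure (m k) (A i)) = (\<Sum>k. emeasure (m k) (\<Union> (range A)))" .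
 qed
qed (use A sets.space_closed in \<open>auto simp: positive_def\<close>)

definition points :: "'a measure \<Rightarrow> nat \<Rightarrow> (nat \<Rightarrow> 'a) \<Rightarrow> 'a measure" where
 "points L n x = distr (count_space {..<n}) L x"

lemma sets_points [simp]: "sets (points L n x) = sets L"
 by (simp add: points_def)

lemma nn_integral_points:
 assumes "\<And>i. i < n \<Longrightarrow> x i \<in> space L" "f \<in> \<B> L"
 shows "(\<integral>\<^sup>+z. f z \<partial>points L n x) = (\<Sum>i<n. f (x i))"
 unfolding points_def using assms
 by (subst nn_integral_distr) (auto simp: nn_integral_count_space_finite)

text \<open>The classical construction: cut the space into cells of finite measure and throw into
  each an independent Poisson number of independent uniform points. The Laplace functional
  factorises over the cells.\<close>

theorem pois_law_exists:
 assumes L: "sigma_finite_measure L"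
 shows "\<exists>P. pois_law L P"
proof -
 interpret L: sigma_finite_measure L by fact
 obtain B :: "nat \<Rightarrow> 'a set" where B: "range B \<subseteq> sets L" "(\<Union>i. B i) = space L"
  "\<And>i. emeasure L (B i) \<noteq> \<infinity>" "disjoint_family B"
  using L.sigma_finite_disjoint by blast
 have Bs[measurable]: "B k \<in> sets L" for k using B(1) by auto
 define I where "I = {k. emeasure L (B k) \<noteq> 0}"
 define c where "c k = measure L (B k)" for k
 have c0: "0 \<le> c k" for k by (simp add: c_def)
 have cpos: "0 < c k" if "k \<in> I" for k
  using that B(3)[of k] by (simp add: I_def c_def measure_def enn2real_positive_iff top.not_eq_extremum zero_less_iff_neq_zero)
 \<comment> \<open>A null cell carries no uniform law. The Dirac placeholder keeps every
   \<open>Q k\<close> a probability measure, while the index set \<open>I\<close> leaves such cells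
   out of the product.\<close>
 define Q where "Q k = (if k \<in> I then uniform_measure L (B k) else return (count_space UNIV) undefined)" for k
 define S where "S k = measure_pmf (poisson_pmf (c k)) \<Otimes>\<^sub>M PiM (UNIV :: nat set) (\<lambda>_. Q k)" for k
 have Q: "prob_space (Q k)" for k
  unfolding Q_def using B(3)[of k]
  by (auto simp: I_def intro!: prob_space_uniform_measure prob_space_return)
 have sQ: "sets (Q k) = sets L" "space (Q k) = space L" if "k \<in> I" for k
  using that by (auto simp: Q_def)
 have PQ: "prob_space (PiM (UNIV :: nat set) (\<lambda>_. Q k))" for k
  by (intro prob_space_PiM Q)
 have S: "prob_space (S k)" for k
  unfolding S_def by (intro prob_space_pair PQ measure_pmf.prob_space_axioms)
 define \<Omega> where "\<Omega> = PiM I S"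
 interpret \<Omega>: prob_space \<Omega> unfolding \<Omega>_def by (intro prob_space_PiM S)
 define m where "m u k = points L (if k \<in> I then fst (u k) else 0) (snd (u k))" for u and k :: nat
 define \<xi> where "\<xi> u = sum_meas L (m u)" for u
 have mk: "(\<lambda>u. snd (u k) i) \<in> \<Omega> \<rightarrow>\<^sub>M L" "(\<lambda>u. fst (u k)) \<in> \<Omega> \<rightarrow>\<^sub>M count_space UNIV"
  if k: "k \<in> I" for k i
 proof -
  have a: "(\<lambda>u. u k) \<in> \<Omega> \<rightarrow>\<^sub>M S k" unfolding \<Omega>_def using k by measurable
  have b: "(\<lambda>z. snd z i) \<in> S k \<rightarrow>\<^sub>M Q k" unfolding S_def by measurable
  have c: "fst \<in> S k \<rightarrow>\<^sub>M count_space UNIV" unfolding S_def by measurable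
  show "(\<lambda>u. snd (u k) i) \<in> \<Omega> \<rightarrow>\<^sub>M L"
   using m_comp[OF a b] measurable_cong_sets[OF refl sQ(1)[OF k]] by blast
  show "(\<lambda>u. fst (u k)) \<in> \<Omega> \<rightarrow>\<^sub>M count_space UNIV" by (rule m_comp[OF a c])
 qed
 have xs: "snd (u k) i \<in> space L" if "u \<in> space \<Omega>" "k \<in> I" for u k i
  using measurable_space[OF mk(1)[OF that(2)] that(1)] .
 have int_m: "(\<integral>\<^sup>+z. f z \<partial>m u k) = (if k \<in> I then \<Sum>i<fst (u k). f (snd (u k) i) else 0)"
  if "u \<in> space \<Omega>" "f \<in> \<B> L" for u k f
  unfolding m_def by (subst nn_integral_points) (use xs[OF that(1), of k] that(2) in \<open>auto split: if_splits\<close>)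
 have em: "emeasure (\<xi> u) A = (\<Sum>k. if k \<in> I then \<Sum>i<fst (u k). indicator A (snd (u k) i) else 0)"
  if "u \<in> space \<Omega>" "A \<in> sets L" for u A
  using int_m[OF that(1), of "indicator A"] that(2)
  by (simp add: \<xi>_def emeasure_sum_meas m_def cong: if_cong)
 have \<xi>m[measurable]: "\<xi> \<in> \<Omega> \<rightarrow>\<^sub>M \<N> L"
 proof (rule measurable_counting_spaceI)
  fix u assume u: "u \<in> space \<Omega>"
  have "emeasure (\<xi> u) A \<in> \<nat> \<union> {\<infinity>}" if A: "A \<in> sets L" for A
  proof -
   define a where "a k = (if k \<in> I then \<Sum>i<fst (u k). indicator A (snd (u k) i) else 0 :: nat)" for k
   have e: "emeasure (\<xi> u) A = (\<Sum>k. of_nat (a k))"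
    unfolding em[OF u A] a_def by (intro suminf_cong) (auto intro!: sum.cong simp: indicator_def simp del: sum_indicator_eq_card sum_indicator_mult)
   show ?thesis
   \<comment> \<open>Either the series is a finite sum of naturals, or infinitely many terms are at
     least 1 and it diverges.\<close>
   proof (cases "finite {k. a k \<noteq> 0}")
    case True
    have "(\<Sum>k. of_nat (a k)) = (\<Sum>k\<in>{k. a k \<noteq> 0}. of_nat (a k) :: ennreal)"
     by (rule suminf_finite[OF True]) auto
    then show ?thesis unfolding e by (metis UnI1 of_nat_in_Nats of_nat_sum)
   next
    case False
    have "of_nat n \<le> (\<Sum>k. of_nat (a k) :: ennreal)" for n
    proof -
     obtain K where K: "K \<subseteq> {k. a k \<noteq> 0}" "finite K" "card K = n"
      using infinite_arbitrarily_large[OF False] by blast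
     have "of_nat n = (\<Sum>k\<in>K. 1 :: ennreal)" using K by simp
     also have "\<dots> \<le> (\<Sum>k\<in>K. of_nat (a k))"
     proof (rule sum_mono)
      fix k assume "k \<in> K"
      then have "1 \<le> a k" using K(1) by auto
      then have "of_nat 1 \<le> (of_nat (a k) :: ennreal)" by (rule of_nat_mono)
      then show "1 \<le> (of_nat (a k) :: ennreal)" by simp
     qed
     also have "\<dots> \<le> (\<Sum>k. of_nat (a k))" by (rule sum_le_suminf) (use K in auto)
     finally show ?thesis .
    qed
    then have "(\<Sum>k. of_nat (a k) :: ennreal) = \<top>"
     by (metis ennreal_SUP_of_nat_eq_top SUP_least top_unique)
    then show ?thesis unfolding e by simp
   qed
  qed
  then show "\<C> L (\<xi> u)" by (auto simp: counting_measure_def \<xi>_def)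
 next
  fix A assume A[measurable]: "A \<in> sets L"
  have "(\<lambda>u. \<Sum>i<fst (u k). indicator A (snd (u k) i) :: ennreal) \<in> \<B> \<Omega>" if k: "k \<in> I" for k
  proof -
   note [measurable] = mk[OF k]
   \<comment> \<open>The random upper limit of the sum is moved into an indicator, which leaves a
     series of measurable terms.\<close>
   have "(\<lambda>u. \<Sum>i. indicator {n. i < n} (fst (u k)) * indicator A (snd (u k) i) :: ennreal) \<in> \<B> \<Omega>"
    by measurable
   also have "(\<lambda>u. \<Sum>i. indicator {n. i < n} (fst (u k)) * indicator A (snd (u k) i) :: ennreal)
     = (\<lambda>u. \<Sum>i<fst (u k). indicator A (snd (u k) i))"
   proof
    fix u
    have "(\<Sum>i. indicator {n. i < n} (fst (u k)) * indicator A (snd (u k) i) :: ennreal)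
     = (\<Sum>i<fst (u k). indicator {n. i < n} (fst (u k)) * indicator A (snd (u k) i))"
     by (rule suminf_finite) auto
    also have "\<dots> = (\<Sum>i<fst (u k). indicator A (snd (u k) i))"
     by (rule sum.cong) auto
    finally show "(\<Sum>i. indicator {n. i < n} (fst (u k)) * indicator A (snd (u k) i) :: ennreal)
     = (\<Sum>i<fst (u k). indicator A (snd (u k) i))" .
   qed
   finally show ?thesis .
  qed
  then have "(\<lambda>u. if k \<in> I then \<Sum>i<fst (u k). indicator A (snd (u k) i) else 0 :: ennreal) \<in> \<B> \<Omega>" for k
   by (cases "k \<in> I") auto
  then have "(\<lambda>u. \<Sum>k. if k \<in> I then \<Sum>i<fst (u k). indicator A (snd (u k) i) else 0 :: ennreal) \<in> \<B> \<Omega>"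
   by measurable
  then show "(\<lambda>u. emeasure (\<xi> u) A) \<in> \<B> \<Omega>"
   by (rule measurable_cong[THEN iffD1, rotated]) (simp add: em)
 qed
 have "(\<integral>m. laplace f m \<partial>distr \<Omega> (\<N> L) \<xi>) = exp (- (\<integral>x. 1 - exp (- f x) \<partial>L))"
  if f: "test_simple L f" for f
 proof -
  have s: "simple_function L f" "\<And>x. 0 \<le> f x" using f by (auto simp: test_simple_def)
  have fm[measurable]: "f \<in> \<B> L" using f by (rule test_simple_measurable)
  define h where "h k z = (\<Prod>i<fst z. exp (- f (snd z i)))" for k :: nat and z :: "nat \<times> (nat \<Rightarrow> 'a)"
  have lim: "(\<lambda>n. \<Prod>k\<in>I\<inter>{..<n}. h k (u k)) \<longlonglongrightarrow> laplace f (\<xi> u)" if u: "u \<in> space \<Omega>" for u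
  proof -
   let ?A = "\<lambda>y. f -` {y} \<inter> space L"
   have A: "?A y \<in> sets L" for y using simple_functionD(2)[OF s(1)] by simp
   have "(\<integral>\<^sup>+x. ennreal (f x) \<partial>\<xi> u) = (\<Sum>y\<in>f ` space L - {0}. ennreal y * (\<Sum>k. emeasure (m u k) (?A y)))"
    using A by (subst nn_integral_simple_values[OF s]) (auto simp: \<xi>_def emeasure_sum_meas m_def)
   also have "\<dots> = (\<Sum>k. \<Sum>y\<in>f ` space L - {0}. ennreal y * emeasure (m u k) (?A y))"
    by (simp add: suminf_sum)
   also have "\<dots> = (\<Sum>k. (\<integral>\<^sup>+x. ennreal (f x) \<partial>m u k))"
    by (subst nn_integral_simple_values[OF s]) (auto simp: m_def)
   finally have "laplace f (\<xi> u) = expneg (\<Sum>k. (\<integral>\<^sup>+x. ennreal (f x) \<partial>m u k))"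
    by (simp add: laplace_def)
   moreover have "expneg (\<integral>\<^sup>+x. ennreal (f x) \<partial>m u k) = (if k \<in> I then h k (u k) else 1)" for k
    using int_m[OF u, of "\<lambda>x. ennreal (f x)" k] s(2)
    by (auto simp: h_def sum_nonneg exp_sum[symmetric] sum_negf)
   ultimately show ?thesis
    using expneg_suminf[of "\<lambda>k. \<integral>\<^sup>+x. ennreal (f x) \<partial>m u k"]
    by (simp add: prod.If_cases Int_commute lessThan_def)
  qed
  have h01: "0 \<le> h k z" "h k z \<le> 1" for k z
   using s(2) by (auto simp: h_def intro!: prod_nonneg prod_le_1)
  have hm: "h k \<in> \<B> (S k)" if k: "k \<in> I" for k
  proof -
   have fQ[measurable]: "f \<in> \<B> (Q k)" using fm measurable_cong_sets[OF sQ(1)[OF k] refl] by blast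
   have "(\<lambda>z. \<Prod>i<n. exp (- f (snd z i))) \<in> \<B> (S k)" for n
    unfolding S_def by measurable
   then show ?thesis unfolding h_def[abs_def]
    by (rule measurable_compose_countable[where g=fst]) (simp add: S_def)
  qed
  \<comment> \<open>Given that there are \<open>n\<close> points, the cell contributes
    \<open>q ^ n\<close>; averaging over \<open>n\<close> evaluates the Poisson generating function
    at \<open>q\<close>.\<close>
  have Eh: "(\<integral>z. h k z \<partial>S k) = exp (- (\<integral>x\<in>B k. 1 - exp (- f x) \<partial>L))" if k: "k \<in> I" for k
  proof -
   interpret Q: prob_space "Q k" by (rule Q)
   interpret PQ: prob_space "PiM (UNIV :: nat set) (\<lambda>_. Q k)" by (rule PQ)
   interpret pp: pair_prob_space "measure_pmf (poisson_pmf (c k))" "PiM (UNIV :: nat set) (\<lambda>_. Q k)" ..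
   interpret Sk: prob_space "S k" by (rule S)
   have fQ[measurable]: "f \<in> \<B> (Q k)" using fm measurable_cong_sets[OF sQ(1)[OF k] refl] by blast
   define q where "q = (\<integral>x. exp (- f x) \<partial>Q k)"
   have q0: "0 \<le> q" using s(2) by (auto simp: q_def)
   have inQ: "integrable (Q k) (\<lambda>x. exp (- f x))" using s(2) by (intro Q.integrable_const_bound[where B=1]) auto
   have "(\<integral>z. h k z \<partial>S k) = (\<integral>n. (\<integral>x. h k (n, x) \<partial>PiM UNIV (\<lambda>_. Q k)) \<partial>measure_pmf (poisson_pmf (c k)))"
    unfolding S_def
    by (rule pp.integral_fst'[symmetric], fold S_def) (use hm[OF k] h01 in \<open>auto intro!: Sk.integrable_const_bound[where B=1]\<close>)
   also have "\<dots> = (\<integral>n. q ^ n \<partial>measure_pmf (poisson_pmf (c k)))"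
   proof -
    have "(\<integral>x. (\<Prod>i<n. exp (- f (x i))) \<partial>PiM (UNIV :: nat set) (\<lambda>_. Q k)) = q ^ n" for n
     using integral_PiM_prod_finite[where M="\<lambda>_. Q k" and J="{..<n}" and I=UNIV and h="\<lambda>_ x. exp (- f x)"] Q inQ
     by (simp add: q_def)
    then show ?thesis by (simp add: h_def)
   qed
   also have "\<dots> = exp (c k * q) * exp (- c k)"
   proof -
    have "(\<integral>\<^sup>+n. ennreal (q ^ n) \<partial>measure_pmf (poisson_pmf (c k))) = (\<Sum>n. ennreal (c k ^ n / fact n * exp (- c k)) * ennreal (q ^ n))"
     by (simp add: nn_integral_measure_pmf nn_integral_count_space_nat pmf_poisson[OF cpos[OF k]])
    also have "\<dots> = (\<Sum>n. ennreal (c k ^ n / fact n * exp (- c k) * q ^ n))"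
     using c0 q0 by (simp add: ennreal_mult[symmetric])
    also have "\<dots> = ennreal (exp (c k * q) * exp (- c k))"
    proof (rule suminf_ennreal_eq)
     show "(\<lambda>n. c k ^ n / fact n * exp (- c k) * q ^ n) sums (exp (c k * q) * exp (- c k))"
      using sums_mult2[OF exp_converges[of "c k * q"], of "exp (- c k)"]
      by (simp add: power_mult_distrib divide_inverse mult_ac scaleR_conv_of_real)
    qed (use c0 q0 in auto)
    finally show ?thesis using q0 by (subst integral_eq_nn_integral) auto
   qed
   also have "\<dots> = exp (- (c k * (1 - q)))" by (simp add: exp_add[symmetric] algebra_simps)
   also have "c k * (1 - q) = (\<integral>x\<in>B k. 1 - exp (- f x) \<partial>L)"
   proof -
    have i1: "set_integrable L (B k) (\<lambda>_. 1 :: real)" using B(3)[of k]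
     unfolding set_integrable_def by (auto simp: less_top)
    have i2: "set_integrable L (B k) (\<lambda>x. exp (- f x))"
     unfolding set_integrable_def
     by (rule B_integrable_bound[OF i1[unfolded set_integrable_def]])
      (use s(2) in \<open>auto simp: indicator_def\<close>)
    let ?r = "\<integral>x\<in>B k. exp (- f x) \<partial>L"
    have r: "(\<integral>\<^sup>+x. ennreal (exp (- f x)) * indicator (B k) x \<partial>L) = ennreal ?r" "0 \<le> ?r"
     unfolding set_lebesgue_integral_def
     using i2 by (subst nn_integral_eq_integral[symmetric])
      (auto simp: set_integrable_def ennreal_mult' ennreal_indicator mult.commute)
    have "q = enn2real (\<integral>\<^sup>+x. ennreal (exp (- f x)) \<partial>Q k)" unfolding q_def by (subst integral_eq_nn_integral) auto
    also have "(\<integral>\<^sup>+x. ennreal (exp (- f x)) \<partial>Q k) = (\<integral>\<^sup>+x. ennreal (exp (- f x)) * indicator (B k) x \<partial>L) / emeasure L (B k)"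
     using k by (simp add: Q_def nn_integral_uniform_measure)
    also have "emeasure L (B k) = ennreal (c k)" using B(3) by (simp add: c_def emeasure_eq_ennreal_measure)
    finally have q: "c k * q = ?r" using cpos[OF k] r by (simp add: divide_ennreal)
    have "(\<integral>x\<in>B k. 1 - exp (- f x) \<partial>L) = (\<integral>x\<in>B k. 1 \<partial>L) - (\<integral>x\<in>B k. exp (- f x) \<partial>L)"
     by (rule set_integral_diff(2)[OF i1 i2])
    then show ?thesis using q by (simp add: algebra_simps c_def set_lebesgue_integral_def)
   qed
   finally show ?thesis .
  qed
  have B0: "(\<integral>x\<in>B k. 1 - exp (- f x) \<partial>L) = 0" if "k \<notin> I" for k
  proof -
   have "B k \<in> null_sets L" using that by (auto simp: I_def null_sets_def)
   then show ?thesis unfolding set_lebesgue_integral_def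
    by (intro integral_eq_zero_AE) (auto dest!: AE_not_in simp: indicator_def elim: AE_mp)
  qed
  have E: "(\<integral>u. (\<Prod>k\<in>I\<inter>{..<n}. h k (u k)) \<partial>\<Omega>) = exp (- (\<integral>x\<in>(\<Union>k<n. B k). 1 - exp (- f x) \<partial>L))" for n
  proof -
   have "(\<integral>u. (\<Prod>k\<in>I\<inter>{..<n}. h k (u k)) \<partial>\<Omega>) = (\<Prod>k\<in>I\<inter>{..<n}. exp (- (\<integral>x\<in>B k. 1 - exp (- f x) \<partial>L)))"
   proof -
    have "integrable (S k) (h k)" if "k \<in> I" for k
    proof -
     interpret Sk: prob_space "S k" by (rule S)
     show ?thesis using hm[OF that] h01 by (intro Sk.integrable_const_bound[where B=1]) auto
    qed
    then show ?thesis unfolding \<Omega>_def using S by (subst integral_PiM_prod_finite) (auto simp: Eh)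
   qed
   also have "\<dots> = (\<Prod>k<n. exp (- (\<integral>x\<in>B k. 1 - exp (- f x) \<partial>L)))"
    by (rule prod.mono_neutral_left) (use B0 in auto)
   also have "\<dots> = exp (- (\<Sum>k<n. \<integral>x\<in>B k. 1 - exp (- f x) \<partial>L))"
    by (simp add: exp_sum sum_negf[symmetric])
   also have "(\<Sum>k<n. \<integral>x\<in>B k. 1 - exp (- f x) \<partial>L) = (\<integral>x\<in>(\<Union>k<n. B k). 1 - exp (- f x) \<partial>L)"
   proof (rule set_integral_finite_Union[symmetric])
    show "disjoint_family_on B {..<n}" using B(4) by (auto simp: disjoint_family_on_def)
    show "set_integrable L (B k) (\<lambda>x. 1 - exp (- f x))" for k
     unfolding set_integrable_def using integrable_test_simple[OF f] by (intro integrable_mult_indicator) auto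
   qed auto
   finally show ?thesis .
  qed
  have "(\<lambda>n. \<integral>u. (\<Prod>k\<in>I\<inter>{..<n}. h k (u k)) \<partial>\<Omega>) \<longlonglongrightarrow> (\<integral>u. laplace f (\<xi> u) \<partial>\<Omega>)"
  proof (rule integral_dominated_convergence[where w="\<lambda>_. 1"])
   show "(\<lambda>u. \<Prod>k\<in>I \<inter> {..<n}. h k (u k)) \<in> \<B> \<Omega>" for n
   proof (rule borel_measurable_prod)
    fix k assume k: "k \<in> I \<inter> {..<n}"
    have "(\<lambda>u. u k) \<in> \<Omega> \<rightarrow>\<^sub>M S k"
     unfolding \<Omega>_def by (rule measurable_component_singleton) (use k in simp)
    from m_comp[OF this hm] k show "(\<lambda>u. h k (u k)) \<in> \<B> \<Omega>" by auto
   qed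
   show "AE u in \<Omega>. norm (\<Prod>k\<in>I \<inter> {..<n}. h k (u k)) \<le> 1" for n
   proof (rule AE_I2)
    fix u
    have "0 \<le> (\<Prod>k\<in>I \<inter> {..<n}. h k (u k))" by (rule prod_nonneg) (rule h01)
    moreover have "(\<Prod>k\<in>I \<inter> {..<n}. h k (u k)) \<le> 1" by (rule prod_le_1) (intro conjI h01)
    ultimately show "norm (\<Prod>k\<in>I \<inter> {..<n}. h k (u k)) \<le> 1" by simp
   qed
   show "AE u in \<Omega>. (\<lambda>n. \<Prod>k\<in>I \<inter> {..<n}. h k (u k)) \<longlonglongrightarrow> laplace f (\<xi> u)"
    using lim by (intro AE_I2)
  qed auto
  moreover have "(\<lambda>n. \<integral>x\<in>(\<Union>k<n. B k). 1 - exp (- f x) \<partial>L) \<longlonglongrightarrow> (\<integral>x. 1 - exp (- f x) \<partial>L)"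
   unfolding set_lebesgue_integral_def
  proof (rule integral_dominated_convergence[where w="\<lambda>x. 1 - exp (- f x)"])
   show "AE x in L. (\<lambda>n. indicator (\<Union>k<n. B k) x *\<^sub>R (1 - exp (- f x))) \<longlonglongrightarrow> 1 - exp (- f x)"
   proof (rule AE_I2)
    fix x assume "x \<in> space L"
    then have "indicator (\<Union>k. B k) x = (1::real)" using B(2) by simp
    moreover have "(\<lambda>n. indicator (\<Union>k<n. B k) x :: real) \<longlonglongrightarrow> indicator (\<Union>k. B k) x"
     by (rule LIMSEQ_indicator_UN)
    ultimately have "(\<lambda>n. indicator (\<Union>k<n. B k) x :: real) \<longlonglongrightarrow> 1" by simp
    from tendsto_scaleR[OF this tendsto_const[of "1 - exp (- f x)"]]
    show "(\<lambda>n. indicator (\<Union>k<n. B k) x *\<^sub>R (1 - exp (- f x))) \<longlonglongrightarrow> 1 - exp (- f x)" by simp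
   qed
   show "AE x in L. norm (indicator (\<Union>k<n. B k) x *\<^sub>R (1 - exp (- f x))) \<le> 1 - exp (- f x)" for n
    using s(2) by (auto simp: indicator_def)
  qed (use integrable_test_simple[OF f] in auto)
  then have "(\<lambda>n. exp (- (\<integral>x\<in>(\<Union>k<n. B k). 1 - exp (- f x) \<partial>L))) \<longlonglongrightarrow> exp (- (\<integral>x. 1 - exp (- f x) \<partial>L))"
   by (intro tendsto_intros)
  ultimately have "(\<integral>u. laplace f (\<xi> u) \<partial>\<Omega>) = exp (- (\<integral>x. 1 - exp (- f x) \<partial>L))"
   unfolding E by (rule LIMSEQ_unique)
  then show ?thesis by (subst integral_distr) auto
 qed
 then have "pois_law L (distr \<Omega> (\<N> L) \<xi>)"
  by (auto simp: pois_law_def intro!: \<Omega>.prob_space_distr)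
 then show ?thesis by blast
qed

section \<open>The interpolating coupling\<close>

text \<open>A point carries a mark telling to which of two superposed processes it belongs. Under
 \<open>marked L t\<close> the two processes share a \<open>t\<close>-thinning and are otherwise independent.\<close>

definition mark_weight :: "real \<Rightarrow> bool \<times> bool \<Rightarrow> real" where
 "mark_weight t k = (if fst k \<and> snd k then t else if fst k \<or> snd k then 1 - t else 0)"

definition mark_space :: "'a measure \<Rightarrow> ('a \<times> bool \<times> bool) measure" where
 "mark_space L = L \<Otimes>\<^sub>M count_space UNIV"

definition marked :: "'a measure \<Rightarrow> real \<Rightarrow> ('a \<times> bool \<times> bool) measure" where
 "marked L t = density (mark_space L) (\<lambda>z. ennreal (mark_weight t (snd z)))"

lemma sets_marked [simp]: "sets (marked L t) = sets (mark_space L)"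
 by (simp add: marked_def)

lemma space_marked [simp]: "space (marked L t) = space (mark_space L)"
 by (simp add: marked_def)

lemma space_mark_space: "space (mark_space L) = space L \<times> UNIV"
 by (simp add: mark_space_def space_pair_measure)

lemma counting_space_marked [simp]: "\<N> (marked L t) = \<N> (mark_space L)"
 by (rule counting_space_cong) simp

lemma borel_measurable_marked [simp]: "\<B> (marked L t) = \<B> (mark_space L)"
 by (intro measurable_cong_sets) auto

lemma nn_integral_marked:
 assumes [measurable]: "g \<in> \<B> (mark_space L)"
 shows "(\<integral>\<^sup>+z. g z \<partial>marked L t) = (\<integral>\<^sup>+x. ennreal t * g (x, True, True)
   + ennreal (1 - t) * g (x, True, False) + ennreal (1 - t) * g (x, False, True) \<partial>L)"
proof -
 interpret c: sigma_finite_measure "count_space (UNIV :: (bool \<times> bool) set)"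
  by (rule sigma_finite_measure_count_space_finite) simp
 have gm[measurable]: "g \<in> \<B> (L \<Otimes>\<^sub>M count_space UNIV)"
  using assms by (simp add: mark_space_def)
 have U: "(UNIV :: (bool \<times> bool) set) = {(True, True), (True, False), (False, True), (False, False)}"
  by (auto simp: UNIV_bool)
 have "(\<integral>\<^sup>+z. g z \<partial>marked L t) = (\<integral>\<^sup>+z. ennreal (mark_weight t (snd z)) * g z \<partial>mark_space L)"
  unfolding marked_def by (rule nn_integral_density) (auto simp: mark_space_def)
 also have "\<dots> = (\<integral>\<^sup>+x. \<integral>\<^sup>+k. ennreal (mark_weight t k) * g (x, k) \<partial>count_space UNIV \<partial>L)"
  unfolding mark_space_def by (subst c.nn_integral_fst[symmetric]) auto
 also have "\<dots> = (\<integral>\<^sup>+x. ennreal t * g (x, True, True)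
   + ennreal (1 - t) * g (x, True, False) + ennreal (1 - t) * g (x, False, True) \<partial>L)"
  by (simp add: nn_integral_count_space_finite U mark_weight_def add.assoc)
 finally show ?thesis .
qed

lemma integral_marked_nonneg:
 assumes [measurable]: "g \<in> \<B> (mark_space L)" and g: "\<And>z. 0 \<le> g z" and t: "t \<in> {0..1}"
 shows "(\<integral>z. g z \<partial>marked L t) = (\<integral>x. t * g (x, True, True)
   + (1 - t) * g (x, True, False) + (1 - t) * g (x, False, True) \<partial>L)"
proof -
 have gm[measurable]: "g \<in> \<B> (L \<Otimes>\<^sub>M count_space UNIV)"
  using assms by (simp add: mark_space_def)
 have "(\<integral>\<^sup>+z. ennreal (g z) \<partial>marked L t) = (\<integral>\<^sup>+x. ennreal (t * g (x, True, True)
   + (1 - t) * g (x, True, False) + (1 - t) * g (x, False, True)) \<partial>L)"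
  using t g by (subst nn_integral_marked) (auto intro!: nn_integral_cong simp: ennreal_mult ennreal_plus)
 then show ?thesis using g t by (simp add: integral_eq_nn_integral)
qed

lemma sigma_finite_marked:
 assumes "sigma_finite_measure L" "t \<in> {0..1}"
 shows "sigma_finite_measure (marked L t)"
proof -
 obtain X where X: "\<And>k. X k \<in> sets L" "incseq X" "(\<Union>k. X k) = space L" "\<And>k. emeasure L (X k) < \<infinity>"
  using exhaustion_exists[OF assms(1)] by metis
 show ?thesis
 proof
  show "\<exists>A. countable A \<and> A \<subseteq> sets (marked L t) \<and> \<Union> A = space (marked L t) \<and> (\<forall>a\<in>A. emeasure (marked L t) a \<noteq> \<infinity>)"
  proof (intro exI[of _ "range (\<lambda>k. X k \<times> UNIV)"] conjI ballI)
   fix a assume "a \<in> range (\<lambda>k. X k \<times> (UNIV :: (bool \<times> bool) set))"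
   then obtain k where a: "a = X k \<times> UNIV" by auto
   have as: "a \<in> sets (mark_space L)" using X(1) a by (auto simp: mark_space_def)
   have "emeasure (marked L t) a = (\<integral>\<^sup>+z. indicator a z \<partial>marked L t)" using as by simp
   also have "\<dots> = (\<integral>\<^sup>+x. ennreal t * indicator a (x, True, True)
    + ennreal (1 - t) * indicator a (x, True, False) + ennreal (1 - t) * indicator a (x, False, True) \<partial>L)"
    using as by (subst nn_integral_marked) auto
   also have "\<dots> \<le> (\<integral>\<^sup>+x. 3 * indicator (X k) x \<partial>L)"
   proof (rule nn_integral_mono)
    fix x
    have "ennreal t + ennreal (1 - t) + ennreal (1 - t) \<le> 1 + 1 + 1"
     using assms(2) by (intro add_mono) (auto simp: ennreal_le_1)
    then show "ennreal t * indicator a (x, True, True)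
     + ennreal (1 - t) * indicator a (x, True, False) + ennreal (1 - t) * indicator a (x, False, True) \<le> 3 * indicator (X k) x"
     by (auto simp: a indicator_def)
   qed
   also have "\<dots> = 3 * emeasure L (X k)" using X(1) by (simp add: nn_integral_cmult_indicator)
   also have "\<dots> < \<infinity>" using X(4)[of k] by (simp add: ennreal_mult_less_top)
   finally show "emeasure (marked L t) a \<noteq> \<infinity>" by simp
  next
   show "range (\<lambda>k. X k \<times> UNIV) \<subseteq> sets (marked L t)" using X(1) by (auto simp: mark_space_def)
   show "\<Union> (range (\<lambda>k. X k \<times> UNIV)) = space (marked L t)" using X(3) by (auto simp: space_mark_space)
  qed simp
 qed
qed

definition proj :: "'a measure \<Rightarrow> (bool \<times> bool) set \<Rightarrow> ('a \<times> bool \<times> bool) measure \<Rightarrow> 'a measure" where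
 "proj L S m = distr (restr (space L \<times> S) m) L fst"

lemma sets_proj [simp]: "sets (proj L S m) = sets L"
 by (simp add: proj_def)

lemma nn_integral_proj:
 assumes m: "sets m = sets (mark_space L)" and f[measurable]: "f \<in> \<B> L"
 shows "(\<integral>\<^sup>+x. f x \<partial>proj L S m) = (\<integral>\<^sup>+z. f (fst z) * indicator S (snd z) \<partial>m)"
proof -
 have S: "space L \<times> S \<in> sets m" unfolding m by (simp add: mark_space_def)
 have "fst \<in> mark_space L \<rightarrow>\<^sub>M L" by (simp add: mark_space_def)
 then have fst[measurable]: "fst \<in> m \<rightarrow>\<^sub>M L" using measurable_cong_sets[OF m refl] by blast
 have fst': "fst \<in> restr (space L \<times> S) m \<rightarrow>\<^sub>M L" using fst by (simp add: restr_def)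
 have sp: "space m = space L \<times> UNIV" using sets_eq_imp_space_eq[OF m] by (simp add: space_mark_space)
 have "(\<integral>\<^sup>+x. f x \<partial>proj L S m) = (\<integral>\<^sup>+z. f (fst z) \<partial>restr (space L \<times> S) m)"
  unfolding proj_def using fst' f by (subst nn_integral_distr) auto
 also have "\<dots> = (\<integral>\<^sup>+z. f (fst z) * indicator (space L \<times> S) z \<partial>m)"
  using S by (intro nn_integral_restr) auto
 also have "\<dots> = (\<integral>\<^sup>+z. f (fst z) * indicator S (snd z) \<partial>m)"
  by (intro nn_integral_cong) (auto simp: sp indicator_def)
 finally show ?thesis .
qed

lemma emeasure_proj:
 assumes m: "sets m = sets (mark_space L)" and A: "A \<in> sets L"
 shows "emeasure (proj L S m) A = emeasure m (A \<times> S)"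
proof -
 have AS: "A \<times> S \<in> sets m" unfolding m mark_space_def using A by auto
 have "emeasure (proj L S m) A = (\<integral>\<^sup>+x. indicator A x \<partial>proj L S m)" using A by simp
 also have "\<dots> = (\<integral>\<^sup>+z. indicator (A \<times> S) z \<partial>m)"
  using A by (subst nn_integral_proj[OF m]) (auto intro!: nn_integral_cong simp: indicator_def)
 finally show ?thesis using AS by simp
qed

lemma counting_measure_proj:
 "\<C> (mark_space L) m \<Longrightarrow> \<C> L (proj L S m)"
 by (auto simp: counting_measure_def emeasure_proj) (auto simp: mark_space_def)

lemma measurable_proj [measurable]:
 "proj L S \<in> \<N> (mark_space L) \<rightarrow>\<^sub>M \<N> L"
proof (rule measurable_counting_spaceI)
 fix A assume A: "A \<in> sets L"
 have "A \<times> S \<in> sets (mark_space L)" using A by (simp add: mark_space_def)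
 then have "(\<lambda>m. emeasure m (A \<times> S)) \<in> \<F> (mark_space L)"
  by (rule measurable_emeasure_counting)
 then show "(\<lambda>m. emeasure (proj L S m) A) \<in> \<F> (mark_space L)"
  by (rule measurable_cong[THEN iffD1, rotated]) (simp add: emeasure_proj[OF _ A] counting_measure_sets)
qed (auto simp: counting_measure_proj)

lemma proj_add_dirac:
 assumes m: "sets m = sets (mark_space L)"
 shows "proj L S (add_dirac m (x, k)) = (if k \<in> S then add_dirac (proj L S m) x else proj L S m)"
proof (rule measure_eqI)
 fix A assume "A \<in> sets (proj L S (add_dirac m (x, k)))"
 then have A: "A \<in> sets L" by simp
 have AS: "A \<times> S \<in> sets m" unfolding m using A by (simp add: mark_space_def)
 show "emeasure (proj L S (add_dirac m (x, k))) A = emeasure (if k \<in> S then add_dirac (proj L S m) x else proj L S m) A"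
  using A AS m by (auto simp: emeasure_proj emeasure_add_dirac indicator_def)
qed simp

lemma laplace_proj:
 assumes m: "sets m = sets (mark_space L)" and f: "f \<in> \<B> L"
 shows "laplace f (proj L S m) = laplace (\<lambda>z. f (fst z) * indicator S (snd z)) m"
 unfolding laplace_def using f
 by (subst nn_integral_proj[OF m]) (auto intro!: arg_cong[of _ _ expneg] nn_integral_cong simp: indicator_def)

abbreviation "fst_marks \<equiv> {k :: bool \<times> bool. fst k}"
abbreviation "snd_marks \<equiv> {k :: bool \<times> bool. snd k}"

lemma test_simple_marked:
 assumes f: "test_simple L f" and t: "t \<in> {0..1}"
 shows "test_simple (marked L t) (\<lambda>z. f (fst z) * indicator S (snd z))"
proof -
 have [measurable]: "f \<in> \<B> L" using f by (rule test_simple_measurable)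
 have m: "(\<lambda>z. f (fst z) * indicator S (snd z) :: real) \<in> \<B> (mark_space L)"
  unfolding mark_space_def by measurable
 have fin: "finite (f ` space L)" using f by (auto simp: test_simple_def simple_function_def)
 have "(\<lambda>z. f (fst z) * indicator S (snd z) :: real) ` space (mark_space L) \<subseteq> insert 0 (f ` space L)"
  by (auto simp: space_mark_space indicator_def)
 then have "finite ((\<lambda>z. f (fst z) * indicator S (snd z) :: real) ` space (mark_space L))"
  by (rule finite_subset) (use fin in simp)
 then have s: "simple_function (marked L t) (\<lambda>z. f (fst z) * indicator S (snd z) :: real)"
  using m by (intro simple_function_borel_measurable) auto
 let ?A = "{z \<in> space (mark_space L). f (fst z) * indicator S (snd z) \<noteq> 0}"
 let ?B = "{x \<in> space L. f x \<noteq> 0}"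
 have as: "?A \<in> sets (mark_space L)" using m by measurable
 have "emeasure (marked L t) ?A = (\<integral>\<^sup>+z. indicator ?A z \<partial>marked L t)" using as by simp
 also have "\<dots> = (\<integral>\<^sup>+x. ennreal t * indicator ?A (x, True, True)
  + ennreal (1 - t) * indicator ?A (x, True, False) + ennreal (1 - t) * indicator ?A (x, False, True) \<partial>L)"
  using as by (subst nn_integral_marked) auto
 also have "\<dots> \<le> (\<integral>\<^sup>+x. 3 * indicator ?B x \<partial>L)"
 proof (rule nn_integral_mono)
  fix x
  have "ennreal t * indicator ?A (x, True, True)
   + ennreal (1 - t) * indicator ?A (x, True, False) + ennreal (1 - t) * indicator ?A (x, False, True)
   \<le> 1 * indicator ?B x + 1 * indicator ?B x + 1 * indicator ?B x"
   using t by (intro add_mono mult_mono) (auto simp: indicator_def space_mark_space ennreal_le_1)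
  also have "\<dots> = 3 * indicator ?B x" by (simp add: indicator_def)
  finally show "ennreal t * indicator ?A (x, True, True)
   + ennreal (1 - t) * indicator ?A (x, True, False) + ennreal (1 - t) * indicator ?A (x, False, True) \<le> 3 * indicator ?B x" .
 qed
 also have "\<dots> = 3 * emeasure L ?B" by (subst nn_integral_cmult_indicator) auto
 also have "\<dots> < \<infinity>" using f by (simp add: test_simple_def ennreal_mult_less_top)
 finally show ?thesis using s f by (auto simp: test_simple_def)
qed

text \<open>Clipping the parameter to [0,1] makes this a probability law for every real
  \<open>t\<close>, so that \<open>kern L\<close> can be a Markov kernel on the whole Borel
  line.\<close>

definition kern :: "'a measure \<Rightarrow> real \<Rightarrow> ('a \<times> bool \<times> bool) measure measure" where
 "kern L t = (SOME P. pois_law (marked L (max 0 (min 1 t))) P)"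

lemma pois_law_kern:
 assumes L: "sigma_finite_measure L" and t: "t \<in> {0..1}"
 shows "pois_law (marked L t) (kern L t)"
proof -
 have "max 0 (min 1 t) = t" using t by auto
 then show ?thesis
  unfolding kern_def using someI_ex[OF pois_law_exists[OF sigma_finite_marked[OF L t]]] by simp
qed

lemma kern_props:
 assumes L: "sigma_finite_measure L"
 shows "prob_space (kern L t)" "sets (kern L t) = sets (\<N> (mark_space L))"
  "space (kern L t) = {m. \<C> (mark_space L) m}"
proof -
 have t: "max 0 (min 1 t) \<in> {0..1}" by auto
 have "kern L t = kern L (max 0 (min 1 t))" by (simp add: kern_def)
 then have "pois_law (marked L (max 0 (min 1 t))) (kern L t)" using pois_law_kern[OF L t] by simp
 from pois_lawD(1,2,3)[OF this]
 show "prob_space (kern L t)" "sets (kern L t) = sets (\<N> (mark_space L))"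
  "space (kern L t) = {m. \<C> (mark_space L) m}"
  by (auto simp: counting_measure_def)
qed

text \<open>The parameter of the exponential is affine in \<open>t\<close>; this is what makes the covariance
 formula for Laplace functionals an instance of the fundamental theorem of calculus.\<close>

lemma kern_laplace:
 assumes L: "sigma_finite_measure L" and t: "t \<in> {0..1}" and f: "test_simple L f" and g: "test_simple L g"
 shows "(\<integral>m. laplace f (proj L fst_marks m) * laplace g (proj L snd_marks m) \<partial>kern L t)
  = exp (- (\<integral>x. 1 - exp (- f x) \<partial>L) - (\<integral>x. 1 - exp (- g x) \<partial>L) + t * (\<integral>x. (1 - exp (- f x)) * (1 - exp (- g x)) \<partial>L))"
proof -
 have [measurable]: "f \<in> \<B> L" "g \<in> \<B> L" using f g by (auto intro: test_simple_measurable)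
 have f0: "0 \<le> f x" and g0: "0 \<le> g x" for x using f g by (auto simp: test_simple_def)
 define F where "F = (\<lambda>z :: 'a \<times> bool \<times> bool. f (fst z) * indicator fst_marks (snd z) + g (fst z) * indicator snd_marks (snd z))"
 have ts: "test_simple (marked L t) F" unfolding F_def by (intro test_simple_add test_simple_marked f g t)
 have Fm: "F \<in> \<B> (mark_space L)" using test_simple_measurable[OF ts] by simp
 have "(\<integral>m. laplace f (proj L fst_marks m) * laplace g (proj L snd_marks m) \<partial>kern L t) = (\<integral>m. laplace F m \<partial>kern L t)"
 proof (rule B_integral_cong[OF refl])
  fix m assume "m \<in> space (kern L t)"
  then have sm: "sets m = sets (mark_space L)" using kern_props(3)[OF L] by (auto simp: counting_measure_sets)
  have m: "(\<lambda>z. h (fst z) * indicator S (snd z) :: real) \<in> \<B> (mark_space L)"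
   if [measurable]: "h \<in> \<B> L" for h S
   unfolding mark_space_def by measurable
  show "laplace f (proj L fst_marks m) * laplace g (proj L snd_marks m) = laplace F m"
   unfolding F_def using f0 g0 sm m by (subst laplace_add) (auto simp: laplace_proj)
 qed
 also have "\<dots> = exp (- (\<integral>z. 1 - exp (- F z) \<partial>marked L t))"
  by (rule pois_lawD(4)[OF pois_law_kern[OF L t] ts])
 also have "(\<integral>z. 1 - exp (- F z) \<partial>marked L t) = (\<integral>x. t * (1 - exp (- F (x, True, True)))
   + (1 - t) * (1 - exp (- F (x, True, False))) + (1 - t) * (1 - exp (- F (x, False, True))) \<partial>L)"
  using Fm ts t by (intro integral_marked_nonneg) (auto simp: test_simple_def)
 also have "\<dots> = (\<integral>x. (1 - exp (- f x)) + (1 - exp (- g x)) - t * ((1 - exp (- f x)) * (1 - exp (- g x))) \<partial>L)"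
  by (intro B_integral_cong) (auto simp: F_def algebra_simps exp_add exp_minus_inverse mult_exp_exp)
 also have "\<dots> = (\<integral>x. 1 - exp (- f x) \<partial>L) + (\<integral>x. 1 - exp (- g x) \<partial>L) - t * (\<integral>x. (1 - exp (- f x)) * (1 - exp (- g x)) \<partial>L)"
 proof -
  have "integrable L (\<lambda>x. (1 - exp (- f x)) * (1 - exp (- g x)))"
   by (rule B_integrable_bound[OF integrable_test_simple[OF f]])
    (use f0 g0 in \<open>auto simp: abs_mult intro!: mult_left_le\<close>)
  moreover have "(\<integral>x. a x + b x - t * c x \<partial>L) = (\<integral>x. a x \<partial>L) + (\<integral>x. b x \<partial>L) - t * (\<integral>x. c x \<partial>L)"
   if "integrable L a" "integrable L b" "integrable L c" for a b c :: "'a \<Rightarrow> real"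
   using that by simp
  ultimately show ?thesis using integrable_test_simple[OF f] integrable_test_simple[OF g] by blast
 qed
 finally show ?thesis by (simp add: algebra_simps)
qed

text \<open>With one of the two test functions equal to zero the term linear in \<open>t\<close>
  disappears from \<open>kern_laplace\<close>, so each of the two processes has intensity
  \<open>L\<close> whatever \<open>t\<close> is.\<close>

lemma pois_law_proj:
 assumes L: "sigma_finite_measure L" and t: "t \<in> {0..1}"
 shows "pois_law L (distr (kern L t) (\<N> L) (proj L fst_marks))"
  "pois_law L (distr (kern L t) (\<N> L) (proj L snd_marks))"
proof -
 interpret K: prob_space "kern L t" by (rule kern_props[OF L])
 have m[measurable]: "proj L S \<in> kern L t \<rightarrow>\<^sub>M \<N> L" for S
  using measurable_proj measurable_cong_sets[OF kern_props(2)[OF L] refl] by blast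
 have fm: "laplace f \<in> \<F> L" if "test_simple L f" for f
  using that by (intro measurable_laplace test_simple_measurable)
 show "pois_law L (distr (kern L t) (\<N> L) (proj L fst_marks))"
  unfolding pois_law_def using kern_laplace[OF L t _ test_simple_zero] fm
  by (auto intro!: K.prob_space_distr simp: integral_distr)
 show "pois_law L (distr (kern L t) (\<N> L) (proj L snd_marks))"
  unfolding pois_law_def using kern_laplace[OF L t test_simple_zero] fm
  by (auto intro!: K.prob_space_distr simp: integral_distr)
qed

text \<open>The induction principle reduces measurability in \<open>t\<close> to Laplace
  functionals, for which the integral is the exponential of an affine function of the clipped
  parameter. Linear combinations and pointwise limits preserve measurability.\<close>

lemma measurable_kern:
 assumes L: "sigma_finite_measure L"
 shows "kern L \<in> borel \<rightarrow>\<^sub>M subprob_algebra (\<N> (mark_space L))"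
proof (rule measurable_subprob_algebra)
 fix t show "subprob_space (kern L t)" by (rule prob_space_imp_subprob_space[OF kern_props(1)[OF L]])
 show "sets (kern L t) = sets (\<N> (mark_space L))" by (rule kern_props[OF L])
next
 fix E assume E: "E \<in> sets (\<N> (mark_space L))"
 interpret K: prob_space "kern L t" for t by (rule kern_props[OF L])
 obtain X where X: "\<And>k. X k \<in> sets L" "incseq X" "(\<Union>k. X k) = space L" "\<And>k. emeasure L (X k) < \<infinity>"
  using exhaustion_exists[OF L] by metis
 let ?Y = "\<lambda>k. X k \<times> (UNIV :: (bool \<times> bool) set)"
 have Y: "\<And>k. ?Y k \<in> sets (mark_space L)" "incseq ?Y" "(\<Union>k. ?Y k) = space (mark_space L)"
  using X(1-3) by (auto simp: mark_space_def space_pair_measure incseq_def)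
 have mK: "\<B> (kern L t) = (\<F> (mark_space L) :: (_ \<Rightarrow> real) set)" for t
  using kern_props(2)[OF L] by (intro measurable_cong_sets) auto
 note spK = kern_props(3)[OF L]
 have int: "integrable (kern L t) f" if "f \<in> \<F> (mark_space L)"
  "\<And>m. \<C> (mark_space L) m \<Longrightarrow> \<bar>f m\<bar> \<le> B" for f :: "_ \<Rightarrow> real" and B t
  using that by (auto intro!: K.integrable_const_bound[where B=B] simp: mK spK)
 have clip: "kern L t = kern L (max 0 (min 1 t))" for t by (simp add: kern_def)
 have "(\<lambda>t. \<integral>m. indicator E m \<partial>kern L t :: real) \<in> \<B> borel"
 proof (rule counting_space_bounded_induct[OF Y, where f="indicator E" and B=1])
  fix f assume f: "f \<in> exh_test (mark_space L) ?Y"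
  obtain k where k: "\<And>z. z \<notin> ?Y k \<Longrightarrow> f z = 0" using f unfolding exh_test_def by blast
  have f0: "0 \<le> f z" for z using f unfolding exh_test_def by blast
  have fm: "f \<in> \<B> (mark_space L)" using f by (auto simp: exh_test_def intro: borel_measurable_simple_function)
  then have fm': "f \<in> \<B> (L \<Otimes>\<^sub>M count_space UNIV)" by (simp add: mark_space_def)
  have ix: "integrable L (\<lambda>x. 1 - exp (- f (x, b)))" for b
  proof (rule B_integrable_bound)
   show "integrable L (indicator (X k) :: 'a \<Rightarrow> real)" using X by (intro integrable_real_indicator) auto
   show "(\<lambda>x. 1 - exp (- f (x, b))) \<in> \<B> L" using fm' by measurable
   show "AE x in L. norm (1 - exp (- f (x, b))) \<le> norm (indicator (X k) x :: real)"
    using k[of "(_, b)"] f0 by (intro AE_I2) (auto simp: indicator_def)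
  qed
  have "(\<integral>m. laplace f m \<partial>kern L t) = exp (- (t * (\<integral>x. 1 - exp (- f (x, True, True)) \<partial>L)
   + (1 - t) * (\<integral>x. 1 - exp (- f (x, True, False)) \<partial>L) + (1 - t) * (\<integral>x. 1 - exp (- f (x, False, True)) \<partial>L)))"
   if t: "t \<in> {0..1}" for t
  proof -
   interpret S: sigma_finite_measure "marked L t" by (rule sigma_finite_marked[OF L t])
   have "f \<in> exh_test (marked L t) ?Y" using f simple_function_borel_measurable[of f "marked L t"] fm
    by (auto simp: exh_test_def simple_function_def)
   moreover have "emeasure (marked L t) (?Y k) < \<infinity>" for k
   proof -
    have "test_simple (marked L t) (\<lambda>z. indicator (X k) (fst z) * indicator UNIV (snd z))"
    proof (intro test_simple_marked t)
     have "{x \<in> space L. indicator (X k) x \<noteq> (0::real)} = X k"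
      using sets.sets_into_space[OF X(1)] by (auto simp: indicator_def)
     then show "test_simple L (indicator (X k))"
      using X(4)[of k] simple_function_indicator[OF X(1), of k] by (simp add: test_simple_def)
    qed
    moreover have "{z \<in> space (marked L t). indicator (X k) (fst z) * indicator UNIV (snd z) \<noteq> (0::real)} = ?Y k"
     using sets.sets_into_space[OF X(1)] by (auto simp: space_mark_space indicator_def)
    ultimately show ?thesis by (simp add: test_simple_def)
   qed
   ultimately have "test_simple (marked L t) f" using Y(1) by (intro exh_test_test_simple) auto
   then have "(\<integral>m. laplace f m \<partial>kern L t) = exp (- (\<integral>z. 1 - exp (- f z) \<partial>marked L t))"
    by (rule pois_lawD(4)[OF pois_law_kern[OF L t]])
   also have "(\<integral>z. 1 - exp (- f z) \<partial>marked L t) = (\<integral>x. t * (1 - exp (- f (x, True, True)))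
    + (1 - t) * (1 - exp (- f (x, True, False))) + (1 - t) * (1 - exp (- f (x, False, True))) \<partial>L)"
    using fm t f0 by (intro integral_marked_nonneg) auto
   finally show ?thesis using ix by simp
  qed
  from this[of "max 0 (min 1 _)"]
  have "(\<lambda>t. \<integral>m. laplace f m \<partial>kern L t) = (\<lambda>t. let t = max 0 (min 1 t) in exp (- (t * (\<integral>x. 1 - exp (- f (x, True, True)) \<partial>L)
   + (1 - t) * (\<integral>x. 1 - exp (- f (x, True, False)) \<partial>L) + (1 - t) * (\<integral>x. 1 - exp (- f (x, False, True)) \<partial>L))))"
   unfolding clip[symmetric] Let_def by auto
  then show "(\<lambda>t. \<integral>m. laplace f m \<partial>kern L t) \<in> \<B> borel"
   by (simp add: Let_def)
 next
  show "(\<lambda>t. \<integral>m. c * f m + d * g m \<partial>kern L t) \<in> \<B> borel"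
   if "f \<in> \<F> (mark_space L)" "\<And>m. \<C> (mark_space L) m \<Longrightarrow> \<bar>f m\<bar> \<le> B"
    "(\<lambda>t. integral\<^sup>L (kern L t) f) \<in> \<B> borel"
    "g \<in> \<F> (mark_space L)" "\<And>m. \<C> (mark_space L) m \<Longrightarrow> \<bar>g m\<bar> \<le> B"
    "(\<lambda>t. integral\<^sup>L (kern L t) g) \<in> \<B> borel" for f g :: "_ \<Rightarrow> real" and c d B
   using int[of f B] int[of g B] that by simp
  show "(\<lambda>t. integral\<^sup>L (kern L t) g) \<in> \<B> borel"
   if "\<And>n. h n \<in> \<F> (mark_space L)" "\<And>n m. \<C> (mark_space L) m \<Longrightarrow> \<bar>h n m\<bar> \<le> B"
    "\<And>n. (\<lambda>t. integral\<^sup>L (kern L t) (h n)) \<in> \<B> borel" "g \<in> \<F> (mark_space L)"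
    "\<And>m. \<C> (mark_space L) m \<Longrightarrow> (\<lambda>n. h n m) \<longlonglongrightarrow> g m" for h B and g :: "_ \<Rightarrow> real"
  proof (rule borel_measurable_LIMSEQ_real[OF _ that(3)])
   show "(\<lambda>n. integral\<^sup>L (kern L t) (h n)) \<longlonglongrightarrow> integral\<^sup>L (kern L t) g" for t
    using that by (intro integral_dominated_convergence[where w="\<lambda>_. B"]) (auto simp: mK spK)
  qed
 qed (use E in auto)
 moreover have "emeasure (kern L t) E = ennreal (\<integral>m. indicator E m \<partial>kern L t)" for t
  using E kern_props(2)[OF L] by (simp add: K.emeasure_eq_measure)
 ultimately show "(\<lambda>t. emeasure (kern L t) E) \<in> \<B> borel" by simp
qed

text \<open>Averaging the couplings over uniform \<open>t\<close> absorbs the integral over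
  \<open>t\<close> of the covariance formula into a single probability measure on pairs of
  configurations.\<close>

definition mix :: "'a measure \<Rightarrow> ('a \<times> bool \<times> bool) measure measure" where
 "mix L = uniform_measure lborel {0..1} \<bind> kern L"

lemma measurable_kern':
 "sigma_finite_measure L \<Longrightarrow> kern L \<in> uniform_measure lborel {0..1} \<rightarrow>\<^sub>M subprob_algebra (\<N> (mark_space L))"
 using measurable_kern by (simp cong: measurable_cong_sets)

lemma mix_props:
 assumes L: "sigma_finite_measure L"
 shows "sets (mix L) = sets (\<N> (mark_space L))" "prob_space (mix L)"
  "space (mix L) = {m. \<C> (mark_space L) m}"
proof -
 show s: "sets (mix L) = sets (\<N> (mark_space L))"
  unfolding mix_def by (rule sets_bind[OF kern_props(2)[OF L]]) simp
 then show "space (mix L) = {m. \<C> (mark_space L) m}" by (auto dest: sets_eq_imp_space_eq)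
 have "prob_space (uniform_measure lborel {0..1::real})" by (rule prob_space_uniform_measure) auto
 then show "prob_space (mix L)"
  unfolding mix_def
  by (rule prob_space.prob_space_bind[OF _ _ measurable_kern'[OF L]]) (simp add: kern_props[OF L])
qed

lemma nn_integral_mix:
 assumes L: "sigma_finite_measure L" and f: "f \<in> \<F> (mark_space L)"
 shows "(\<integral>\<^sup>+m. f m \<partial>mix L) = (\<integral>\<^sup>+t\<in>{0..1}. (\<integral>\<^sup>+m. f m \<partial>kern L t) \<partial>lborel)"
proof -
 have "(\<integral>\<^sup>+m. f m \<partial>mix L) = (\<integral>\<^sup>+t. (\<integral>\<^sup>+m. f m \<partial>kern L t) \<partial>uniform_measure lborel {0..1})"
  unfolding mix_def by (rule nn_integral_bind[OF f measurable_kern'[OF L]])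
 also have "\<dots> = (\<integral>\<^sup>+t\<in>{0..1}. (\<integral>\<^sup>+m. f m \<partial>kern L t) \<partial>lborel)"
  using m_comp[OF measurable_kern[OF L] nn_integral_measurable_subprob_algebra[OF f]]
  by (subst nn_integral_uniform_measure) (auto simp: divide_ennreal_def)
 finally show ?thesis .
qed

section \<open>The covariance formula\<close>

lemma measurable_add_one_cost:
 assumes F: "F \<in> \<F> L"
  and X: "X \<in> N \<rightarrow>\<^sub>M L" and T: "T \<in> N \<rightarrow>\<^sub>M \<N> L"
 shows "(\<lambda>z. \<D> (X z) F (T z)) \<in> \<B> N"
proof -
 have "(\<lambda>z. (X z, T z)) \<in> N \<rightarrow>\<^sub>M L \<Otimes>\<^sub>M \<N> L" using X T by measurable
 from m_comp[OF this measurable_add_dirac]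
 have "(\<lambda>z. add_dirac (T z) (X z)) \<in> N \<rightarrow>\<^sub>M \<N> L" by simp
 then show ?thesis unfolding add_one_cost_def
  by (intro borel_measurable_diff m_comp[OF _ F] T)
qed

lemma abs_add_one_cost_le:
 assumes "\<And>m. \<C> L m \<Longrightarrow> \<bar>F m\<bar> \<le> B" "\<C> L m"
 shows "\<bar>\<D> x F m\<bar> \<le> 2 * B"
 using assms(1)[OF assms(2)] assms(1)[OF counting_measure_add_dirac[OF assms(2), of x]]
 by (simp add: add_one_cost_def)

text \<open>The locale is interpreted for \<open>L\<close> and, in the fluctuation estimate, again
  for \<open>marked L t\<close>. The Poincare inequality for pairs of coupled configurations is
  thereby an instance of the one for a single configuration.\<close>

locale poisson_space = sigma_finite_measure L for L :: "'a measure" +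
 fixes P :: "'a measure measure" and X :: "nat \<Rightarrow> 'a set"
 assumes P: "pois_law L P"
  and X: "\<And>k. X k \<in> sets L" "incseq X" "(\<Union>k. X k) = space L" "\<And>k. emeasure L (X k) < \<infinity>"
begin

lemma L: "sigma_finite_measure L" ..

sublocale P: prob_space P by (rule pois_lawD[OF P])
sublocale Q: prob_space "mix L" by (rule mix_props[OF L])
sublocale LQ: pair_sigma_finite L "mix L" ..
sublocale LP: pair_sigma_finite L P ..
sublocale PP: pair_prob_space P P ..

lemma spaceP [simp]: "space P = {m. \<C> L m}"
 by (rule pois_lawD[OF P])

lemma spaceQ [simp]: "space (mix L) = {m. \<C> (mark_space L) m}"
 by (rule mix_props[OF L])

lemma measP [simp]: "measurable P N = measurable (\<N> L) N"
 by (intro measurable_cong_sets pois_lawD(2)[OF P] refl)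

lemma measQ [simp]: "measurable (mix L) N = measurable (\<N> (mark_space L)) N"
 by (intro measurable_cong_sets mix_props(1)[OF L] refl)

lemma setsP [measurable_cong]: "sets P = sets (\<N> L)"
 by (rule pois_lawD[OF P])

lemma setsQ [measurable_cong]: "sets (mix L) = sets (\<N> (mark_space L))"
 by (rule mix_props[OF L])

abbreviation "\<alpha> \<equiv> proj L fst_marks"
abbreviation "\<beta> \<equiv> proj L snd_marks"
abbreviation "\<L> \<equiv> L \<Otimes>\<^sub>M mix L"
abbreviation "\<P> \<equiv> P \<Otimes>\<^sub>M P"
abbreviation "\<Q> \<equiv> mix L \<Otimes>\<^sub>M P"
abbreviation "\<I> U \<equiv> \<integral>\<^sup>+x. (\<integral>\<^sup>+m. ennreal (U x m) \<partial>P) \<partial>L"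
abbreviation "\<Gamma> F G z \<equiv> \<D> (fst z) F (\<alpha> (snd z)) * \<D> (fst z) G (\<beta> (snd z))"

lemma \<alpha>: "\<alpha> \<in> mix L \<rightarrow>\<^sub>M \<N> L" and \<beta>: "\<beta> \<in> mix L \<rightarrow>\<^sub>M \<N> L"
 by (simp_all add: measurable_proj)

lemma kern_distr:
 assumes t: "t \<in> {0..1}"
 shows "distr (kern L t) (\<N> L) \<alpha> = P" "distr (kern L t) (\<N> L) \<beta> = P"
 using pois_law_unique[OF L _ P] pois_law_proj[OF L t] by auto

lemma kern_marginal:
 assumes t: "t \<in> {0..1}" and f: "f \<in> \<F> L"
 shows "(\<integral>\<^sup>+m. f (\<alpha> m) \<partial>kern L t) = (\<integral>\<^sup>+m. f m \<partial>P)" "(\<integral>\<^sup>+m. f (\<beta> m) \<partial>kern L t) = (\<integral>\<^sup>+m. f m \<partial>P)"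
proof -
 have m: "proj L S \<in> kern L t \<rightarrow>\<^sub>M \<N> L" for S
  using measurable_proj measurable_cong_sets[OF kern_props(2)[OF L] refl] by blast
 have "(\<integral>\<^sup>+m. f (proj L S m) \<partial>kern L t) = (\<integral>\<^sup>+m. f m \<partial>distr (kern L t) (\<N> L) (proj L S))" for S
  using f by (subst nn_integral_distr[OF m]) auto
 then show "(\<integral>\<^sup>+m. f (\<alpha> m) \<partial>kern L t) = (\<integral>\<^sup>+m. f m \<partial>P)" "(\<integral>\<^sup>+m. f (\<beta> m) \<partial>kern L t) = (\<integral>\<^sup>+m. f m \<partial>P)"
  by (simp_all add: kern_distr[OF t])
qed

lemma mix_marginal:
 assumes f: "f \<in> \<F> L"
 shows "(\<integral>\<^sup>+m. f (\<alpha> m) \<partial>mix L) = (\<integral>\<^sup>+m. f m \<partial>P)" "(\<integral>\<^sup>+m. f (\<beta> m) \<partial>mix L) = (\<integral>\<^sup>+m. f m \<partial>P)"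
proof -
 have m: "(\<lambda>m. f (proj L S m)) \<in> \<F> (mark_space L)" for S
  by (rule m_comp[OF measurable_proj f])
 have c: "(\<integral>\<^sup>+t\<in>{0..1::real}. c \<partial>lborel) = c" for c :: ennreal
  by (subst nn_integral_cmult_indicator) auto
 have "(\<integral>\<^sup>+m. f (\<alpha> m) \<partial>mix L) = (\<integral>\<^sup>+t\<in>{0..1::real}. (\<integral>\<^sup>+m. f m \<partial>P) \<partial>lborel)"
  unfolding nn_integral_mix[OF L m] by (intro nn_integral_cong) (auto simp: indicator_def kern_marginal(1)[OF _ f])
 then show "(\<integral>\<^sup>+m. f (\<alpha> m) \<partial>mix L) = (\<integral>\<^sup>+m. f m \<partial>P)" unfolding c .
 have "(\<integral>\<^sup>+m. f (\<beta> m) \<partial>mix L) = (\<integral>\<^sup>+t\<in>{0..1::real}. (\<integral>\<^sup>+m. f m \<partial>P) \<partial>lborel)"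
  unfolding nn_integral_mix[OF L m] by (intro nn_integral_cong) (auto simp: indicator_def kern_marginal(2)[OF _ f])
 then show "(\<integral>\<^sup>+m. f (\<beta> m) \<partial>mix L) = (\<integral>\<^sup>+m. f m \<partial>P)" unfolding c .
qed

text \<open>The expectation under \<open>kern L t\<close> is \<open>exp (c + t * b)\<close>;
  multiplied by \<open>b\<close> it is an exact derivative in \<open>t\<close>. Keeping
  \<open>b\<close> as a factor on the left includes the case \<open>b = 0\<close>.\<close>

lemma mix_laplace:
 assumes f: "test_simple L f" and g: "test_simple L g"
 defines "b \<equiv> (\<integral>x. (1 - exp (- f x)) * (1 - exp (- g x)) \<partial>L)"
  and "c \<equiv> - (\<integral>x. 1 - exp (- f x) \<partial>L) - (\<integral>x. 1 - exp (- g x) \<partial>L)"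
 shows "b * (\<integral>m. laplace f (\<alpha> m) * laplace g (\<beta> m) \<partial>mix L) = exp (c + b) - exp c"
proof -
 have [measurable]: "f \<in> \<B> L" "g \<in> \<B> L" using f g by (auto intro: test_simple_measurable)
 have f0: "0 \<le> f x" and g0: "0 \<le> g x" for x using f g by (auto simp: test_simple_def)
 have b0: "0 \<le> b" unfolding b_def using f0 g0 by (intro integral_nonneg_AE) auto
 have lm: "laplace f \<in> \<F> L" "laplace g \<in> \<F> L" by measurable
 have m: "(\<lambda>m. laplace f (\<alpha> m) * laplace g (\<beta> m)) \<in> \<F> (mark_space L)"
  by (intro borel_measurable_times m_comp[OF measurable_proj lm(1)] m_comp[OF measurable_proj lm(2)])
 have "ennreal b * (\<integral>\<^sup>+m. ennreal (laplace f (\<alpha> m) * laplace g (\<beta> m)) \<partial>mix L)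
   = ennreal b * (\<integral>\<^sup>+t\<in>{0..1}. (\<integral>\<^sup>+m. ennreal (laplace f (\<alpha> m) * laplace g (\<beta> m)) \<partial>kern L t) \<partial>lborel)"
  using m by (subst nn_integral_mix[OF L]) auto
 also have "\<dots> = ennreal b * (\<integral>\<^sup>+t\<in>{0..1}. ennreal (exp (c + t * b)) \<partial>lborel)"
 proof -
  have "(\<integral>\<^sup>+m. ennreal (laplace f (\<alpha> m) * laplace g (\<beta> m)) \<partial>kern L t) = ennreal (exp (c + t * b))" if t: "t \<in> {0..1}" for t
  proof -
   interpret K: prob_space "kern L t" by (rule kern_props[OF L])
   have "integrable (kern L t) (\<lambda>m. laplace f (\<alpha> m) * laplace g (\<beta> m))"
   proof (rule K.integrable_const_bound[where B=1])
    show "(\<lambda>m. laplace f (\<alpha> m) * laplace g (\<beta> m)) \<in> \<B> (kern L t)"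
     by (subst measurable_cong_sets[OF kern_props(2)[OF L] refl]) (rule m)
   qed (auto simp: abs_mult intro!: mult_le_one)
   then show ?thesis using kern_laplace[OF L t f g]
    by (subst nn_integral_eq_integral) (auto simp: b_def c_def)
  qed
  then show ?thesis by (intro arg_cong[of _ _ "(*) _"] nn_integral_cong) (auto simp: indicator_def)
 qed
 also have "\<dots> = (\<integral>\<^sup>+t. ennreal (b * exp (c + t * b)) * indicator {0..1} t \<partial>lborel)"
  using b0 by (subst nn_integral_cmult[symmetric]) (auto simp: ennreal_mult mult.assoc)
 also have "\<dots> = ennreal (exp (c + 1 * b) - exp (c + 0 * b))"
  using b0 by (intro nn_integral_FTC_Icc) (auto intro!: derivative_eq_intros)
 finally have "ennreal b * (\<integral>\<^sup>+m. ennreal (laplace f (\<alpha> m) * laplace g (\<beta> m)) \<partial>mix L) = ennreal (exp (c + b) - exp c)" by simp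
 moreover have "(\<integral>\<^sup>+m. ennreal (laplace f (\<alpha> m) * laplace g (\<beta> m)) \<partial>mix L) = ennreal (\<integral>m. laplace f (\<alpha> m) * laplace g (\<beta> m) \<partial>mix L)"
  using m by (intro nn_integral_eq_integral Q.integrable_const_bound[where B=1]) (auto simp: abs_mult intro!: mult_le_one)
 moreover have "0 \<le> exp (c + b) - exp c" using b0 by simp
 moreover have "0 \<le> (\<integral>m. laplace f (\<alpha> m) * laplace g (\<beta> m) \<partial>mix L)" by (intro integral_nonneg_AE) auto
 ultimately show ?thesis using b0 by (simp add: ennreal_mult[symmetric])
qed

subsection \<open>Bounded functionals of a restricted configuration\<close>

text \<open>The right-hand side of the covariance formula when the second functional sees only
  \<open>X n\<close>. A point outside \<open>X n\<close> then has no effect, and the integral runs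
  over a set of finite intensity, where bounded functionals give a bounded integrand.\<close>

definition J :: "nat \<Rightarrow> ('a measure \<Rightarrow> real) \<Rightarrow> ('a measure \<Rightarrow> real) \<Rightarrow> real" where
 "J n F G = (\<integral>z. indicator (X n) (fst z) * (\<D> (fst z) F (\<alpha> (snd z)) *
   \<D> (fst z) G (restr (X n) (\<beta> (snd z)))) \<partial>\<L>)"

definition bdd :: "('a measure \<Rightarrow> real) \<Rightarrow> real \<Rightarrow> bool" where
 "bdd F B \<longleftrightarrow> F \<in> \<F> L \<and> (\<forall>m. \<C> L m \<longrightarrow> \<bar>F m\<bar> \<le> B)"

lemma bddD: "bdd F B \<Longrightarrow> F \<in> \<F> L" "bdd F B \<Longrightarrow> \<C> L m \<Longrightarrow> \<bar>F m\<bar> \<le> B"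
 by (auto simp: bdd_def)

lemma measurable_restr_X: "restr (X n) \<in> \<N> L \<rightarrow>\<^sub>M \<N> L"
 by (rule measurable_restr[OF X(1)])

lemma bdd_restr: "bdd G B \<Longrightarrow> bdd (\<lambda>m. G (restr (X n) m)) B"
 unfolding bdd_def using m_comp[OF measurable_restr_X] counting_measure_restr[OF _ X(1)] by auto

lemma bdd_integrable: "bdd F B \<Longrightarrow> integrable P F"
 by (rule P.integrable_const_bound[where B=B]) (auto simp: bdd_def)

lemma bdd_mult: "bdd F B \<Longrightarrow> bdd G B' \<Longrightarrow> bdd (\<lambda>m. F m * G m) (B * B')"
 unfolding bdd_def by (auto simp: abs_mult intro!: mult_mono)

lemma measurable_J_integrand:
 assumes F: "F \<in> \<F> L" and G: "G \<in> \<F> L"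
 shows "(\<lambda>z. indicator (X n) (fst z) * (\<D> (fst z) F (\<alpha> (snd z)) *
   \<D> (fst z) G (restr (X n) (\<beta> (snd z))))) \<in> \<B> \<L>"
proof (intro borel_measurable_times measurable_add_one_cost[OF F] measurable_add_one_cost[OF G])
 show "(\<lambda>z. indicator (X n) (fst z) :: real) \<in> \<B> \<L>" using X(1) by measurable
 show "(\<lambda>z. \<alpha> (snd z)) \<in> \<L> \<rightarrow>\<^sub>M \<N> L" by (rule m_comp[OF measurable_snd \<alpha>])
 show "(\<lambda>z. restr (X n) (\<beta> (snd z))) \<in> \<L> \<rightarrow>\<^sub>M \<N> L"
  by (rule m_comp[OF m_comp[OF measurable_snd \<beta>] measurable_restr_X])
qed auto

lemma J_integrand_bound:
 assumes F: "bdd F B" and G: "bdd G B'" and z: "z \<in> space \<L>"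
 shows "\<bar>indicator (X n) (fst z) * (\<D> (fst z) F (\<alpha> (snd z)) *
   \<D> (fst z) G (restr (X n) (\<beta> (snd z))))\<bar> \<le> 4 * B * B' * indicator (X n) (fst z)"
proof -
 have c: "\<C> L (\<alpha> (snd z))" "\<C> L (restr (X n) (\<beta> (snd z)))"
  using z X(1) by (auto simp: space_pair_measure intro!: counting_measure_proj counting_measure_restr)
 have "\<bar>\<D> (fst z) F (\<alpha> (snd z))\<bar> \<le> 2 * B" "\<bar>\<D> (fst z) G (restr (X n) (\<beta> (snd z)))\<bar> \<le> 2 * B'"
  using F G c by (auto intro!: abs_add_one_cost_le[of L] simp: bdd_def)
 then have "\<bar>\<D> (fst z) F (\<alpha> (snd z)) * \<D> (fst z) G (restr (X n) (\<beta> (snd z)))\<bar> \<le> (2 * B) * (2 * B')"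
  unfolding abs_mult by (intro mult_mono) auto
 then show ?thesis by (auto simp: indicator_def)
qed

lemma integrable_indicator_X: "integrable \<L> (\<lambda>z. c * indicator (X n) (fst z) :: real)"
proof -
 have XS: "X n \<times> space (mix L) \<in> sets \<L>"
  by (rule pair_measureI[OF X(1) sets.top])
 have "emeasure \<L> (X n \<times> space (mix L)) < \<infinity>"
  using X(1,4)[of n] by (subst Q.emeasure_pair_measure_Times) (auto simp: Q.emeasure_space_1 simp del: spaceQ)
 then have "integrable \<L> (\<lambda>z. c * indicator (X n \<times> space (mix L)) z :: real)"
  using XS by (intro integrable_mult_right integrable_real_indicator) auto
 then show ?thesis
  by (rule Bochner_Integration.integrable_cong[THEN iffD1, rotated -1]) (auto simp: indicator_def space_pair_measure)
qed

lemma J_integrable: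
 assumes F: "bdd F B" and G: "bdd G B'"
 shows "integrable \<L> (\<lambda>z. indicator (X n) (fst z) * (\<D> (fst z) F (\<alpha> (snd z)) *
   \<D> (fst z) G (restr (X n) (\<beta> (snd z)))))"
 by (rule B_integrable_bound[OF integrable_indicator_X[of "4 * B * B'" n] measurable_J_integrand])
  (use F G J_integrand_bound[OF F G] in \<open>auto simp: bdd_def intro!: AE_I2 order_trans[OF _ abs_ge_self]\<close>)

lemma add_one_cost_lin: "\<D> x (\<lambda>m. c * f m + d * g m) m = c * \<D> x f m + d * \<D> x g m"
 by (simp add: add_one_cost_def algebra_simps)

lemma J_lim:
 assumes F: "\<And>k. bdd (F k) B" "bdd F' B" "\<And>m. \<C> L m \<Longrightarrow> (\<lambda>k. F k m) \<longlonglongrightarrow> F' m"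
  and G: "\<And>k. bdd (G k) B'" "bdd G' B'" "\<And>m. \<C> L m \<Longrightarrow> (\<lambda>k. G k m) \<longlonglongrightarrow> G' m"
 shows "(\<lambda>k. J n (F k) (G k)) \<longlonglongrightarrow> J n F' G'"
 unfolding J_def
proof (rule integral_dominated_convergence[OF _ _ integrable_indicator_X[of "4 * B * B'" n]])
 show "AE z in \<L>. (\<lambda>k. indicator (X n) (fst z) * (\<D> (fst z) (F k) (\<alpha> (snd z)) *
   \<D> (fst z) (G k) (restr (X n) (\<beta> (snd z))))) \<longlonglongrightarrow> indicator (X n) (fst z) * (\<D> (fst z) F' (\<alpha> (snd z)) *
   \<D> (fst z) G' (restr (X n) (\<beta> (snd z))))"
 proof (rule AE_I2)
  fix z assume z: "z \<in> space \<L>"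
  have c: "\<C> L (\<alpha> (snd z))" "\<C> L (restr (X n) (\<beta> (snd z)))"
   using z X(1) by (auto simp: space_pair_measure intro!: counting_measure_proj counting_measure_restr)
  show "(\<lambda>k. indicator (X n) (fst z) * (\<D> (fst z) (F k) (\<alpha> (snd z)) *
   \<D> (fst z) (G k) (restr (X n) (\<beta> (snd z))))) \<longlonglongrightarrow> indicator (X n) (fst z) * (\<D> (fst z) F' (\<alpha> (snd z)) *
   \<D> (fst z) G' (restr (X n) (\<beta> (snd z))))"
   unfolding add_one_cost_def
   by (intro tendsto_intros F(3) G(3) c counting_measure_add_dirac)
 qed
qed (use F G J_integrand_bound[OF F(1) G(1)] in \<open>auto intro!: measurable_J_integrand AE_I2 simp: bdd_def\<close>)

lemma laplace_bdd: "f \<in> \<B> L \<Longrightarrow> bdd (laplace f) 1"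
 by (auto simp: bdd_def)

text \<open>Adding a point \<open>x\<close> multiplies \<open>laplace f\<close> by
  \<open>exp (- f x)\<close>. The integrand therefore splits into a function of \<open>x\<close>,
  with integral \<open>b\<close>, and a function of the pair. In \<open>mix_laplace\<close>,
  \<open>exp c\<close> is the product of the two means and \<open>exp (c + b)\<close> the mean of
  the product.\<close>

lemma restricted_covariance_laplace:
 assumes f: "f \<in> exh_test L X" and g: "g \<in> exh_test L X"
 shows "(\<integral>m. laplace f m * laplace g (restr (X n) m) \<partial>P) - (\<integral>m. laplace f m \<partial>P) * (\<integral>m. laplace g (restr (X n) m) \<partial>P)
  = J n (laplace f) (laplace g)"
proof -
 define h where "h x = g x * indicator (X n) x" for x
 have tf: "test_simple L f" and tg: "test_simple L g"
  using exh_test_test_simple[OF f X(1,4)] exh_test_test_simple[OF g X(1,4)] by auto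
 have th: "test_simple L h" unfolding h_def by (rule test_simple_mult_indicator[OF tg X(1)])
 have [measurable]: "f \<in> \<B> L" "g \<in> \<B> L" "h \<in> \<B> L"
  using tf tg th by (auto intro: test_simple_measurable)
 have f0: "0 \<le> f x" and g0: "0 \<le> g x" and h0: "0 \<le> h x" for x using tf tg th by (auto simp: test_simple_def)
 have r: "laplace g (restr (X n) m) = laplace h m" if "\<C> L m" for m
 proof -
  have "sets m = sets L" using that by (rule counting_measure_sets)
  moreover from this have "g \<in> \<B> m" by (simp cong: measurable_cong_sets)
  ultimately show ?thesis unfolding h_def using X(1) by (intro laplace_restr) auto
 qed
 define b where "b = (\<integral>x. (1 - exp (- f x)) * (1 - exp (- h x)) \<partial>L)"
 define c where "c = - (\<integral>x. 1 - exp (- f x) \<partial>L) - (\<integral>x. 1 - exp (- h x) \<partial>L)"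
 have "J n (laplace f) (laplace g) = (\<integral>z. ((1 - exp (- f (fst z))) * (1 - exp (- h (fst z)))) * (laplace f (\<alpha> (snd z)) * laplace h (\<beta> (snd z))) \<partial>\<L>)"
  unfolding J_def
 proof (rule B_integral_cong[OF refl])
  fix z assume z: "z \<in> space \<L>"
  obtain x m where [simp]: "z = (x, m)" by (cases z)
  have x: "x \<in> space L" and m: "\<C> (mark_space L) m" using z by (auto simp: space_pair_measure)
  have c: "\<C> L (\<alpha> m)" "\<C> L (\<beta> m)" using m by (auto intro: counting_measure_proj)
  have s: "sets (restr (X n) (\<beta> m)) = sets L" by simp
  show "indicator (X n) (fst z) * (\<D> (fst z) (laplace f) (\<alpha> (snd z)) *
   \<D> (fst z) (laplace g) (restr (X n) (\<beta> (snd z)))) = ((1 - exp (- f (fst z))) * (1 - exp (- h (fst z)))) * (laplace f (\<alpha> (snd z)) * laplace h (\<beta> (snd z)))"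
   using x c(2) s f0 g0
   by (auto simp: add_one_cost_def laplace_add_dirac[of _ L] r h_def indicator_def algebra_simps)
 qed
 also have "\<dots> = b * (\<integral>m. laplace f (\<alpha> m) * laplace h (\<beta> m) \<partial>mix L)"
 proof -
  have lm: "laplace f \<in> \<F> L" "laplace h \<in> \<F> L" by measurable
  have m: "(\<lambda>m. laplace f (\<alpha> m) * laplace h (\<beta> m)) \<in> \<F> (mark_space L)"
   by (intro borel_measurable_times m_comp[OF measurable_proj lm(1)] m_comp[OF measurable_proj lm(2)])
  have "integrable \<L> (\<lambda>z. ((1 - exp (- f (fst z))) * (1 - exp (- h (fst z)))) * (laplace f (\<alpha> (snd z)) * laplace h (\<beta> (snd z))))"
  proof (rule B_integrable_bound[OF integrable_indicator_X[of 1 n]])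
   have "(\<lambda>z. laplace f (\<alpha> (snd z)) * laplace h (\<beta> (snd z))) \<in> \<B> \<L>"
    by (rule m_comp[OF measurable_snd]) (use m in simp)
   then show "(\<lambda>z. ((1 - exp (- f (fst z))) * (1 - exp (- h (fst z)))) * (laplace f (\<alpha> (snd z)) * laplace h (\<beta> (snd z)))) \<in> \<B> \<L>"
    by (intro borel_measurable_times) measurable
   show "AE z in \<L>. norm (((1 - exp (- f (fst z))) * (1 - exp (- h (fst z)))) * (laplace f (\<alpha> (snd z)) * laplace h (\<beta> (snd z)))) \<le> norm (1 * indicator (X n) (fst z) :: real)"
    using f0 g0 by (intro AE_I2) (auto simp: abs_mult h_def indicator_def intro!: mult_le_one)
  qed
  then have "(\<integral>z. ((1 - exp (- f (fst z))) * (1 - exp (- h (fst z)))) * (laplace f (\<alpha> (snd z)) * laplace h (\<beta> (snd z))) \<partial>\<L>)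
    = (\<integral>x. (\<integral>m. ((1 - exp (- f x)) * (1 - exp (- h x))) * (laplace f (\<alpha> m) * laplace h (\<beta> m)) \<partial>mix L) \<partial>L)"
   by (subst LQ.integral_fst'[symmetric]) (auto simp: case_prod_beta')
  then show ?thesis by (simp add: b_def)
 qed
 also have "\<dots> = exp (c + b) - exp c" unfolding b_def c_def by (rule mix_laplace[OF tf th])
 also have "exp c = (\<integral>m. laplace f m \<partial>P) * (\<integral>m. laplace g (restr (X n) m) \<partial>P)"
 proof -
  have "(\<integral>m. laplace g (restr (X n) m) \<partial>P) = (\<integral>m. laplace h m \<partial>P)"
   by (intro B_integral_cong) (auto simp: r)
  then show ?thesis using pois_lawD(4)[OF P tf] pois_lawD(4)[OF P th] by (simp add: c_def exp_add[symmetric])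
 qed
 also have "exp (c + b) = (\<integral>m. laplace f m * laplace g (restr (X n) m) \<partial>P)"
 proof -
  have "(\<integral>m. laplace f m * laplace g (restr (X n) m) \<partial>P) = (\<integral>m. laplace (\<lambda>x. f x + h x) m \<partial>P)"
   using f0 h0 by (intro B_integral_cong) (auto simp: r laplace_add[of _ L] counting_measure_sets)
  also have "\<dots> = exp (- (\<integral>x. 1 - exp (- (f x + h x)) \<partial>L))"
   by (rule pois_lawD(4)[OF P test_simple_add[OF tf th]])
  also have "(\<integral>x. 1 - exp (- (f x + h x)) \<partial>L) = (\<integral>x. (1 - exp (- f x)) + (1 - exp (- h x)) - (1 - exp (- f x)) * (1 - exp (- h x)) \<partial>L)"
   by (intro B_integral_cong) (auto simp: algebra_simps exp_add exp_diff exp_minus divide_inverse)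
  also have "\<dots> = - c - b"
  proof -
   have i: "integrable L (\<lambda>x. (1 - exp (- f x)) * (1 - exp (- h x)))"
    by (rule B_integrable_bound[OF integrable_test_simple[OF tf]])
     (use f0 h0 in \<open>auto simp: abs_mult intro!: mult_left_le\<close>)
   have "(\<integral>x. u x + v x - w x \<partial>L) = (\<integral>x. u x \<partial>L) + (\<integral>x. v x \<partial>L) - (\<integral>x. w x \<partial>L)"
    if "integrable L u" "integrable L v" "integrable L w" for u v w :: "'a \<Rightarrow> real"
    using that by simp
   from this[OF integrable_test_simple[OF tf] integrable_test_simple[OF th] i] show ?thesis by (simp add: b_def c_def)
  qed
  finally show ?thesis by (simp add: algebra_simps)
 qed
 finally show ?thesis by simp
qed

text \<open>Both sides are bilinear and stable under bounded pointwise limits. The induction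
  principle is applied first to \<open>F\<close> with a Laplace functional as second argument, then
  to \<open>G\<close> with an arbitrary bounded \<open>F\<close>.\<close>

lemma restricted_covariance:
 assumes F: "bdd F B" and G: "bdd G B'"
 shows "(\<integral>m. F m * G (restr (X n) m) \<partial>P) - (\<integral>m. F m \<partial>P) * (\<integral>m. G (restr (X n) m) \<partial>P) = J n F G"
  (is "?I F G = _")
proof -
 have lin1: "?I (\<lambda>m. c * f m + d * g m) G = J n (\<lambda>m. c * f m + d * g m) G"
  if "bdd f K" "bdd g K" "bdd G K'" "?I f G = J n f G" "?I g G = J n g G" for f g G c d K K'
 proof -
  have "J n (\<lambda>m. c * f m + d * g m) G = c * J n f G + d * J n g G"
   unfolding J_def add_one_cost_lin
   using J_integrable[OF that(1,3), of n] J_integrable[OF that(2,3), of n]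
   by (subst (1 2) integral_mult_right_zero[symmetric], subst B_integral_add[symmetric])
    (auto intro!: B_integral_cong simp: algebra_simps)
  moreover have "?I (\<lambda>m. c * f m + d * g m) G = c * ?I f G + d * ?I g G"
   using bdd_integrable[OF that(1)] bdd_integrable[OF that(2)] bdd_integrable[OF bdd_mult[OF that(1) bdd_restr[OF that(3), of n]]]
    bdd_integrable[OF bdd_mult[OF that(2) bdd_restr[OF that(3), of n]]]
   by (simp add: algebra_simps)
  ultimately show ?thesis using that by simp
 qed
 have lin2: "?I F (\<lambda>m. c * f m + d * g m) = J n F (\<lambda>m. c * f m + d * g m)"
  if "bdd f K" "bdd g K" "bdd F K'" "?I F f = J n F f" "?I F g = J n F g" for f g F c d K K'
 proof -
  have "J n F (\<lambda>m. c * f m + d * g m) = c * J n F f + d * J n F g"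
   unfolding J_def add_one_cost_lin
   using J_integrable[OF that(3,1), of n] J_integrable[OF that(3,2), of n]
   by (subst (1 2) integral_mult_right_zero[symmetric], subst B_integral_add[symmetric])
    (auto intro!: B_integral_cong simp: algebra_simps)
  moreover have "?I F (\<lambda>m. c * f m + d * g m) = c * ?I F f + d * ?I F g"
   using bdd_integrable[OF bdd_restr[OF that(1), of n]] bdd_integrable[OF bdd_restr[OF that(2), of n]]
    bdd_integrable[OF bdd_mult[OF that(3) bdd_restr[OF that(1), of n]]]
    bdd_integrable[OF bdd_mult[OF that(3) bdd_restr[OF that(2), of n]]]
   by (simp add: algebra_simps)
  ultimately show ?thesis using that by simp
 qed
 have lim: "?I F0 G0 = J n F0 G0"
  if "\<And>k. bdd (Fs k) K" "bdd F0 K" "\<And>m. \<C> L m \<Longrightarrow> (\<lambda>k. Fs k m) \<longlonglongrightarrow> F0 m"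
   "\<And>k. bdd (Gs k) K'" "bdd G0 K'" "\<And>m. \<C> L m \<Longrightarrow> (\<lambda>k. Gs k m) \<longlonglongrightarrow> G0 m"
   "\<And>k. ?I (Fs k) (Gs k) = J n (Fs k) (Gs k)" for Fs F0 K Gs G0 K'
 proof -
  have conv: "(\<lambda>k. \<integral>m. h k m \<partial>P) \<longlonglongrightarrow> (\<integral>m. h' m \<partial>P)"
   if "\<And>k. bdd (h k) B" "bdd h' B" "\<And>m. \<C> L m \<Longrightarrow> (\<lambda>k. h k m) \<longlonglongrightarrow> h' m" for h h' B
   using that by (intro integral_dominated_convergence[where w="\<lambda>_. B"]) (auto simp: bdd_def)
  have "(\<lambda>k. ?I (Fs k) (Gs k)) \<longlonglongrightarrow> ?I F0 G0"
   using that(3,6) X(1)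
   by (intro tendsto_diff tendsto_mult conv[OF that(1,2)] conv[OF bdd_restr[OF that(4)] bdd_restr[OF that(5)]]
     conv[OF bdd_mult[OF that(1) bdd_restr[OF that(4)]] bdd_mult[OF that(2) bdd_restr[OF that(5)]]])
    (auto intro: counting_measure_restr)
  moreover have "(\<lambda>k. J n (Fs k) (Gs k)) \<longlonglongrightarrow> J n F0 G0" by (rule J_lim[OF that(1-6)])
  ultimately show ?thesis using that(7) LIMSEQ_unique by auto
 qed
 have one: "?I F (laplace g) = J n F (laplace g)" if g: "g \<in> exh_test L X" and F: "bdd F B" for g F B
 proof (rule counting_space_bounded_induct[OF X(1-3), where f=F and B=B])
  have lg: "bdd (laplace g) 1" using g by (intro laplace_bdd) (auto simp: exh_test_def intro: borel_measurable_simple_function)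
  show "?I (laplace f) (laplace g) = J n (laplace f) (laplace g)" if "f \<in> exh_test L X" for f
   by (rule restricted_covariance_laplace[OF that g])
  show "?I (\<lambda>m. c * f m + d * h m) (laplace g) = J n (\<lambda>m. c * f m + d * h m) (laplace g)"
   if "f \<in> \<F> L" "\<And>m. \<C> L m \<Longrightarrow> \<bar>f m\<bar> \<le> B" "?I f (laplace g) = J n f (laplace g)"
    "h \<in> \<F> L" "\<And>m. \<C> L m \<Longrightarrow> \<bar>h m\<bar> \<le> B" "?I h (laplace g) = J n h (laplace g)" for f h c d B
  proof -
   have "bdd f B" "bdd h B" using that by (auto simp: bdd_def)
   then show ?thesis by (rule lin1[OF _ _ lg that(3,6)])
  qed
  show "?I f (laplace g) = J n f (laplace g)"
   if "\<And>k. h k \<in> \<F> L" "\<And>k m. \<C> L m \<Longrightarrow> \<bar>h k m\<bar> \<le> B"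
    "\<And>k. ?I (h k) (laplace g) = J n (h k) (laplace g)" "f \<in> \<F> L"
    "\<And>m. \<C> L m \<Longrightarrow> \<bar>f m\<bar> \<le> B"
    "\<And>m. \<C> L m \<Longrightarrow> (\<lambda>k. h k m) \<longlonglongrightarrow> f m" for h B f
  proof -
   have b: "bdd (h k) B" "bdd f B" for k using that by (auto simp: bdd_def)
   show ?thesis by (rule lim[OF b that(6) lg lg tendsto_const that(3)])
  qed
 qed (use F in \<open>auto simp: bdd_def\<close>)
 show ?thesis
 proof (rule counting_space_bounded_induct[OF X(1-3), where f=G and B=B'])
  show "?I F (laplace f) = J n F (laplace f)" if "f \<in> exh_test L X" for f
   by (rule one[OF that F])
  show "?I F (\<lambda>m. c * f m + d * h m) = J n F (\<lambda>m. c * f m + d * h m)"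
   if "f \<in> \<F> L" "\<And>m. \<C> L m \<Longrightarrow> \<bar>f m\<bar> \<le> B" "?I F f = J n F f"
    "h \<in> \<F> L" "\<And>m. \<C> L m \<Longrightarrow> \<bar>h m\<bar> \<le> B" "?I F h = J n F h" for f h c d B
  proof -
   have "bdd f B" "bdd h B" using that by (auto simp: bdd_def)
   then show ?thesis by (rule lin2[OF _ _ F that(3,6)])
  qed
  show "?I F f = J n F f"
   if "\<And>k. h k \<in> \<F> L" "\<And>k m. \<C> L m \<Longrightarrow> \<bar>h k m\<bar> \<le> B"
    "\<And>k. ?I F (h k) = J n F (h k)" "f \<in> \<F> L"
    "\<And>m. \<C> L m \<Longrightarrow> \<bar>f m\<bar> \<le> B"
    "\<And>m. \<C> L m \<Longrightarrow> (\<lambda>k. h k m) \<longlonglongrightarrow> f m" for h B and f :: "'a measure \<Rightarrow> real"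
  proof -
   have b: "bdd (h k) B" "bdd f B" for k using that by (auto simp: bdd_def)
   show ?thesis by (rule lim[OF F F tendsto_const b that(6,3)])
  qed
 qed (use G in \<open>auto simp: bdd_def\<close>)
qed


subsection \<open>Removing the restriction\<close>

text \<open>The configuration \<open>m\<close> inside \<open>X n\<close>, with the outside resampled
  from \<nu>. For frozen \<nu> it depends on \<open>m\<close> only through its restriction to
  \<open>X n\<close>, yet for independent \<open>m\<close> and \<nu> it still has law
  \<open>P\<close>.\<close>

definition hyb :: "nat \<Rightarrow> 'a measure \<Rightarrow> 'a measure \<Rightarrow> 'a measure" where
 "hyb n m \<nu> = add_meas (restr (X n) m) (restr (space L - X n) \<nu>)"

abbreviation "\<H> n z \<equiv> hyb n (fst z) (snd z)"

lemma counting_measure_hyb: "\<C> L m \<Longrightarrow> \<C> L \<nu> \<Longrightarrow> \<C> L (hyb n m \<nu>)"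
 unfolding hyb_def using X(1) by (intro counting_measure_add_meas counting_measure_restr) auto

lemma measurable_hyb:
 assumes "f \<in> N \<rightarrow>\<^sub>M \<N> L" "g \<in> N \<rightarrow>\<^sub>M \<N> L"
 shows "(\<lambda>z. hyb n (f z) (g z)) \<in> N \<rightarrow>\<^sub>M \<N> L"
proof -
 have "(\<lambda>z. (restr (X n) (f z), restr (space L - X n) (g z))) \<in> N \<rightarrow>\<^sub>M \<N> L \<Otimes>\<^sub>M \<N> L"
  using X(1) by (intro measurable_Pair m_comp[OF assms(1)] m_comp[OF assms(2)] measurable_restr) auto
 from m_comp[OF this measurable_add_meas] show ?thesis by (simp add: hyb_def)
qed

lemma laplace_hyb:
 assumes f: "f \<in> \<B> L" and m: "\<C> L m" and \<nu>: "\<C> L \<nu>"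
 shows "laplace f (hyb n m \<nu>) = laplace (\<lambda>x. f x * indicator (X n) x) m * laplace (\<lambda>x. f x * indicator (space L - X n) x) \<nu>"
proof -
 have s: "sets m = sets L" "sets \<nu> = sets L" using m \<nu> by (auto simp: counting_measure_sets)
 have m: "f \<in> \<B> \<kappa>" if "sets \<kappa> = sets L" for \<kappa> using f that by (simp cong: measurable_cong_sets)
 show ?thesis unfolding hyb_def
  using s X(1) by (subst laplace_add_meas) (auto simp: laplace_restr m)
qed

text \<open>The Laplace functional of the hybrid is a product over the two independent inputs, and
  the exponents of the two pieces of \<open>f\<close> add up to that of \<open>f\<close>.\<close>

lemma distr_hyb: "distr \<P> (\<N> L) (\<lambda>z. \<H> n z) = P"
proof (rule prob_space_eq_counting[OF L X(1-3)])
 have m: "(\<lambda>z. \<H> n z) \<in> \<P> \<rightarrow>\<^sub>M \<N> L"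
  by (intro measurable_hyb) (simp_all cong: measurable_cong_sets add: setsP measurable_fst measurable_snd)
 show "prob_space (distr \<P> (\<N> L) (\<lambda>z. \<H> n z))"
  by (rule PP.prob_space_distr[OF m])
 fix f assume "f \<in> exh_test L X"
 then have f: "test_simple L f" by (rule exh_test_test_simple[OF _ X(1,4)])
 let ?f1 = "\<lambda>x. f x * indicator (X n) x" and ?f2 = "\<lambda>x. f x * indicator (space L - X n) x"
 have f1: "test_simple L ?f1" and f2: "test_simple L ?f2"
  using X(1) by (auto intro!: test_simple_mult_indicator f)
 have [measurable]: "f \<in> \<B> L" "?f1 \<in> \<B> L" "?f2 \<in> \<B> L"
  using f f1 f2 by (auto intro: test_simple_measurable)
 have lm: "laplace f \<in> \<F> L" "laplace ?f1 \<in> \<B> P" "laplace ?f2 \<in> \<B> P"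
  using measurable_laplace[of f L] measurable_laplace[of ?f1 L] measurable_laplace[of ?f2 L] by auto
 have m2: "(\<lambda>z. laplace ?f1 (fst z) * laplace ?f2 (snd z)) \<in> \<B> \<P>"
  by (intro borel_measurable_times m_comp[OF measurable_fst lm(2)] m_comp[OF measurable_snd lm(3)])
 have "(\<integral>m. laplace f m \<partial>distr \<P> (\<N> L) (\<lambda>z. \<H> n z))
  = (\<integral>z. laplace f (\<H> n z) \<partial>\<P>)"
  by (rule integral_distr[OF m lm(1)])
 also have "\<dots> = (\<integral>z. laplace ?f1 (fst z) * laplace ?f2 (snd z) \<partial>\<P>)"
  by (intro B_integral_cong) (auto simp: space_pair_measure laplace_hyb)
 also have "\<dots> = (\<integral>m. (\<integral>\<nu>. laplace ?f1 m * laplace ?f2 \<nu> \<partial>P) \<partial>P)"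
  by (subst PP.integral_fst'[symmetric])
   (use m2 in \<open>auto intro!: PP.integrable_const_bound[where B=1] AE_I2 mult_le_one simp: abs_mult\<close>)
 also have "\<dots> = (\<integral>m. laplace ?f1 m \<partial>P) * (\<integral>m. laplace ?f2 m \<partial>P)" by simp
 also have "\<dots> = exp (- ((\<integral>x. 1 - exp (- ?f1 x) \<partial>L) + (\<integral>x. 1 - exp (- ?f2 x) \<partial>L)))"
  using pois_lawD(4)[OF P f1] pois_lawD(4)[OF P f2] by (simp add: exp_add[symmetric])
 also have "(\<integral>x. 1 - exp (- ?f1 x) \<partial>L) + (\<integral>x. 1 - exp (- ?f2 x) \<partial>L) = (\<integral>x. (1 - exp (- ?f1 x)) + (1 - exp (- ?f2 x)) \<partial>L)"
  by (rule B_integral_add[symmetric]; rule integrable_test_simple; fact)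
 also have "\<dots> = (\<integral>x. 1 - exp (- f x) \<partial>L)"
  by (intro B_integral_cong) (auto simp: indicator_def)
 finally show "(\<integral>m. laplace f m \<partial>distr \<P> (\<N> L) (\<lambda>z. \<H> n z)) = (\<integral>m. laplace f m \<partial>P)"
  using pois_lawD(4)[OF P f] by simp
qed (auto simp: setsP P.prob_space_axioms)

lemma measurable_hyb_PP: "(\<lambda>z. \<H> n z) \<in> \<P> \<rightarrow>\<^sub>M \<N> L"
 by (intro measurable_hyb) (simp_all cong: measurable_cong_sets add: setsP measurable_fst measurable_snd)

lemma nn_integral_hyb:
 assumes "f \<in> \<F> L"
 shows "(\<integral>\<^sup>+z. f (\<H> n z) \<partial>\<P>) = (\<integral>\<^sup>+m. f m \<partial>P)"
proof -
 have "(\<integral>\<^sup>+z. f (\<H> n z) \<partial>\<P>) = (\<integral>\<^sup>+m. f m \<partial>distr \<P> (\<N> L) (\<lambda>z. \<H> n z))"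
  using assms by (subst nn_integral_distr[OF measurable_hyb_PP]) auto
 then show ?thesis by (simp add: distr_hyb)
qed

lemma hyb_measurable_diff:
 assumes \<phi>: "\<phi> \<in> \<F> L"
 shows "(\<lambda>z. \<bar>\<phi> (\<H> n z) - \<phi> (fst z)\<bar> :: real) \<in> \<B> \<P>"
proof -
 have "fst \<in> \<P> \<rightarrow>\<^sub>M \<N> L" by (simp cong: measurable_cong_sets add: setsP measurable_fst)
 from m_comp[OF this \<phi>] m_comp[OF measurable_hyb_PP \<phi>] show ?thesis by measurable
qed

text \<open>For a Laplace functional of \<open>f\<close> supported in \<open>X k\<close> the
  difference vanishes as soon as \<open>n \<ge> k\<close>. The limit step works since the hybrid has
  law \<open>P\<close>: replacing \<phi> by an approximation costs the same amount at both
  arguments, hence the factor 2, uniformly in \<open>n\<close>.\<close>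

lemma hyb_converges:
 assumes \<phi>: "bdd \<phi> B"
 shows "(\<lambda>n. \<integral>\<^sup>+z. ennreal \<bar>\<phi> (\<H> n z) - \<phi> (fst z)\<bar> \<partial>\<P>) \<longlonglongrightarrow> 0"
proof (rule counting_space_bounded_induct[OF X(1-3), where f=\<phi> and B=B])
 fix f assume f: "f \<in> exh_test L X"
 obtain k where k: "\<And>x. x \<notin> X k \<Longrightarrow> f x = 0" using f unfolding exh_test_def by blast
 have fm: "f \<in> \<B> L" using f by (auto simp: exh_test_def intro: borel_measurable_simple_function)
 have "(\<integral>\<^sup>+z. ennreal \<bar>laplace f (\<H> n z) - laplace f (fst z)\<bar> \<partial>\<P>) = 0" if n: "n \<ge> k" for n
 proof -
  have "X k \<subseteq> X n" using n X(2) by (auto simp: incseq_def)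
  then have "x \<notin> X k" if "x \<notin> X n" for x using that by blast
  then have e: "(\<lambda>x. f x * indicator (X n) x) = f" "(\<lambda>x. f x * indicator (space L - X n) x) = (\<lambda>_. 0)"
   using k \<open>X k \<subseteq> X n\<close> by (auto simp: indicator_def fun_eq_iff)
  have "(\<integral>\<^sup>+z. ennreal \<bar>laplace f (\<H> n z) - laplace f (fst z)\<bar> \<partial>\<P>) = (\<integral>\<^sup>+z. 0 \<partial>\<P>)"
   by (intro nn_integral_cong) (auto simp: space_pair_measure laplace_hyb[OF fm] e)
  then show ?thesis by simp
 qed
 then show "(\<lambda>n. \<integral>\<^sup>+z. ennreal \<bar>laplace f (\<H> n z) - laplace f (fst z)\<bar> \<partial>\<P>) \<longlonglongrightarrow> 0"
  by (intro tendsto_eventually) (auto simp: eventually_sequentially)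
next
 let ?D = "\<lambda>\<phi> n. \<integral>\<^sup>+z. ennreal \<bar>\<phi> (\<H> n z) - \<phi> (fst z)\<bar> \<partial>\<P>"
 show "?D (\<lambda>m. c * f m + d * g m) \<longlonglongrightarrow> 0"
  if f: "f \<in> \<F> L" "?D f \<longlonglongrightarrow> 0"
   and g: "g \<in> \<F> L" "?D g \<longlonglongrightarrow> 0" for f g :: "'a measure \<Rightarrow> real" and c d
 proof (rule tendsto_sandwich[of "\<lambda>_. 0" _ _ "\<lambda>n. ennreal \<bar>c\<bar> * ?D f n + ennreal \<bar>d\<bar> * ?D g n"])
  show "\<forall>\<^sub>F n in sequentially. ?D (\<lambda>m. c * f m + d * g m) n \<le> ennreal \<bar>c\<bar> * ?D f n + ennreal \<bar>d\<bar> * ?D g n"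
  proof (intro always_eventually allI)
   fix n
   have "?D (\<lambda>m. c * f m + d * g m) n \<le> (\<integral>\<^sup>+z. ennreal \<bar>c\<bar> * ennreal \<bar>f (\<H> n z) - f (fst z)\<bar>
    + ennreal \<bar>d\<bar> * ennreal \<bar>g (\<H> n z) - g (fst z)\<bar> \<partial>\<P>)"
   proof (rule nn_integral_mono)
    fix z
    let ?u = "f (\<H> n z) - f (fst z)" and ?v = "g (\<H> n z) - g (fst z)"
    have "\<bar>c * f (\<H> n z) + d * g (\<H> n z) - (c * f (fst z) + d * g (fst z))\<bar> = \<bar>c * ?u + d * ?v\<bar>"
     by (simp add: algebra_simps)
    also have "\<dots> \<le> \<bar>c\<bar> * \<bar>?u\<bar> + \<bar>d\<bar> * \<bar>?v\<bar>" using abs_triangle_ineq[of "c * ?u" "d * ?v"] by (simp add: abs_mult)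
    finally show "ennreal \<bar>c * f (\<H> n z) + d * g (\<H> n z) - (c * f (fst z) + d * g (fst z))\<bar>
     \<le> ennreal \<bar>c\<bar> * ennreal \<bar>?u\<bar> + ennreal \<bar>d\<bar> * ennreal \<bar>?v\<bar>"
     by (simp add: ennreal_mult[symmetric] ennreal_plus[symmetric] del: ennreal_plus) 
   qed
   also have "\<dots> = ennreal \<bar>c\<bar> * ?D f n + ennreal \<bar>d\<bar> * ?D g n"
    using hyb_measurable_diff[OF f(1), of n] hyb_measurable_diff[OF g(1), of n]
    by (subst nn_integral_add) (auto simp: nn_integral_cmult)
   finally show "?D (\<lambda>m. c * f m + d * g m) n \<le> ennreal \<bar>c\<bar> * ?D f n + ennreal \<bar>d\<bar> * ?D g n" .
  qed
  have "(\<lambda>n. ennreal \<bar>c\<bar> * ?D f n + ennreal \<bar>d\<bar> * ?D g n) \<longlonglongrightarrow> ennreal \<bar>c\<bar> * 0 + ennreal \<bar>d\<bar> * 0"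
   by (intro tendsto_add ennreal_tendsto_cmult f(2) g(2)) auto
  then show "(\<lambda>n. ennreal \<bar>c\<bar> * ?D f n + ennreal \<bar>d\<bar> * ?D g n) \<longlonglongrightarrow> 0" by simp
 qed auto
 show "?D g \<longlonglongrightarrow> 0"
  if h: "\<And>k. h k \<in> \<F> L" "\<And>k m. \<C> L m \<Longrightarrow> \<bar>h k m\<bar> \<le> B"
    "\<And>k. ?D (h k) \<longlonglongrightarrow> 0" and g: "g \<in> \<F> L" "\<And>m. \<C> L m \<Longrightarrow> \<bar>g m\<bar> \<le> B"
    and lim: "\<And>m. \<C> L m \<Longrightarrow> (\<lambda>k. h k m) \<longlonglongrightarrow> g m" for h B and g :: "'a measure \<Rightarrow> real"
 proof -
  define e where "e k = (\<integral>\<^sup>+m. ennreal \<bar>g m - h k m\<bar> \<partial>P)" for k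
  have em: "(\<lambda>m. ennreal \<bar>g m - h k m\<bar>) \<in> \<F> L" for k using h g by measurable
  have "e \<longlonglongrightarrow> (\<integral>\<^sup>+m. 0 \<partial>P)" unfolding e_def
  proof (rule nn_integral_dominated_convergence[where w="\<lambda>_. ennreal (2 * B)"])
   show "AE m in P. ennreal \<bar>g m - h k m\<bar> \<le> ennreal (2 * B)" for k
   proof (intro AE_I2 ennreal_leI)
    fix m assume "m \<in> space P"
    then have "\<bar>g m\<bar> \<le> B" "\<bar>h k m\<bar> \<le> B" using h(2)[of m k] g(2) by auto
    then show "\<bar>g m - h k m\<bar> \<le> 2 * B" by linarith
   qed
   show "AE m in P. (\<lambda>k. ennreal \<bar>g m - h k m\<bar>) \<longlonglongrightarrow> 0"
   proof (intro AE_I2)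
    fix m assume "m \<in> space P"
    then have "(\<lambda>k. \<bar>g m - h k m\<bar>) \<longlonglongrightarrow> \<bar>g m - g m\<bar>" by (intro tendsto_intros lim) simp
    then show "(\<lambda>k. ennreal \<bar>g m - h k m\<bar>) \<longlonglongrightarrow> 0" by (auto dest: tendsto_ennrealI)
   qed
  qed (use em in \<open>auto simp: P.emeasure_space_1 ennreal_mult_less_top simp del: spaceP\<close>)
  then have e0: "(\<lambda>k. 2 * e k) \<longlonglongrightarrow> 0" using ennreal_tendsto_cmult[of 2 e 0] by simp
  have le: "?D g n \<le> 2 * e k + ?D (h k) n" for n k
  proof -
   have fm: "fst \<in> \<P> \<rightarrow>\<^sub>M \<N> L" by (simp cong: measurable_cong_sets add: setsP measurable_fst)
   have "?D g n \<le> (\<integral>\<^sup>+z. (ennreal \<bar>g (\<H> n z) - h k (\<H> n z)\<bar> + ennreal \<bar>g (fst z) - h k (fst z)\<bar>)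
     + ennreal \<bar>h k (\<H> n z) - h k (fst z)\<bar> \<partial>\<P>)"
    by (intro nn_integral_mono) (simp add: ennreal_plus[symmetric] del: ennreal_plus)
   also have "\<dots> = (\<integral>\<^sup>+z. ennreal \<bar>g (\<H> n z) - h k (\<H> n z)\<bar> \<partial>\<P>)
    + (\<integral>\<^sup>+z. ennreal \<bar>g (fst z) - h k (fst z)\<bar> \<partial>\<P>) + ?D (h k) n"
    using hyb_measurable_diff[OF h(1)[of k], of n] m_comp[OF measurable_hyb_PP em[of k], of n] m_comp[OF fm em[of k]]
    by (simp add: nn_integral_add)
   also have "(\<integral>\<^sup>+z. ennreal \<bar>g (\<H> n z) - h k (\<H> n z)\<bar> \<partial>\<P>) = e k"
    unfolding e_def by (rule nn_integral_hyb[OF em])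
   also have "(\<integral>\<^sup>+z. ennreal \<bar>g (fst z) - h k (fst z)\<bar> \<partial>\<P>) = (\<integral>\<^sup>+m. (\<integral>\<^sup>+\<nu>. ennreal \<bar>g m - h k m\<bar> \<partial>P) \<partial>P)"
    using m_comp[OF fm em[of k]] by (subst P.nn_integral_fst[symmetric]) auto
   also have "\<dots> = e k" by (simp add: e_def P.emeasure_space_1 del: spaceP)
   finally show ?thesis by (simp add: mult_2)
  qed
  show ?thesis
  proof (rule order_tendstoI)
   fix a :: ennreal assume a: "0 < a"
   then obtain a' where a': "0 < a'" "a' < a" using dense by blast
   have "0 < a - a'" using a' by (simp add: diff_gr0_ennreal)
   then obtain k where k: "2 * e k < a - a'" using eventually_happens[OF order_tendstoD(2)[OF e0]] by auto
   have "\<forall>\<^sub>F n in sequentially. ?D (h k) n < a'" using order_tendstoD(2)[OF h(3) a'(1)] .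
   then show "\<forall>\<^sub>F n in sequentially. ?D g n < a"
   proof eventually_elim
    case (elim n)
    have "?D g n \<le> 2 * e k + ?D (h k) n" by (rule le)
    also have "\<dots> < (a - a') + a'" using k elim by (intro add_strict_mono) auto
    also have "\<dots> = a" using a' by (simp add: diff_add_cancel_ennreal less_imp_le)
    finally show ?case .
   qed
  qed auto
 qed
qed (use \<phi> in \<open>auto simp: bdd_def\<close>)

sublocale QP: pair_prob_space "mix L" P ..
sublocale LQP: pair_sigma_finite "\<L>" P ..

lemma nn_integral_\<beta>_pair:
 assumes f: "f \<in> \<B> (\<N> L \<Otimes>\<^sub>M \<N> L)"
 shows "(\<integral>\<^sup>+y. f (\<beta> (fst y), snd y) \<partial>\<Q>) = (\<integral>\<^sup>+z. f z \<partial>\<P>)"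
proof -
 have f': "f \<in> \<B> \<P>" using f by (simp cong: measurable_cong_sets add: setsP)
 have "snd \<in> \<Q> \<rightarrow>\<^sub>M \<N> L" by (simp cong: measurable_cong_sets add: setsP measurable_snd)
 then have fm: "(\<lambda>y. f (\<beta> (fst y), snd y)) \<in> \<B> \<Q>"
  by (intro m_comp[OF _ f] measurable_Pair m_comp[OF measurable_fst \<beta>])
 have "(\<integral>\<^sup>+m. f (\<beta> m, \<nu>) \<partial>mix L) = (\<integral>\<^sup>+m. f (m, \<nu>) \<partial>P)" if "\<nu> \<in> space P" for \<nu>
 proof (rule mix_marginal(2))
  show "(\<lambda>m. f (m, \<nu>)) \<in> \<F> L"
   using f that by (intro m_comp[OF _ f] measurable_Pair) auto
 qed
 then have "(\<integral>\<^sup>+\<nu>. (\<integral>\<^sup>+m. f (\<beta> m, \<nu>) \<partial>mix L) \<partial>P) = (\<integral>\<^sup>+\<nu>. (\<integral>\<^sup>+m. f (m, \<nu>) \<partial>P) \<partial>P)"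
  by (intro nn_integral_cong)
 also have "\<dots> = (\<integral>\<^sup>+z. f z \<partial>\<P>)" using f' by (rule PP.nn_integral_snd)
 finally show ?thesis using QP.nn_integral_snd[OF fm] by simp
qed

text \<open>A bound by a sum of terms in one configuration each is insensitive to the dependence
  between the two: its integral is the same under every coupling with marginals \<open>P\<close>.
  The same pair \<open>U\<close>, \<open>V\<close> thus controls all couplings, hybrids and
  truncations.\<close>

definition dominated :: "('a measure \<Rightarrow> real) \<Rightarrow> ('a measure \<Rightarrow> real) \<Rightarrow> ('a \<Rightarrow> 'a measure \<Rightarrow> real) \<Rightarrow> ('a \<Rightarrow> 'a measure \<Rightarrow> real) \<Rightarrow> bool" where
 "dominated F G U V \<longleftrightarrow>
   (\<lambda>z. U (fst z) (snd z)) \<in> \<B> (L \<Otimes>\<^sub>M \<N> L) \<and>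
   (\<lambda>z. V (fst z) (snd z)) \<in> \<B> (L \<Otimes>\<^sub>M \<N> L) \<and>
   (\<forall>x m. 0 \<le> U x m) \<and> (\<forall>x m. 0 \<le> V x m) \<and>
   (\<integral>\<^sup>+x. (\<integral>\<^sup>+m. ennreal (U x m) \<partial>P) \<partial>L) < \<infinity> \<and> (\<integral>\<^sup>+x. (\<integral>\<^sup>+m. ennreal (V x m) \<partial>P) \<partial>L) < \<infinity> \<and>
   (\<forall>x\<in>space L. \<forall>m \<nu>. \<C> L m \<longrightarrow> \<C> L \<nu> \<longrightarrow>
    \<bar>\<D> x F m * \<D> x G \<nu>\<bar> \<le> U x m + V x \<nu>)"

lemma dominatedD:
 assumes "dominated F G U V"
 shows "(\<lambda>z. U (fst z) (snd z)) \<in> \<B> (L \<Otimes>\<^sub>M \<N> L)"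
  "(\<lambda>z. V (fst z) (snd z)) \<in> \<B> (L \<Otimes>\<^sub>M \<N> L)"
  "0 \<le> U x m" "0 \<le> V x m"
  "(\<integral>\<^sup>+x. (\<integral>\<^sup>+m. ennreal (U x m) \<partial>P) \<partial>L) < \<infinity>" "(\<integral>\<^sup>+x. (\<integral>\<^sup>+m. ennreal (V x m) \<partial>P) \<partial>L) < \<infinity>"
  "x \<in> space L \<Longrightarrow> \<C> L m \<Longrightarrow> \<C> L \<nu> \<Longrightarrow>
    \<bar>\<D> x F m * \<D> x G \<nu>\<bar> \<le> U x m + V x \<nu>"
  "x \<in> space L \<Longrightarrow> U x \<in> \<F> L"
  "x \<in> space L \<Longrightarrow> V x \<in> \<F> L"
proof -
 note a = assms[unfolded dominated_def]
 show 1: "(\<lambda>z. U (fst z) (snd z)) \<in> \<B> (L \<Otimes>\<^sub>M \<N> L)"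
  and 2: "(\<lambda>z. V (fst z) (snd z)) \<in> \<B> (L \<Otimes>\<^sub>M \<N> L)" using a by auto
 show "x \<in> space L \<Longrightarrow> U x \<in> \<F> L"
  using m_comp[OF measurable_Pair1' 1, of x] by simp
 show "x \<in> space L \<Longrightarrow> V x \<in> \<F> L"
  using m_comp[OF measurable_Pair1' 2, of x] by simp
qed (use assms in \<open>auto simp: dominated_def\<close>)

lemma measurable_cov_integrand:
 assumes F: "F \<in> \<F> L" and G: "G \<in> \<F> L"
 shows "(\<lambda>z. \<Gamma> F G z) \<in> \<B> \<L>"
 by (intro borel_measurable_times measurable_add_one_cost[OF F] measurable_add_one_cost[OF G] measurable_fst
  m_comp[OF measurable_snd \<alpha>] m_comp[OF measurable_snd \<beta>])

lemma coupling_bound: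
 assumes d: "dominated F G U V" and K: "prob_space K" "sets K = sets (\<N> (mark_space L))"
  and marg: "\<And>f. f \<in> \<F> L \<Longrightarrow> (\<integral>\<^sup>+m. f (\<alpha> m) \<partial>K) = (\<integral>\<^sup>+m. f m \<partial>P)"
   "\<And>f. f \<in> \<F> L \<Longrightarrow> (\<integral>\<^sup>+m. f (\<beta> m) \<partial>K) = (\<integral>\<^sup>+m. f m \<partial>P)"
 shows "(\<integral>\<^sup>+x. (\<integral>\<^sup>+m. ennreal \<bar>\<D> x F (\<alpha> m) * \<D> x G (\<beta> m)\<bar> \<partial>K) \<partial>L)
  \<le> (\<integral>\<^sup>+x. (\<integral>\<^sup>+m. ennreal (U x m) \<partial>P) \<partial>L) + (\<integral>\<^sup>+x. (\<integral>\<^sup>+m. ennreal (V x m) \<partial>P) \<partial>L)"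
proof -
 have spK: "space K = {m. \<C> (mark_space L) m}" using sets_eq_imp_space_eq[OF K(2)] by simp
 have pm: "proj L S \<in> K \<rightarrow>\<^sub>M \<N> L" for S
  using measurable_proj by (simp cong: measurable_cong_sets add: K(2))
 have "(\<integral>\<^sup>+m. ennreal \<bar>\<D> x F (\<alpha> m) * \<D> x G (\<beta> m)\<bar> \<partial>K) \<le> (\<integral>\<^sup>+m. ennreal (U x m) \<partial>P) + (\<integral>\<^sup>+m. ennreal (V x m) \<partial>P)"
  if x: "x \<in> space L" for x
 proof -
  note UV [measurable] = dominatedD(8,9)[OF d x] and [measurable] = pm
  have "(\<integral>\<^sup>+m. ennreal \<bar>\<D> x F (\<alpha> m) * \<D> x G (\<beta> m)\<bar> \<partial>K) \<le> (\<integral>\<^sup>+m. ennreal (U x (\<alpha> m)) + ennreal (V x (\<beta> m)) \<partial>K)"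
  proof (rule nn_integral_mono)
   fix m assume "m \<in> space K"
   then have "\<C> L (\<alpha> m)" "\<C> L (\<beta> m)" by (auto simp: spK intro: counting_measure_proj)
   from dominatedD(7)[OF d x this]
   show "ennreal \<bar>\<D> x F (\<alpha> m) * \<D> x G (\<beta> m)\<bar> \<le> ennreal (U x (\<alpha> m)) + ennreal (V x (\<beta> m))"
    using dominatedD(3,4)[OF d] by (simp add: ennreal_plus[symmetric] del: ennreal_plus)
  qed
  also have "\<dots> = (\<integral>\<^sup>+m. ennreal (U x (\<alpha> m)) \<partial>K) + (\<integral>\<^sup>+m. ennreal (V x (\<beta> m)) \<partial>K)"
   by (rule nn_integral_add) measurable
  finally show ?thesis using marg(1)[of "\<lambda>m. ennreal (U x m)"] marg(2)[of "\<lambda>m. ennreal (V x m)"] UV by simp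
 qed
 then have "(\<integral>\<^sup>+x. (\<integral>\<^sup>+m. ennreal \<bar>\<D> x F (\<alpha> m) * \<D> x G (\<beta> m)\<bar> \<partial>K) \<partial>L)
  \<le> (\<integral>\<^sup>+x. (\<integral>\<^sup>+m. ennreal (U x m) \<partial>P) + (\<integral>\<^sup>+m. ennreal (V x m) \<partial>P) \<partial>L)"
  by (intro nn_integral_mono)
 also have "\<dots> = (\<integral>\<^sup>+x. (\<integral>\<^sup>+m. ennreal (U x m) \<partial>P) \<partial>L) + (\<integral>\<^sup>+x. (\<integral>\<^sup>+m. ennreal (V x m) \<partial>P) \<partial>L)"
  by (intro nn_integral_add P.borel_measurable_nn_integral; use dominatedD(1,2)[OF d] in \<open>simp add: case_prod_beta' cong: measurable_cong_sets\<close>)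
 finally show ?thesis .
qed

lemma cov_nn_bound:
 assumes F: "F \<in> \<F> L" and G: "G \<in> \<F> L"
  and d: "dominated F G U V"
 shows "(\<integral>\<^sup>+z. ennreal (norm (\<Gamma> F G z)) \<partial>\<L>)
  \<le> (\<integral>\<^sup>+x. (\<integral>\<^sup>+m. ennreal (U x m) \<partial>P) \<partial>L) + (\<integral>\<^sup>+x. (\<integral>\<^sup>+m. ennreal (V x m) \<partial>P) \<partial>L)"
proof -
 have m: "(\<lambda>z. ennreal (norm (\<Gamma> F G z))) \<in> \<B> \<L>"
  by (rule m_comp[OF m_comp[OF measurable_cov_integrand[OF F G] borel_measurable_norm] measurable_ennreal])
 show ?thesis
  unfolding Q.nn_integral_fst[OF m, symmetric]
  by (simp only: fst_conv snd_conv real_norm_def) (rule coupling_bound[OF d Q.prob_space_axioms setsQ mix_marginal])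
qed

lemma cov_integrable:
 assumes F: "F \<in> \<F> L" and G: "G \<in> \<F> L"
  and d: "dominated F G U V"
 shows "integrable \<L> (\<lambda>z. \<Gamma> F G z)"
 using order_le_less_trans[OF cov_nn_bound[OF F G d]] dominatedD(5,6)[OF d]
 by (intro integrableI_bounded[OF measurable_cov_integrand[OF F G]]) simp

text \<open>The second argument is resampled outside \<open>X n\<close>, the restricted formula is
  applied for each frozen copy, and Fubini integrates over the copy. As \<open>n\<close> grows, the
  left side converges by \<open>hyb_converges\<close>, the right side first for fixed
  \<open>x\<close> and then by domination in \<open>x\<close>.\<close>

lemma covariance_formula_bounded:
 assumes F: "bdd F B" and G: "bdd G B'" and d: "dominated F G U V"
 shows "(\<integral>m. F m * G m \<partial>P) - (\<integral>m. F m \<partial>P) * (\<integral>m. G m \<partial>P) =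
  (\<integral>z. \<Gamma> F G z \<partial>\<L>)"
proof -
 note Fm = bddD(1)[OF F] and Gm = bddD(1)[OF G]
 have fstP: "fst \<in> \<P> \<rightarrow>\<^sub>M \<N> L" by (simp cong: measurable_cong_sets add: setsP measurable_fst)
 have sndP: "snd \<in> N \<Otimes>\<^sub>M P \<rightarrow>\<^sub>M \<N> L" for N :: "'b measure"
  by (simp cong: measurable_cong_sets add: setsP measurable_snd)
 have null: "\<C> L (null_measure L)" by (simp add: counting_measure_def)
 have B0: "0 \<le> B" "0 \<le> B'" using bddD(2)[OF F null] bddD(2)[OF G null] by linarith+
 define H where "H n x y = indicator (X n) x * (\<D> x F (\<alpha> (fst y)) * \<D> x G (hyb n (\<beta> (fst y)) (snd y)))"
  for n x and y :: "('a \<times> bool \<times> bool) measure \<times> 'a measure"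
 define k where "k n x = (\<integral>y. H n x y \<partial>\<Q>)" for n x
 define k' where "k' x = (\<integral>m. \<D> x F (\<alpha> m) * \<D> x G (\<beta> m) \<partial>mix L)" for x
 have Hm: "(\<lambda>z. H n (fst (fst z)) (snd (fst z), snd z)) \<in> \<B> (\<L> \<Otimes>\<^sub>M P)" for n
  unfolding H_def fst_conv snd_conv
 proof (intro borel_measurable_times measurable_add_one_cost[OF Fm] measurable_add_one_cost[OF Gm] measurable_hyb sndP)
  show "(\<lambda>z. \<alpha> (snd (fst z))) \<in> \<L> \<Otimes>\<^sub>M P \<rightarrow>\<^sub>M \<N> L"
   "(\<lambda>z. \<beta> (snd (fst z))) \<in> \<L> \<Otimes>\<^sub>M P \<rightarrow>\<^sub>M \<N> L"
   by (intro m_comp[OF m_comp[OF measurable_fst measurable_snd] \<alpha>]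
    m_comp[OF m_comp[OF measurable_fst measurable_snd] \<beta>])+
  show "(\<lambda>z. indicator (X n) (fst (fst z)) :: real) \<in> \<B> (\<L> \<Otimes>\<^sub>M P)"
   using X(1) by measurable
 qed measurable
 have Hmx: "H n x \<in> \<B> \<Q>" if "x \<in> space L" for n x
  unfolding H_def using that
  by (intro borel_measurable_times measurable_add_one_cost[OF Fm] measurable_add_one_cost[OF Gm] measurable_hyb sndP
   m_comp[OF measurable_fst \<alpha>] m_comp[OF measurable_fst \<beta>]) auto
 have Hb: "\<bar>H n x y\<bar> \<le> 4 * B * B' * indicator (X n) x" if "y \<in> space \<Q>" for n x y
 proof -
  have "\<C> L (\<alpha> (fst y))" "\<C> L (hyb n (\<beta> (fst y)) (snd y))"
   using that by (auto simp: space_pair_measure intro!: counting_measure_proj counting_measure_hyb)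
  then have "\<bar>\<D> x F (\<alpha> (fst y)) * \<D> x G (hyb n (\<beta> (fst y)) (snd y))\<bar> \<le> (2 * B) * (2 * B')"
   unfolding abs_mult using F G B0 by (intro mult_mono abs_add_one_cost_le[of L]) (auto simp: bdd_def)
  then show ?thesis by (auto simp: H_def indicator_def)
 qed
 have Hi: "integrable \<Q> (H n x)" if "x \<in> space L" for n x
 proof (rule QP.integrable_const_bound[where B="4 * B * B'"])
  have le: "4 * B * B' * indicator (X n) x \<le> 4 * B * B'" using B0 by (auto simp: indicator_def)
  show "AE y in \<Q>. norm (H n x y) \<le> 4 * B * B'"
  proof (rule AE_I2)
   fix y assume y: "y \<in> space \<Q>"
   show "norm (H n x y) \<le> 4 * B * B'" using order_trans[OF Hb[OF y] le] by simp
  qed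
 qed (rule Hmx[OF that])
 have Hint: "integrable (\<L> \<Otimes>\<^sub>M P) (\<lambda>z. H n (fst (fst z)) (snd (fst z), snd z))" for n
 proof (rule B_integrable_bound[OF _ Hm])
  show "integrable (\<L> \<Otimes>\<^sub>M P) (\<lambda>z. 4 * B * B' * indicator (X n) (fst (fst z)))"
   by (rule LQP.Fubini_integrable) (use X(1) integrable_indicator_X[of "4 * B * B'" n] B0 in \<open>auto simp: P.prob_space simp del: spaceP\<close>)
  show "AE z in \<L> \<Otimes>\<^sub>M P. norm (H n (fst (fst z)) (snd (fst z), snd z)) \<le> norm (4 * B * B' * indicator (X n) (fst (fst z)))"
   using Hb B0 by (intro AE_I2) (auto simp: space_pair_measure abs_mult)
 qed
 have sym: "(\<integral>\<nu>. (\<integral>z. H n (fst z) (snd z, \<nu>) \<partial>\<L>) \<partial>P) = (\<integral>x. k n x \<partial>L)" for n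
 proof -
  have "(\<integral>\<nu>. (\<integral>z. H n (fst z) (snd z, \<nu>) \<partial>\<L>) \<partial>P) = (\<integral>z. H n (fst (fst z)) (snd (fst z), snd z) \<partial>(\<L> \<Otimes>\<^sub>M P))"
   using LQP.integral_snd[of "\<lambda>z \<nu>. H n (fst z) (snd z, \<nu>)"] Hint[of n] by (simp add: case_prod_beta')
  also have "\<dots> = (\<integral>z. (\<integral>\<nu>. H n (fst z) (snd z, \<nu>) \<partial>P) \<partial>\<L>)"
   using LQP.integral_fst'[OF Hint[of n]] by simp
  also have "\<dots> = (\<integral>x. (\<integral>m. (\<integral>\<nu>. H n x (m, \<nu>) \<partial>P) \<partial>mix L) \<partial>L)"
   using LQ.integral_fst'[OF LQP.integrable_fst'[OF Hint[of n]]] by simp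
  also have "\<dots> = (\<integral>x. k n x \<partial>L)"
   unfolding k_def using QP.integral_fst'[OF Hi] by (intro B_integral_cong) auto
  finally show ?thesis .
 qed
 have Ghm: "(\<lambda>z. G (\<H> n z)) \<in> \<B> \<P>" for n by (rule m_comp[OF measurable_hyb_PP Gm])
 have Gh: "\<bar>G (hyb n m \<nu>)\<bar> \<le> B'" if "\<C> L m" "\<C> L \<nu>" for n m \<nu>
  using that by (intro bddD(2)[OF G] counting_measure_hyb)
 have i1: "integrable \<P> (\<lambda>z. F (fst z) * G (\<H> n z))" for n
 proof (rule PP.integrable_const_bound[where B="B * B'"])
  show "AE z in \<P>. norm (F (fst z) * G (\<H> n z)) \<le> B * B'"
   using Gh bddD(2)[OF F] B0 by (intro AE_I2) (auto simp: space_pair_measure abs_mult intro!: mult_mono)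
 qed (intro borel_measurable_times m_comp[OF fstP Fm] Ghm)
 have A: "(\<integral>z. F (fst z) * G (\<H> n z) \<partial>\<P>) - (\<integral>m. F m \<partial>P) * (\<integral>m. G m \<partial>P) = (\<integral>x. k n x \<partial>L)" for n
 proof -
  have i2: "integrable \<P> (\<lambda>z. G (\<H> n z))"
   using Gh Ghm by (intro PP.integrable_const_bound[where B=B'] AE_I2) (auto simp: space_pair_measure)
  have EG: "(\<integral>z. G (\<H> n z) \<partial>\<P>) = (\<integral>m. G m \<partial>P)"
   using integral_distr[OF measurable_hyb_PP Gm, of n] by (simp add: distr_hyb)
  have e: "(\<integral>m. F m * G (hyb n m \<nu>) \<partial>P) - (\<integral>m. F m \<partial>P) * (\<integral>m. G (hyb n m \<nu>) \<partial>P) = (\<integral>z. H n (fst z) (snd z, \<nu>) \<partial>\<L>)"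
   if \<nu>: "\<C> L \<nu>" for \<nu>
  proof -
   \<comment> \<open>Precomposed with the restriction to \<open>X n\<close>, this is
     \<open>G\<close> at the hybrid, so the restricted formula for \<open>G'\<close> speaks about
     \<open>G\<close>.\<close>
   define G' where "G' m = G (add_meas m (restr (space L - X n) \<nu>))" for m
   have r: "\<C> L (restr (space L - X n) \<nu>)" using \<nu> X(1) by (intro counting_measure_restr) auto
   have "(\<lambda>m. add_meas m (restr (space L - X n) \<nu>)) \<in> \<N> L \<rightarrow>\<^sub>M \<N> L"
    using m_comp[OF measurable_Pair[OF measurable_ident measurable_const] measurable_add_meas, of "restr (space L - X n) \<nu>"] r by simp
   from m_comp[OF this Gm] have G': "bdd G' B'"
    unfolding bdd_def G'_def using counting_measure_add_meas[OF _ r] bddD(2)[OF G] by auto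
   have "J n F G' = (\<integral>z. H n (fst z) (snd z, \<nu>) \<partial>\<L>)"
    unfolding J_def
   proof (rule B_integral_cong[OF refl])
    fix z assume z: "z \<in> space \<L>"
    have "sets (restr (space L - X n) \<nu>) = sets (restr (X n) (\<beta> (snd z)))" using \<nu> by (simp add: counting_measure_sets)
    then show "indicator (X n) (fst z) * (\<D> (fst z) F (\<alpha> (snd z)) * \<D> (fst z) G' (restr (X n) (\<beta> (snd z)))) = H n (fst z) (snd z, \<nu>)"
     using X(1) by (auto simp: H_def add_one_cost_def G'_def hyb_def add_meas_add_dirac restr_add_dirac indicator_def)
   qed
   moreover have "G' (restr (X n) m) = G (hyb n m \<nu>)" for m by (simp add: G'_def hyb_def)
   ultimately show ?thesis using restricted_covariance[OF F G', of n] by simp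
  qed
  have "(\<integral>x. k n x \<partial>L) = (\<integral>\<nu>. (\<integral>m. F m * G (hyb n m \<nu>) \<partial>P) - (\<integral>m. F m \<partial>P) * (\<integral>m. G (hyb n m \<nu>) \<partial>P) \<partial>P)"
   unfolding sym[symmetric] by (intro B_integral_cong) (auto simp: e)
  also have "\<dots> = (\<integral>\<nu>. (\<integral>m. F m * G (hyb n m \<nu>) \<partial>P) \<partial>P) - (\<integral>m. F m \<partial>P) * (\<integral>\<nu>. (\<integral>m. G (hyb n m \<nu>) \<partial>P) \<partial>P)"
   using PP.integrable_snd[of "\<lambda>m \<nu>. F m * G (hyb n m \<nu>)"] PP.integrable_snd[of "\<lambda>m \<nu>. G (hyb n m \<nu>)"] i1 i2
   by (subst B_integral_diff) (auto simp: case_prod_beta')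
  also have "(\<integral>\<nu>. (\<integral>m. F m * G (hyb n m \<nu>) \<partial>P) \<partial>P) = (\<integral>z. F (fst z) * G (\<H> n z) \<partial>\<P>)"
   using PP.integral_snd[of "\<lambda>m \<nu>. F m * G (hyb n m \<nu>)"] i1 by (simp add: case_prod_beta')
  also have "(\<integral>\<nu>. (\<integral>m. G (hyb n m \<nu>) \<partial>P) \<partial>P) = (\<integral>m. G m \<partial>P)"
   using PP.integral_snd[of "\<lambda>m \<nu>. G (hyb n m \<nu>)"] i2 EG by (simp add: case_prod_beta')
  finally show ?thesis by simp
 qed
 have abs_le: "ennreal \<bar>\<integral>y. u y \<partial>N\<bar> \<le> (\<integral>\<^sup>+y. ennreal \<bar>u y\<bar> \<partial>N)" for u :: "'c \<Rightarrow> real" and N :: "'c measure"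
  using integral_norm_bound_ennreal[of N u] not_integrable_integral_eq[of N u] by (cases "integrable N u") auto
 have zeroD: "(\<lambda>n. a n) \<longlonglongrightarrow> l" if "\<And>n. ennreal \<bar>a n - l\<bar> \<le> e n" "e \<longlonglongrightarrow> 0" for a :: "nat \<Rightarrow> real" and l e
 proof -
  have "(\<lambda>n. ennreal \<bar>a n - l\<bar>) \<longlonglongrightarrow> ennreal 0"
   using tendsto_sandwich[OF _ _ tendsto_const that(2), of "\<lambda>n. ennreal \<bar>a n - l\<bar>"] that(1) by auto
  then have "(\<lambda>n. \<bar>a n - l\<bar>) \<longlonglongrightarrow> 0" by (rule tendsto_ennrealD) auto
  then show ?thesis by (simp add: LIM_zero_iff tendsto_rabs_zero_iff)
 qed
 have limL: "(\<lambda>n. \<integral>z. F (fst z) * G (\<H> n z) \<partial>\<P>) \<longlonglongrightarrow> (\<integral>m. F m * G m \<partial>P)"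
 proof (rule zeroD)
  let ?e = "\<lambda>n. \<integral>\<^sup>+z. ennreal \<bar>G (\<H> n z) - G (fst z)\<bar> \<partial>\<P>"
  show "(\<lambda>n. ennreal B * ?e n) \<longlonglongrightarrow> 0"
   using ennreal_tendsto_cmult[OF _ hyb_converges[OF G], of "ennreal B"] by simp
  fix n
  have i0: "integrable \<P> (\<lambda>z. F (fst z) * G (fst z))"
  proof (rule PP.integrable_const_bound[where B="B * B'"])
   show "AE z in \<P>. norm (F (fst z) * G (fst z)) \<le> B * B'"
    using bddD(2)[OF G] bddD(2)[OF F] B0 by (intro AE_I2) (auto simp: space_pair_measure abs_mult intro!: mult_mono)
  qed (intro borel_measurable_times m_comp[OF fstP Fm] m_comp[OF fstP Gm])
  have "(\<integral>m. F m * G m \<partial>P) = (\<integral>z. F (fst z) * G (fst z) \<partial>\<P>)"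
   by (subst PP.integral_fst'[OF i0, symmetric]) (simp add: P.prob_space del: spaceP)
  then have "(\<integral>z. F (fst z) * G (\<H> n z) \<partial>\<P>) - (\<integral>m. F m * G m \<partial>P) =
   (\<integral>z. F (fst z) * (G (\<H> n z) - G (fst z)) \<partial>\<P>)"
   using B_integral_diff[OF i1 i0] by (simp add: algebra_simps)
  then have "ennreal \<bar>(\<integral>z. F (fst z) * G (\<H> n z) \<partial>\<P>) - (\<integral>m. F m * G m \<partial>P)\<bar>
   \<le> (\<integral>\<^sup>+z. ennreal \<bar>F (fst z) * (G (\<H> n z) - G (fst z))\<bar> \<partial>\<P>)"
   using abs_le by simp
  also have "\<dots> \<le> (\<integral>\<^sup>+z. ennreal B * ennreal \<bar>G (\<H> n z) - G (fst z)\<bar> \<partial>\<P>)"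
   using bddD(2)[OF F] B0 by (intro nn_integral_mono) (auto simp: space_pair_measure abs_mult ennreal_mult[symmetric] intro!: ennreal_leI mult_right_mono)
  also have "\<dots> = ennreal B * ?e n" using hyb_measurable_diff[OF Gm, of n] by (intro nn_integral_cmult) auto
  finally show "ennreal \<bar>(\<integral>z. F (fst z) * G (\<H> n z) \<partial>\<P>) - (\<integral>m. F m * G m \<partial>P)\<bar> \<le> ennreal B * ?e n" .
 qed
 have limk: "(\<lambda>n. k n x) \<longlonglongrightarrow> k' x" if x: "x \<in> space L" for x
 proof -
  \<comment> \<open>From the index \<open>n0\<close> on the indicator in \<open>H\<close> equals 1
    at \<open>x\<close>, so the difference is only that of \<phi> at the hybrid and at the original
    configuration.\<close>
  obtain n0 where n0: "x \<in> X n0" using x X(3) by auto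
  have xn: "x \<in> X n" if "n \<ge> n0" for n using n0 that X(2) by (auto simp: incseq_def)
  define \<phi> where "\<phi> = \<D> x G"
  have \<phi>: "bdd \<phi> (2 * B')"
   unfolding bdd_def \<phi>_def using abs_add_one_cost_le[of L G B'] bddD(2)[OF G] measurable_add_one_cost[OF Gm _ measurable_ident, of "\<lambda>_. x"] x
   by (auto simp: measurable_ident_sets)
  let ?e = "\<lambda>n. \<integral>\<^sup>+z. ennreal \<bar>\<phi> (\<H> n z) - \<phi> (fst z)\<bar> \<partial>\<P>"
  have "(\<lambda>n. k (n + n0) x) \<longlonglongrightarrow> k' x"
  proof (rule zeroD)
   show "(\<lambda>n. ennreal (2 * B) * ?e (n + n0)) \<longlonglongrightarrow> 0"
    using LIMSEQ_ignore_initial_segment[OF ennreal_tendsto_cmult[OF _ hyb_converges[OF \<phi>], of "ennreal (2 * B)"], of n0] by simp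
   fix m
   define n where "n = m + n0"
   let ?g = "\<lambda>y. \<D> x F (\<alpha> (fst y)) * \<D> x G (\<beta> (fst y))"
   have gm: "(\<lambda>m. \<D> x F (\<alpha> m) * \<D> x G (\<beta> m)) \<in> \<B> (mix L)"
    using x by (intro borel_measurable_times measurable_add_one_cost[OF Fm _ \<alpha>] measurable_add_one_cost[OF Gm _ \<beta>]) auto
   have gi: "integrable \<Q> ?g"
   proof (rule QP.integrable_const_bound[where B="(2 * B) * (2 * B')"])
    show "AE y in \<Q>. norm (?g y) \<le> (2 * B) * (2 * B')"
    proof (rule AE_I2)
     fix y assume "y \<in> space \<Q>"
     then have "\<C> L (\<alpha> (fst y))" "\<C> L (\<beta> (fst y))"
      by (auto simp: space_pair_measure intro!: counting_measure_proj)
     then show "norm (?g y) \<le> (2 * B) * (2 * B')"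
      unfolding real_norm_def abs_mult using F G B0 by (intro mult_mono abs_add_one_cost_le[of L]) (auto simp: bdd_def)
    qed
   qed (rule m_comp[OF measurable_fst gm])
   have "k' x = (\<integral>y. ?g y \<partial>\<Q>)"
    by (subst QP.integral_fst'[OF gi, symmetric]) (simp add: P.prob_space k'_def del: spaceP)
   then have "k n x - k' x = (\<integral>y. H n x y - ?g y \<partial>\<Q>)"
    unfolding k_def using B_integral_diff[OF Hi[OF x] gi] by simp
   then have "ennreal \<bar>k n x - k' x\<bar> \<le> (\<integral>\<^sup>+y. ennreal \<bar>H n x y - ?g y\<bar> \<partial>\<Q>)"
    using abs_le by simp
   also have "\<dots> \<le> (\<integral>\<^sup>+y. ennreal (2 * B) * ennreal \<bar>\<phi> (hyb n (\<beta> (fst y)) (snd y)) - \<phi> (\<beta> (fst y))\<bar> \<partial>\<Q>)"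
   proof (rule nn_integral_mono)
    fix y assume "y \<in> space \<Q>"
    then have "\<bar>\<D> x F (\<alpha> (fst y))\<bar> \<le> 2 * B"
     using F by (intro abs_add_one_cost_le[of L]) (auto simp: bdd_def space_pair_measure counting_measure_proj)
    moreover have "H n x y - ?g y = \<D> x F (\<alpha> (fst y)) * (\<phi> (hyb n (\<beta> (fst y)) (snd y)) - \<phi> (\<beta> (fst y)))"
     using xn[of n] by (simp add: H_def \<phi>_def n_def algebra_simps)
    ultimately show "ennreal \<bar>H n x y - ?g y\<bar> \<le> ennreal (2 * B) * ennreal \<bar>\<phi> (hyb n (\<beta> (fst y)) (snd y)) - \<phi> (\<beta> (fst y))\<bar>"
     using B0 by (simp add: abs_mult ennreal_mult[symmetric] mult_right_mono)
   qed
   also have "\<dots> = (\<integral>\<^sup>+z. ennreal (2 * B) * ennreal \<bar>\<phi> (\<H> n z) - \<phi> (fst z)\<bar> \<partial>\<P>)"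
   proof -
    have "(\<lambda>z. ennreal (2 * B) * ennreal \<bar>\<phi> (\<H> n z) - \<phi> (fst z)\<bar>) \<in> \<B> (\<N> L \<Otimes>\<^sub>M \<N> L)"
     using hyb_measurable_diff[OF bddD(1)[OF \<phi>], of n] by (simp cong: measurable_cong_sets add: setsP)
    from nn_integral_\<beta>_pair[OF this] show ?thesis by simp
   qed
   also have "\<dots> = ennreal (2 * B) * ?e n"
    using hyb_measurable_diff[OF bddD(1)[OF \<phi>], of n] by (intro nn_integral_cmult) auto
   finally show "ennreal \<bar>k (m + n0) x - k' x\<bar> \<le> ennreal (2 * B) * ?e (m + n0)" by (simp add: n_def)
  qed
  then show ?thesis by (rule LIMSEQ_offset)
 qed
 define u where "u x = (\<integral>\<^sup>+m. ennreal (U x m) \<partial>P)" for x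
 define v where "v x = (\<integral>\<^sup>+m. ennreal (V x m) \<partial>P)" for x
 have um: "u \<in> \<B> L" "v \<in> \<B> L"
  unfolding u_def v_def
  by (intro P.borel_measurable_nn_integral; use dominatedD(1,2)[OF d] in \<open>simp add: case_prod_beta' cong: measurable_cong_sets\<close>)+
 have fin: "AE x in L. u x \<noteq> \<infinity>" "AE x in L. v x \<noteq> \<infinity>"
 proof -
  have "integral\<^sup>N L u < \<infinity>" "integral\<^sup>N L v < \<infinity>" using dominatedD(5,6)[OF d] by (simp_all add: u_def[abs_def] v_def[abs_def])
  then show "AE x in L. u x \<noteq> \<infinity>" "AE x in L. v x \<noteq> \<infinity>"
   using nn_integral_noteq_infinite[OF um(1)] nn_integral_noteq_infinite[OF um(2)] by auto
 qed
 \<comment> \<open>The majorant does not depend on \<open>n\<close> because the hybrid has law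
   \<open>P\<close>; it is integrable in \<open>x\<close> by the domination hypothesis.\<close>
 have kb: "ennreal \<bar>k n x\<bar> \<le> u x + v x" if x: "x \<in> space L" for n x
 proof -
  have m1: "(\<lambda>y. ennreal (U x (\<alpha> (fst y)))) \<in> \<B> \<Q>"
   by (rule m_comp[OF m_comp[OF m_comp[OF measurable_fst \<alpha>] dominatedD(8)[OF d x]] measurable_ennreal])
  have vm: "(\<lambda>z. ennreal (V x (\<H> n z))) \<in> \<B> (\<N> L \<Otimes>\<^sub>M \<N> L)"
   using m_comp[OF measurable_hyb_PP dominatedD(9)[OF d x], of n] by (simp cong: measurable_cong_sets add: setsP)
  have m2: "(\<lambda>y. ennreal (V x (hyb n (\<beta> (fst y)) (snd y)))) \<in> \<B> \<Q>"
   using m_comp[OF measurable_hyb[OF m_comp[OF measurable_fst \<beta>] sndP] dominatedD(9)[OF d x], of n] by simp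
  have "ennreal \<bar>k n x\<bar> \<le> (\<integral>\<^sup>+y. ennreal \<bar>H n x y\<bar> \<partial>\<Q>)" unfolding k_def by (rule abs_le)
  also have "\<dots> \<le> (\<integral>\<^sup>+y. ennreal (U x (\<alpha> (fst y))) + ennreal (V x (hyb n (\<beta> (fst y)) (snd y))) \<partial>\<Q>)"
  proof (rule nn_integral_mono)
   fix y assume "y \<in> space \<Q>"
   then have "\<bar>\<D> x F (\<alpha> (fst y)) * \<D> x G (hyb n (\<beta> (fst y)) (snd y))\<bar> \<le> U x (\<alpha> (fst y)) + V x (hyb n (\<beta> (fst y)) (snd y))"
    using x by (intro dominatedD(7)[OF d]) (auto simp: space_pair_measure intro!: counting_measure_proj counting_measure_hyb)
   then have "\<bar>H n x y\<bar> \<le> U x (\<alpha> (fst y)) + V x (hyb n (\<beta> (fst y)) (snd y))"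
    using dominatedD(3,4)[OF d] by (auto simp: H_def indicator_def)
   then show "ennreal \<bar>H n x y\<bar> \<le> ennreal (U x (\<alpha> (fst y))) + ennreal (V x (hyb n (\<beta> (fst y)) (snd y)))"
    using dominatedD(3,4)[OF d] by (simp add: ennreal_plus[symmetric] del: ennreal_plus)
  qed
  also have "\<dots> = (\<integral>\<^sup>+y. ennreal (U x (\<alpha> (fst y))) \<partial>\<Q>) + (\<integral>\<^sup>+y. ennreal (V x (hyb n (\<beta> (fst y)) (snd y))) \<partial>\<Q>)"
   using m1 m2 by (rule nn_integral_add)
  also have "(\<integral>\<^sup>+y. ennreal (U x (\<alpha> (fst y))) \<partial>\<Q>) = u x"
   using m1 dominatedD(8)[OF d x]
   by (subst P.nn_integral_fst[symmetric]) (auto simp: P.emeasure_space_1 u_def mix_marginal(1)[of "\<lambda>m. ennreal (U x m)"] simp del: spaceP)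
  also have "(\<integral>\<^sup>+y. ennreal (V x (hyb n (\<beta> (fst y)) (snd y))) \<partial>\<Q>) = v x"
   using nn_integral_\<beta>_pair[OF vm] nn_integral_hyb[of "\<lambda>m. ennreal (V x m)" n] dominatedD(9)[OF d x] by (simp add: v_def)
  finally show ?thesis .
 qed
 have km: "(\<lambda>x. k n x) \<in> \<B> L" for n
 proof -
  have "(\<lambda>x. (\<integral>m. (\<integral>\<nu>. H n x (m, \<nu>) \<partial>P) \<partial>mix L)) \<in> \<B> L"
   using LQ.integrable_fst'[OF LQP.integrable_fst'[OF Hint[of n]]] by auto
  then show ?thesis
   unfolding k_def by (rule measurable_cong[THEN iffD1, rotated]) (use QP.integral_fst'[OF Hi] in auto)
 qed
 have ci: "integrable \<L> (\<lambda>z. \<Gamma> F G z)"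
  by (rule cov_integrable[OF Fm Gm d])
 have "(\<lambda>n. \<integral>x. k n x \<partial>L) \<longlonglongrightarrow> (\<integral>x. k' x \<partial>L)"
 proof (rule integral_dominated_convergence[where w="\<lambda>x. enn2real (u x) + enn2real (v x)"])
  show "k' \<in> \<B> L" unfolding k'_def using LQ.integrable_fst'[OF ci] by auto
  show "integrable L (\<lambda>x. enn2real (u x) + enn2real (v x))"
  proof (intro B_integrable_add integrableI_bounded)
   have "(\<integral>\<^sup>+x. ennreal (norm (enn2real (u x))) \<partial>L) \<le> (\<integral>\<^sup>+x. u x \<partial>L)"
    by (intro nn_integral_mono) (simp add: ennreal_enn2real_if)
   also have "\<dots> < \<infinity>" using dominatedD(5)[OF d] by (simp add: u_def)
   finally show "(\<integral>\<^sup>+x. ennreal (norm (enn2real (u x))) \<partial>L) < \<infinity>" .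
   have "(\<integral>\<^sup>+x. ennreal (norm (enn2real (v x))) \<partial>L) \<le> (\<integral>\<^sup>+x. v x \<partial>L)"
    by (intro nn_integral_mono) (simp add: ennreal_enn2real_if)
   also have "\<dots> < \<infinity>" using dominatedD(6)[OF d] by (simp add: v_def)
   finally show "(\<integral>\<^sup>+x. ennreal (norm (enn2real (v x))) \<partial>L) < \<infinity>" .
  qed (use um in auto)
  show "AE x in L. (\<lambda>n. k n x) \<longlonglongrightarrow> k' x" using limk by (intro AE_I2)
  show "AE x in L. norm (k n x) \<le> enn2real (u x) + enn2real (v x)" for n
   using fin AE_space
  proof eventually_elim
   case (elim x)
   then have "u x = ennreal (enn2real (u x))" "v x = ennreal (enn2real (v x))" by (auto simp: less_top)
   then have "ennreal \<bar>k n x\<bar> \<le> ennreal (enn2real (u x) + enn2real (v x))"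
    using kb[OF elim(3), of n] by (simp add: ennreal_plus)
   then have "\<bar>k n x\<bar> \<le> enn2real (u x) + enn2real (v x)" by (subst (asm) ennreal_le_iff) auto
   then show ?case by simp
  qed
 qed (rule km)
 moreover have "(\<integral>x. k' x \<partial>L) = (\<integral>z. \<Gamma> F G z \<partial>\<L>)"
  unfolding k'_def using LQ.integral_fst'[OF ci] by simp
 moreover have "(\<lambda>n. \<integral>x. k n x \<partial>L) \<longlonglongrightarrow> (\<integral>m. F m * G m \<partial>P) - (\<integral>m. F m \<partial>P) * (\<integral>m. G m \<partial>P)"
  unfolding A[symmetric] by (intro tendsto_intros limL)
 ultimately show ?thesis by (simp add: LIMSEQ_unique)
qed

text \<open>Clipping to an interval is 1-Lipschitz, so it does not increase add-one costs and the
  clipped functionals are dominated by the same \<open>U\<close> and \<open>V\<close>. Dominated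
  convergence then removes the clipping from all integrals.\<close>

theorem covariance_formula:
 assumes F: "F \<in> \<F> L" "integrable P (\<lambda>m. (F m)\<^sup>2)"
  and G: "G \<in> \<F> L" "integrable P (\<lambda>m. (G m)\<^sup>2)"
  and d: "dominated F G U V"
 shows "(\<integral>m. F m * G m \<partial>P) - (\<integral>m. F m \<partial>P) * (\<integral>m. G m \<partial>P) =
  (\<integral>z. \<Gamma> F G z \<partial>\<L>)"
proof -
 define c where "c k t = max (- real k) (min (real k) t)" for k and t :: real
 have cb: "\<bar>c k t\<bar> \<le> real k" "\<bar>c k t\<bar> \<le> \<bar>t\<bar>" "\<bar>c k t - c k s\<bar> \<le> \<bar>t - s\<bar>" for k t s
  by (auto simp: c_def max_def min_def)
 have cl: "(\<lambda>k. c k t) \<longlonglongrightarrow> t" for t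
 proof (rule tendsto_eventually)
  show "\<forall>\<^sub>F k in sequentially. c k t = t"
  proof (rule eventually_sequentiallyI[of "nat \<lceil>\<bar>t\<bar>\<rceil>"])
   fix k assume "nat \<lceil>\<bar>t\<bar>\<rceil> \<le> k"
   then have "\<bar>t\<bar> \<le> real k" by linarith
   then show "c k t = t" by (auto simp: c_def max_def min_def)
  qed
 qed
 have cm: "c k \<in> \<B> borel" for k unfolding c_def[abs_def] by measurable
 have b: "bdd (\<lambda>m. c k (H m)) (real k)" if "H \<in> \<F> L" for k H
  using m_comp[OF that cm] cb(1) by (auto simp: bdd_def)
 have dk: "dominated (\<lambda>m. c k (F m)) (\<lambda>m. c k (G m)) U V" for k
 proof -
  have "\<bar>\<D> x (\<lambda>m. c k (F m)) m * \<D> x (\<lambda>m. c k (G m)) \<nu>\<bar> \<le> \<bar>\<D> x F m * \<D> x G \<nu>\<bar>" for x m \<nu>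
   unfolding abs_mult add_one_cost_def by (intro mult_mono cb(3)) auto
  then show ?thesis using d unfolding dominated_def by (meson order_trans)
 qed
 have e: "(\<integral>m. c k (F m) * c k (G m) \<partial>P) - (\<integral>m. c k (F m) \<partial>P) * (\<integral>m. c k (G m) \<partial>P) =
  (\<integral>z. \<D> (fst z) (\<lambda>m. c k (F m)) (\<alpha> (snd z)) * \<D> (fst z) (\<lambda>m. c k (G m)) (\<beta> (snd z)) \<partial>\<L>)" for k
  by (rule covariance_formula_bounded[OF b[OF F(1)] b[OF G(1)] dk])
 have Fm: "F \<in> \<B> P" and Gm: "G \<in> \<B> P" using F G by auto
 have i1: "integrable P F" using P.square_integrable_imp_integrable[OF Fm F(2)] .
 have i2: "integrable P G" using P.square_integrable_imp_integrable[OF Gm G(2)] .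
 have i12: "integrable P (\<lambda>m. F m * G m)"
 proof (rule B_integrable_bound[OF B_integrable_add[OF F(2) G(2)]])
  show "AE m in P. norm (F m * G m) \<le> norm ((F m)\<^sup>2 + (G m)\<^sup>2)"
  proof (rule AE_I2)
   fix m
   have "0 \<le> (\<bar>F m\<bar> - \<bar>G m\<bar>)\<^sup>2" by simp
   then have "2 * \<bar>F m\<bar> * \<bar>G m\<bar> \<le> (F m)\<^sup>2 + (G m)\<^sup>2" by (simp add: power2_diff)
   moreover have "0 \<le> \<bar>F m\<bar> * \<bar>G m\<bar>" by simp
   ultimately have "\<bar>F m\<bar> * \<bar>G m\<bar> \<le> (F m)\<^sup>2 + (G m)\<^sup>2" by linarith
   then show "norm (F m * G m) \<le> norm ((F m)\<^sup>2 + (G m)\<^sup>2)" by (simp add: abs_mult)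
  qed
 qed (use Fm Gm in measurable)
 have lim1: "(\<lambda>k. \<integral>m. c k (H m) \<partial>P) \<longlonglongrightarrow> (\<integral>m. H m \<partial>P)" if "integrable P H" for H
 proof (rule integral_dominated_convergence[where w="\<lambda>m. \<bar>H m\<bar>"])
  have "H \<in> \<F> L" using borel_measurable_integrable[OF that] by simp
  then show "(\<lambda>m. c k (H m)) \<in> \<B> P" for k by (simp add: m_comp[OF _ cm])
 qed (use that cl cb(2) in auto)
 have lim2: "(\<lambda>k. \<integral>m. c k (F m) * c k (G m) \<partial>P) \<longlonglongrightarrow> (\<integral>m. F m * G m \<partial>P)"
 proof (rule integral_dominated_convergence[where w="\<lambda>m. \<bar>F m * G m\<bar>"])
  show "AE m in P. norm (c k (F m) * c k (G m)) \<le> \<bar>F m * G m\<bar>" for k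
   using cb(2) by (auto simp: abs_mult intro!: AE_I2 mult_mono)
 qed (use Fm Gm i12 cl m_comp[OF Fm cm] m_comp[OF Gm cm] in \<open>auto intro!: tendsto_mult\<close>)
 have lim3: "(\<lambda>k. \<integral>z. \<D> (fst z) (\<lambda>m. c k (F m)) (\<alpha> (snd z)) * \<D> (fst z) (\<lambda>m. c k (G m)) (\<beta> (snd z)) \<partial>\<L>)
  \<longlonglongrightarrow> (\<integral>z. \<Gamma> F G z \<partial>\<L>)"
 proof (rule integral_dominated_convergence[where w="\<lambda>z. \<bar>\<Gamma> F G z\<bar>"])
  show "AE z in \<L>. norm (\<D> (fst z) (\<lambda>m. c k (F m)) (\<alpha> (snd z)) * \<D> (fst z) (\<lambda>m. c k (G m)) (\<beta> (snd z)))
    \<le> \<bar>\<Gamma> F G z\<bar>" for k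
   unfolding real_norm_def abs_mult add_one_cost_def by (intro AE_I2 mult_mono cb(3)) auto
  show "AE z in \<L>. (\<lambda>k. \<D> (fst z) (\<lambda>m. c k (F m)) (\<alpha> (snd z)) * \<D> (fst z) (\<lambda>m. c k (G m)) (\<beta> (snd z)))
    \<longlonglongrightarrow> \<Gamma> F G z"
   unfolding add_one_cost_def by (intro AE_I2 tendsto_intros cl)
 qed (use cov_integrable[OF F(1) G(1) d] measurable_cov_integrand[OF bddD(1)[OF b[OF F(1)]] bddD(1)[OF b[OF G(1)]]] measurable_cov_integrand[OF F(1) G(1)] in auto)
 have "(\<lambda>k. (\<integral>m. c k (F m) * c k (G m) \<partial>P) - (\<integral>m. c k (F m) \<partial>P) * (\<integral>m. c k (G m) \<partial>P))
  \<longlonglongrightarrow> (\<integral>m. F m * G m \<partial>P) - (\<integral>m. F m \<partial>P) * (\<integral>m. G m \<partial>P)"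
  by (intro tendsto_diff tendsto_mult lim1 lim2 i1 i2)
 then show ?thesis unfolding e by (rule LIMSEQ_unique[OF _ lim3])
qed

end

section \<open>Hoelder and Minkowski inequalities on \<open>[0, \<infinity>]\<close>\<close>

lemma epow_ennreal [simp]: "0 \<le> r \<Longrightarrow> epow (ennreal r) s = ennreal (r powr s)"
 by (simp add: epow_def)

lemma epow_top [simp]: "epow \<top> s = \<top>"
 by (simp add: epow_def)

lemma epow_0 [simp]: "epow 0 s = 0"
 by (simp add: epow_def)

lemma epow_one [simp]: "epow x 1 = x"
 by (cases x) auto

lemma epow_1 [simp]: "epow 1 s = 1"
 using epow_ennreal[of 1 s] by simp

lemma epow_mono: "0 \<le> s \<Longrightarrow> x \<le> y \<Longrightarrow> epow x s \<le> epow y s"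
 by (cases x; cases y) (auto simp: powr_mono2 top_unique)

lemma epow_mult: "epow (x * y) s = epow x s * epow y s"
proof (cases x; cases y)
 fix r assume "x = ennreal r" "0 \<le> r" "y = \<top>"
 then show ?thesis by (cases "r = 0") (auto simp: ennreal_mult_top)
next
 fix r assume "y = ennreal r" "0 \<le> r" "x = \<top>"
 then show ?thesis by (cases "r = 0") (auto simp: ennreal_top_mult)
qed (auto simp: ennreal_mult[symmetric] powr_mult)

lemma epow_epow: "epow (epow x s) r = epow x (s * r)"
 by (cases x) (auto simp: powr_powr)

lemma epow_add: "epow x (s + r) = epow x s * epow x r"
 by (cases x) (auto simp: powr_add ennreal_mult[symmetric])

lemma epow_eq_0_iff [simp]: "epow x s = 0 \<longleftrightarrow> x = 0"
 by (cases x) auto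

lemma epow_neq_top_iff [simp]: "epow x s = \<top> \<longleftrightarrow> x = \<top>"
 by (cases x) auto

lemma measurable_epow [measurable]: "(\<lambda>x. epow x s) \<in> \<B> borel"
 unfolding epow_def by measurable

lemma abs_moment_eq: "abs_moment M r Y = (\<integral>\<^sup>+u. epow (ennreal \<bar>Y u\<bar>) r \<partial>M)"
 by (simp add: abs_moment_def)

lemma epow_young:
 assumes "0 < a" "0 < b" "a + b = 1"
 shows "epow x a * epow y b \<le> ennreal a * x + ennreal b * y"
proof (cases x; cases y)
 fix r s assume *: "x = ennreal r" "0 \<le> r" "y = ennreal s" "0 \<le> s"
 have "r powr a * s powr b \<le> a * r + b * s"
 proof (cases "r = 0 \<or> s = 0")
  case False
  then show ?thesis using * assms by (intro Youngs_inequality_0) auto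
 qed (use * assms in auto)
 then show ?thesis using * assms by (simp add: ennreal_mult[symmetric] ennreal_plus[symmetric] del: ennreal_plus)
qed (use assms in \<open>auto simp: ennreal_mult_top ennreal_top_mult\<close>)

lemma holder_nn_integral:
 assumes [measurable]: "f \<in> \<B> M" "g \<in> \<B> M" and ab: "0 < a" "0 < b" "a + b = 1"
 shows "(\<integral>\<^sup>+x. epow (f x) a * epow (g x) b \<partial>M) \<le> epow (\<integral>\<^sup>+x. f x \<partial>M) a * epow (\<integral>\<^sup>+x. g x \<partial>M) b"
proof -
 let ?A = "\<integral>\<^sup>+x. f x \<partial>M" and ?B = "\<integral>\<^sup>+x. g x \<partial>M"
 consider "?A = 0 \<or> ?B = 0" | "?A \<noteq> 0" "?B \<noteq> 0" "?A = \<top> \<or> ?B = \<top>" | "?A \<noteq> 0" "?B \<noteq> 0" "?A \<noteq> \<top>" "?B \<noteq> \<top>" by blast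
 then show ?thesis
 proof cases
  case 1
  then have "AE x in M. f x = 0 \<or> g x = 0" by (auto simp: nn_integral_0_iff_AE elim: AE_mp)
  then have "(\<integral>\<^sup>+x. epow (f x) a * epow (g x) b \<partial>M) = 0" by (subst nn_integral_0_iff_AE) auto
  then show ?thesis by simp
 next
  case 2
  then have "epow ?A a * epow ?B b = \<top>" by (auto simp: ennreal_mult_eq_top_iff)
  then show ?thesis by (simp del: epow_neq_top_iff)
 next
  case 3
  then obtain A B where A: "?A = ennreal A" "0 < A" and B: "?B = ennreal B" "0 < B"
   by (metis ennreal_cases ennreal_neg less_eq_real_def ennreal_0)
  have scale: "epow u a * epow v b = ennreal (A powr a * B powr b) * (epow (ennreal (1 / A) * u) a * epow (ennreal (1 / B) * v) b)" for u v
  proof -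
   have "ennreal (A powr a * B powr b) * (epow (ennreal (1 / A) * u) a * epow (ennreal (1 / B) * v) b)
    = ennreal (A powr a * B powr b * ((1 / A) powr a * (1 / B) powr b)) * (epow u a * epow v b)"
    using A B by (simp add: epow_mult ennreal_mult mult_ac)
   also have "A powr a * B powr b * ((1 / A) powr a * (1 / B) powr b) = 1"
    using A B by (simp add: powr_divide)
   finally show ?thesis by simp
  qed
  have "(\<integral>\<^sup>+x. epow (f x) a * epow (g x) b \<partial>M)
   = ennreal (A powr a * B powr b) * (\<integral>\<^sup>+x. epow (ennreal (1 / A) * f x) a * epow (ennreal (1 / B) * g x) b \<partial>M)"
   by (subst nn_integral_cmult[symmetric]) (auto intro!: nn_integral_cong scale)
  also have "(\<integral>\<^sup>+x. epow (ennreal (1 / A) * f x) a * epow (ennreal (1 / B) * g x) b \<partial>M)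
   \<le> (\<integral>\<^sup>+x. ennreal a * (ennreal (1 / A) * f x) + ennreal b * (ennreal (1 / B) * g x) \<partial>M)"
   by (intro nn_integral_mono epow_young ab)
  also have "\<dots> = ennreal a * (ennreal (1 / A) * ?A) + ennreal b * (ennreal (1 / B) * ?B)"
   by (simp add: nn_integral_add nn_integral_cmult)
  also have "\<dots> = 1"
   using A B ab by (simp add: ennreal_mult[symmetric] ennreal_plus[symmetric] del: ennreal_plus)
  finally have "(\<integral>\<^sup>+x. epow (f x) a * epow (g x) b \<partial>M) \<le> ennreal (A powr a * B powr b) * 1" by (simp add: mult_left_mono)
  then show ?thesis using A B by (simp add: ennreal_mult)
 qed
qed

lemma moment_le_prob:
 assumes "prob_space M" "f \<in> \<B> M" "1 \<le> p"
 shows "(\<integral>\<^sup>+x. f x \<partial>M) \<le> epow (\<integral>\<^sup>+x. epow (f x) p \<partial>M) (1 / p)"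
proof (cases "p = 1")
 case False
 interpret prob_space M by fact
 note [measurable] = assms(2)
 have "(\<integral>\<^sup>+x. f x \<partial>M) = (\<integral>\<^sup>+x. epow (epow (f x) p) (1 / p) * epow 1 (1 - 1 / p) \<partial>M)"
  using assms(3) by (simp add: epow_epow)
 also have "\<dots> \<le> epow (\<integral>\<^sup>+x. epow (f x) p \<partial>M) (1 / p) * epow (\<integral>\<^sup>+x. 1 \<partial>M) (1 - 1 / p)"
  using False assms(3) by (intro holder_nn_integral) auto
 finally show ?thesis by (simp add: emeasure_space_1)
qed simp

text \<open>Writing \<open>S ^ p\<close> as \<open>S * S ^ (p - 1)\<close>, Fubini and Hoelder give
  \<open>T \<le> W * T powr (1 - 1/p)\<close>. Dividing by the power of \<open>T\<close> needs
  finiteness, so \<open>S\<close> is first cut off at \<open>k\<close>; the supremum over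
  \<open>k\<close> restores it.\<close>

lemma minkowski_nn_integral:
 assumes L: "sigma_finite_measure L" and Q: "prob_space Q"
  and g[measurable]: "(\<lambda>z. g (fst z) (snd z)) \<in> \<B> (L \<Otimes>\<^sub>M Q)" and p: "1 \<le> p"
 shows "(\<integral>\<^sup>+u. epow (\<integral>\<^sup>+x. g x u \<partial>L) p \<partial>Q) \<le> epow (\<integral>\<^sup>+x. epow (\<integral>\<^sup>+u. epow (g x u) p \<partial>Q) (1 / p) \<partial>L) p"
proof -
 interpret L: sigma_finite_measure L by fact
 interpret Q: prob_space Q by fact
 interpret pair_sigma_finite L Q ..
 have gm: "(\<lambda>(x, u). g x u) \<in> \<B> (L \<Otimes>\<^sub>M Q)" using g by (simp add: case_prod_beta')
 have swap: "(\<integral>\<^sup>+u. (\<integral>\<^sup>+x. h x u \<partial>L) \<partial>Q) = (\<integral>\<^sup>+x. (\<integral>\<^sup>+u. h x u \<partial>Q) \<partial>L)"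
  if "(\<lambda>(x, u). h x u) \<in> \<B> (L \<Otimes>\<^sub>M Q)" for h
  using Fubini[OF that] by simp
 show ?thesis
 proof (cases "p = 1")
  case True
  then show ?thesis using swap[OF gm] by simp
 next
  case False
  then have p1: "1 < p" using p by simp
  define S where "S u = (\<integral>\<^sup>+x. g x u \<partial>L)" for u
  define W where "W = (\<integral>\<^sup>+x. epow (\<integral>\<^sup>+u. epow (g x u) p \<partial>Q) (1 / p) \<partial>L)"
  have S[measurable]: "S \<in> \<B> Q"
   unfolding S_def using m_comp[OF measurable_pair_swap' g]
   by (intro L.borel_measurable_nn_integral) (simp add: case_prod_beta')
  define T where "T k = (\<integral>\<^sup>+u. epow (min (S u) (of_nat k)) p \<partial>Q)" for k :: nat
  have gx: "g x \<in> \<B> Q" if "x \<in> space L" for x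
   using m_comp[OF measurable_Pair1'[OF that] gm] by simp
  have Tle: "T k \<le> epow W p" for k
  proof -
   have "T k \<le> (\<integral>\<^sup>+u. S u * epow (min (S u) (of_nat k)) (p - 1) \<partial>Q)"
    unfolding T_def
   proof (rule nn_integral_mono)
    fix u
    have "epow (min (S u) (of_nat k)) p = min (S u) (of_nat k) * epow (min (S u) (of_nat k)) (p - 1)"
     using epow_add[of "min (S u) (of_nat k)" 1 "p - 1"] by simp
    also have "\<dots> \<le> S u * epow (min (S u) (of_nat k)) (p - 1)" by (intro mult_right_mono) auto
    finally show "epow (min (S u) (of_nat k)) p \<le> S u * epow (min (S u) (of_nat k)) (p - 1)" .
   qed
   also have "\<dots> = (\<integral>\<^sup>+u. (\<integral>\<^sup>+x. g x u * epow (min (S u) (of_nat k)) (p - 1) \<partial>L) \<partial>Q)"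
   proof (rule nn_integral_cong)
    fix u assume "u \<in> space Q"
    then have "(\<lambda>x. g x u) \<in> \<B> L" using m_comp[OF measurable_Pair2' gm] by simp
    then show "S u * epow (min (S u) (of_nat k)) (p - 1) = (\<integral>\<^sup>+x. g x u * epow (min (S u) (of_nat k)) (p - 1) \<partial>L)"
     unfolding S_def by (subst nn_integral_multc) auto
   qed
   also have "\<dots> = (\<integral>\<^sup>+x. (\<integral>\<^sup>+u. g x u * epow (min (S u) (of_nat k)) (p - 1) \<partial>Q) \<partial>L)"
    using g by (intro swap) (simp add: case_prod_beta')
   also have "\<dots> \<le> (\<integral>\<^sup>+x. epow (\<integral>\<^sup>+u. epow (g x u) p \<partial>Q) (1 / p) * epow (T k) (1 - 1 / p) \<partial>L)"
   proof (rule nn_integral_mono)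
    fix x assume x: "x \<in> space L"
    have "(\<integral>\<^sup>+u. g x u * epow (min (S u) (of_nat k)) (p - 1) \<partial>Q)
     = (\<integral>\<^sup>+u. epow (epow (g x u) p) (1 / p) * epow (epow (min (S u) (of_nat k)) p) (1 - 1 / p) \<partial>Q)"
     using p1 by (simp add: epow_epow algebra_simps)
    also have "\<dots> \<le> epow (\<integral>\<^sup>+u. epow (g x u) p \<partial>Q) (1 / p) * epow (T k) (1 - 1 / p)"
     unfolding T_def using p1 gx[OF x] by (intro holder_nn_integral) (auto simp: field_simps)
    finally show "(\<integral>\<^sup>+u. g x u * epow (min (S u) (of_nat k)) (p - 1) \<partial>Q) \<le> epow (\<integral>\<^sup>+u. epow (g x u) p \<partial>Q) (1 / p) * epow (T k) (1 - 1 / p)" .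
   qed
   also have "\<dots> = W * epow (T k) (1 - 1 / p)"
   proof -
    have "(\<lambda>x. epow (\<integral>\<^sup>+u. epow (g x u) p \<partial>Q) (1 / p)) \<in> \<B> L"
    proof (intro m_comp[OF _ measurable_epow] Q.borel_measurable_nn_integral)
     show "(\<lambda>(x, u). epow (g x u) p) \<in> \<B> (L \<Otimes>\<^sub>M Q)"
      using m_comp[OF g measurable_epow] by (simp add: case_prod_beta')
    qed
    then show ?thesis unfolding W_def by (intro nn_integral_multc) auto
   qed
   finally have le: "T k \<le> W * epow (T k) (1 - 1 / p)" .
   have "T k \<le> (\<integral>\<^sup>+u. epow (of_nat k) p \<partial>Q)" unfolding T_def using p by (intro nn_integral_mono epow_mono) auto
   also have "\<dots> < \<top>" by (simp add: Q.emeasure_space_1 ennreal_of_nat_eq_real_of_nat)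
   finally obtain r where r: "T k = ennreal r" "0 \<le> r" by (cases "T k") auto
   show ?thesis
   proof (cases "r = 0")
    case False
    then have r0: "0 < r" using r by simp
    show ?thesis
    proof (cases W)
     case (real w)
     have "r \<le> w * r powr (1 - 1 / p)" using le r real by (simp add: ennreal_mult[symmetric])
     then have "r powr (1 / p) * r powr (1 - 1 / p) \<le> w * r powr (1 - 1 / p)"
      using r0 by (simp add: powr_add[symmetric])
     then have "r powr (1 / p) \<le> w" using r0 by simp
     then have "(r powr (1 / p)) powr p \<le> w powr p" using p by (intro powr_mono2) auto
     then show ?thesis using r0 real r p by (simp add: powr_powr)
    qed simp
   qed (use r in simp)
  qed
  have sup: "(SUP k. epow (min (S u) (of_nat k)) p) = epow (S u) p" for u
  proof (rule antisym)
   show "(SUP k. epow (min (S u) (of_nat k)) p) \<le> epow (S u) p" using p by (intro SUP_least epow_mono) auto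
   show "epow (S u) p \<le> (SUP k. epow (min (S u) (of_nat k)) p)"
   proof (cases "S u")
    case (real s)
    obtain k :: nat where "s \<le> real k" using real_arch_simple by blast
    then have "min (S u) (of_nat k) = S u" using real by (simp add: min_def ennreal_of_nat_eq_real_of_nat)
    then show ?thesis by (intro SUP_upper2[of k]) auto
   next
    case top
    have "of_nat k \<le> epow (min (S u) (of_nat k)) p" for k :: nat
    proof (cases "k = 0")
     case False
     then have "real k powr 1 \<le> real k powr p" using p by (intro powr_mono) auto
     then show ?thesis using top False by (simp add: ennreal_of_nat_eq_real_of_nat)
    qed simp
    then have "(SUP k. of_nat k) \<le> (SUP k. epow (min (S u) (of_nat k)) p)" by (intro SUP_mono) auto
    then show ?thesis using top by (simp add: ennreal_SUP_of_nat_eq_top top_unique)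
   qed
  qed
  have "(\<integral>\<^sup>+u. epow (S u) p \<partial>Q) = (\<integral>\<^sup>+u. (SUP k. epow (min (S u) (of_nat k)) p) \<partial>Q)" by (simp add: sup)
  also have "\<dots> = (SUP k. T k)" unfolding T_def
   using p by (intro nn_integral_monotone_convergence_SUP)
    (auto simp: incseq_def le_fun_def intro!: epow_mono min.mono of_nat_mono)
  also have "\<dots> \<le> epow W p" by (intro SUP_least Tle)
  finally show ?thesis by (simp add: S_def W_def)
 qed
qed

text \<open>Young's inequality for \<open>p\<close> and its conjugate exponent, written without the
  conjugate so that the endpoint \<open>p = 1\<close> is covered.\<close>

lemma young_powr:
 fixes u v p :: real
 assumes "0 \<le> u" "0 \<le> v" "1 \<le> p"
 shows "u * v powr (p - 1) \<le> u powr p / p + (1 - 1 / p) * v powr p"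
proof (cases "p = 1")
 case True
 then show ?thesis using assms by (auto intro: mult_left_le simp: powr_def)
next
 case False
 define q where "q = p / (p - 1)"
 have "u * v powr (p - 1) \<le> u powr p / p + (v powr (p - 1)) powr q / q"
  using assms False by (intro Youngs_inequality) (auto simp: q_def field_simps)
 also have "(v powr (p - 1)) powr q = v powr p" using False by (simp add: powr_powr q_def)
 also have "v powr p / q = (1 - 1 / p) * v powr p" using False assms by (simp add: q_def field_simps)
 finally show ?thesis .
qed

text \<open>Convexity of the \<open>p\<close>-th power for the average of \<open>s1 / c1\<close> and
  \<open>s2 / c2\<close> with weights proportional to \<open>c1\<close> and \<open>c2\<close>. If
  the weights are the two norms, integrating this pointwise bound yields Minkowski's
  inequality.\<close>

lemma powr_add_weighted:
 fixes s1 s2 c1 c2 p :: real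
 assumes s: "0 \<le> s1" "0 \<le> s2" and c: "0 < c1" "0 < c2" and p: "1 \<le> p"
 shows "(s1 + s2) powr p \<le> (c1 + c2) powr (p - 1) * (s1 powr p * c1 powr (1 - p) + s2 powr p * c2 powr (1 - p))"
proof -
 define C where "C = c1 + c2"
 define v where "v = (s1 + s2) / C"
 have C: "0 < C" using c by (simp add: C_def)
 have v: "0 \<le> v" using s C by (simp add: v_def)
 have Sv: "s1 + s2 = C * v" using C by (simp add: v_def)
 have 1: "s * v powr (p - 1) \<le> (s powr p * c powr (1 - p)) / p + c * (1 - 1 / p) * v powr p" if "0 \<le> s" "0 < c" for s c
 proof -
  have "c * (s / c * v powr (p - 1)) \<le> c * ((s / c) powr p / p + (1 - 1 / p) * v powr p)"
   using that v p by (intro mult_left_mono young_powr) auto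
  moreover have "c * (s / c) powr p = s powr p * c powr (1 - p)"
   using that by (simp add: powr_divide powr_diff)
  ultimately show ?thesis using that by (simp add: algebra_simps)
 qed
 have vp: "C * v powr p = (s1 + s2) * v powr (p - 1)"
  unfolding Sv using powr_mult_base[OF v, of "p - 1"] by simp
 have "(s1 + s2) * v powr (p - 1) \<le> (s1 powr p * c1 powr (1 - p) + s2 powr p * c2 powr (1 - p)) / p + (1 - 1 / p) * (C * v powr p)"
  using 1[OF s(1) c(1)] 1[OF s(2) c(2)] by (simp add: C_def algebra_simps add_divide_distrib)
 then have "(C * v powr p) / p \<le> (s1 powr p * c1 powr (1 - p) + s2 powr p * c2 powr (1 - p)) / p"
  unfolding vp[symmetric] by (simp add: algebra_simps diff_divide_distrib)
 then have "C * v powr p \<le> s1 powr p * c1 powr (1 - p) + s2 powr p * c2 powr (1 - p)"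
  using p by (simp add: divide_le_cancel)
 then have "C powr (p - 1) * (C * v powr p) \<le> C powr (p - 1) * (s1 powr p * c1 powr (1 - p) + s2 powr p * c2 powr (1 - p))"
  by (intro mult_left_mono) auto
 moreover have "C powr (p - 1) * (C * v powr p) = (s1 + s2) powr p"
  unfolding Sv powr_mult using C powr_mult_base[of C "p - 1"] by (simp add: mult.assoc[symmetric] mult.commute)
 ultimately show ?thesis by (simp add: C_def)
qed

lemma minkowski_add:
 assumes [measurable]: "S1 \<in> \<B> M" "S2 \<in> \<B> M" and p: "1 \<le> p"
  and A: "0 \<le> A" "(\<integral>\<^sup>+x. epow (S1 x) p \<partial>M) \<le> ennreal (A powr p)"
  and B: "0 \<le> B" "(\<integral>\<^sup>+x. epow (S2 x) p \<partial>M) \<le> ennreal (B powr p)"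
 shows "(\<integral>\<^sup>+x. epow (S1 x + S2 x) p \<partial>M) \<le> ennreal ((A + B) powr p)"
proof -
 \<comment> \<open>The weights must be positive although the norms may vanish, so both are shifted
   by \<open>e\<close>, which tends to 0 at the end.\<close>
 have eps: "(\<integral>\<^sup>+x. epow (S1 x + S2 x) p \<partial>M) \<le> ennreal ((A + B + 2 * e) powr p)" if e: "0 < e" for e
 proof -
  let ?c1 = "A + e" and ?c2 = "B + e"
  have c: "0 < ?c1" "0 < ?c2" using A B e by auto
  have pt: "epow (s + t) p \<le> ennreal ((?c1 + ?c2) powr (p - 1)) * (ennreal (?c1 powr (1 - p)) * epow s p + ennreal (?c2 powr (1 - p)) * epow t p)" for s t
  proof (cases s; cases t)
   fix a b assume *: "s = ennreal a" "0 \<le> a" "t = ennreal b" "0 \<le> b"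
   then show ?thesis using powr_add_weighted[OF *(2,4) c p]
    by (simp add: ennreal_mult[symmetric] ennreal_plus[symmetric] mult_ac del: ennreal_plus)
  qed (use c in \<open>auto simp: ennreal_mult_top\<close>)
  have "(\<integral>\<^sup>+x. epow (S1 x + S2 x) p \<partial>M) \<le> (\<integral>\<^sup>+x. ennreal ((?c1 + ?c2) powr (p - 1)) * (ennreal (?c1 powr (1 - p)) * epow (S1 x) p + ennreal (?c2 powr (1 - p)) * epow (S2 x) p) \<partial>M)"
   by (intro nn_integral_mono pt)
  also have "\<dots> = ennreal ((?c1 + ?c2) powr (p - 1)) * (ennreal (?c1 powr (1 - p)) * (\<integral>\<^sup>+x. epow (S1 x) p \<partial>M) + ennreal (?c2 powr (1 - p)) * (\<integral>\<^sup>+x. epow (S2 x) p \<partial>M))"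
   by (simp add: nn_integral_cmult nn_integral_add)
  also have "\<dots> \<le> ennreal ((?c1 + ?c2) powr (p - 1)) * (ennreal (?c1 powr (1 - p)) * ennreal (?c1 powr p) + ennreal (?c2 powr (1 - p)) * ennreal (?c2 powr p))"
   using A B e p
   by (intro mult_left_mono add_mono order_trans[OF A(2)] order_trans[OF B(2)] ennreal_leI powr_mono2) auto
  also have "\<dots> = ennreal ((?c1 + ?c2) powr (p - 1) * (?c1 + ?c2))"
   using c by (simp add: ennreal_mult[symmetric] ennreal_plus[symmetric] powr_add[symmetric] del: ennreal_plus)
  also have "(?c1 + ?c2) powr (p - 1) * (?c1 + ?c2) = (A + B + 2 * e) powr p"
   using powr_mult_base[of "?c1 + ?c2" "p - 1"] c by (simp add: mult.commute algebra_simps)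
  finally show ?thesis .
 qed
 have "((\<lambda>e. (A + B + 2 * e) powr p) \<longlongrightarrow> (A + B + 2 * 0) powr p) (at_right 0)"
  using A B p eventually_at_right_less[of 0]
  by (intro tendsto_powr' tendsto_intros) (auto elim: eventually_mono)
 then have "((\<lambda>e. ennreal ((A + B + 2 * e) powr p)) \<longlongrightarrow> ennreal ((A + B) powr p)) (at_right 0)"
  by (intro tendsto_ennrealI) simp
 then show ?thesis
  by (rule tendsto_lowerbound) (use eps in \<open>auto simp: eventually_at_right_field intro!: exI[of _ 1]\<close>)
qed

section \<open>The Poincare inequality in \<open>L\<^sup>p\<close>\<close>

lemma powr_subadd:
 fixes x y a :: real
 assumes "0 \<le> x" "0 \<le> y" "0 \<le> a" "a \<le> 1"
 shows "(x + y) powr a \<le> x powr a + y powr a"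
proof (cases "x + y = 0")
 case False
 then have S: "0 < x + y" using assms by simp
 have *: "z / (x + y) \<le> (z / (x + y)) powr a" if "0 \<le> z" "z \<le> x + y" for z
 proof (cases "z = 0")
  case False
  then have "(z / (x + y)) powr 1 \<le> (z / (x + y)) powr a" using that S assms by (intro powr_mono') auto
  then show ?thesis using that S by simp
 qed simp
 have "1 = x / (x + y) + y / (x + y)" using S by (simp add: add_divide_distrib[symmetric])
 also have "\<dots> \<le> (x / (x + y)) powr a + (y / (x + y)) powr a" using * assms by (intro add_mono) auto
 also have "\<dots> = (x powr a + y powr a) / (x + y) powr a" using assms S by (simp add: powr_divide add_divide_distrib)
 finally show ?thesis using S by (simp add: le_divide_eq)
qed (use assms in auto)

lemma powr_superadd_const:
 fixes x y a :: real
 assumes "0 \<le> x" "0 \<le> y" "0 \<le> a" "a \<le> 1"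
 shows "x powr a + y powr a \<le> 2 powr (1 - a) * (x + y) powr a"
proof (cases "x = 0 \<or> y = 0")
 case True
 have "1 \<le> 2 powr (1 - a)" using assms by (intro ge_one_powr_ge_zero) auto
 then have "z \<le> 2 powr (1 - a) * z" if "0 \<le> z" for z using mult_right_mono[of 1 "2 powr (1 - a)" z] that by simp
 then show ?thesis using True by auto
next
 case False
 then have pos: "0 < x" "0 < y" using assms by auto
 \<comment> \<open>Weighted arithmetic-geometric mean with 1/2 as companion: both sides agree at
   \<open>x = y\<close>, the case in which the constant \<open>2 powr (1 - a)\<close> is
   attained.\<close>
 have y: "(z / (x + y)) powr a * (1 / 2) powr (1 - a) \<le> a * (z / (x + y)) + (1 - a) * (1 / 2)" if "0 < z" for z
  using pos that assms by (intro Youngs_inequality_0) auto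
 have "((x / (x + y)) powr a + (y / (x + y)) powr a) * (1 / 2) powr (1 - a)
  \<le> a * (x / (x + y) + y / (x + y)) + (1 - a)"
 proof -
  have "(P + Q) * h \<le> a * (X + Y) + (1 - a)" if "P * h \<le> a * X + (1 - a) * (1 / 2)" "Q * h \<le> a * Y + (1 - a) * (1 / 2)"
   for P Q h X Y :: real
  proof -
   have "(1 - a) * (1 / 2) + (1 - a) * (1 / 2) = 1 - a" by simp
   then show ?thesis using that unfolding distrib_right[of P Q h] distrib_left[of a X Y] by linarith
  qed
  from this[OF y[OF pos(1)] y[OF pos(2)]] show ?thesis .
 qed
 also have "\<dots> = 1" using pos by (simp add: add_divide_distrib[symmetric])
 finally have "(x powr a + y powr a) / (x + y) powr a * (1 / 2) powr (1 - a) \<le> 1"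
  using pos by (simp add: powr_divide add_divide_distrib)
 then show ?thesis using pos by (simp add: powr_divide field_simps)
qed

text \<open>Chosen so that \<open>u * signed_power p u\<close> is the \<open>p\<close>-th power of
  the absolute value: a centred variable and its signed power have the \<open>p\<close>-th absolute
  moment as covariance.\<close>

definition signed_power :: "real \<Rightarrow> real \<Rightarrow> real" where
 "signed_power p u = sgn u * \<bar>u\<bar> powr (p - 1)"

text \<open>For equal signs subadditivity of the power \<open>p - 1\<close> gives constant 1.
  Opposite signs are the worst case: a sum of two powers is compared with the power of the sum, at
  the cost of \<open>2 powr (2 - p)\<close>.\<close>

lemma signed_power_holder:
 assumes p: "1 \<le> p" "p \<le> 2"
 shows "\<bar>signed_power p u - signed_power p v\<bar> \<le> 2 powr (2 - p) * \<bar>u - v\<bar> powr (p - 1)"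
proof -
 have one: "1 \<le> 2 powr (2 - p)" using p by (intro ge_one_powr_ge_zero) auto
 have same: "\<bar>x powr (p - 1) - y powr (p - 1)\<bar> \<le> 2 powr (2 - p) * \<bar>x - y\<bar> powr (p - 1)" if "0 \<le> x" "0 \<le> y" for x y
 proof -
  have *: "x powr (p - 1) - y powr (p - 1) \<le> (x - y) powr (p - 1)" "0 \<le> x powr (p - 1) - y powr (p - 1)" if "0 \<le> y" "y \<le> x" for x y
   using powr_subadd[of "x - y" y "p - 1"] powr_mono2[of "p - 1" y x] that p by auto
  have "\<bar>x powr (p - 1) - y powr (p - 1)\<bar> \<le> \<bar>x - y\<bar> powr (p - 1)"
   using *[of y x] *[of x y] that by (cases "y \<le> x") (auto simp: abs_if)
  also have "\<dots> \<le> 2 powr (2 - p) * \<bar>x - y\<bar> powr (p - 1)"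
   using mult_right_mono[OF one, of "\<bar>x - y\<bar> powr (p - 1)"] by simp
  finally show ?thesis .
 qed
 have opp: "x powr (p - 1) + y powr (p - 1) \<le> 2 powr (2 - p) * (x + y) powr (p - 1)" if "0 \<le> x" "0 \<le> y" for x y
  using powr_superadd_const[of x y "p - 1"] that p by (simp add: algebra_simps)
 consider "u = 0" | "v = 0" | "u > 0" "v > 0" | "u < 0" "v < 0" | "u > 0" "v < 0" | "u < 0" "v > 0" by linarith
 then show ?thesis
 proof cases
  case 1
  then show ?thesis using opp[of "\<bar>v\<bar>" 0] by (simp add: signed_power_def abs_mult abs_sgn_eq)
 next
  case 2
  then show ?thesis using opp[of "\<bar>u\<bar>" 0] by (simp add: signed_power_def abs_mult abs_sgn_eq)
 next
  case 3
  then show ?thesis using same[of u v] by (simp add: signed_power_def)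
 next
  case 4
  then show ?thesis using same[of "- u" "- v"] by (simp add: signed_power_def abs_minus_commute)
 next
  case 5
  then show ?thesis using opp[of u "- v"] by (simp add: signed_power_def)
 next
  case 6
  then have "signed_power p u - signed_power p v = - ((- u) powr (p - 1) + v powr (p - 1))" "\<bar>u - v\<bar> = - u + v"
   by (auto simp: signed_power_def)
  moreover have "\<bar>- ((- u) powr (p - 1) + v powr (p - 1))\<bar> = (- u) powr (p - 1) + v powr (p - 1)"
   unfolding abs_minus_cancel by (rule abs_of_nonneg) simp
  ultimately show ?thesis using opp[of "- u" v] 6 by simp
 qed
qed

context poisson_space
begin

text \<open>The covariance formula is applied to the centred \<open>G\<close> and its signed power.
  Young's inequality splits the product of add-one costs into \<open>U\<close> and \<open>V\<close>,
  with weights \<open>1 / p\<close> and \<open>1 - 1 / p\<close>; they sum to 1, so the Hoelder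
  constant is the only one left.\<close>

lemma p_poincare_bounded:
 assumes G: "bdd G B" and p: "1 \<le> p" "p \<le> 2"
 shows "(\<integral>\<^sup>+m. ennreal (\<bar>G m - (\<integral>\<nu>. G \<nu> \<partial>P)\<bar> powr p) \<partial>P)
  \<le> ennreal (2 powr (2 - p)) * (\<integral>\<^sup>+x. (\<integral>\<^sup>+m. ennreal (\<bar>\<D> x G m\<bar> powr p) \<partial>P) \<partial>L)"
proof (cases "(\<integral>\<^sup>+x. (\<integral>\<^sup>+m. ennreal (\<bar>\<D> x G m\<bar> powr p) \<partial>P) \<partial>L) = \<infinity>")
 case True
 have "ennreal (2 powr (2 - p)) * \<infinity> = \<infinity>" by (simp add: ennreal_mult_top)
 then show ?thesis using True by simp
next
 case False
 note Gm = bddD(1)[OF G]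
 have null: "\<C> L (null_measure L)" by (simp add: counting_measure_def)
 have B0: "0 \<le> B" using bddD(2)[OF G null] by linarith
 define c where "c = (\<integral>\<nu>. G \<nu> \<partial>P)"
 define Y where "Y m = G m - c" for m
 define Z where "Z m = signed_power p (Y m)" for m
 have cB: "\<bar>c\<bar> \<le> B"
 proof -
  have "\<bar>c\<bar> \<le> (\<integral>\<nu>. \<bar>G \<nu>\<bar> \<partial>P)" unfolding c_def by (rule integral_abs_bound)
  also have "\<dots> \<le> (\<integral>\<nu>. B \<partial>P)" using bdd_integrable[OF G] bddD(2)[OF G] by (intro integral_mono) auto
  finally show ?thesis by (simp add: P.prob_space del: spaceP)
 qed
 have Y: "bdd Y (2 * B)" unfolding bdd_def Y_def
 proof (intro conjI allI impI)
  show "\<bar>G m - c\<bar> \<le> 2 * B" if "\<C> L m" for m using bddD(2)[OF G that] cB by linarith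
 qed (use Gm in measurable)
 have sm: "signed_power p \<in> \<B> borel" unfolding signed_power_def[abs_def] by measurable
 have Z: "bdd Z ((2 * B) powr (p - 1))" unfolding bdd_def Z_def
 proof (intro conjI allI impI)
  show "\<bar>signed_power p (Y m)\<bar> \<le> (2 * B) powr (p - 1)" if "\<C> L m" for m
  proof -
   have "\<bar>signed_power p (Y m)\<bar> \<le> \<bar>Y m\<bar> powr (p - 1)" by (simp add: signed_power_def abs_mult abs_sgn_eq)
   also have "\<dots> \<le> (2 * B) powr (p - 1)" using bddD(2)[OF Y that] p by (intro powr_mono2) auto
   finally show ?thesis .
  qed
 qed (rule m_comp[OF bddD(1)[OF Y] sm])
 have DY: "\<D> x Y m = \<D> x G m" for x m by (simp add: add_one_cost_def Y_def)
 define U where "U x m = 2 powr (2 - p) * (\<bar>\<D> x G m\<bar> powr p / p)" for x m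
 define V where "V x m = 2 powr (2 - p) * ((1 - 1 / p) * \<bar>\<D> x G m\<bar> powr p)" for x m
 have Dm: "(\<lambda>z. \<D> (fst z) G (snd z)) \<in> \<B> (L \<Otimes>\<^sub>M \<N> L)"
  by (rule measurable_add_one_cost[OF Gm measurable_fst measurable_snd])
 have Dmx: "(\<lambda>m. \<D> x G m) \<in> \<F> L" if "x \<in> space L" for x
  using m_comp[OF measurable_Pair1'[OF that] Dm] by simp
 define I where "I = (\<integral>\<^sup>+x. (\<integral>\<^sup>+m. ennreal (\<bar>\<D> x G m\<bar> powr p) \<partial>P) \<partial>L)"
 have Im: "(\<lambda>x. \<integral>\<^sup>+m. ennreal (\<bar>\<D> x G m\<bar> powr p) \<partial>P) \<in> \<B> L"
 proof (rule P.borel_measurable_nn_integral)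
  have "(\<lambda>z. ennreal (\<bar>\<D> (fst z) G (snd z)\<bar> powr p)) \<in> \<B> (L \<Otimes>\<^sub>M \<N> L)"
   using Dm by measurable
  then show "(\<lambda>(x, m). ennreal (\<bar>\<D> x G m\<bar> powr p)) \<in> \<B> (L \<Otimes>\<^sub>M P)"
   by (simp add: case_prod_beta' cong: measurable_cong_sets add: setsP)
 qed
 have IU: "(\<integral>\<^sup>+x. (\<integral>\<^sup>+m. ennreal (U x m) \<partial>P) \<partial>L) = ennreal (2 powr (2 - p) / p) * I"
  and IV: "(\<integral>\<^sup>+x. (\<integral>\<^sup>+m. ennreal (V x m) \<partial>P) \<partial>L) = ennreal (2 powr (2 - p) * (1 - 1 / p)) * I"
 proof -
  have *: "(\<integral>\<^sup>+x. (\<integral>\<^sup>+m. ennreal (d * \<bar>\<D> x G m\<bar> powr p) \<partial>P) \<partial>L) = ennreal d * I" if "0 \<le> d" for d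
  proof -
   have "(\<integral>\<^sup>+m. ennreal (d * \<bar>\<D> x G m\<bar> powr p) \<partial>P) = ennreal d * (\<integral>\<^sup>+m. ennreal (\<bar>\<D> x G m\<bar> powr p) \<partial>P)" if "x \<in> space L" for x
    using Dmx[OF that] \<open>0 \<le> d\<close> by (subst nn_integral_cmult[symmetric]) (auto simp: ennreal_mult)
   then show ?thesis unfolding I_def using Im by (subst nn_integral_cmult[symmetric]) (auto intro!: nn_integral_cong)
  qed
  show "(\<integral>\<^sup>+x. (\<integral>\<^sup>+m. ennreal (U x m) \<partial>P) \<partial>L) = ennreal (2 powr (2 - p) / p) * I"
   using *[of "2 powr (2 - p) / p"] p by (simp add: U_def)
  show "(\<integral>\<^sup>+x. (\<integral>\<^sup>+m. ennreal (V x m) \<partial>P) \<partial>L) = ennreal (2 powr (2 - p) * (1 - 1 / p)) * I"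
   using *[of "2 powr (2 - p) * (1 - 1 / p)"] p by (simp add: V_def mult.assoc)
 qed
 have d: "dominated Y Z U V"
  unfolding dominated_def IU IV
 proof (intro conjI allI ballI impI)
  show "(\<lambda>z. U (fst z) (snd z)) \<in> \<B> (L \<Otimes>\<^sub>M \<N> L)"
   "(\<lambda>z. V (fst z) (snd z)) \<in> \<B> (L \<Otimes>\<^sub>M \<N> L)"
   unfolding U_def V_def using Dm by measurable
  show "0 \<le> U x m" "0 \<le> V x m" for x m using p by (auto simp: U_def V_def)
  have "I < \<infinity>" using False by (simp add: I_def less_top)
  then show "ennreal (2 powr (2 - p) / p) * I < \<infinity>" "ennreal (2 powr (2 - p) * (1 - 1 / p)) * I < \<infinity>"
   by (auto simp: ennreal_mult_less_top)
  show "\<bar>\<D> x Y m * \<D> x Z \<nu>\<bar> \<le> U x m + V x \<nu>" for x m \<nu>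
  proof -
   have "\<bar>\<D> x Z \<nu>\<bar> \<le> 2 powr (2 - p) * \<bar>\<D> x G \<nu>\<bar> powr (p - 1)"
    using signed_power_holder[OF p, of "Y (add_dirac \<nu> x)" "Y \<nu>"] by (simp add: add_one_cost_def Z_def Y_def)
   then have "\<bar>\<D> x Y m * \<D> x Z \<nu>\<bar> \<le> \<bar>\<D> x G m\<bar> * (2 powr (2 - p) * \<bar>\<D> x G \<nu>\<bar> powr (p - 1))"
    unfolding abs_mult DY by (intro mult_left_mono) auto
   also have "\<dots> = 2 powr (2 - p) * (\<bar>\<D> x G m\<bar> * \<bar>\<D> x G \<nu>\<bar> powr (p - 1))" by simp
   also have "\<dots> \<le> 2 powr (2 - p) * (\<bar>\<D> x G m\<bar> powr p / p + (1 - 1 / p) * \<bar>\<D> x G \<nu>\<bar> powr p)"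
    using p by (intro mult_left_mono young_powr) auto
   finally show ?thesis by (simp add: U_def V_def distrib_left)
  qed
 qed
 have YZ: "Y m * Z m = \<bar>Y m\<bar> powr p" for m
 proof -
  have "Y m * sgn (Y m) = \<bar>Y m\<bar>" by (simp add: sgn_if)
  then show ?thesis
   using powr_mult_base[of "\<bar>Y m\<bar>" "p - 1"] by (simp add: Z_def signed_power_def mult.assoc[symmetric])
 qed
 have iYZ: "integrable P (\<lambda>m. \<bar>Y m\<bar> powr p)" using bdd_integrable[OF bdd_mult[OF Y Z]] by (simp add: YZ)
 have "(\<integral>m. Y m \<partial>P) = 0"
  using bdd_integrable[OF G] by (simp add: Y_def c_def P.prob_space del: spaceP)
 then have "(\<integral>m. \<bar>Y m\<bar> powr p \<partial>P) = (\<integral>z. \<Gamma> Y Z z \<partial>\<L>)"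
  using covariance_formula_bounded[OF Y Z d] by (simp add: YZ)
 then have "ennreal (\<integral>m. \<bar>Y m\<bar> powr p \<partial>P) \<le> ennreal \<bar>\<integral>z. \<Gamma> Y Z z \<partial>\<L>\<bar>"
  by (intro ennreal_leI) simp
 also have "\<dots> \<le> (\<integral>\<^sup>+z. ennreal (norm (\<Gamma> Y Z z)) \<partial>\<L>)"
  using integral_norm_bound_ennreal[OF cov_integrable[OF bddD(1)[OF Y] bddD(1)[OF Z] d]] by simp
 also have "\<dots> \<le> (\<integral>\<^sup>+x. (\<integral>\<^sup>+m. ennreal (U x m) \<partial>P) \<partial>L) + (\<integral>\<^sup>+x. (\<integral>\<^sup>+m. ennreal (V x m) \<partial>P) \<partial>L)"
  by (rule cov_nn_bound[OF bddD(1)[OF Y] bddD(1)[OF Z] d])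
 also have "\<dots> = ennreal (2 powr (2 - p)) * I"
  unfolding IU IV distrib_right[symmetric] using p
  by (subst ennreal_plus[symmetric]) (auto simp: field_simps)
 finally show ?thesis
  using nn_integral_eq_integral[OF iYZ] by (simp add: I_def Y_def c_def)
qed

text \<open>Jensen passes from the \<open>p\<close>-th to the first absolute moment and turns the
  constant into its \<open>p\<close>-th root. Unbounded \<open>G\<close> is reached by clipping,
  which can only decrease the right-hand side.\<close>

theorem p_poincare:
 assumes G: "G \<in> \<F> L" "integrable P G" and p: "1 \<le> p" "p \<le> 2"
 shows "ennreal (\<integral>m. \<bar>G m - (\<integral>\<nu>. G \<nu> \<partial>P)\<bar> \<partial>P)
  \<le> ennreal (2 powr (2 / p - 1)) * epow (\<integral>\<^sup>+x. (\<integral>\<^sup>+m. epow (ennreal \<bar>\<D> x G m\<bar>) p \<partial>P) \<partial>L) (1 / p)"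
  (is "_ \<le> ?R")
proof -
 define c where "c k t = max (- real k) (min (real k) t)" for k and t :: real
 have cb: "\<bar>c k t\<bar> \<le> real k" "\<bar>c k t\<bar> \<le> \<bar>t\<bar>" "\<bar>c k t - c k s\<bar> \<le> \<bar>t - s\<bar>" for k t s
  by (auto simp: c_def max_def min_def)
 have cl: "(\<lambda>k. c k t) \<longlonglongrightarrow> t" for t
 proof (rule tendsto_eventually)
  show "\<forall>\<^sub>F k in sequentially. c k t = t"
  proof (rule eventually_sequentiallyI[of "nat \<lceil>\<bar>t\<bar>\<rceil>"])
   fix k assume "nat \<lceil>\<bar>t\<bar>\<rceil> \<le> k"
   then have "\<bar>t\<bar> \<le> real k" by linarith
   then show "c k t = t" by (auto simp: c_def max_def min_def)
  qed
 qed
 have cm: "c k \<in> \<B> borel" for k unfolding c_def[abs_def] by measurable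
 define H where "H k = (\<lambda>m. c k (G m))" for k
 have H: "bdd (H k) (real k)" for k
  using m_comp[OF G(1) cm] cb(1) by (auto simp: bdd_def H_def)
 define e where "e k = (\<integral>\<nu>. H k \<nu> \<partial>P)" for k
 have Hi: "integrable P (H k)" for k by (rule bdd_integrable[OF H])
 have Gm: "G \<in> \<B> P" and Hm: "H k \<in> \<B> P" for k using G(2) Hi by auto
 have step: "ennreal (\<integral>m. \<bar>H k m - e k\<bar> \<partial>P) \<le> ?R" for k
 proof -
  have "ennreal (\<integral>m. \<bar>H k m - e k\<bar> \<partial>P) = (\<integral>\<^sup>+m. ennreal \<bar>H k m - e k\<bar> \<partial>P)"
   using Hi by (intro nn_integral_eq_integral[symmetric]) auto
  also have "\<dots> \<le> epow (\<integral>\<^sup>+m. epow (ennreal \<bar>H k m - e k\<bar>) p \<partial>P) (1 / p)"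
  proof (intro moment_le_prob p P.prob_space_axioms)
   have "(\<lambda>m. ennreal \<bar>H k m - e k\<bar>) \<in> \<F> L"
    using bddD(1)[OF H, of k] by measurable
   then show "(\<lambda>m. ennreal \<bar>H k m - e k\<bar>) \<in> \<B> P" by simp
  qed
  also have "\<dots> \<le> epow (ennreal (2 powr (2 - p)) * (\<integral>\<^sup>+x. (\<integral>\<^sup>+m. ennreal (\<bar>\<D> x (H k) m\<bar> powr p) \<partial>P) \<partial>L)) (1 / p)"
   using p p_poincare_bounded[OF H p, of k] by (intro epow_mono) (auto simp: e_def)
  also have "\<dots> \<le> epow (ennreal (2 powr (2 - p)) * (\<integral>\<^sup>+x. (\<integral>\<^sup>+m. epow (ennreal \<bar>\<D> x G m\<bar>) p \<partial>P) \<partial>L)) (1 / p)"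
   using p by (intro epow_mono mult_left_mono nn_integral_mono)
    (auto simp: add_one_cost_def H_def intro!: ennreal_leI powr_mono2 cb(3))
  also have "\<dots> = ?R"
   using p by (simp add: epow_mult powr_powr diff_divide_distrib)
  finally show ?thesis .
 qed
 have "(\<lambda>k. \<integral>m. \<bar>H k m - e k\<bar> \<partial>P) \<longlonglongrightarrow> (\<integral>m. \<bar>G m - (\<integral>\<nu>. G \<nu> \<partial>P)\<bar> \<partial>P)"
 proof (rule integral_dominated_convergence[where w="\<lambda>m. \<bar>G m\<bar> + (\<integral>\<nu>. \<bar>G \<nu>\<bar> \<partial>P)"])
  have "e \<longlonglongrightarrow> (\<integral>\<nu>. G \<nu> \<partial>P)" unfolding e_def
   by (rule integral_dominated_convergence[where w="\<lambda>m. \<bar>G m\<bar>"]) (use Gm Hm G cb(2) cl in \<open>auto simp: H_def\<close>)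
  then show "AE m in P. (\<lambda>k. \<bar>H k m - e k\<bar>) \<longlonglongrightarrow> \<bar>G m - (\<integral>\<nu>. G \<nu> \<partial>P)\<bar>"
   unfolding H_def by (intro AE_I2 tendsto_intros cl)
  show "AE m in P. norm \<bar>H k m - e k\<bar> \<le> \<bar>G m\<bar> + (\<integral>\<nu>. \<bar>G \<nu>\<bar> \<partial>P)" for k
  proof (rule AE_I2)
   fix m
   have "\<bar>e k\<bar> \<le> (\<integral>\<nu>. \<bar>H k \<nu>\<bar> \<partial>P)" unfolding e_def by (rule integral_abs_bound)
   also have "\<dots> \<le> (\<integral>\<nu>. \<bar>G \<nu>\<bar> \<partial>P)" using integrable_abs[OF Hi[of k]] G(2) cb(2) by (intro integral_mono) (auto simp: H_def)
   finally show "norm \<bar>H k m - e k\<bar> \<le> \<bar>G m\<bar> + (\<integral>\<nu>. \<bar>G \<nu>\<bar> \<partial>P)" using cb(2)[of k "G m"] by (auto simp: H_def)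
  qed
 qed (use Gm Hm G(2) in auto)
 then have "(\<lambda>k. ennreal (\<integral>m. \<bar>H k m - e k\<bar> \<partial>P)) \<longlonglongrightarrow> ennreal (\<integral>m. \<bar>G m - (\<integral>\<nu>. G \<nu> \<partial>P)\<bar> \<partial>P)"
  by (rule tendsto_ennrealI)
 then show ?thesis by (rule LIMSEQ_le_const2) (use step in auto)
qed

end

section \<open>Fluctuations of the carre-du-champ\<close>

lemma measurable_add_one_cost2:
 assumes F: "F \<in> \<F> L"
  and X: "X \<in> N \<rightarrow>\<^sub>M L" and Y: "Y \<in> N \<rightarrow>\<^sub>M L" and T: "T \<in> N \<rightarrow>\<^sub>M \<N> L"
 shows "(\<lambda>z. \<D>\<^sub>2 (X z) (Y z) F (T z)) \<in> \<B> N"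
proof -
 have "(\<lambda>z. (Y z, T z)) \<in> N \<rightarrow>\<^sub>M L \<Otimes>\<^sub>M \<N> L" using Y T by measurable
 from m_comp[OF this measurable_add_dirac]
 have "(\<lambda>z. add_dirac (T z) (Y z)) \<in> N \<rightarrow>\<^sub>M \<N> L" by simp
 then show ?thesis
  using measurable_add_one_cost[OF F X] T unfolding add_one_cost2_def add_one_cost_def[of "Y _"]
  by (intro borel_measurable_diff) auto
qed

lemma add_one_cost_add_dirac: "\<D> x F (add_dirac m y) = \<D> x F m + \<D>\<^sub>2 x y F m"
 by (simp add: add_one_cost2_def add_one_cost_def)

text \<open>If \<open>v\<close> is not integrable the right side is infinite and nothing is claimed.
  This permits perturbing by terms with second differences before their integrability is
  known.\<close>

lemma integral_perturb:
 fixes u v :: "'a \<Rightarrow> real"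
 assumes u: "integrable M u" and v: "v \<in> \<B> M"
 shows "ennreal \<bar>(\<integral>x. u x + v x \<partial>M) - (\<integral>x. u x \<partial>M)\<bar> \<le> (\<integral>\<^sup>+x. ennreal \<bar>v x\<bar> \<partial>M)"
proof (cases "(\<integral>\<^sup>+x. ennreal \<bar>v x\<bar> \<partial>M) < \<infinity>")
 case True
 then have iv: "integrable M v" using v by (intro integrableI_bounded) auto
 then have "(\<integral>x. u x + v x \<partial>M) - (\<integral>x. u x \<partial>M) = (\<integral>x. v x \<partial>M)" using u by simp
 then show ?thesis using integral_norm_bound_ennreal[OF iv] by simp
next
 case False
 then show ?thesis by (simp add: not_less top_unique)
qed

definition field_moment :: "'a measure measure \<Rightarrow> real \<Rightarrow> ('a measure \<Rightarrow> real) \<Rightarrow> ennreal" ("\<M>") where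
 "\<M> P r Y = epow (\<integral>\<^sup>+m. epow (ennreal \<bar>Y m\<bar>) r \<partial>P) (1 / r)"

context poisson_space
begin

abbreviation "d12 p F G \<equiv> \<integral>\<^sup>+y. epow (\<integral>\<^sup>+x. \<M> P (2 * p) (\<D> x F) * \<M> P (2 * p) (\<D>\<^sub>2 x y G) \<partial>L) p \<partial>L"
abbreviation "d21 p F G \<equiv> \<integral>\<^sup>+y. epow (\<integral>\<^sup>+x. \<M> P (2 * p) (\<D>\<^sub>2 x y F) * \<M> P (2 * p) (\<D> x G) \<partial>L) p \<partial>L"
abbreviation "d22 p F G \<equiv> \<integral>\<^sup>+y. epow (\<integral>\<^sup>+x. \<M> P (2 * p) (\<D>\<^sub>2 x y F) * \<M> P (2 * p) (\<D>\<^sub>2 x y G) \<partial>L) p \<partial>L"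

text \<open>The inner integral of the covariance formula over \<open>x\<close>, for one pair of
  coupled configurations, hence a functional of a single marked configuration.\<close>

definition carre :: "('a measure \<Rightarrow> real) \<Rightarrow> ('a measure \<Rightarrow> real) \<Rightarrow> ('a \<times> bool \<times> bool) measure \<Rightarrow> real" where
 "carre F G m = (\<integral>x. \<D> x F (\<alpha> m) * \<D> x G (\<beta> m) \<partial>L)"

lemma carre_measurable:
 assumes F: "F \<in> \<F> L" and G: "G \<in> \<F> L"
 shows "carre F G \<in> \<F> (mark_space L)"
 unfolding carre_def[abs_def]
proof (rule borel_measurable_lebesgue_integral)
 have "(\<lambda>z. \<D> (snd z) F (\<alpha> (fst z)) * \<D> (snd z) G (\<beta> (fst z))) \<in> \<B> (\<N> (mark_space L) \<Otimes>\<^sub>M L)"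
  by (intro borel_measurable_times measurable_add_one_cost[OF F] measurable_add_one_cost[OF G] measurable_snd
   m_comp[OF measurable_fst measurable_proj])
 then show "(\<lambda>(m, x). \<D> x F (\<alpha> m) * \<D> x G (\<beta> m)) \<in> \<B> (\<N> (mark_space L) \<Otimes>\<^sub>M L)"
  by (simp add: case_prod_beta')
qed

text \<open>Cauchy-Schwarz separates the two coupled configurations, after which only their common
  law \<open>P\<close> matters. This step doubles the exponent from \<open>p\<close> to
  \<open>2 * p\<close>.\<close>

lemma field_moment_product:
 assumes t: "t \<in> {0..1}" and p: "1 \<le> p"
  and u: "u \<in> \<F> L" and v: "v \<in> \<F> L"
 shows "epow (\<integral>\<^sup>+m. epow (ennreal \<bar>u (\<alpha> m)\<bar> * ennreal \<bar>v (\<beta> m)\<bar>) p \<partial>kern L t) (1 / p)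
  \<le> \<M> P (2 * p) u * \<M> P (2 * p) v"
proof -
 have mK: "measurable (kern L t) N = measurable (\<N> (mark_space L)) N" for N :: "'b measure"
  by (intro measurable_cong_sets kern_props(2)[OF L] refl)
 have um: "(\<lambda>m. epow (ennreal \<bar>u m\<bar>) (2 * p)) \<in> \<F> L"
  and vm: "(\<lambda>m. epow (ennreal \<bar>v m\<bar>) (2 * p)) \<in> \<F> L" using u v by measurable
 have "(\<integral>\<^sup>+m. epow (ennreal \<bar>u (\<alpha> m)\<bar> * ennreal \<bar>v (\<beta> m)\<bar>) p \<partial>kern L t)
  = (\<integral>\<^sup>+m. epow (epow (ennreal \<bar>u (\<alpha> m)\<bar>) (2 * p)) (1 / 2) * epow (epow (ennreal \<bar>v (\<beta> m)\<bar>) (2 * p)) (1 / 2) \<partial>kern L t)"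
  by (simp add: epow_epow epow_mult del: epow_ennreal)
 also have "\<dots> \<le> epow (\<integral>\<^sup>+m. epow (ennreal \<bar>u (\<alpha> m)\<bar>) (2 * p) \<partial>kern L t) (1 / 2) * epow (\<integral>\<^sup>+m. epow (ennreal \<bar>v (\<beta> m)\<bar>) (2 * p) \<partial>kern L t) (1 / 2)"
  using m_comp[OF measurable_proj um] m_comp[OF measurable_proj vm]
  by (intro holder_nn_integral) (auto simp: mK simp del: epow_ennreal)
 also have "\<dots> = epow (\<integral>\<^sup>+m. epow (ennreal \<bar>u m\<bar>) (2 * p) \<partial>P) (1 / 2) * epow (\<integral>\<^sup>+m. epow (ennreal \<bar>v m\<bar>) (2 * p) \<partial>P) (1 / 2)"
  using kern_marginal(1)[OF t um] kern_marginal(2)[OF t vm] by (simp del: epow_ennreal)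
 finally have "epow (\<integral>\<^sup>+m. epow (ennreal \<bar>u (\<alpha> m)\<bar> * ennreal \<bar>v (\<beta> m)\<bar>) p \<partial>kern L t) (1 / p)
  \<le> epow (epow (\<integral>\<^sup>+m. epow (ennreal \<bar>u m\<bar>) (2 * p) \<partial>P) (1 / 2) * epow (\<integral>\<^sup>+m. epow (ennreal \<bar>v m\<bar>) (2 * p) \<partial>P) (1 / 2)) (1 / p)"
  using p by (intro epow_mono) auto
 also have "\<dots> = \<M> P (2 * p) u * \<M> P (2 * p) v"
  using p by (simp add: field_moment_def epow_mult epow_epow del: epow_ennreal)
 finally show ?thesis .
qed

text \<open>For each new point \<open>y\<close>, Minkowski pulls the \<open>p\<close>-norm over the
  coupling inside the integral over \<open>x\<close>, where the product bound applies. What remains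
  no longer depends on \<open>t\<close>.\<close>

lemma carre_term_bound:
 fixes u v :: "'a \<Rightarrow> 'a \<Rightarrow> 'a measure \<Rightarrow> real"
 assumes t: "t \<in> {0..1}" and p: "1 \<le> p"
  and u: "(\<lambda>z. u (fst z) (fst (snd z)) (snd (snd z))) \<in> \<B> (L \<Otimes>\<^sub>M (L \<Otimes>\<^sub>M \<N> L))"
  and v: "(\<lambda>z. v (fst z) (fst (snd z)) (snd (snd z))) \<in> \<B> (L \<Otimes>\<^sub>M (L \<Otimes>\<^sub>M \<N> L))"
 defines "S \<equiv> \<lambda>w. \<integral>\<^sup>+x. ennreal \<bar>u x (fst w) (\<alpha> (snd w))\<bar> * ennreal \<bar>v x (fst w) (\<beta> (snd w))\<bar> \<partial>L"
 shows "S \<in> \<B> (L \<Otimes>\<^sub>M kern L t)"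
  and "(\<integral>\<^sup>+w. epow (S w) p \<partial>(L \<Otimes>\<^sub>M kern L t))
   \<le> (\<integral>\<^sup>+y. epow (\<integral>\<^sup>+x. \<M> P (2 * p) (u x y) * \<M> P (2 * p) (v x y) \<partial>L) p \<partial>L)"
proof -
 interpret K: prob_space "kern L t" by (rule kern_props[OF L])
 interpret LK: pair_sigma_finite L "kern L t" ..
 have sK[measurable_cong]: "sets (kern L t) = sets (\<N> (mark_space L))" by (rule kern_props[OF L])
 have \<alpha>K: "\<alpha> \<in> kern L t \<rightarrow>\<^sub>M \<N> L" and \<beta>K: "\<beta> \<in> kern L t \<rightarrow>\<^sub>M \<N> L"
  using measurable_proj by (simp_all cong: measurable_cong_sets add: sK)
 have m: "(\<lambda>z. ennreal \<bar>u (fst z) (fst (snd z)) (\<alpha> (snd (snd z)))\<bar> * ennreal \<bar>v (fst z) (fst (snd z)) (\<beta> (snd (snd z)))\<bar>)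
   \<in> \<B> (L \<Otimes>\<^sub>M (L \<Otimes>\<^sub>M kern L t))"
 proof -
  have "(\<lambda>z. (fst z, fst (snd z), T (snd (snd z)))) \<in> L \<Otimes>\<^sub>M (L \<Otimes>\<^sub>M kern L t) \<rightarrow>\<^sub>M L \<Otimes>\<^sub>M (L \<Otimes>\<^sub>M \<N> L)"
   if T: "T \<in> kern L t \<rightarrow>\<^sub>M \<N> L" for T
   by (intro measurable_Pair measurable_fst m_comp[OF measurable_snd measurable_fst]
    m_comp[OF m_comp[OF measurable_snd measurable_snd] T])
  from m_comp[OF this[OF \<alpha>K] u] m_comp[OF this[OF \<beta>K] v] show ?thesis by simp
 qed
 show Sm: "S \<in> \<B> (L \<Otimes>\<^sub>M kern L t)"
  unfolding S_def using m_comp[OF measurable_pair_swap' m]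
  by (intro borel_measurable_nn_integral) (simp add: case_prod_beta')
 have "(\<integral>\<^sup>+w. epow (S w) p \<partial>(L \<Otimes>\<^sub>M kern L t)) = (\<integral>\<^sup>+y. (\<integral>\<^sup>+m. epow (S (y, m)) p \<partial>kern L t) \<partial>L)"
  by (rule K.nn_integral_fst[symmetric]) (rule m_comp[OF Sm measurable_epow])
 also have "\<dots> \<le> (\<integral>\<^sup>+y. epow (\<integral>\<^sup>+x. epow (\<integral>\<^sup>+m. epow (ennreal \<bar>u x y (\<alpha> m)\<bar> * ennreal \<bar>v x y (\<beta> m)\<bar>) p \<partial>kern L t) (1 / p) \<partial>L) p \<partial>L)"
 proof (rule nn_integral_mono)
  fix y assume y: "y \<in> space L"
  have "(\<lambda>z. (fst z, y, snd z)) \<in> L \<Otimes>\<^sub>M kern L t \<rightarrow>\<^sub>M L \<Otimes>\<^sub>M (L \<Otimes>\<^sub>M kern L t)"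
   using y by (intro measurable_Pair measurable_fst measurable_snd) auto
  from m_comp[OF this m]
  show "(\<integral>\<^sup>+m. epow (S (y, m)) p \<partial>kern L t) \<le> epow (\<integral>\<^sup>+x. epow (\<integral>\<^sup>+m. epow (ennreal \<bar>u x y (\<alpha> m)\<bar> * ennreal \<bar>v x y (\<beta> m)\<bar>) p \<partial>kern L t) (1 / p) \<partial>L) p"
   unfolding S_def fst_conv snd_conv by (intro minkowski_nn_integral[OF L kern_props(1)[OF L] _ p]) simp
 qed
 also have "\<dots> \<le> (\<integral>\<^sup>+y. epow (\<integral>\<^sup>+x. \<M> P (2 * p) (u x y) * \<M> P (2 * p) (v x y) \<partial>L) p \<partial>L)"
 proof (intro nn_integral_mono epow_mono field_moment_product[OF t p])
  fix x y assume "y \<in> space L" "x \<in> space L"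
  then have "(\<lambda>m. (x, y, m)) \<in> \<N> L \<rightarrow>\<^sub>M L \<Otimes>\<^sub>M (L \<Otimes>\<^sub>M \<N> L)" by measurable
  from m_comp[OF this u] m_comp[OF this v]
  show "u x y \<in> \<F> L" "v x y \<in> \<F> L" by auto
 qed (use p in auto)
 finally show "(\<integral>\<^sup>+w. epow (S w) p \<partial>(L \<Otimes>\<^sub>M kern L t))
   \<le> (\<integral>\<^sup>+y. epow (\<integral>\<^sup>+x. \<M> P (2 * p) (u x y) * \<M> P (2 * p) (v x y) \<partial>L) p \<partial>L)" .
qed

text \<open>A new point with mark \<open>k\<close> enters the first process if \<open>fst k\<close>
  holds and the second if \<open>snd k\<close> holds. The add-one cost of \<open>carre\<close> is
  thus bounded by \<open>S1\<close>, by \<open>S2\<close>, or, for a shared point, by both plus the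
  cross term \<open>S3\<close>; the intensity weights these cases with \<open>1 - t\<close>,
  \<open>1 - t\<close> and \<open>t\<close>.\<close>

theorem carre_fluctuation:
 assumes F: "F \<in> \<F> L" and G: "G \<in> \<F> L"
  and t: "t \<in> {0..1}" and p: "1 \<le> p" "p \<le> 2"
  and fin: "(\<integral>\<^sup>+x. (\<integral>\<^sup>+m. ennreal \<bar>\<D> x F (\<alpha> m) * \<D> x G (\<beta> m)\<bar> \<partial>kern L t) \<partial>L) < \<infinity>"
  and A: "0 \<le> A" "d21 p F G \<le> ennreal (A powr p)"
  and B: "0 \<le> B" "d12 p F G \<le> ennreal (B powr p)"
  and C: "0 \<le> C" "d22 p F G \<le> ennreal (C powr p)"
 shows "integrable (kern L t) (carre F G)"
  and "(\<integral>m. \<bar>carre F G m - (\<integral>\<nu>. carre F G \<nu> \<partial>kern L t)\<bar> \<partial>kern L t) \<le> 2 powr (2 / p - 1) * (A + B + C)"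
proof -
 interpret K: prob_space "kern L t" by (rule kern_props[OF L])
 interpret LK: pair_sigma_finite L "kern L t" ..
 have sK[measurable_cong]: "sets (kern L t) = sets (\<N> (mark_space L))" by (rule kern_props[OF L])
 have spK: "space (kern L t) = {m. \<C> (mark_space L) m}" by (rule kern_props[OF L])
 have \<alpha>K: "\<alpha> \<in> kern L t \<rightarrow>\<^sub>M \<N> L" and \<beta>K: "\<beta> \<in> kern L t \<rightarrow>\<^sub>M \<N> L"
  using measurable_proj by (simp_all cong: measurable_cong_sets add: sK)
 note cm = carre_measurable[OF F G]
 have bm: "(\<lambda>(x, m). \<D> x F (\<alpha> m) * \<D> x G (\<beta> m)) \<in> \<B> (L \<Otimes>\<^sub>M kern L t)"
  unfolding case_prod_beta'
  by (intro borel_measurable_times measurable_add_one_cost[OF F] measurable_add_one_cost[OF G] measurable_fst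
   m_comp[OF measurable_snd \<alpha>K] m_comp[OF measurable_snd \<beta>K])
 have base: "integrable (L \<Otimes>\<^sub>M kern L t) (\<lambda>(x, m). \<D> x F (\<alpha> m) * \<D> x G (\<beta> m))"
 proof (rule integrableI_bounded[OF bm])
  have "(\<integral>\<^sup>+z. ennreal (norm (case z of (x, m) \<Rightarrow> \<D> x F (\<alpha> m) * \<D> x G (\<beta> m))) \<partial>(L \<Otimes>\<^sub>M kern L t))
   = (\<integral>\<^sup>+x. (\<integral>\<^sup>+m. ennreal \<bar>\<D> x F (\<alpha> m) * \<D> x G (\<beta> m)\<bar> \<partial>kern L t) \<partial>L)"
   using bm by (subst K.nn_integral_fst[symmetric]) (auto simp: case_prod_beta')
  then show "(\<integral>\<^sup>+z. ennreal (norm (case z of (x, m) \<Rightarrow> \<D> x F (\<alpha> m) * \<D> x G (\<beta> m))) \<partial>(L \<Otimes>\<^sub>M kern L t)) < \<infinity>"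
   using fin by simp
 qed
 show ci: "integrable (kern L t) (carre F G)"
  unfolding carre_def[abs_def] by (rule LK.integrable_snd[OF base])
 \<comment> \<open>Where the product is not integrable the value of \<open>carre\<close> is a
   convention and no perturbation bound holds; the finiteness assumption confines this to a null
   set.\<close>
 have AEb: "AE m in kern L t. integrable L (\<lambda>x. \<D> x F (\<alpha> m) * \<D> x G (\<beta> m))"
  using LK.AE_integrable_snd[OF base] by simp
 define S1 where "S1 w = (\<integral>\<^sup>+x. ennreal \<bar>\<D>\<^sub>2 x (fst w) F (\<alpha> (snd w))\<bar> * ennreal \<bar>\<D> x G (\<beta> (snd w))\<bar> \<partial>L)" for w
 define S2 where "S2 w = (\<integral>\<^sup>+x. ennreal \<bar>\<D> x F (\<alpha> (snd w))\<bar> * ennreal \<bar>\<D>\<^sub>2 x (fst w) G (\<beta> (snd w))\<bar> \<partial>L)" for w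
 define S3 where "S3 w = (\<integral>\<^sup>+x. ennreal \<bar>\<D>\<^sub>2 x (fst w) F (\<alpha> (snd w))\<bar> * ennreal \<bar>\<D>\<^sub>2 x (fst w) G (\<beta> (snd w))\<bar> \<partial>L)" for w
 have m1: "(\<lambda>z. \<D> (fst z) H (snd (snd z))) \<in> \<B> (L \<Otimes>\<^sub>M (L \<Otimes>\<^sub>M \<N> L))"
  and m2: "(\<lambda>z. \<D>\<^sub>2 (fst z) (fst (snd z)) H (snd (snd z))) \<in> \<B> (L \<Otimes>\<^sub>M (L \<Otimes>\<^sub>M \<N> L))"
  if H: "H \<in> \<F> L" for H
  by (intro measurable_add_one_cost[OF H] measurable_add_one_cost2[OF H] measurable_fst
   m_comp[OF measurable_snd measurable_snd] m_comp[OF measurable_snd measurable_fst])+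
 have S1: "S1 \<in> \<B> (L \<Otimes>\<^sub>M kern L t)" "(\<integral>\<^sup>+w. epow (S1 w) p \<partial>(L \<Otimes>\<^sub>M kern L t)) \<le> ennreal (A powr p)"
  using carre_term_bound[OF t p(1), of "\<lambda>x y. \<D>\<^sub>2 x y F" "\<lambda>x y. \<D> x G"] m1[OF G] m2[OF F] A(2)
  by (auto simp: S1_def[abs_def] intro: order_trans)
 have S2: "S2 \<in> \<B> (L \<Otimes>\<^sub>M kern L t)" "(\<integral>\<^sup>+w. epow (S2 w) p \<partial>(L \<Otimes>\<^sub>M kern L t)) \<le> ennreal (B powr p)"
  using carre_term_bound[OF t p(1), of "\<lambda>x y. \<D> x F" "\<lambda>x y. \<D>\<^sub>2 x y G"] m1[OF F] m2[OF G] B(2)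
  by (auto simp: S2_def[abs_def] intro: order_trans)
 have S3: "S3 \<in> \<B> (L \<Otimes>\<^sub>M kern L t)" "(\<integral>\<^sup>+w. epow (S3 w) p \<partial>(L \<Otimes>\<^sub>M kern L t)) \<le> ennreal (C powr p)"
  using carre_term_bound[OF t p(1), of "\<lambda>x y. \<D>\<^sub>2 x y F" "\<lambda>x y. \<D>\<^sub>2 x y G"] m2[OF F] m2[OF G] C(2)
  by (auto simp: S3_def[abs_def] intro: order_trans)
 note [measurable] = S1(1) S2(1) S3(1)
 have S123: "(\<integral>\<^sup>+w. epow (S1 w + S2 w + S3 w) p \<partial>(L \<Otimes>\<^sub>M kern L t)) \<le> ennreal ((A + B + C) powr p)"
  using A B C S1(2) S2(2) S3(2) by (intro minkowski_add p) auto
 have xm: "(\<lambda>x. \<D> x H m) \<in> \<B> L" "(\<lambda>x. \<D>\<^sub>2 x y H m) \<in> \<B> L"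
  if "H \<in> \<F> L" "\<C> L m" "y \<in> space L" for H m y
  using that by (auto intro!: measurable_add_one_cost[OF that(1)] measurable_add_one_cost2[OF that(1)])
 have D: "ennreal \<bar>\<D> (y, k) (carre F G) m\<bar> \<le>
    (if k = (True, True) then S1 (y, m) + S2 (y, m) + S3 (y, m) else if k = (True, False) then S1 (y, m) else S2 (y, m))"
  if k: "k \<in> {(True, True), (True, False), (False, True)}" and y: "y \<in> space L" and m: "\<C> (mark_space L) m"
   and i: "integrable L (\<lambda>x. \<D> x F (\<alpha> m) * \<D> x G (\<beta> m))" for y k m
 proof -
  have s: "sets m = sets (mark_space L)" using m by (rule counting_measure_sets)
  have c: "\<C> L (\<alpha> m)" "\<C> L (\<beta> m)" using m by (auto intro: counting_measure_proj)
  note meas[measurable] = xm(1)[OF F c(1) y] xm(2)[OF F c(1) y] xm(1)[OF G c(2) y] xm(2)[OF G c(2) y]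
  define f g f' g' where "f x = \<D> x F (\<alpha> m)" and "g x = \<D> x G (\<beta> m)"
   and "f' x = \<D>\<^sub>2 x y F (\<alpha> m)" and "g' x = \<D>\<^sub>2 x y G (\<beta> m)" for x
  have [measurable]: "f \<in> \<B> L" "g \<in> \<B> L" "f' \<in> \<B> L" "g' \<in> \<B> L"
   using meas by (simp_all add: f_def[abs_def] g_def[abs_def] f'_def[abs_def] g'_def[abs_def])
  have ifg: "integrable L (\<lambda>x. f x * g x)" using i by (simp add: f_def g_def)
  have Seq: "S1 (y, m) = (\<integral>\<^sup>+x. ennreal \<bar>f' x * g x\<bar> \<partial>L)" "S2 (y, m) = (\<integral>\<^sup>+x. ennreal \<bar>f x * g' x\<bar> \<partial>L)"
   "S3 (y, m) = (\<integral>\<^sup>+x. ennreal \<bar>f' x * g' x\<bar> \<partial>L)"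
   by (simp_all add: S1_def S2_def S3_def f_def g_def f'_def g'_def abs_mult ennreal_mult)
  have \<alpha>d: "\<alpha> (add_dirac m (y, k)) = (if fst k then add_dirac (\<alpha> m) y else \<alpha> m)"
   and \<beta>d: "\<beta> (add_dirac m (y, k)) = (if snd k then add_dirac (\<beta> m) y else \<beta> m)"
   by (simp_all add: proj_add_dirac[OF s])
  have base: "carre F G m = (\<integral>x. f x * g x \<partial>L)" by (simp add: carre_def f_def g_def)
  consider "k = (True, True)" | "k = (True, False)" | "k = (False, True)" using k by blast
  then show ?thesis
  proof cases
   case 1
   have "carre F G (add_dirac m (y, k)) = (\<integral>x. f x * g x + (f' x * g x + f x * g' x + f' x * g' x) \<partial>L)"
    unfolding carre_def \<alpha>d \<beta>d using 1 by (simp add: add_one_cost_add_dirac f_def g_def f'_def g'_def algebra_simps)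
   then have "ennreal \<bar>\<D> (y, k) (carre F G) m\<bar> \<le> (\<integral>\<^sup>+x. ennreal \<bar>f' x * g x + f x * g' x + f' x * g' x\<bar> \<partial>L)"
    unfolding add_one_cost_def base using integral_perturb[OF ifg, of "\<lambda>x. f' x * g x + f x * g' x + f' x * g' x"] by simp
   also have "\<dots> \<le> (\<integral>\<^sup>+x. ennreal \<bar>f' x * g x\<bar> + ennreal \<bar>f x * g' x\<bar> + ennreal \<bar>f' x * g' x\<bar> \<partial>L)"
    by (intro nn_integral_mono) (auto simp: ennreal_plus[symmetric] simp del: ennreal_plus)
   also have "\<dots> = S1 (y, m) + S2 (y, m) + S3 (y, m)" unfolding Seq by (simp add: nn_integral_add)
   finally show ?thesis using 1 by simp
  next
   case 2
   have "carre F G (add_dirac m (y, k)) = (\<integral>x. f x * g x + f' x * g x \<partial>L)"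
    unfolding carre_def \<alpha>d \<beta>d using 2 by (simp add: add_one_cost_add_dirac f_def g_def f'_def g'_def algebra_simps)
   then show ?thesis unfolding add_one_cost_def base using 2 integral_perturb[OF ifg, of "\<lambda>x. f' x * g x"] by (simp add: Seq)
  next
   case 3
   have "carre F G (add_dirac m (y, k)) = (\<integral>x. f x * g x + f x * g' x \<partial>L)"
    unfolding carre_def \<alpha>d \<beta>d using 3 by (simp add: add_one_cost_add_dirac f_def g_def f'_def g'_def algebra_simps)
   then show ?thesis unfolding add_one_cost_def base using 3 integral_perturb[OF ifg, of "\<lambda>x. f x * g' x"] by (simp add: Seq)
  qed
 qed
 define E where "E z = (\<integral>\<^sup>+m. epow (ennreal \<bar>\<D> z (carre F G) m\<bar>) p \<partial>kern L t)" for z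
 have Em: "E \<in> \<B> (mark_space L)"
  unfolding E_def
 proof (rule K.borel_measurable_nn_integral)
  have "(\<lambda>z. \<D> (fst z) (carre F G) (snd z)) \<in> \<B> (mark_space L \<Otimes>\<^sub>M kern L t)"
   using cm by (rule measurable_add_one_cost) (simp_all cong: measurable_cong_sets add: sK measurable_snd)
  then show "(\<lambda>(z, m). epow (ennreal \<bar>\<D> z (carre F G) m\<bar>) p) \<in> \<B> (mark_space L \<Otimes>\<^sub>M kern L t)"
   unfolding case_prod_beta' by measurable
 qed
 define e1 e2 e3 where "e1 y = (\<integral>\<^sup>+m. epow (S1 (y, m)) p \<partial>kern L t)"
  and "e2 y = (\<integral>\<^sup>+m. epow (S2 (y, m)) p \<partial>kern L t)"
  and "e3 y = (\<integral>\<^sup>+m. epow (S1 (y, m) + S2 (y, m) + S3 (y, m)) p \<partial>kern L t)" for y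
 have e: "integral\<^sup>N L e1 \<le> ennreal (A powr p)" "integral\<^sup>N L e2 \<le> ennreal (B powr p)" "integral\<^sup>N L e3 \<le> ennreal ((A + B + C) powr p)"
  unfolding e1_def[abs_def] e2_def[abs_def] e3_def[abs_def]
  using S1(2) S2(2) S123 K.nn_integral_fst[of "\<lambda>w. epow (S1 w) p"] K.nn_integral_fst[of "\<lambda>w. epow (S2 w) p"]
   K.nn_integral_fst[of "\<lambda>w. epow (S1 w + S2 w + S3 w) p"] by simp_all
 have em[measurable]: "e1 \<in> \<B> L" "e2 \<in> \<B> L" "e3 \<in> \<B> L"
  unfolding e1_def[abs_def] e2_def[abs_def] e3_def[abs_def] by (rule K.borel_measurable_nn_integral, measurable)+
 have Ele: "E (y, True, True) \<le> e3 y" "E (y, True, False) \<le> e1 y" "E (y, False, True) \<le> e2 y" if y: "y \<in> space L" for y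
 proof -
  have mono: "E (y, k) \<le> (\<integral>\<^sup>+m. epow (h m) p \<partial>kern L t)"
   if "\<And>m. \<C> (mark_space L) m \<Longrightarrow> integrable L (\<lambda>x. \<D> x F (\<alpha> m) * \<D> x G (\<beta> m)) \<Longrightarrow>
    ennreal \<bar>\<D> (y, k) (carre F G) m\<bar> \<le> h m" for k h
   unfolding E_def
  proof (rule nn_integral_mono_AE)
   show "AE m in kern L t. epow (ennreal \<bar>\<D> (y, k) (carre F G) m\<bar>) p \<le> epow (h m) p"
    using AEb AE_space by eventually_elim (use p that in \<open>auto simp: spK simp del: epow_ennreal intro!: epow_mono\<close>)
  qed
  show "E (y, True, True) \<le> e3 y" "E (y, True, False) \<le> e1 y" "E (y, False, True) \<le> e2 y"
   unfolding e1_def e2_def e3_def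
   using D[OF _ y, of "(True, True)"] D[OF _ y, of "(True, False)"] D[OF _ y, of "(False, True)"] by (auto intro!: mono)
 qed
 define s where "s = A + B + C"
 have s0: "0 \<le> s" using A B C by (simp add: s_def)
 have "(\<integral>\<^sup>+z. E z \<partial>marked L t) \<le> (\<integral>\<^sup>+y. ennreal t * e3 y + ennreal (1 - t) * e1 y + ennreal (1 - t) * e2 y \<partial>L)"
  unfolding nn_integral_marked[OF Em] by (intro nn_integral_mono add_mono mult_left_mono Ele) auto
 also have "\<dots> = ennreal t * integral\<^sup>N L e3 + ennreal (1 - t) * integral\<^sup>N L e1 + ennreal (1 - t) * integral\<^sup>N L e2"
  by (simp add: nn_integral_add nn_integral_cmult)
 also have "\<dots> \<le> ennreal t * ennreal (s powr p) + ennreal (1 - t) * ennreal (A powr p) + ennreal (1 - t) * ennreal (B powr p)"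
  using e by (intro add_mono mult_left_mono) (auto simp: s_def)
 also have "\<dots> = ennreal (t * s powr p + (1 - t) * A powr p + (1 - t) * B powr p)"
  using t by (simp add: ennreal_mult[symmetric] ennreal_plus[symmetric] del: ennreal_plus)
 also have "\<dots> \<le> ennreal (s powr p)"
 proof (rule ennreal_leI)
  \<comment> \<open>This makes the \<open>p\<close>-th power superadditive below \<open>s\<close>,
    so the powers of \<open>A\<close> and \<open>B\<close> add up to at most that of
    \<open>s\<close>, and the mixture with weights \<open>t\<close> and \<open>1 - t\<close> is
    bounded uniformly in \<open>t\<close>.\<close>
  have *: "z powr p \<le> z * s powr (p - 1)" if "0 \<le> z" "z \<le> s" for z
  proof -
   have "z powr p = z * z powr (p - 1)" using powr_mult_base[OF that(1), of "p - 1"] by simp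
   also have "\<dots> \<le> z * s powr (p - 1)" using that p by (intro mult_left_mono powr_mono2) auto
   finally show ?thesis .
  qed
  have "A powr p + B powr p \<le> A * s powr (p - 1) + B * s powr (p - 1)"
   using *[of A] *[of B] A B C by (intro add_mono) (auto simp: s_def)
  also have "\<dots> \<le> s * s powr (p - 1)" using A B C unfolding distrib_right[symmetric] by (intro mult_right_mono) (auto simp: s_def)
  also have "\<dots> = s powr p" using powr_mult_base[OF s0, of "p - 1"] by simp
  finally have "(1 - t) * (A powr p + B powr p) \<le> (1 - t) * s powr p" using t by (intro mult_left_mono) auto
  then show "t * s powr p + (1 - t) * A powr p + (1 - t) * B powr p \<le> s powr p" by (simp add: algebra_simps)
 qed
 finally have Ebound: "(\<integral>\<^sup>+z. E z \<partial>marked L t) \<le> ennreal (s powr p)" .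
 obtain Y where Y: "\<And>k. Y k \<in> sets (marked L t)" "incseq Y" "(\<Union>k. Y k) = space (marked L t)" "\<And>k. emeasure (marked L t) (Y k) < \<infinity>"
  using exhaustion_exists[OF sigma_finite_marked[OF L t]] by metis
 \<comment> \<open>The marked measure with its own exhaustion is again a Poisson space, whose law is
   the coupling \<open>kern L t\<close>.\<close>
 interpret MK: poisson_space "marked L t" "kern L t" Y
  by (intro poisson_space.intro sigma_finite_marked[OF L t] poisson_space_axioms.intro pois_law_kern[OF L t] Y)
 have "ennreal (\<integral>m. \<bar>carre F G m - (\<integral>\<nu>. carre F G \<nu> \<partial>kern L t)\<bar> \<partial>kern L t)
  \<le> ennreal (2 powr (2 / p - 1)) * epow (\<integral>\<^sup>+z. E z \<partial>marked L t) (1 / p)"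
  unfolding E_def using cm by (intro MK.p_poincare ci p) simp
 also have "\<dots> \<le> ennreal (2 powr (2 / p - 1)) * epow (ennreal (s powr p)) (1 / p)"
  using p by (intro mult_left_mono epow_mono Ebound) auto
 also have "\<dots> = ennreal (2 powr (2 / p - 1) * s)"
  using p s0 by (simp add: powr_powr ennreal_mult)
 finally show "(\<integral>m. \<bar>carre F G m - (\<integral>\<nu>. carre F G \<nu> \<partial>kern L t)\<bar> \<partial>kern L t) \<le> 2 powr (2 / p - 1) * (A + B + C)"
  using s0 by (simp add: s_def)
qed

end

section \<open>Gaussian integration by parts\<close>

text \<open>Finite products of shifted cosines replace complex characters: they are closed under
  multiplication, and the product formula expands them into cosines, so statements need to be
  checked on single cosines only.\<close>

inductive_set trig :: "('a::euclidean_space \<Rightarrow> real) set" where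
 one: "(\<lambda>_. 1) \<in> trig"
| cos: "\<psi> \<in> trig \<Longrightarrow> (\<lambda>x. \<psi> x * cos (\<xi> \<bullet> x + c)) \<in> trig"

lemma trig_mult: "\<psi> \<in> trig \<Longrightarrow> \<phi> \<in> trig \<Longrightarrow> (\<lambda>x. \<phi> x * \<psi> x) \<in> trig"
proof (induction rule: trig.induct)
 case (cos \<psi> \<xi> c)
 then show ?case using trig.cos[of "\<lambda>x. \<phi> x * \<psi> x" \<xi> c] by (simp add: mult.assoc)
qed simp

lemma trig_measurable: "\<psi> \<in> trig \<Longrightarrow> \<psi> \<in> \<B> borel"
 by (induction rule: trig.induct) auto

lemma trig_bound: "\<psi> \<in> trig \<Longrightarrow> \<bar>\<psi> x\<bar> \<le> 1"
 by (induction rule: trig.induct) (auto simp: abs_mult intro!: mult_le_one)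

text \<open>Recovers a linear function from bounded trigonometric ones. Hence the coordinates are
  measurable for the \<sigma>-algebra generated by \<open>trig\<close>, which is therefore the Borel
  one.\<close>

lemma sin_scaled_limit: "(\<lambda>n. real n * sin (y / real n)) \<longlonglongrightarrow> y"
proof -
 have "((\<lambda>h. sin (y * h)) has_real_derivative y) (at 0)"
  by (auto intro!: derivative_eq_intros)
 from DERIV_D[OF this] have "((\<lambda>h. sin (y * h) / h) \<longlongrightarrow> y) (at 0)"
  by simp
 moreover have "filterlim (\<lambda>n. 1 / real n) (at 0) sequentially"
  unfolding filterlim_at using lim_1_over_n[where 'a=real] eventually_gt_at_top[of 0]
  by (auto elim: eventually_mono)
 ultimately have "(\<lambda>n. sin (y * (1 / real n)) / (1 / real n)) \<longlonglongrightarrow> y"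
  by (rule filterlim_compose)
 then show ?thesis by (simp add: mult.commute)
qed

text \<open>The mean value theorem bounds all difference quotients by \<open>w\<close>, so dominated
  convergence applies along any sequence of increments. Measurability of \<open>f' r\<close> comes
  from its being a limit of such quotients.\<close>

lemma has_real_derivative_integral:
 fixes f f' :: "real \<Rightarrow> 'a \<Rightarrow> real"
 assumes D: "\<And>r u. u \<in> space M \<Longrightarrow> ((\<lambda>r. f r u) has_real_derivative f' r u) (at r)"
  and f: "\<And>r. integrable M (f r)"
  and B: "\<And>r u. u \<in> space M \<Longrightarrow> \<bar>f' r u\<bar> \<le> w u" and w: "integrable M w"
 shows "integrable M (f' r)"
  and "((\<lambda>r. \<integral>u. f r u \<partial>M) has_real_derivative (\<integral>u. f' r u \<partial>M)) (at r)"
proof -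
 have lip: "\<bar>f (r + h) u - f r u\<bar> \<le> w u * \<bar>h\<bar>" if u: "u \<in> space M" for h u
  using field_differentiable_bound[of UNIV "\<lambda>r. f r u" "\<lambda>r. f' r u" "w u" "r + h" r] D[OF u] B[OF u] by simp
 have *: "integrable M (f' r) \<and> (\<lambda>n. ((\<integral>u. f (r + S n) u \<partial>M) - (\<integral>u. f r u \<partial>M)) / S n) \<longlonglongrightarrow> (\<integral>u. f' r u \<partial>M)"
  if S: "\<And>n. S n \<noteq> 0" "S \<longlonglongrightarrow> 0" for S :: "nat \<Rightarrow> real"
 proof -
  have hl: "filterlim S (at 0) sequentially" using S by (auto simp: filterlim_at)
  have l: "(\<lambda>n. (f (r + S n) u - f r u) / S n) \<longlonglongrightarrow> f' r u" if "u \<in> space M" for u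
   using filterlim_compose[OF DERIV_D[OF D[OF that, of r]] hl] by simp
  note [measurable] = borel_measurable_integrable[OF f]
  have m: "f' r \<in> \<B> M"
   by (rule borel_measurable_LIMSEQ_real[OF l]) measurable
  have b: "AE u in M. norm ((f (r + S n) u - f r u) / S n) \<le> w u" for n
   using lip[of _ "S n"] S(1)[of n] by (intro AE_I2) (simp add: divide_le_eq)
  have "integrable M (f' r)"
   by (rule integrable_dominated_convergence[OF m _ w _ b]) (auto intro: l)
  moreover have "(\<lambda>n. \<integral>u. (f (r + S n) u - f r u) / S n \<partial>M) \<longlonglongrightarrow> (\<integral>u. f' r u \<partial>M)"
   by (rule integral_dominated_convergence[OF m _ w _ b]) (auto intro: l)
  ultimately show ?thesis using f by simp
 qed
 show "integrable M (f' r)"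
  using *[of "\<lambda>n. 1 / real (Suc n)"] LIMSEQ_Suc[OF lim_1_over_n[where 'a=real]] by auto
 show "((\<lambda>r. \<integral>u. f r u \<partial>M) has_real_derivative (\<integral>u. f' r u \<partial>M)) (at r)"
  unfolding DERIV_def tendsto_at_iff_sequentially using * by (auto simp: o_def)
qed

theorem borel_bounded_induct:
 fixes f :: "'a::euclidean_space \<Rightarrow> real"
 assumes f: "f \<in> \<B> borel" "\<And>x. \<bar>f x\<bar> \<le> B"
  and H_cos: "\<And>\<xi> c. H (\<lambda>x. cos (\<xi> \<bullet> x + c))"
  and H_lin: "\<And>B c d f g. f \<in> \<B> borel \<Longrightarrow> (\<And>x. \<bar>f x\<bar> \<le> B) \<Longrightarrow> H f \<Longrightarrow>
    g \<in> \<B> borel \<Longrightarrow> (\<And>x. \<bar>g x\<bar> \<le> B) \<Longrightarrow> H g \<Longrightarrow> H (\<lambda>x. c * f x + d * g x)"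
  and H_lim: "\<And>B h g. (\<And>n. h n \<in> \<B> borel) \<Longrightarrow> (\<And>n x. \<bar>h n x\<bar> \<le> B) \<Longrightarrow>
    (\<And>n. H (h n)) \<Longrightarrow> g \<in> \<B> borel \<Longrightarrow> (\<And>x. (\<lambda>n. h n x) \<longlonglongrightarrow> g x) \<Longrightarrow> H g"
 shows "H f"
proof -
 have cosm: "(\<lambda>x. cos (\<xi> \<bullet> x + c)) \<in> trig" for \<xi> :: 'a and c
  using trig.cos[OF trig.one, of \<xi> c] by simp
 \<comment> \<open>The frequency and phase of the last cosine are arbitrary in the induction:
   removing one factor from the product replaces them by their sum and difference with those of that
   factor.\<close>
 have H_cos': "H (\<lambda>x. \<psi> x * cos (\<xi> \<bullet> x + c))" if "\<psi> \<in> trig" for \<psi> \<xi> c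
  using that
 proof (induction arbitrary: \<xi> c rule: trig.induct)
  case one
  then show ?case using H_cos by simp
 next
  case (cos \<psi> \<xi>' c')
  have "H (\<lambda>x. 1 / 2 * (\<psi> x * cos ((\<xi>' - \<xi>) \<bullet> x + (c' - c))) + 1 / 2 * (\<psi> x * cos ((\<xi>' + \<xi>) \<bullet> x + (c' + c))))"
   using cos trig.cos[OF cos(1)]
   by (intro H_lin[where B=1] trig_measurable trig_bound trig.cos) auto
  also have "(\<lambda>x. 1 / 2 * (\<psi> x * cos ((\<xi>' - \<xi>) \<bullet> x + (c' - c))) + 1 / 2 * (\<psi> x * cos ((\<xi>' + \<xi>) \<bullet> x + (c' + c))))
   = (\<lambda>x. \<psi> x * cos (\<xi>' \<bullet> x + c') * cos (\<xi> \<bullet> x + c))"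
  proof
   fix x
   have "cos (\<xi>' \<bullet> x + c') * cos (\<xi> \<bullet> x + c) = (cos ((\<xi>' - \<xi>) \<bullet> x + (c' - c)) + cos ((\<xi>' + \<xi>) \<bullet> x + (c' + c))) / 2"
    by (simp add: cos_times_cos inner_diff_left inner_add_left algebra_simps)
   from arg_cong[OF this, of "\<lambda>y. \<psi> x * y"] show "1 / 2 * (\<psi> x * cos ((\<xi>' - \<xi>) \<bullet> x + (c' - c))) + 1 / 2 * (\<psi> x * cos ((\<xi>' + \<xi>) \<bullet> x + (c' + c)))
    = \<psi> x * cos (\<xi>' \<bullet> x + c') * cos (\<xi> \<bullet> x + c)"
    by (simp add: mult.assoc distrib_left)
  qed
  finally show ?case .
 qed
 have H_one: "H (\<lambda>_. 1)" using H_cos[of 0 0] by simp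
 interpret bounded_class "borel :: 'a measure" trig H
 proof
  show "H \<psi>" if "\<psi> \<in> trig" for \<psi> using that by cases (use H_one H_cos' in auto)
  let ?G = "{{x \<in> space borel. \<tau> \<le> \<psi> x} |\<psi> \<tau>. \<psi> \<in> (trig :: ('a \<Rightarrow> real) set)}"
  define N where "N = sigma UNIV ?G"
  have sN: "space N = UNIV" "sets N = sigma_sets UNIV ?G"
   unfolding N_def by (auto simp: space_measure_of_conv sets_measure_of)
  have cN: "(\<lambda>x. cos (\<xi> \<bullet> x + c)) \<in> \<B> N" for \<xi> c
  proof (subst borel_measurable_iff_ge, intro allI)
   fix \<tau> :: real
   show "{x \<in> space N. \<tau> \<le> cos (\<xi> \<bullet> x + c)} \<in> sets N"
    unfolding sN using cosm[of \<xi> c] by (intro sigma_sets.Basic) auto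
  qed
  have "(\<lambda>x. x) \<in> \<B> N"
  proof (subst borel_measurable_euclidean_space, rule ballI)
   fix i :: 'a
   show "(\<lambda>x. x \<bullet> i) \<in> \<B> N"
   proof (rule borel_measurable_LIMSEQ_real)
    show "(\<lambda>n. real n * sin (x \<bullet> i / real n)) \<longlonglongrightarrow> x \<bullet> i" for x by (rule sin_scaled_limit)
    have e: "sin (x \<bullet> i / real n) = cos ((- (1 / real n) *\<^sub>R i) \<bullet> x + pi / 2)" for x n
     by (simp add: sin_cos_eq inner_commute)
    show "(\<lambda>x. real n * sin (x \<bullet> i / real n)) \<in> \<B> N" for n
     unfolding e by (intro borel_measurable_times borel_measurable_const cN)
   qed
  qed
  then have "A \<in> sets N" if "A \<in> sets borel" for A
   using measurable_sets[of "\<lambda>x. x" N borel A] that by (simp add: sN(1))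
  then show "sets borel \<subseteq> sigma_sets (space borel) ?G" by (auto simp: sN(2))
 next
  show "H (\<lambda>x. c * f x + d * g x)" if "f \<in> \<B> borel"
    "\<And>x. x \<in> space borel \<Longrightarrow> \<bar>f x\<bar> \<le> B" "H f" "g \<in> \<B> borel"
    "\<And>x. x \<in> space borel \<Longrightarrow> \<bar>g x\<bar> \<le> B" "H g" for f g :: "'a \<Rightarrow> real" and B c d
   by (rule H_lin[of f B g]) (use that in simp_all)
  show "H g" if "\<And>n. h n \<in> \<B> borel"
    "\<And>n x. x \<in> space borel \<Longrightarrow> \<bar>h n x\<bar> \<le> B" "\<And>n. H (h n)" "g \<in> \<B> borel"
    "\<And>x. x \<in> space borel \<Longrightarrow> (\<lambda>n. h n x) \<longlonglongrightarrow> g x" for h B and g :: "'a \<Rightarrow> real"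
   by (rule H_lim[of h B g]) (use that in simp_all)
 qed (auto intro: trig_mult trig_measurable trig_bound trig.one)
 show ?thesis by (rule bounded_measurable[where B=B]) (use f in auto)
qed

locale gaussian = prob_space N for N :: "'v measure" +
 fixes X :: "'v \<Rightarrow> real^'m::finite" and C :: "real^'m^'m"
 assumes gauss: "gaussian_vector N X C" and psd: "pos_semidef C"
begin

definition Q :: "real^'m \<Rightarrow> real" where "Q a = a \<bullet> (C *v a)"

lemma Q_nonneg: "0 \<le> Q a"
 using psd by (simp add: Q_def pos_semidef_def)

lemma C_sym: "a \<bullet> (C *v b) = b \<bullet> (C *v a)"
proof -
 have "a v* C = a v* transpose C" using psd by (simp add: pos_semidef_def)
 then show ?thesis by (metis dot_lmul_matrix vector_transpose_matrix inner_commute)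
qed

lemma Q_add: "Q (a + b) = Q a + 2 * (a \<bullet> (C *v b)) + Q b"
 unfolding Q_def using C_sym[of a b] by (simp add: matrix_vector_right_distrib inner_add_left inner_add_right)

lemma Q_scale: "Q (c *\<^sub>R a) = c\<^sup>2 * Q a"
 by (simp add: Q_def matrix_vector_mult_scaleR power2_eq_square)

lemma Xm [measurable]: "X \<in> \<B> N"
 using gauss by (simp add: gaussian_vector_def)

lemma Q_zero: "Q a = 0 \<Longrightarrow> AE u in N. a \<bullet> X u = 0"
proof -
 assume "Q a = 0"
 then have d: "distr N borel (\<lambda>u. a \<bullet> X u) = return borel 0"
  using gauss by (simp add: gaussian_vector_def Q_def)
 have "AE x in return borel (0::real). x = 0" by (simp add: AE_return)
 then have "AE x in distr N borel (\<lambda>u. a \<bullet> X u). x = 0" by (simp only: d)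
 then show ?thesis by (simp add: AE_distr_iff)
qed

lemma std:
 assumes "Q a \<noteq> 0"
 shows "distr N borel (\<lambda>u. (a \<bullet> X u) / sqrt (Q a)) = std_normal_distribution"
proof -
 have s: "0 < sqrt (Q a)" using assms Q_nonneg[of a] by simp
 have "distributed N lborel (\<lambda>u. a \<bullet> X u) (\<lambda>u. ennreal (normal_density 0 (sqrt (Q a)) u))"
  using gauss assms by (auto simp: distributed_def gaussian_vector_def Q_def cong: distr_cong)
 then have "distributed N lborel (\<lambda>u. (a \<bullet> X u - 0) / sqrt (Q a)) std_normal_density"
  by (rule normal_standard_normal_convert[OF s, THEN iffD1])
 then show ?thesis by (auto simp: distributed_def cong: distr_cong)
qed

lemma integrable_comp_std:
 fixes g :: "real \<Rightarrow> 'b::{banach, second_countable_topology}"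
 assumes "Q a \<noteq> 0" "g \<in> \<B> borel" 
 shows "integrable N (\<lambda>u. g ((a \<bullet> X u) / sqrt (Q a))) \<longleftrightarrow> integrable std_normal_distribution g"
  and "(\<integral>u. g ((a \<bullet> X u) / sqrt (Q a)) \<partial>N) = (\<integral>x. g x \<partial>std_normal_distribution)"
 using integrable_distr_eq[of "\<lambda>u. (a \<bullet> X u) / sqrt (Q a)" N borel g] integral_distr[of "\<lambda>u. (a \<bullet> X u) / sqrt (Q a)" N borel g]
  std[OF assms(1)] assms(2) by simp_all

lemma square_integrable: "integrable N (\<lambda>u. (a \<bullet> X u)\<^sup>2)"
proof (cases "Q a = 0")
 case True
 then have "AE u in N. (a \<bullet> X u)\<^sup>2 = 0" using Q_zero[OF True] by auto
 then show ?thesis by (subst integrable_cong_AE[where g="\<lambda>_. 0"]) auto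
next
 case False
 have "integrable N (\<lambda>u. ((a \<bullet> X u) / sqrt (Q a))\<^sup>2)"
  using integrable_comp_std(1)[OF False, of "\<lambda>x. x\<^sup>2"] integrable_std_normal_distribution_moment[of 2] by simp
 from integrable_mult_right[OF this, of "Q a"] show ?thesis
  using False Q_nonneg[of a] by (simp add: power_divide)
qed

lemma integrable_inner: "integrable N (\<lambda>u. a \<bullet> X u)"
 by (rule square_integrable_imp_integrable[OF _ square_integrable]) measurable

lemma abs_moment_inner: "(\<integral>u. \<bar>a \<bullet> X u\<bar> \<partial>N) = sqrt (2 / pi) * sqrt (Q a)"
proof (cases "Q a = 0")
 case True
 then have "AE u in N. \<bar>a \<bullet> X u\<bar> = 0" using Q_zero[OF True] by auto
 then have "(\<integral>u. \<bar>a \<bullet> X u\<bar> \<partial>N) = (\<integral>u. 0 \<partial>N)" by (intro integral_cong_AE) auto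
 then show ?thesis using True by simp
next
 case False
 have "(\<integral>u. \<bar>(a \<bullet> X u) / sqrt (Q a)\<bar> \<partial>N) = sqrt (2 / pi)"
  using integrable_comp_std(2)[OF False, of "\<lambda>x. \<bar>x\<bar>"] std_normal_distribution_odd_moments_abs[of 0] by simp
 then show ?thesis using False Q_nonneg[of a] by (simp add: field_simps)
qed

text \<open>Real and imaginary part of the standard normal characteristic function, with the phase
  split off by the addition theorem. In a degenerate direction the inner product vanishes almost
  surely.\<close>

lemma integral_cos_inner: "(\<integral>u. cos (\<xi> \<bullet> X u + d) \<partial>N) = cos d * exp (- (Q \<xi> / 2))"
proof (cases "Q \<xi> = 0")
 case True
 then have "AE u in N. cos (\<xi> \<bullet> X u + d) = cos d" using Q_zero[OF True] by auto
 then have "(\<integral>u. cos (\<xi> \<bullet> X u + d) \<partial>N) = (\<integral>u. cos d \<partial>N)" by (intro integral_cong_AE) auto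
 then show ?thesis using True by (simp add: prob_space)
next
 case False
 define s where "s = sqrt (Q \<xi>)"
 have s: "s \<noteq> 0" using False by (simp add: s_def)
 interpret S: real_distribution std_normal_distribution by (rule real_dist_normal_dist)
 have "(CLINT x|std_normal_distribution. iexp (s * x)) = complex_of_real (exp (- (s\<^sup>2) / 2))"
  using char_std_normal_distribution[THEN fun_cong, of s] by (simp add: char_def)
 moreover have i: "integrable std_normal_distribution (\<lambda>x. iexp (s * x))" by (rule S.integrable_iexp) (simp_all del: of_real_mult)
 moreover have "Re (iexp (s * x)) = cos (s * x)" "Im (iexp (s * x)) = sin (s * x)" for x
  by (simp_all only: cis_conv_exp[symmetric] cis.sel)
 ultimately have c: "(\<integral>x. cos (s * x) \<partial>std_normal_distribution) = exp (- (s\<^sup>2) / 2)"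
  and sn: "(\<integral>x. sin (s * x) \<partial>std_normal_distribution) = 0"
  using integral_Re[OF i] integral_Im[OF i] by (simp_all del: of_real_mult of_real_exp)
 have ic: "integrable std_normal_distribution (\<lambda>x. cos (s * x))" "integrable std_normal_distribution (\<lambda>x. sin (s * x))"
  by (rule S.integrable_const_bound[where B=1]; simp)+
 have "(\<integral>u. cos (\<xi> \<bullet> X u + d) \<partial>N) = (\<integral>u. cos (s * ((\<xi> \<bullet> X u) / sqrt (Q \<xi>)) + d) \<partial>N)"
  using s by (simp add: s_def)
 also have "\<dots> = (\<integral>x. cos (s * x + d) \<partial>std_normal_distribution)"
  by (rule integrable_comp_std(2)[OF False]) measurable
 also have "\<dots> = (\<integral>x. cos d * cos (s * x) - sin d * sin (s * x) \<partial>std_normal_distribution)"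
  by (simp add: cos_add mult.commute)
 also have "\<dots> = cos d * exp (- (s\<^sup>2) / 2)" using ic c sn by simp
 finally show ?thesis using Q_nonneg[of \<xi>] by (simp add: s_def)
qed

text \<open>The previous identity is differentiated in the frequency, along the direction
  \<open>a\<close>: the cosine becomes a sine with the factor \<open>a \<bullet> X\<close>, and the
  quadratic form produces the mixed term.\<close>

lemma integral_inner_sin:
 "(\<integral>u. (a \<bullet> X u) * sin (\<xi> \<bullet> X u + d) \<partial>N) = (\<xi> \<bullet> (C *v a)) * cos d * exp (- (Q \<xi> / 2))"
proof -
 define w where "w \<tau> = (\<integral>u. cos (\<xi> \<bullet> X u + \<tau> * (a \<bullet> X u) + d) \<partial>N)" for \<tau>
 have "w \<tau> = cos d * exp (- (Q (\<xi> + \<tau> *\<^sub>R a) / 2))" for \<tau>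
  unfolding w_def integral_cos_inner[symmetric] by (simp add: inner_add_left)
 then have weq: "w = (\<lambda>\<tau>. cos d * exp (- ((Q \<xi> + 2 * \<tau> * (\<xi> \<bullet> (C *v a)) + \<tau>\<^sup>2 * Q a) / 2)))"
  unfolding Q_add Q_scale by (simp add: fun_eq_iff matrix_vector_mult_scaleR mult.assoc)
 have "(w has_real_derivative (- (\<xi> \<bullet> (C *v a)) * cos d * exp (- (Q \<xi> / 2)))) (at 0)"
  unfolding weq by (auto intro!: derivative_eq_intros)
 moreover have "(w has_real_derivative (\<integral>u. - ((a \<bullet> X u) * sin (\<xi> \<bullet> X u + 0 * (a \<bullet> X u) + d)) \<partial>N)) (at 0)"
  unfolding w_def
 proof (rule has_real_derivative_integral[where w="\<lambda>u. \<bar>a \<bullet> X u\<bar>"])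
  show "integrable N (\<lambda>u. cos (\<xi> \<bullet> X u + \<tau> * (a \<bullet> X u) + d))" for \<tau>
   by (rule integrable_const_bound[where B=1]) auto
 qed (auto intro!: derivative_eq_intros integrable_inner simp: abs_mult mult_left_le)
 ultimately have "- (\<xi> \<bullet> (C *v a)) * cos d * exp (- (Q \<xi> / 2)) = (\<integral>u. - ((a \<bullet> X u) * sin (\<xi> \<bullet> X u + 0 * (a \<bullet> X u) + d)) \<partial>N)"
  by (rule DERIV_unique)
 then show ?thesis by simp
qed

abbreviation "U01 \<equiv> uniform_measure lborel {0..1::real}"

sublocale U: prob_space U01 by (rule prob_space_uniform_measure) auto
sublocale UN: pair_prob_space U01 N ..

lemma distr_UN_snd: "distr (U01 \<Otimes>\<^sub>M N) N snd = N"
proof (rule measure_eqI)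
 fix A assume "A \<in> sets (distr (U01 \<Otimes>\<^sub>M N) N snd)"
 then have A: "A \<in> sets N" by simp
 have "snd -` A \<inter> space (U01 \<Otimes>\<^sub>M N) = space U01 \<times> A"
  using sets.sets_into_space[OF A] by (auto simp: space_pair_measure)
 then show "emeasure (distr (U01 \<Otimes>\<^sub>M N) N snd) A = emeasure N A"
  using emeasure_pair_measure_Times[OF sets.top[of U01] A] A U.emeasure_space_1
  by (simp add: emeasure_distr del: space_uniform_measure)
qed simp

lemma integral_U01_FTC:
 assumes "\<And>s. (F has_real_derivative f s) (at s)" "continuous_on UNIV f"
 shows "(\<integral>s. f s \<partial>U01) = F 1 - F 0"
proof -
 have m [measurable]: "f \<in> \<B> borel" using assms(2) by (rule borel_measurable_continuous_onI)
 have "(\<integral>s. f s \<partial>U01) = (\<integral>s. f s \<partial>density lborel (\<lambda>s. ennreal (indicator {0..1} s)))"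
  unfolding uniform_measure_def by (simp add: divide_ennreal_def ennreal_indicator)
 also have "\<dots> = (\<integral>s. indicator {0..1} s *\<^sub>R f s \<partial>lborel)"
  by (rule integral_density) auto
 also have "\<dots> = F 1 - F 0"
 proof (rule integral_FTC_atLeastAtMost)
  show "(F has_vector_derivative f s) (at s within {0..1})" for s
   using assms(1)[of s] has_field_derivative_at_within has_real_derivative_iff_has_vector_derivative by blast
  show "continuous_on {0..1} f" using assms(2) continuous_on_subset by blast
 qed simp
 finally show ?thesis .
qed

lemma integrable_norm: "integrable N (\<lambda>u. (norm (X u))\<^sup>2)" "integrable N (\<lambda>u. norm (X u))"
proof -
 have "(norm (X u))\<^sup>2 = (\<Sum>i\<in>UNIV. (axis i 1 \<bullet> X u)\<^sup>2)" for u
  unfolding power2_norm_eq_inner inner_axis' by (simp add: inner_vec_def power2_eq_square)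
 then show i: "integrable N (\<lambda>u. (norm (X u))\<^sup>2)" using square_integrable by simp
 show "integrable N (\<lambda>u. norm (X u))" by (rule square_integrable_imp_integrable[OF _ i]) measurable
qed

lemma integrable_linear_growth:
 assumes m [measurable]: "\<phi> \<in> \<B> borel" and K: "\<And>x. \<bar>\<phi> x\<bar> \<le> K * (1 + norm x)"
 shows "integrable N (\<lambda>u. \<phi> (X u + v))"
  and "integrable (U01 \<Otimes>\<^sub>M N) (\<lambda>z. \<bar>a \<bullet> X (snd z)\<bar> * (K * (1 + norm (X (snd z)) + norm v)))"
  and "0 \<le> s \<Longrightarrow> s \<le> 1 \<Longrightarrow> \<bar>\<phi> (x + s *\<^sub>R v)\<bar> \<le> K * (1 + norm x + norm v)"
proof -
 have K0: "0 \<le> K" using K[of 0] by auto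
 have le: "\<bar>\<phi> (x + s *\<^sub>R v)\<bar> \<le> K * (1 + norm x + norm v)" if "0 \<le> s" "s \<le> 1" for x s
 proof -
  have "norm (x + s *\<^sub>R v) \<le> norm x + s * norm v" using norm_triangle_ineq[of x "s *\<^sub>R v"] that by simp
  also have "\<dots> \<le> norm x + 1 * norm v" using that by (intro add_left_mono mult_right_mono) auto
  finally have "K * (1 + norm (x + s *\<^sub>R v)) \<le> K * (1 + norm x + norm v)" using K0 by (intro mult_left_mono) auto
  with K[of "x + s *\<^sub>R v"] show ?thesis by linarith
 qed
 then show "0 \<le> s \<Longrightarrow> s \<le> 1 \<Longrightarrow> \<bar>\<phi> (x + s *\<^sub>R v)\<bar> \<le> K * (1 + norm x + norm v)" .
 show "integrable N (\<lambda>u. \<phi> (X u + v))"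
 proof (rule B_integrable_bound)
  show "integrable N (\<lambda>u. K * (1 + norm (X u) + norm v))" using integrable_norm by simp
  show "AE u in N. norm (\<phi> (X u + v)) \<le> norm (K * (1 + norm (X u) + norm v))"
   using le[of 1] K0 by (auto intro!: order_trans[OF _ abs_ge_self])
 qed simp
 have "integrable N (\<lambda>u. \<bar>a \<bullet> X u\<bar> * (K * (1 + norm (X u) + norm v)))"
 proof (rule B_integrable_bound)
  show "integrable N (\<lambda>u. K * norm a * ((norm (X u))\<^sup>2 + (1 + norm v) * norm (X u)))" using integrable_norm by simp
  show "AE u in N. norm (\<bar>a \<bullet> X u\<bar> * (K * (1 + norm (X u) + norm v))) \<le> norm (K * norm a * ((norm (X u))\<^sup>2 + (1 + norm v) * norm (X u)))"
  proof (rule AE_I2)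
   fix u
   have "\<bar>a \<bullet> X u\<bar> * (K * (1 + norm (X u) + norm v)) \<le> (norm a * norm (X u)) * (K * (1 + norm (X u) + norm v))"
    using K0 by (intro mult_right_mono Cauchy_Schwarz_ineq2) auto
   also have "\<dots> = K * norm a * ((norm (X u))\<^sup>2 + (1 + norm v) * norm (X u))"
    by (simp add: power2_eq_square algebra_simps)
   finally show "norm (\<bar>a \<bullet> X u\<bar> * (K * (1 + norm (X u) + norm v))) \<le> norm (K * norm a * ((norm (X u))\<^sup>2 + (1 + norm v) * norm (X u)))"
    using K0 by simp
  qed
 qed simp
 then show "integrable (U01 \<Otimes>\<^sub>M N) (\<lambda>z. \<bar>a \<bullet> X (snd z)\<bar> * (K * (1 + norm (X (snd z)) + norm v)))"
  using integrable_distr_eq[of snd "U01 \<Otimes>\<^sub>M N" N "\<lambda>u. \<bar>a \<bullet> X u\<bar> * (K * (1 + norm (X u) + norm v))"] distr_UN_snd by simp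
qed

lemma measurable_shift [measurable]:
 assumes [measurable]: "\<phi> \<in> \<B> borel"
 shows "(\<lambda>z. (a \<bullet> X (snd z)) * \<phi> (X (snd z) + fst z *\<^sub>R v)) \<in> \<B> (U01 \<Otimes>\<^sub>M N)"
proof -
 have [measurable]: "fst \<in> \<B> (U01 \<Otimes>\<^sub>M N)" using measurable_fst[of U01 N] by simp
 show ?thesis by measurable
qed

text \<open>This integrated form of integration by parts involves no derivative of \<open>\<phi>\<close> and is stable under
 dominated pointwise limits, so it may be checked on cosines.\<close>

definition ibp :: "real^'m \<Rightarrow> (real^'m \<Rightarrow> real) \<Rightarrow> bool" where
 "ibp a \<phi> \<longleftrightarrow> (\<integral>u. \<phi> (X u + C *v a) \<partial>N) - (\<integral>u. \<phi> (X u) \<partial>N) =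
   (\<integral>z. (a \<bullet> X (snd z)) * \<phi> (X (snd z) + fst z *\<^sub>R (C *v a)) \<partial>(U01 \<Otimes>\<^sub>M N))"

lemma AE_UN: "AE z in U01 \<Otimes>\<^sub>M N. 0 \<le> fst z \<and> fst z \<le> 1"
proof -
 have "AE s in U01. 0 \<le> s \<and> s \<le> 1" by (rule AE_uniform_measureI) auto
 then have "AE s in distr (U01 \<Otimes>\<^sub>M N) U01 fst. 0 \<le> s \<and> s \<le> 1" by (simp only: distr_pair_fst)
 then show ?thesis by (rule AE_distrD[OF measurable_fst])
qed

lemma ibp_lim:
 assumes m [measurable]: "\<And>n. h n \<in> \<B> borel" "g \<in> \<B> borel"
  and K: "\<And>n x. \<bar>h n x\<bar> \<le> K * (1 + norm x)" and H: "\<And>n. ibp a (h n)"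
  and l: "\<And>x. (\<lambda>n. h n x) \<longlonglongrightarrow> g x"
 shows "ibp a g"
proof -
 have "(\<lambda>n. \<integral>u. h n (X u + v) \<partial>N) \<longlonglongrightarrow> (\<integral>u. g (X u + v) \<partial>N)" for v
 proof (rule integral_dominated_convergence[where w="\<lambda>u. K * (1 + norm (X u) + norm v)"])
  show "integrable N (\<lambda>u. K * (1 + norm (X u) + norm v))" using integrable_norm by simp
  show "AE u in N. norm (h n (X u + v)) \<le> K * (1 + norm (X u) + norm v)" for n
   using integrable_linear_growth(3)[OF m(1) K, of 1] by simp
 qed (auto intro: l)
 from this[of "C *v a"] this[of 0]
 have 1: "(\<lambda>n. (\<integral>u. h n (X u + C *v a) \<partial>N) - (\<integral>u. h n (X u) \<partial>N)) \<longlonglongrightarrow> (\<integral>u. g (X u + C *v a) \<partial>N) - (\<integral>u. g (X u) \<partial>N)"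
  by (intro tendsto_diff) simp_all
 have 2: "(\<lambda>n. \<integral>z. (a \<bullet> X (snd z)) * h n (X (snd z) + fst z *\<^sub>R (C *v a)) \<partial>(U01 \<Otimes>\<^sub>M N))
   \<longlonglongrightarrow> (\<integral>z. (a \<bullet> X (snd z)) * g (X (snd z) + fst z *\<^sub>R (C *v a)) \<partial>(U01 \<Otimes>\<^sub>M N))"
 proof (rule integral_dominated_convergence)
  show "AE z in U01 \<Otimes>\<^sub>M N. norm ((a \<bullet> X (snd z)) * h n (X (snd z) + fst z *\<^sub>R (C *v a))) \<le> \<bar>a \<bullet> X (snd z)\<bar> * (K * (1 + norm (X (snd z)) + norm (C *v a)))" for n
   using AE_UN by eventually_elim (auto simp: abs_mult intro!: mult_left_mono integrable_linear_growth(3)[OF m(1) K])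
 qed (auto intro!: l tendsto_mult integrable_linear_growth(2)[OF m(1) K])
 show ?thesis using LIMSEQ_unique[OF 1 2[folded H[unfolded ibp_def]]] by (simp add: ibp_def)
qed

text \<open>On cosines both sides are explicit, a phase shift by \<open>pi / 2\<close> bringing in
  \<open>integral_inner_sin\<close> and the fundamental theorem handling the segment variable.
  Bounded Borel functions follow by induction, linear growth by clipping.\<close>

lemma ibp_linear_growth:
 assumes m [measurable]: "\<phi> \<in> \<B> borel" and K: "\<And>x. \<bar>\<phi> x\<bar> \<le> K * (1 + norm x)"
 shows "ibp a \<phi>"
proof -
 have *: "\<bar>t\<bar> \<le> \<bar>B\<bar> * (1 + norm x)" if "\<bar>t\<bar> \<le> B" for t B and x :: "real^'m"
 proof -
  have "\<bar>B\<bar> * 1 \<le> \<bar>B\<bar> * (1 + norm x)" by (intro mult_left_mono) auto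
  with that show ?thesis by linarith
 qed
 have bdd: "ibp a \<phi>" if "\<phi> \<in> \<B> borel" "\<And>x. \<bar>\<phi> x\<bar> \<le> B" for \<phi> B
 proof (rule borel_bounded_induct[where H="ibp a", OF that])
  show "ibp a (\<lambda>x. cos (\<xi> \<bullet> x + c))" for \<xi> c
  proof -
   define b E where "b = \<xi> \<bullet> (C *v a)" and "E = exp (- (Q \<xi> / 2))"
   have i: "integrable (U01 \<Otimes>\<^sub>M N) (\<lambda>(s, u). (a \<bullet> X u) * cos (\<xi> \<bullet> (X u + s *\<^sub>R (C *v a)) + c))"
   proof (rule B_integrable_bound)
    show "integrable (U01 \<Otimes>\<^sub>M N) (\<lambda>z. \<bar>a \<bullet> X (snd z)\<bar> * (1 * (1 + norm (X (snd z)) + norm (0::real^'m))))"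
     by (rule integrable_linear_growth(2)[of "\<lambda>_. 0"]) auto
    show "AE z in U01 \<Otimes>\<^sub>M N. norm (case z of (s, u) \<Rightarrow> (a \<bullet> X u) * cos (\<xi> \<bullet> (X u + s *\<^sub>R (C *v a)) + c)) \<le> norm (\<bar>a \<bullet> X (snd z)\<bar> * (1 * (1 + norm (X (snd z)) + norm (0::real^'m))))"
     by (rule AE_I2) (auto simp: abs_mult split_beta intro!: mult_left_mono order_trans[OF abs_cos_le_one])
   qed (use measurable_shift[of "\<lambda>x. cos (\<xi> \<bullet> x + c)" a "C *v a"] in \<open>simp add: case_prod_beta'\<close>)
   have "(\<integral>z. (a \<bullet> X (snd z)) * cos (\<xi> \<bullet> (X (snd z) + fst z *\<^sub>R (C *v a)) + c) \<partial>(U01 \<Otimes>\<^sub>M N))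
    = (\<integral>s. (\<integral>u. (a \<bullet> X u) * cos (\<xi> \<bullet> (X u + s *\<^sub>R (C *v a)) + c) \<partial>N) \<partial>U01)"
    using UN.integral_fst'[OF i] by (simp add: case_prod_beta')
   also have "\<dots> = (\<integral>s. - (b * sin (s * b + c) * E) \<partial>U01)"
   proof (rule B_integral_cong)
    fix s
    have "(\<integral>u. (a \<bullet> X u) * cos (\<xi> \<bullet> (X u + s *\<^sub>R (C *v a)) + c) \<partial>N)
     = (\<integral>u. (a \<bullet> X u) * sin (\<xi> \<bullet> X u + (s * b + c + pi / 2)) \<partial>N)"
     by (simp add: inner_add_right b_def sin_add cos_add add.assoc[symmetric] distrib_left distrib_right)
    also have "\<dots> = b * cos (s * b + c + pi / 2) * E" unfolding integral_inner_sin b_def E_def ..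
    also have "\<dots> = - (b * sin (s * b + c) * E)" by (simp add: cos_add)
    finally show "(\<integral>u. (a \<bullet> X u) * cos (\<xi> \<bullet> (X u + s *\<^sub>R (C *v a)) + c) \<partial>N) = - (b * sin (s * b + c) * E)" .
   qed simp
   also have "\<dots> = cos (1 * b + c) * E - cos (0 * b + c) * E"
    by (rule integral_U01_FTC) (auto intro!: derivative_eq_intros continuous_intros)
   also have "\<dots> = (\<integral>u. cos (\<xi> \<bullet> X u + (b + c)) \<partial>N) - (\<integral>u. cos (\<xi> \<bullet> X u + c) \<partial>N)"
    unfolding integral_cos_inner E_def by simp
   finally show ?thesis unfolding ibp_def by (simp add: inner_add_right b_def add.assoc)
  qed
 next
  fix B c d and f g :: "real^'m \<Rightarrow> real"
  assume f: "f \<in> \<B> borel" "\<And>x. \<bar>f x\<bar> \<le> B" "ibp a f"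
   and g: "g \<in> \<B> borel" "\<And>x. \<bar>g x\<bar> \<le> B" "ibp a g"
  have i: "integrable N (\<lambda>u. f (X u + v))" "integrable N (\<lambda>u. g (X u + v))" for v
   by (intro integrable_linear_growth(1)[where K="\<bar>B\<bar>"] f g *)+
  have iUN: "integrable (U01 \<Otimes>\<^sub>M N) (\<lambda>z. (a \<bullet> X (snd z)) * \<psi> (X (snd z) + fst z *\<^sub>R (C *v a)))"
   if \<psi>: "\<psi> \<in> \<B> borel" "\<And>x. \<bar>\<psi> x\<bar> \<le> B" for \<psi>
  proof (rule B_integrable_bound[OF integrable_linear_growth(2)[OF \<psi>(1) *[OF \<psi>(2)], of a "C *v a"]])
   show "AE z in U01 \<Otimes>\<^sub>M N. norm ((a \<bullet> X (snd z)) * \<psi> (X (snd z) + fst z *\<^sub>R (C *v a))) \<le>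
     norm (\<bar>a \<bullet> X (snd z)\<bar> * (\<bar>B\<bar> * (1 + norm (X (snd z)) + norm (C *v a))))"
    using AE_UN by eventually_elim
     (auto simp: abs_mult intro!: mult_left_mono order_trans[OF integrable_linear_growth(3)[OF \<psi>(1) *[OF \<psi>(2)]]])
  qed (use \<psi> in auto)
  note e = iUN[OF f(1,2)] iUN[OF g(1,2)]
  have "(\<integral>z. (a \<bullet> X (snd z)) * (c * f (X (snd z) + fst z *\<^sub>R (C *v a)) + d * g (X (snd z) + fst z *\<^sub>R (C *v a))) \<partial>(U01 \<Otimes>\<^sub>M N))
   = (\<integral>z. c * ((a \<bullet> X (snd z)) * f (X (snd z) + fst z *\<^sub>R (C *v a))) + d * ((a \<bullet> X (snd z)) * g (X (snd z) + fst z *\<^sub>R (C *v a))) \<partial>(U01 \<Otimes>\<^sub>M N))"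
   by (simp add: algebra_simps)
  then show "ibp a (\<lambda>x. c * f x + d * g x)"
   using f(3) g(3) i[of "C *v a"] i[of 0] e unfolding ibp_def by (simp add: right_diff_distrib[symmetric] algebra_simps)
 next
  show "ibp a g" if "\<And>n. h n \<in> \<B> borel" "\<And>n x. \<bar>h n x\<bar> \<le> B" "\<And>n. ibp a (h n)"
    "g \<in> \<B> borel" "\<And>x. (\<lambda>n. h n x) \<longlonglongrightarrow> g x" for h B and g :: "real^'m \<Rightarrow> real"
   by (rule ibp_lim[of h g "\<bar>B\<bar>"]) (rule that *[OF that(2)])+
 qed
 define h where "h n x = max (- real n) (min (real n) (\<phi> x))" for n x
 show ?thesis
 proof (rule ibp_lim[where h=h])
  show "ibp a (h n)" for n by (rule bdd[of _ "real n"]) (auto simp: h_def[abs_def])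
  show "\<bar>h n x\<bar> \<le> K * (1 + norm x)" for n x using K[of x] by (auto simp: h_def max_def min_def)
  show "(\<lambda>n. h n x) \<longlonglongrightarrow> \<phi> x" for x
  proof (rule tendsto_eventually)
   obtain k where "\<bar>\<phi> x\<bar> \<le> real k" using real_arch_simple by blast
   then show "\<forall>\<^sub>F n in sequentially. h n x = \<phi> x"
    unfolding eventually_sequentially h_def by (intro exI[of _ k]) auto
  qed
 qed (simp_all add: h_def[abs_def])
qed

text \<open>The integrated identity is used for \<open>h n *\<^sub>R a\<close> with
  \<open>h n\<close> tending to 0. After division by \<open>h n\<close> the left side is a
  difference quotient, while on the right the factor cancels and continuity of \<phi> shrinks the
  segment to its starting point.\<close>

theorem integration_by_parts:
 assumes D: "\<And>x. (\<phi> has_derivative \<phi>' x) (at x)" and B: "\<And>x. \<bar>\<phi>' x (C *v a)\<bar> \<le> B"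
  and K: "\<And>x. \<bar>\<phi> x\<bar> \<le> K * (1 + norm x)"
 shows "(\<integral>u. \<phi>' (X u) (C *v a) \<partial>N) = (\<integral>u. (a \<bullet> X u) * \<phi> (X u) \<partial>N)"
proof -
 have cont: "continuous_on UNIV \<phi>" by (intro continuous_at_imp_continuous_on ballI has_derivative_continuous[OF D])
 then have m [measurable]: "\<phi> \<in> \<B> borel" by (rule borel_measurable_continuous_onI)
 define v where "v = C *v a"
 define h where "h n = 1 / real (Suc n)" for n
 have h: "0 < h n" "h n \<le> 1" for n by (auto simp: h_def)
 have h0: "h \<longlonglongrightarrow> 0" unfolding h_def using LIMSEQ_Suc[OF lim_1_over_n[where 'a=real]] by simp
 then have hl: "filterlim h (at 0) sequentially" using h by (auto simp: filterlim_at less_imp_neq[symmetric] intro!: always_eventually)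
 have "((\<lambda>r. \<integral>u. \<phi> (X u + r *\<^sub>R v) \<partial>N) has_real_derivative (\<integral>u. \<phi>' (X u + 0 *\<^sub>R v) v \<partial>N)) (at 0)"
 proof (rule has_real_derivative_integral(2)[where w="\<lambda>_. B"])
  show "((\<lambda>r. \<phi> (X u + r *\<^sub>R v)) has_real_derivative \<phi>' (X u + r *\<^sub>R v) v) (at r)" for u r
  proof -
   have "((\<lambda>r. \<phi> (X u + r *\<^sub>R v)) has_derivative (\<lambda>t. \<phi>' (X u + r *\<^sub>R v) (t *\<^sub>R v))) (at r)"
    by (rule has_derivative_compose[of "\<lambda>r. X u + r *\<^sub>R v" "\<lambda>t. t *\<^sub>R v"]) (auto intro!: derivative_eq_intros D)
   then show ?thesis
    using linear_scale[OF has_derivative_linear[OF D]] by (simp add: has_field_derivative_def mult.commute[of _ "\<phi>' _ v"])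
  qed
  show "integrable N (\<lambda>u. \<phi> (X u + r *\<^sub>R v))" for r by (rule integrable_linear_growth(1)[OF m K])
 qed (use B in \<open>auto simp: v_def\<close>)
 from filterlim_compose[OF DERIV_D[OF this] hl]
 have 1: "(\<lambda>n. ((\<integral>u. \<phi> (X u + h n *\<^sub>R v) \<partial>N) - (\<integral>u. \<phi> (X u) \<partial>N)) / h n) \<longlonglongrightarrow> (\<integral>u. \<phi>' (X u) v \<partial>N)"
  by simp
 have e: "((\<integral>u. \<phi> (X u + h n *\<^sub>R v) \<partial>N) - (\<integral>u. \<phi> (X u) \<partial>N)) / h n =
  (\<integral>z. (a \<bullet> X (snd z)) * \<phi> (X (snd z) + (fst z * h n) *\<^sub>R v) \<partial>(U01 \<Otimes>\<^sub>M N))" for n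
  using ibp_linear_growth[OF m K, of "h n *\<^sub>R a"] h(1)[of n]
  by (simp add: ibp_def v_def matrix_vector_mult_scaleR mult.assoc)
 have 2: "(\<lambda>n. \<integral>z. (a \<bullet> X (snd z)) * \<phi> (X (snd z) + (fst z * h n) *\<^sub>R v) \<partial>(U01 \<Otimes>\<^sub>M N))
   \<longlonglongrightarrow> (\<integral>z. (a \<bullet> X (snd z)) * \<phi> (X (snd z) + 0 *\<^sub>R v) \<partial>(U01 \<Otimes>\<^sub>M N))"
 proof (rule integral_dominated_convergence)
  show "AE z in U01 \<Otimes>\<^sub>M N. norm ((a \<bullet> X (snd z)) * \<phi> (X (snd z) + (fst z * h n) *\<^sub>R v)) \<le> \<bar>a \<bullet> X (snd z)\<bar> * (K * (1 + norm (X (snd z)) + norm v))" for n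
   using AE_UN
  proof eventually_elim
   case (elim z)
   then have "0 \<le> fst z * h n" "fst z * h n \<le> 1" using h[of n] by (auto intro!: mult_le_one)
   from integrable_linear_growth(3)[OF m K this] show ?case by (auto simp: abs_mult intro!: mult_left_mono)
  qed
  show "AE z in U01 \<Otimes>\<^sub>M N. (\<lambda>n. (a \<bullet> X (snd z)) * \<phi> (X (snd z) + (fst z * h n) *\<^sub>R v)) \<longlonglongrightarrow> (a \<bullet> X (snd z)) * \<phi> (X (snd z) + 0 *\<^sub>R v)"
  proof (rule AE_I2)
   fix z
   have "(\<lambda>n. X (snd z) + (fst z * h n) *\<^sub>R v) \<longlonglongrightarrow> X (snd z) + (fst z * 0) *\<^sub>R v"
    by (intro tendsto_intros h0)
   from continuous_on_tendsto_compose[OF cont this]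
   show "(\<lambda>n. (a \<bullet> X (snd z)) * \<phi> (X (snd z) + (fst z * h n) *\<^sub>R v)) \<longlonglongrightarrow> (a \<bullet> X (snd z)) * \<phi> (X (snd z) + 0 *\<^sub>R v)"
    by (intro tendsto_mult tendsto_const) auto
  qed
 qed (use integrable_linear_growth(2)[OF m K] measurable_shift[OF m, of a "h _ *\<^sub>R v"] measurable_shift[OF m, of a 0] in \<open>simp_all\<close>)
 have "(\<integral>z. (a \<bullet> X (snd z)) * \<phi> (X (snd z)) \<partial>(U01 \<Otimes>\<^sub>M N)) = (\<integral>u. (a \<bullet> X u) * \<phi> (X u) \<partial>distr (U01 \<Otimes>\<^sub>M N) N snd)"
  by (rule integral_distr[symmetric]) measurable
 also have "distr (U01 \<Otimes>\<^sub>M N) N snd = N" by (rule distr_UN_snd)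
 finally show ?thesis using LIMSEQ_unique[OF 1 2[folded e]] by (simp add: v_def)
qed

end

text \<open>Since \<open>r\<close> is the product of its powers \<open>2 - q\<close> and
  \<open>q - 1\<close>, using one bound for each gives \<open>A\<close> the exponent
  \<open>(2 - q) + 2 * (q - 1) = q\<close>; the geometric mean of the constants is at most their
  convex combination.\<close>

lemma power_interpolation:
 fixes r a b A q :: real
 assumes r: "0 \<le> r" "r \<le> a * A" "r \<le> b * A\<^sup>2" and A: "0 \<le> A" and ab: "0 \<le> a" "0 \<le> b" and q: "1 \<le> q" "q \<le> 2"
 shows "r \<le> ((2 - q) * a + (q - 1) * b) * A powr q"
proof (cases "r = 0")
 case True
 then show ?thesis using ab q by simp
next
 case False
 then have p: "0 < r" "A \<noteq> 0" "a \<noteq> 0" "b \<noteq> 0" using r by auto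
 then have p: "0 < r" "0 < A" "0 < a" "0 < b" using A ab by auto
 have "r = r powr (2 - q) * r powr (q - 1)" using p by (simp add: powr_add[symmetric])
 also have "\<dots> \<le> (a * A) powr (2 - q) * (b * A\<^sup>2) powr (q - 1)"
  using r p q by (intro mult_mono powr_mono2) auto
 also have "\<dots> = (a powr (2 - q) * b powr (q - 1)) * (A powr (2 - q) * A powr (2 * (q - 1)))"
  using p by (simp add: powr_mult powr_powr powr_numeral[symmetric] del: powr_numeral)
 also have "A powr (2 - q) * A powr (2 * (q - 1)) = A powr q" by (simp add: powr_add[symmetric])
 also have "a powr (2 - q) * b powr (q - 1) * A powr q \<le> ((2 - q) * a + (q - 1) * b) * A powr q"
  using q p by (intro mult_right_mono Youngs_inequality_0) auto
 finally show ?thesis .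
qed

text \<open>Jensen's inequality, proved by applying Young to each term with the mean as companion.
  It is the source of the factor \<open>CARD('m) powr (q - 1)\<close> in
  \<open>zeta4\<close>.\<close>

lemma power_mean:
 fixes a :: "'m::finite \<Rightarrow> real"
 assumes a: "\<And>j. 0 \<le> a j" and q: "1 \<le> q"
 shows "(\<Sum>j\<in>UNIV. a j) powr q \<le> real CARD('m) powr (q - 1) * (\<Sum>j\<in>UNIV. a j powr q)"
proof -
 define m S s where "m = real CARD('m)" and "S = (\<Sum>j\<in>UNIV. a j)" and "s = S / m"
 have m: "0 < m" by (simp add: m_def)
 have S0: "0 \<le> S" "0 \<le> s" using a m by (auto simp: S_def s_def intro!: sum_nonneg divide_nonneg_pos)
 have "m * s powr q = S * s powr (q - 1)"
 proof -
  have "S = m * s" using m by (simp add: s_def)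
  then show ?thesis using powr_mult_base[OF S0(2), of "q - 1"] by (simp add: mult.assoc)
 qed
 also have "\<dots> = (\<Sum>j\<in>UNIV. a j * s powr (q - 1))" by (simp add: S_def sum_distrib_right)
 also have "\<dots> \<le> (\<Sum>j\<in>UNIV. a j powr q / q + (1 - 1 / q) * s powr q)"
  using a S0 q by (intro sum_mono young_powr) auto
 also have "\<dots> = (\<Sum>j\<in>UNIV. a j powr q) / q + m * ((1 - 1 / q) * s powr q)"
  by (simp add: sum.distrib sum_divide_distrib[symmetric] m_def)
 finally have "m * s powr q \<le> (\<Sum>j\<in>UNIV. a j powr q)" using q by (simp add: field_simps)
 moreover have "S powr q = m powr (q - 1) * (m * s powr q)"
 proof -
  have "S powr q = m powr q * s powr q" using m S0 by (simp add: powr_mult[symmetric] s_def)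
  also have "m powr q = m powr (q - 1) * m" using powr_mult_base[of m "q - 1"] m by (simp add: mult.commute)
  finally show ?thesis by simp
 qed
 ultimately show ?thesis using m by (simp add: S_def m_def mult_left_mono)
qed

section \<open>Functionals in the domain of the add-one cost and weighted carre-du-champ
  terms\<close>

context poisson_space
begin

definition dom_P :: "('a measure \<Rightarrow> real) \<Rightarrow> bool" where
 "dom_P F \<longleftrightarrow> F \<in> \<F> L \<and> integrable P (\<lambda>m. (F m)\<^sup>2) \<and>
   (\<integral>\<^sup>+x. (\<integral>\<^sup>+m. ennreal ((\<D> x F m)\<^sup>2) \<partial>P) \<partial>L) < \<infinity>"

lemma dominated_dom_P:
 assumes F: "dom_P F" and G: "dom_P G"
 shows "dominated F G (\<lambda>x m. (\<D> x F m)\<^sup>2 / 2) (\<lambda>x m. (\<D> x G m)\<^sup>2 / 2)"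
proof -
 have m: "(\<lambda>z. (\<D> (fst z) H (snd z))\<^sup>2 / 2) \<in> \<B> (L \<Otimes>\<^sub>M \<N> L)" if "dom_P H" for H
  using that measurable_add_one_cost[of H L fst "L \<Otimes>\<^sub>M \<N> L" snd] by (auto simp: dom_P_def)
 have i: "(\<integral>\<^sup>+x. (\<integral>\<^sup>+m. ennreal ((\<D> x H m)\<^sup>2 / 2) \<partial>P) \<partial>L) < \<infinity>" if "dom_P H" for H
 proof -
  have "(\<integral>\<^sup>+x. (\<integral>\<^sup>+m. ennreal ((\<D> x H m)\<^sup>2 / 2) \<partial>P) \<partial>L) \<le> (\<integral>\<^sup>+x. (\<integral>\<^sup>+m. ennreal ((\<D> x H m)\<^sup>2) \<partial>P) \<partial>L)"
   by (intro nn_integral_mono ennreal_leI) simp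
  then show ?thesis using that by (auto simp: dom_P_def intro: le_less_trans)
 qed
 have "\<bar>a * b\<bar> \<le> a\<^sup>2 / 2 + b\<^sup>2 / 2" for a b :: real
  using sum_squares_bound[of "\<bar>a\<bar>" "\<bar>b\<bar>"] by (simp add: abs_mult)
 then show ?thesis using m[OF F] m[OF G] i[OF F] i[OF G] by (simp add: dominated_def)
qed

lemma dom_P_pair_integrable:
 assumes F: "dom_P F" and G: "dom_P G"
 shows "integrable \<L> (\<lambda>z. \<Gamma> F G z)"
 using F G by (intro cov_integrable[OF _ _ dominated_dom_P[OF F G]]) (auto simp: dom_P_def)

lemma dom_P_fin:
 assumes F: "dom_P F" and G: "dom_P G" and t: "t \<in> {0..1}"
 shows "(\<integral>\<^sup>+x. (\<integral>\<^sup>+m. ennreal \<bar>\<D> x F (\<alpha> m) * \<D> x G (\<beta> m)\<bar> \<partial>kern L t) \<partial>L) < \<infinity>"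
proof -
 note d = dominated_dom_P[OF F G]
 have "prob_space (kern L t)" "sets (kern L t) = sets (\<N> (mark_space L))" by (rule kern_props[OF L])+
 note c = coupling_bound[OF d this kern_marginal[OF t]]
 have fin: "a < \<infinity> \<Longrightarrow> b < \<infinity> \<Longrightarrow> a + b < \<infinity>" for a b :: ennreal by simp
 show ?thesis by (rule order_le_less_trans[OF c fin[OF dominatedD(5)[OF d] dominatedD(6)[OF d]]])
qed

lemma integrable_weighted:
 assumes F: "dom_P F" and G: "dom_P G" and v: "bdd v K"
 shows "integrable \<L> (\<lambda>z. v (\<alpha> (snd z)) * (\<Gamma> F G z))" (is "integrable _ ?f")
  and "integrable (mix L) (\<lambda>m. v (\<alpha> m) * carre F G m)"
  and "(\<integral>z. v (\<alpha> (snd z)) * (\<Gamma> F G z) \<partial>\<L>)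
   = (\<integral>m. v (\<alpha> m) * carre F G m \<partial>mix L)"
proof -
 note i = dom_P_pair_integrable[OF F G]
 have m: "(\<lambda>z. v (\<alpha> (snd z))) \<in> \<B> \<L>"
  using bddD(1)[OF v] by (intro m_comp[OF m_comp[OF measurable_snd \<alpha>]])
 show f: "integrable \<L> ?f"
 proof (rule B_integrable_bound[OF integrable_mult_right[OF i, of K]])
  show "?f \<in> \<B> \<L>" by (intro borel_measurable_times[OF m] borel_measurable_integrable[OF i])
  show "AE z in \<L>. norm (?f z) \<le> norm (K * (\<Gamma> F G z))"
  proof (rule AE_I2)
   fix z assume "z \<in> space \<L>"
   then have "\<C> L (\<alpha> (snd z))" by (auto simp: space_pair_measure intro: counting_measure_proj)
   from order_trans[OF bddD(2)[OF v this] abs_ge_self]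
   show "norm (?f z) \<le> norm (K * (\<Gamma> F G z))"
    by (simp add: abs_mult mult_right_mono)
  qed
 qed
 then have f': "integrable \<L> (\<lambda>(x, m). v (\<alpha> m) * (\<D> x F (\<alpha> m) * \<D> x G (\<beta> m)))"
  by (simp add: case_prod_beta')
 show "integrable (mix L) (\<lambda>m. v (\<alpha> m) * carre F G m)"
  using LQ.integrable_snd[OF f'] by (simp add: carre_def)
 show "(\<integral>z. ?f z \<partial>\<L>) = (\<integral>m. v (\<alpha> m) * carre F G m \<partial>mix L)"
  using LQ.integral_snd[OF f'] by (simp add: carre_def case_prod_beta')
qed

lemma carre_integrable: "dom_P F \<Longrightarrow> dom_P G \<Longrightarrow> integrable (mix L) (carre F G)"
 using integrable_weighted(2)[of F G "\<lambda>_. 1" 1] by (simp add: bdd_def)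

lemma covariance_carre:
 assumes F: "dom_P F" and G: "dom_P G"
 shows "(\<integral>m. F m * G m \<partial>P) - (\<integral>m. F m \<partial>P) * (\<integral>m. G m \<partial>P) = (\<integral>m. carre F G m \<partial>mix L)"
proof -
 have "(\<integral>m. F m * G m \<partial>P) - (\<integral>m. F m \<partial>P) * (\<integral>m. G m \<partial>P) =
  (\<integral>z. \<Gamma> F G z \<partial>\<L>)"
  using F G by (intro covariance_formula[OF _ _ _ _ dominated_dom_P[OF F G]]) (auto simp: dom_P_def)
 then show ?thesis using integrable_weighted(3)[OF F G, of "\<lambda>_. 1" 1] by (simp add: bdd_def)
qed

text \<open>The disintegration of \<open>mix\<close> is available for nonnegative integrands. The
  bound on the conditional means is therefore rewritten as an inequality between positive and
  negative part, integrated over \<open>t\<close>, and rewritten back.\<close>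

lemma integral_mix_le:
 fixes Y :: "('a \<times> bool \<times> bool) measure \<Rightarrow> real"
 assumes i: "integrable (mix L) Y" and k: "\<And>t. t \<in> {0..1} \<Longrightarrow> integrable (kern L t) Y"
  and b: "\<And>t. t \<in> {0..1} \<Longrightarrow> (\<integral>m. Y m \<partial>kern L t) \<le> b" and b0: "0 \<le> b"
 shows "(\<integral>m. Y m \<partial>mix L) \<le> b"
proof -
 have Ym [measurable]: "Y \<in> \<F> (mark_space L)" using i by (simp add: borel_measurable_integrable)
 let ?p = "\<lambda>m. ennreal (Y m)" and ?n = "\<lambda>m. ennreal (- Y m)"
 have one: "(\<integral>\<^sup>+t\<in>{0..1::real}. ennreal b \<partial>lborel) = ennreal b"
  by (subst nn_integral_cmult_indicator) auto
 have pt: "(\<integral>\<^sup>+m. ?p m \<partial>kern L t) \<le> (\<integral>\<^sup>+m. ?n m \<partial>kern L t) + ennreal b" if t: "t \<in> {0..1}" for t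
 proof -
  have fin: "(\<integral>\<^sup>+m. ?p m \<partial>kern L t) < \<infinity>" "(\<integral>\<^sup>+m. ?n m \<partial>kern L t) < \<infinity>"
   using k[OF t] by (auto simp: real_integrable_def top.not_eq_extremum)
  then obtain x y where xy: "0 \<le> x" "0 \<le> y" "(\<integral>\<^sup>+m. ?p m \<partial>kern L t) = ennreal x" "(\<integral>\<^sup>+m. ?n m \<partial>kern L t) = ennreal y"
   by (cases "(\<integral>\<^sup>+m. ?p m \<partial>kern L t)"; cases "(\<integral>\<^sup>+m. ?n m \<partial>kern L t)") auto
  then have "(\<integral>m. Y m \<partial>kern L t) = x - y" using real_lebesgue_integral_def[OF k[OF t]] by simp
  then have "x \<le> y + b" using b[OF t] by simp
  then show ?thesis using xy b0 by (simp add: ennreal_plus[symmetric] del: ennreal_plus)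
 qed
 have km: "(\<lambda>t. \<integral>\<^sup>+m. ?n m \<partial>kern L t) \<in> \<B> borel"
  using m_comp[OF measurable_kern'[OF L] nn_integral_measurable_subprob_algebra[of ?n "\<N> (mark_space L)"]]
  by simp
 have "(\<integral>\<^sup>+m. ?p m \<partial>mix L) = (\<integral>\<^sup>+t\<in>{0..1}. (\<integral>\<^sup>+m. ?p m \<partial>kern L t) \<partial>lborel)"
  by (rule nn_integral_mix[OF L]) measurable
 also have "\<dots> \<le> (\<integral>\<^sup>+t. (\<integral>\<^sup>+m. ?n m \<partial>kern L t) * indicator {0..1} t + ennreal b * indicator {0..1} t \<partial>lborel)"
  using pt by (intro nn_integral_mono) (auto simp: indicator_def)
 also have "\<dots> = (\<integral>\<^sup>+t\<in>{0..1}. (\<integral>\<^sup>+m. ?n m \<partial>kern L t) \<partial>lborel) + (\<integral>\<^sup>+t\<in>{0..1::real}. ennreal b \<partial>lborel)"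
  using km by (intro nn_integral_add) auto
 also have "\<dots> = (\<integral>\<^sup>+m. ?n m \<partial>mix L) + ennreal b"
  unfolding one by (subst nn_integral_mix[OF L]) auto
 finally have le: "(\<integral>\<^sup>+m. ?p m \<partial>mix L) \<le> (\<integral>\<^sup>+m. ?n m \<partial>mix L) + ennreal b" .
 have fin: "(\<integral>\<^sup>+m. ?p m \<partial>mix L) < \<infinity>" "(\<integral>\<^sup>+m. ?n m \<partial>mix L) < \<infinity>"
  using i by (auto simp: real_integrable_def top.not_eq_extremum)
 then obtain x y where xy: "0 \<le> x" "0 \<le> y" "(\<integral>\<^sup>+m. ?p m \<partial>mix L) = ennreal x" "(\<integral>\<^sup>+m. ?n m \<partial>mix L) = ennreal y"
  by (cases "(\<integral>\<^sup>+m. ?p m \<partial>mix L)"; cases "(\<integral>\<^sup>+m. ?n m \<partial>mix L)") auto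
 then have "x \<le> y + b" using le b0 by (simp add: ennreal_plus[symmetric] del: ennreal_plus)
 then show ?thesis using real_lebesgue_integral_def[OF i] xy by simp
qed

text \<open>Conditionally on the correlation parameter \<open>t\<close> the weight \<open>v\<close> may be centred, so that only
 the fluctuation of the carre-du-champ around its conditional mean matters.\<close>

lemma weighted_carre:
 assumes F: "dom_P F" and G: "dom_P G" and v: "bdd v K" and p: "1 \<le> p" "p \<le> 2"
  and A: "0 \<le> A" "d21 p F G \<le> ennreal (A powr p)"
  and B: "0 \<le> B" "d12 p F G \<le> ennreal (B powr p)"
  and C: "0 \<le> C" "d22 p F G \<le> ennreal (C powr p)"
 shows "\<bar>(\<integral>m. v (\<alpha> m) * carre F G m \<partial>mix L) - (\<integral>m. v m \<partial>P) * (\<integral>m. carre F G m \<partial>mix L)\<bar>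
  \<le> K * (2 powr (2 / p - 1) * (A + B + C))"
proof -
 have K0: "0 \<le> K"
 proof -
  obtain m where "m \<in> space P" using P.not_empty by blast
  then show ?thesis using bddD(2)[OF v, of m] by simp
 qed
 have Fm: "F \<in> \<F> L" and Gm: "G \<in> \<F> L"
  using F G by (auto simp: dom_P_def)
 define b where "b = K * (2 powr (2 / p - 1) * (A + B + C))"
 have b0: "0 \<le> b" using K0 A B C by (simp add: b_def)
 define e where "e = (\<integral>m. v m \<partial>P)"
 define Y where "Y m = (v (\<alpha> m) - e) * carre F G m" for m
 have iv: "integrable (mix L) (\<lambda>m. v (\<alpha> m) * carre F G m)" by (rule integrable_weighted(2)[OF F G v])
 have i: "integrable (mix L) Y" unfolding Y_def[abs_def] left_diff_distrib
  using iv carre_integrable[OF F G] by simp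
 have t: "integrable (kern L t) Y \<and> \<bar>\<integral>m. Y m \<partial>kern L t\<bar> \<le> b" if t: "t \<in> {0..1}" for t
 proof -
  interpret K: prob_space "kern L t" by (rule kern_props[OF L])
  have sK[measurable_cong]: "sets (kern L t) = sets (\<N> (mark_space L))" by (rule kern_props[OF L])
  have pm: "\<alpha> \<in> kern L t \<rightarrow>\<^sub>M \<N> L"
   using measurable_proj by (simp cong: measurable_cong_sets add: sK)
  have vm: "(\<lambda>m. v (\<alpha> m)) \<in> \<B> (kern L t)" by (rule m_comp[OF pm bddD(1)[OF v]])
  have vb: "\<bar>v (\<alpha> m)\<bar> \<le> K" if "m \<in> space (kern L t)" for m
   using that by (intro bddD(2)[OF v]) (auto simp: kern_props[OF L] intro: counting_measure_proj)
  note c = carre_fluctuation[OF Fm Gm t p dom_P_fin[OF F G t] A B C]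
  have wi: "integrable (kern L t) (\<lambda>m. v (\<alpha> m) * w m)" "\<bar>\<integral>m. v (\<alpha> m) * w m \<partial>kern L t\<bar> \<le> K * (\<integral>m. \<bar>w m\<bar> \<partial>kern L t)"
   if w: "integrable (kern L t) w" for w
  proof -
   show wi: "integrable (kern L t) (\<lambda>m. v (\<alpha> m) * w m)"
   proof (rule B_integrable_bound[OF integrable_mult_right[OF w, of K]])
    show "AE m in kern L t. norm (v (\<alpha> m) * w m) \<le> norm (K * w m)"
     using vb K0 by (intro AE_I2) (auto simp: abs_mult intro!: mult_right_mono)
   qed (intro borel_measurable_times[OF vm] borel_measurable_integrable[OF w])
   have "\<bar>\<integral>m. v (\<alpha> m) * w m \<partial>kern L t\<bar> \<le> (\<integral>m. \<bar>v (\<alpha> m) * w m\<bar> \<partial>kern L t)" by (rule integral_abs_bound)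
   also have "\<dots> \<le> (\<integral>m. K * \<bar>w m\<bar> \<partial>kern L t)"
    using integrable_abs[OF wi] w vb by (intro integral_mono) (auto simp: abs_mult intro!: mult_right_mono)
   finally show "\<bar>\<integral>m. v (\<alpha> m) * w m \<partial>kern L t\<bar> \<le> K * (\<integral>m. \<bar>w m\<bar> \<partial>kern L t)" by simp
  qed
  define \<theta> where "\<theta> = (\<integral>\<nu>. carre F G \<nu> \<partial>kern L t)"
  have ve: "integrable (kern L t) (\<lambda>m. v (\<alpha> m))" "(\<integral>m. v (\<alpha> m) \<partial>kern L t) = e"
  proof -
   show "integrable (kern L t) (\<lambda>m. v (\<alpha> m))" using wi(1)[of "\<lambda>_. 1"] by simp
   show "(\<integral>m. v (\<alpha> m) \<partial>kern L t) = e"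
    unfolding e_def using integral_distr[OF pm bddD(1)[OF v]] kern_distr(1)[OF t] by simp
  qed
  have Yi: "integrable (kern L t) Y" unfolding Y_def[abs_def] left_diff_distrib using wi(1)[OF c(1)] c(1) by simp
  have "(\<integral>m. Y m \<partial>kern L t) = (\<integral>m. v (\<alpha> m) * carre F G m \<partial>kern L t) - e * \<theta>"
   unfolding Y_def left_diff_distrib \<theta>_def using wi(1)[OF c(1)] c(1) by simp
  also have "\<dots> = (\<integral>m. v (\<alpha> m) * (carre F G m - \<theta>) \<partial>kern L t)"
   unfolding right_diff_distrib using wi(1)[OF c(1)] ve by simp
  also have "\<bar>\<dots>\<bar> \<le> K * (\<integral>m. \<bar>carre F G m - \<theta>\<bar> \<partial>kern L t)" using c(1) by (intro wi(2)) simp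
  also have "\<dots> \<le> b" unfolding b_def \<theta>_def using c(2) K0 by (intro mult_left_mono)
  finally show ?thesis using Yi by simp
 qed
 have "(\<integral>m. Y m \<partial>mix L) \<le> b"
  using t by (intro integral_mix_le[OF i _ _ b0]) (auto dest: t abs_le_D1)
 moreover have "(\<integral>m. - Y m \<partial>mix L) \<le> b"
  using t i by (intro integral_mix_le[OF _ _ _ b0]) (auto dest: t abs_le_D2)
 moreover have "(\<integral>m. Y m \<partial>mix L) = (\<integral>m. v (\<alpha> m) * carre F G m \<partial>mix L) - e * (\<integral>m. carre F G m \<partial>mix L)"
  unfolding Y_def left_diff_distrib using iv carre_integrable[OF F G] by simp
 ultimately show ?thesis unfolding e_def b_def by simp
qed


text \<open>Hoelder with exponents \<open>q + 1\<close> and \<open>(q + 1) / q\<close> separates the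
  two coupled copies; each then integrates to a moment under \<open>P\<close>, which is the shape of
  the summands of \<open>zeta4\<close>.\<close>

lemma mixed_moment:
 assumes F: "F \<in> \<F> L" and G: "G \<in> \<F> L" and q: "1 \<le> q"
 shows "(\<integral>\<^sup>+z. ennreal (\<bar>\<D> (fst z) F (\<alpha> (snd z))\<bar> powr q * \<bar>\<D> (fst z) G (\<beta> (snd z))\<bar>) \<partial>\<L>)
  \<le> (\<integral>\<^sup>+x. \<M> P (q + 1) (\<D> x G) *
     epow (\<integral>\<^sup>+m. epow (ennreal \<bar>\<D> x F m\<bar>) (q + 1) \<partial>P) (1 - 1 / (q + 1)) \<partial>L)"
proof -
 have m: "(\<lambda>z. ennreal (\<bar>\<D> (fst z) F (\<alpha> (snd z))\<bar> powr q * \<bar>\<D> (fst z) G (\<beta> (snd z))\<bar>)) \<in> \<B> \<L>"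
 proof -
  have [measurable]: "(\<lambda>z. \<D> (fst z) F (\<alpha> (snd z))) \<in> \<B> \<L>"
   "(\<lambda>z. \<D> (fst z) G (\<beta> (snd z))) \<in> \<B> \<L>"
   by (intro measurable_add_one_cost[OF F] measurable_add_one_cost[OF G] measurable_fst
    m_comp[OF measurable_snd \<alpha>] m_comp[OF measurable_snd \<beta>])+
  show ?thesis by measurable
 qed
 have "(\<integral>\<^sup>+m. ennreal (\<bar>\<D> x F (\<alpha> m)\<bar> powr q * \<bar>\<D> x G (\<beta> m)\<bar>) \<partial>mix L)
  \<le> \<M> P (q + 1) (\<D> x G) * epow (\<integral>\<^sup>+m. epow (ennreal \<bar>\<D> x F m\<bar>) (q + 1) \<partial>P) (1 - 1 / (q + 1))"
  if x: "x \<in> space L" for x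
 proof -
  have fm: "\<D> x F \<in> \<F> L" "\<D> x G \<in> \<F> L"
   using x by (auto intro!: measurable_add_one_cost[OF F] measurable_add_one_cost[OF G])
  define f g where "f m = epow (ennreal \<bar>\<D> x F m\<bar>) (q + 1)" and "g m = epow (ennreal \<bar>\<D> x G m\<bar>) (q + 1)" for m
  have fg: "f \<in> \<F> L" "g \<in> \<F> L"
   unfolding f_def[abs_def] g_def[abs_def] using fm by (auto intro!: m_comp[OF _ measurable_epow])
  have fg': "(\<lambda>m. f (\<alpha> m)) \<in> \<B> (mix L)" "(\<lambda>m. g (\<beta> m)) \<in> \<B> (mix L)"
   by (rule m_comp[OF \<alpha> fg(1)], rule m_comp[OF \<beta> fg(2)])
  have "(\<integral>\<^sup>+m. ennreal (\<bar>\<D> x F (\<alpha> m)\<bar> powr q * \<bar>\<D> x G (\<beta> m)\<bar>) \<partial>mix L)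
   = (\<integral>\<^sup>+m. epow (g (\<beta> m)) (1 / (q + 1)) * epow (f (\<alpha> m)) (1 - 1 / (q + 1)) \<partial>mix L)"
  proof (intro nn_integral_cong)
   fix m
   have "(q + 1) * (1 - 1 / (q + 1)) = q" "(q + 1) * (1 / (q + 1)) = 1" using q by (auto simp: field_simps)
   then show "ennreal (\<bar>\<D> x F (\<alpha> m)\<bar> powr q * \<bar>\<D> x G (\<beta> m)\<bar>) = epow (g (\<beta> m)) (1 / (q + 1)) * epow (f (\<alpha> m)) (1 - 1 / (q + 1))"
    unfolding f_def g_def epow_epow by (simp only: epow_one, simp add: ennreal_mult mult.commute)
  qed
  also have "\<dots> \<le> epow (\<integral>\<^sup>+m. g (\<beta> m) \<partial>mix L) (1 / (q + 1)) * epow (\<integral>\<^sup>+m. f (\<alpha> m) \<partial>mix L) (1 - 1 / (q + 1))"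
   using q by (intro holder_nn_integral fg') (auto simp: field_simps)
  also have "\<dots> = epow (\<integral>\<^sup>+m. g m \<partial>P) (1 / (q + 1)) * epow (\<integral>\<^sup>+m. f m \<partial>P) (1 - 1 / (q + 1))"
   by (simp only: mix_marginal(1)[OF fg(1)] mix_marginal(2)[OF fg(2)])
  finally show ?thesis unfolding f_def g_def field_moment_def .
 qed
 then show ?thesis
  unfolding Q.nn_integral_fst[OF m, symmetric] by (simp add: nn_integral_mono)
qed

end

section \<open>Gaussian smoothing of test functions\<close>

lemma has_derivative_partial:
 fixes g :: "real^'m::finite \<Rightarrow> real"
 assumes "g differentiable (at x)"
 shows "(g has_derivative (\<lambda>v. \<Sum>j\<in>UNIV. v $ j * partial j g x)) (at x)"
proof -
 let ?D = "frechet_derivative g (at x)"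
 have D: "(g has_derivative ?D) (at x)" using assms by (simp add: frechet_derivative_works)
 have "?D v = (\<Sum>j\<in>UNIV. v $ j * partial j g x)" for v
 proof -
  have "?D v = ?D (\<Sum>j\<in>UNIV. v $ j *\<^sub>R axis j 1)"
   using basis_expansion[of v] by (simp add: scalar_mult_eq_scaleR)
  also have "\<dots> = (\<Sum>j\<in>UNIV. v $ j * partial j g x)"
   using has_derivative_linear[OF D] by (simp add: linear_sum linear_scale partial_def)
  finally show ?thesis .
 qed
 then have "?D = (\<lambda>v. \<Sum>j\<in>UNIV. v $ j * partial j g x)" by blast
 with D show ?thesis by simp
qed

lemma has_derivative_along_line:
 fixes g :: "real^'m::finite \<Rightarrow> real"
 assumes "\<And>x. g differentiable (at x)"
 shows "((\<lambda>r. g (z + r *\<^sub>R d)) has_real_derivative (\<Sum>j\<in>UNIV. d $ j * partial j g (z + r *\<^sub>R d))) (at r)"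
proof -
 have "((\<lambda>r. z + r *\<^sub>R d) has_derivative (\<lambda>t. t *\<^sub>R d)) (at r)" by (auto intro!: derivative_eq_intros)
 from has_derivative_compose[OF this has_derivative_partial[OF assms]]
 show ?thesis unfolding has_field_derivative_def
  by (rule has_derivative_eq_rhs) (simp add: fun_eq_iff sum_distrib_left mult_ac)
qed

lemma sum_abs_le_norm:
 fixes d :: "real^'m::finite"
 shows "(\<Sum>j\<in>UNIV. \<bar>d $ j\<bar>) \<le> real CARD('m) * norm d"
 using sum_bounded_above[of UNIV "\<lambda>j. \<bar>d $ j\<bar>" "norm d"] component_le_norm_cart[of d] by simp

lemma lipschitz_partial:
 fixes g :: "real^'m::finite \<Rightarrow> real"
 assumes g: "\<And>x. g differentiable (at x)" and B: "\<And>j x. \<bar>partial j g x\<bar> \<le> B"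
 shows "\<bar>g (x + d) - g x\<bar> \<le> B * (\<Sum>j\<in>UNIV. \<bar>d $ j\<bar>)"
proof -
 have "norm (g (x + 1 *\<^sub>R d) - g (x + 0 *\<^sub>R d)) \<le> (B * (\<Sum>j\<in>UNIV. \<bar>d $ j\<bar>)) * norm (1 - 0 :: real)"
 proof (rule field_differentiable_bound[where S=UNIV and f="\<lambda>r. g (x + r *\<^sub>R d)"])
  show "((\<lambda>r. g (x + r *\<^sub>R d)) has_field_derivative (\<Sum>j\<in>UNIV. d $ j * partial j g (x + r *\<^sub>R d))) (at r within UNIV)" for r
   using has_derivative_along_line[OF g] by simp
  show "norm (\<Sum>j\<in>UNIV. d $ j * partial j g (x + r *\<^sub>R d)) \<le> B * (\<Sum>j\<in>UNIV. \<bar>d $ j\<bar>)" for r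
   unfolding sum_distrib_left real_norm_def
   using B by (intro order_trans[OF sum_abs] sum_mono) (simp add: abs_mult mult.commute[of B] mult_left_mono)
 qed auto
 then show ?thesis by simp
qed

text \<open>The increment and its linear part are each at most \<open>K1 * A\<close>, giving the
  first-order bound; Lipschitz continuity of the gradient \<open>v\<close> gives the second-order
  one. Interpolating between them reaches any exponent \<open>q\<close> in [1,2].\<close>

lemma taylor_remainder:
 fixes u :: "real^'m::finite \<Rightarrow> real"
 assumes D: "\<And>y d r. ((\<lambda>r. u (y + r *\<^sub>R d)) has_real_derivative (\<Sum>j\<in>UNIV. d $ j * v j (y + r *\<^sub>R d))) (at r)"
  and K1: "\<And>j y. \<bar>v j y\<bar> \<le> K1" and K2: "\<And>j y d. \<bar>v j (y + d) - v j y\<bar> \<le> K2 * (\<Sum>j\<in>UNIV. \<bar>d $ j\<bar>)"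
  and q: "1 \<le> q" "q \<le> 2"
 shows "\<bar>u (y + d) - u y\<bar> \<le> K1 * (\<Sum>j\<in>UNIV. \<bar>d $ j\<bar>)"
  and "\<bar>u (y + d) - u y - (\<Sum>j\<in>UNIV. d $ j * v j y)\<bar> \<le>
   ((2 - q) * (2 * K1) + (q - 1) * (K2 / 2)) * (\<Sum>j\<in>UNIV. \<bar>d $ j\<bar>) powr q"
proof -
 define A where "A = (\<Sum>j\<in>UNIV. \<bar>d $ j\<bar>)"
 define S where "S = (\<Sum>j\<in>UNIV. d $ j * v j y)"
 have A0: "0 \<le> A" by (simp add: A_def sum_nonneg)
 have K10: "0 \<le> K1" using K1[of undefined 0] by simp
 have K20: "0 \<le> K2"
 proof -
  have "0 \<le> K2 * real CARD('m)" using order_trans[OF abs_ge_zero K2[of undefined 0 "\<chi> j. 1"]] by simp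
  then show ?thesis by (simp add: zero_le_mult_iff)
 qed
 have wsum: "\<bar>\<Sum>j\<in>UNIV. d $ j * w j\<bar> \<le> k * A" if "\<And>j. \<bar>w j\<bar> \<le> k" for w k
  unfolding A_def sum_distrib_left
  using that by (intro order_trans[OF sum_abs] sum_mono) (simp add: abs_mult mult.commute[of k] mult_left_mono)
 have b: "\<bar>u (y + d) - u y\<bar> \<le> K1 * A"
 proof -
  have "norm (u (y + 1 *\<^sub>R d) - u (y + 0 *\<^sub>R d)) \<le> (K1 * A) * norm (1 - 0 :: real)"
   by (rule field_differentiable_bound[where S=UNIV and f="\<lambda>r. u (y + r *\<^sub>R d)"])
    (use D wsum[OF K1] in \<open>auto simp: has_field_derivative_at_within\<close>)
  then show ?thesis by simp
 qed
 then show "\<bar>u (y + d) - u y\<bar> \<le> K1 * (\<Sum>j\<in>UNIV. \<bar>d $ j\<bar>)" by (simp add: A_def)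
 have "\<bar>S\<bar> \<le> K1 * A" unfolding S_def by (rule wsum) (rule K1)
 with b have r1: "\<bar>u (y + d) - u y - S\<bar> \<le> (2 * K1) * A" by linarith
 have d2: "\<bar>(\<Sum>j\<in>UNIV. d $ j * v j (y + r *\<^sub>R d)) - S\<bar> \<le> K2 * A\<^sup>2 * r" if "0 \<le> r" for r
 proof -
  have "(\<Sum>j\<in>UNIV. d $ j * v j (y + r *\<^sub>R d)) - S = (\<Sum>j\<in>UNIV. d $ j * (v j (y + r *\<^sub>R d) - v j y))"
   by (simp add: S_def sum_subtractf right_diff_distrib)
  also have "\<bar>\<dots>\<bar> \<le> (K2 * (r * A)) * A"
  proof (rule wsum)
   show "\<bar>v j (y + r *\<^sub>R d) - v j y\<bar> \<le> K2 * (r * A)" for j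
    using K2[of j y "r *\<^sub>R d"] that by (simp add: A_def abs_mult sum_distrib_left)
  qed
  finally show ?thesis by (simp add: power2_eq_square ac_simps)
 qed
 have half: "\<sigma> * (u (y + d) - u y - S) \<le> K2 / 2 * A\<^sup>2" if \<sigma>: "\<sigma> \<in> {1, -1}" for \<sigma> :: real
 proof -
  \<comment> \<open>Comparison with a parabola: the Lipschitz bound makes \<open>G\<close>
    nonincreasing on [0,1], which yields the factor 1/2 from first derivatives of \<open>u\<close>
    alone. The sign \<sigma> covers both sides of the absolute value.\<close>
  define G where "G r = \<sigma> * (u (y + r *\<^sub>R d) - r * S) - K2 / 2 * A\<^sup>2 * r\<^sup>2" for r
  have "G 1 \<le> G 0"
  proof (rule DERIV_nonpos_imp_nonincreasing[where f=G])
   fix r :: real assume r: "0 \<le> r" "r \<le> 1"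
   have "(G has_real_derivative \<sigma> * ((\<Sum>j\<in>UNIV. d $ j * v j (y + r *\<^sub>R d)) - S) - K2 * A\<^sup>2 * r) (at r)"
    unfolding G_def[abs_def] by (auto intro!: derivative_eq_intros D)
   moreover have "\<sigma> * ((\<Sum>j\<in>UNIV. d $ j * v j (y + r *\<^sub>R d)) - S) - K2 * A\<^sup>2 * r \<le> 0"
    using d2[OF r(1)] \<sigma> by (auto simp: abs_le_iff)
   ultimately show "\<exists>l. (G has_real_derivative l) (at r) \<and> l \<le> 0" by blast
  qed simp
  then show ?thesis by (simp add: G_def algebra_simps)
 qed
 have r2: "\<bar>u (y + d) - u y - S\<bar> \<le> (K2 / 2) * A\<^sup>2" 
  using half[of 1] half[of "-1"] by (intro abs_leI) simp_all
 show "\<bar>u (y + d) - u y - (\<Sum>j\<in>UNIV. d $ j * v j y)\<bar> \<le>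
   ((2 - q) * (2 * K1) + (q - 1) * (K2 / 2)) * (\<Sum>j\<in>UNIV. \<bar>d $ j\<bar>) powr q"
  using power_interpolation[OF abs_ge_zero r1 r2 A0 _ _ q] K10 K20 by (simp add: S_def A_def)
qed

lemma mat_op_norm_bound: "norm (A *v x) \<le> mat_op_norm A * norm x"
 unfolding mat_op_norm_def by (rule onorm) (rule matrix_vector_mul_bounded_linear)

lemma mat_op_norm_nonneg: "0 \<le> mat_op_norm A"
 unfolding mat_op_norm_def by (rule onorm_pos_le) (rule matrix_vector_mul_bounded_linear)

text \<open>The last claim, obtained from one unit vector, is that the condition number is at least
  1. It later brings the constants of the \<open>d\<^sub>2\<close> bound into their stated
  form.\<close>

lemma pos_def_inv:
 fixes C :: "real^'m::finite^'m"
 assumes "pos_def C"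
 shows "C *v (matrix_inv C *v x) = x" and "x \<bullet> (matrix_inv C *v x) \<le> mat_op_norm (matrix_inv C) * (norm x)\<^sup>2"
  and "1 \<le> mat_op_norm (matrix_inv C) * mat_op_norm C"
proof -
 have "inj ((*v) C)"
  using assms unfolding pos_def_def by (intro linear_injective_0[THEN iffD2] matrix_vector_mul_linear allI impI) (metis inner_zero_right less_irrefl)
 then have "invertible C" by (metis invertible_left_inverse matrix_left_invertible_injective)
 then have i: "C ** matrix_inv C = mat 1"
  unfolding invertible_def matrix_inv_def by (rule someI_ex[THEN conjunct1])
 then show e: "C *v (matrix_inv C *v x) = x" for x by (simp add: matrix_vector_mul_assoc)
 have "x \<bullet> (matrix_inv C *v x) \<le> norm x * norm (matrix_inv C *v x)" by (rule norm_cauchy_schwarz)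
 also have "\<dots> \<le> norm x * (mat_op_norm (matrix_inv C) * norm x)" by (intro mult_left_mono mat_op_norm_bound) simp
 finally show "x \<bullet> (matrix_inv C *v x) \<le> mat_op_norm (matrix_inv C) * (norm x)\<^sup>2" by (simp add: power2_eq_square ac_simps)
 let ?e = "axis undefined 1 :: real^'m"
 have "norm ?e = norm (C *v (matrix_inv C *v ?e))" by (simp only: e)
 also have "\<dots> \<le> mat_op_norm C * norm (matrix_inv C *v ?e)" by (rule mat_op_norm_bound)
 also have "\<dots> \<le> mat_op_norm C * (mat_op_norm (matrix_inv C) * norm ?e)" by (intro mult_left_mono mat_op_norm_bound mat_op_norm_nonneg)
 finally show "1 \<le> mat_op_norm (matrix_inv C) * mat_op_norm C" by (simp add: norm_axis_1 mult.commute)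
qed

context gaussian
begin

text \<open>For \<open>c\<close> and \<open>s\<close> the cosine and sine of one angle this is
  Mehler's formula for the Ornstein-Uhlenbeck semigroup with stationary law N(0, C). It appears when
  \<open>X\<close> is integrated out along the interpolation path.\<close>

definition smooth :: "real \<Rightarrow> real \<Rightarrow> (real^'m \<Rightarrow> real) \<Rightarrow> real^'m \<Rightarrow> real" where
 "smooth c s g y = (\<integral>u. g (c *\<^sub>R y + s *\<^sub>R X u) \<partial>N)"

lemma smooth_measurable [measurable]:
 assumes [measurable]: "g \<in> \<B> borel"
 shows "smooth c s g \<in> \<B> borel"
 unfolding smooth_def[abs_def] by measurable

lemma shifted_growth:
 fixes g :: "real^'m \<Rightarrow> real"
 assumes g: "\<And>x. g differentiable (at x)" and B: "\<And>j x. \<bar>partial j g x\<bar> \<le> B"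
 shows "\<bar>g (z + s *\<^sub>R x)\<bar> \<le> (\<bar>g z\<bar> + B * real CARD('m) * \<bar>s\<bar>) * (1 + norm x)"
proof -
 have B0: "0 \<le> B" using B[of undefined 0] by simp
 have "\<bar>g (z + s *\<^sub>R x) - g z\<bar> \<le> B * (\<Sum>j\<in>UNIV. \<bar>(s *\<^sub>R x) $ j\<bar>)" by (rule lipschitz_partial[OF g B])
 also have "\<dots> \<le> B * (real CARD('m) * norm (s *\<^sub>R x))" using B0 sum_abs_le_norm[of "s *\<^sub>R x"] by (intro mult_left_mono)
 finally have "\<bar>g (z + s *\<^sub>R x)\<bar> \<le> \<bar>g z\<bar> * 1 + (B * real CARD('m) * \<bar>s\<bar>) * norm x" by (simp add: mult.assoc)
 also have "\<dots> \<le> \<bar>g z\<bar> * (1 + norm x) + (B * real CARD('m) * \<bar>s\<bar>) * (1 + norm x)"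
  using B0 by (intro add_mono mult_left_mono) auto
 finally show ?thesis by (simp add: distrib_right)
qed

lemma differentiable_measurable:
 fixes g :: "real^'m \<Rightarrow> real"
 shows "(\<And>x. g differentiable (at x)) \<Longrightarrow> g \<in> \<B> borel"
 by (intro borel_measurable_continuous_onI continuous_at_imp_continuous_on ballI differentiable_imp_continuous_within)

lemma integrable_shifted:
 assumes g: "\<And>x. g differentiable (at x)" and B: "\<And>j x. \<bar>partial j g x\<bar> \<le> B"
 shows "integrable N (\<lambda>u. g (z + s *\<^sub>R X u))"
proof -
 have [measurable]: "g \<in> \<B> borel" using g by (rule differentiable_measurable)
 show ?thesis using integrable_linear_growth(1)[OF _ shifted_growth[OF g B, of z s], of 0] by simp
qed

lemma smooth_derivative:
 assumes g: "\<And>x. g differentiable (at x)" and B: "\<And>j x. \<bar>partial j g x\<bar> \<le> B"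
  and m: "\<And>j. partial j g \<in> \<B> borel"
 shows "((\<lambda>r. smooth c s g (y + r *\<^sub>R d)) has_real_derivative
   (\<Sum>j\<in>UNIV. d $ j * (c * smooth c s (partial j g) (y + r *\<^sub>R d)))) (at r)"
proof -
 note [measurable] = m
 have ip: "integrable N (\<lambda>u. partial j g (z + s *\<^sub>R X u))" for j z
  by (rule integrable_const_bound[where B=B]) (use B in auto)
 let ?z = "\<lambda>r u. (c *\<^sub>R y + s *\<^sub>R X u) + r *\<^sub>R (c *\<^sub>R d)"
 have z: "c *\<^sub>R (y + r *\<^sub>R d) + s *\<^sub>R X u = ?z r u" for r u by (simp add: scaleR_add_right ac_simps)
 have "((\<lambda>r. \<integral>u. g (?z r u) \<partial>N) has_real_derivative (\<integral>u. (\<Sum>j\<in>UNIV. (c *\<^sub>R d) $ j * partial j g (?z r u)) \<partial>N)) (at r)"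
 proof (rule has_real_derivative_integral(2)[where w="\<lambda>_. \<Sum>j\<in>UNIV. \<bar>(c *\<^sub>R d) $ j\<bar> * B"])
  show "integrable N (\<lambda>u. g (?z r u))" for r
   using integrable_shifted[OF g B, of "c *\<^sub>R y + r *\<^sub>R (c *\<^sub>R d)" s] by (simp add: ac_simps)
  show "\<bar>\<Sum>j\<in>UNIV. (c *\<^sub>R d) $ j * partial j g (?z r u)\<bar> \<le> (\<Sum>j\<in>UNIV. \<bar>(c *\<^sub>R d) $ j\<bar> * B)" for r u
   using B by (intro order_trans[OF sum_abs] sum_mono) (simp add: abs_mult mult_left_mono)
  show "((\<lambda>r. g (?z r u)) has_real_derivative (\<Sum>j\<in>UNIV. (c *\<^sub>R d) $ j * partial j g (?z r u))) (at r)" for r u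
   by (rule has_derivative_along_line[OF g])
 qed simp
 moreover have "(\<integral>u. (\<Sum>j\<in>UNIV. (c *\<^sub>R d) $ j * partial j g (?z r u)) \<partial>N) = (\<Sum>j\<in>UNIV. d $ j * (c * smooth c s (partial j g) (y + r *\<^sub>R d)))"
 proof -
  have "integrable N (\<lambda>u. partial j g (?z r u))" for j
   using ip[of j "c *\<^sub>R y + r *\<^sub>R (c *\<^sub>R d)"] by (simp add: ac_simps)
  then show ?thesis unfolding smooth_def z by (subst B_integral_sum) (auto simp: ac_simps)
 qed
 ultimately show ?thesis unfolding smooth_def z by simp
qed

lemma smooth_bound:
 assumes [measurable]: "g \<in> \<B> borel" and B: "\<And>x. \<bar>g x\<bar> \<le> B"
 shows "\<bar>smooth c s g y\<bar> \<le> B"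
proof -
 have i: "integrable N (\<lambda>u. g (c *\<^sub>R y + s *\<^sub>R X u))" by (rule integrable_const_bound[where B=B]) (use B in auto)
 have "\<bar>smooth c s g y\<bar> \<le> (\<integral>u. \<bar>g (c *\<^sub>R y + s *\<^sub>R X u)\<bar> \<partial>N)" unfolding smooth_def by (rule integral_abs_bound)
 also have "\<dots> \<le> B" by (rule integral_le_const) (use i B in auto)
 finally show ?thesis .
qed

lemma smooth_ibp:
 assumes g: "\<And>x. g differentiable (at x)" and B: "\<And>j x. \<bar>partial j g x\<bar> \<le> B"
  and m: "\<And>j. partial j g \<in> \<B> borel"
 shows "(\<integral>u. (a \<bullet> X u) * g (c *\<^sub>R y + s *\<^sub>R X u) \<partial>N) = s * (\<Sum>j\<in>UNIV. (C *v a) $ j * smooth c s (partial j g) y)"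
proof -
 note [measurable] = m
 define \<phi> where "\<phi> x = g (c *\<^sub>R y + s *\<^sub>R x)" for x
 define \<phi>' where "\<phi>' x v = (\<Sum>j\<in>UNIV. (s *\<^sub>R v) $ j * partial j g (c *\<^sub>R y + s *\<^sub>R x))" for x v
 have "(\<integral>u. \<phi>' (X u) (C *v a) \<partial>N) = (\<integral>u. (a \<bullet> X u) * \<phi> (X u) \<partial>N)"
 proof (rule integration_by_parts)
  show "(\<phi> has_derivative \<phi>' x) (at x)" for x
   unfolding \<phi>_def[abs_def] \<phi>'_def[abs_def]
   by (rule has_derivative_compose[OF _ has_derivative_partial[OF g]]) (auto intro!: derivative_eq_intros)
  show "\<bar>\<phi>' x (C *v a)\<bar> \<le> (\<Sum>j\<in>UNIV. \<bar>(s *\<^sub>R (C *v a)) $ j\<bar> * B)" for x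
   unfolding \<phi>'_def using B by (intro order_trans[OF sum_abs] sum_mono) (simp add: abs_mult mult_left_mono)
  show "\<bar>\<phi> x\<bar> \<le> (\<bar>g (c *\<^sub>R y)\<bar> + B * real CARD('m) * \<bar>s\<bar>) * (1 + norm x)" for x
   unfolding \<phi>_def by (rule shifted_growth[OF g B])
 qed
 moreover have "integrable N (\<lambda>u. partial j g (c *\<^sub>R y + s *\<^sub>R X u))" for j
  by (rule integrable_const_bound[where B=B]) (use B in auto)
 ultimately show ?thesis
  by (simp add: \<phi>_def \<phi>'_def smooth_def sum_distrib_left mult.assoc)
qed

text \<open>When \<open>C\<close> is invertible, integration by parts with \<open>a = C\<^sup>-\<^sup>1 e\<^sub>j / s\<close> removes the derivative.\<close>

lemma smooth_pos_def:
 assumes C: "pos_def C" and s: "0 < s" and z: "z = c *\<^sub>R d"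
  and g: "\<And>x. g differentiable (at x)" and B: "\<And>j x. \<bar>partial j g x\<bar> \<le> B"
  and m: "\<And>j. partial j g \<in> \<B> borel"
  and h: "\<And>x. \<bar>g (x + z) - e * g x\<bar> \<le> b"
 shows "\<bar>smooth c s (partial j g) (y + d) - e * smooth c s (partial j g) y\<bar> \<le> sqrt (2 / pi) * sqrt (mat_op_norm (matrix_inv C)) / s * b"
proof -
 define a where "a = matrix_inv C *v axis j (1::real)"
 have Ca: "C *v a = axis j 1" unfolding a_def by (rule pos_def_inv(1)[OF C])
 have v: "smooth c s (partial j g) y = (\<integral>u. (a \<bullet> X u) * g (c *\<^sub>R y + s *\<^sub>R X u) \<partial>N) / s" for y
 proof -
  have "(\<Sum>i\<in>UNIV. axis j 1 $ i * smooth c s (partial i g) y) = smooth c s (partial j g) y"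
   by (simp add: axis_def if_distrib[where f="\<lambda>x. x * _"] cong: if_cong)
  then show ?thesis using smooth_ibp[OF g B m, of a c y s] s by (simp add: Ca)
 qed
 have gm [measurable]: "g \<in> \<B> borel" using g by (rule differentiable_measurable)
 have i: "integrable N (\<lambda>u. (a \<bullet> X u) * g (z' + s *\<^sub>R X u))" for z'
 proof (rule B_integrable_bound)
  let ?K = "\<bar>g z'\<bar> + B * real CARD('m) * \<bar>s\<bar>"
  show "integrable N (\<lambda>u. norm a * ?K * (norm (X u) + (norm (X u))\<^sup>2))" using integrable_norm by simp
  show "AE u in N. norm ((a \<bullet> X u) * g (z' + s *\<^sub>R X u)) \<le> norm (norm a * ?K * (norm (X u) + (norm (X u))\<^sup>2))"
  proof (rule AE_I2)
   fix u
   have "norm ((a \<bullet> X u) * g (z' + s *\<^sub>R X u)) \<le> (norm a * norm (X u)) * (?K * (1 + norm (X u)))"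
    unfolding real_norm_def abs_mult by (intro mult_mono Cauchy_Schwarz_ineq2 shifted_growth[OF g B]) auto
   also have "\<dots> = norm a * ?K * (norm (X u) + (norm (X u))\<^sup>2)" by (simp add: power2_eq_square algebra_simps)
   finally show "norm ((a \<bullet> X u) * g (z' + s *\<^sub>R X u)) \<le> norm (norm a * ?K * (norm (X u) + (norm (X u))\<^sup>2))"
    by (rule order_trans) simp
  qed
 qed measurable
 have b0: "0 \<le> b" using h[of 0] by linarith
 \<comment> \<open>The parameter \<open>e\<close> unites two uses: with \<open>e = 0\<close> and
   \<open>d = 0\<close> the estimate bounds the smoothed derivative itself, with
   \<open>e = 1\<close> its increment.\<close>
 have "s * (smooth c s (partial j g) (y + d) - e * smooth c s (partial j g) y)
   = (\<integral>u. (a \<bullet> X u) * (g ((c *\<^sub>R y + s *\<^sub>R X u) + z) - e * g (c *\<^sub>R y + s *\<^sub>R X u)) \<partial>N)"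
 proof -
  have "integrable N (\<lambda>u. (a \<bullet> X u) * g ((c *\<^sub>R y + s *\<^sub>R X u) + z))" using i[of "c *\<^sub>R y + z"] by (simp add: ac_simps)
  with i[of "c *\<^sub>R y"] have "(\<integral>u. (a \<bullet> X u) * g ((c *\<^sub>R y + s *\<^sub>R X u) + z) - e * ((a \<bullet> X u) * g (c *\<^sub>R y + s *\<^sub>R X u)) \<partial>N)
   = (\<integral>u. (a \<bullet> X u) * g ((c *\<^sub>R y + s *\<^sub>R X u) + z) \<partial>N) - e * (\<integral>u. (a \<bullet> X u) * g (c *\<^sub>R y + s *\<^sub>R X u) \<partial>N)"
   by simp
  moreover have "c *\<^sub>R (y + d) + s *\<^sub>R X u = (c *\<^sub>R y + s *\<^sub>R X u) + z" for u by (simp add: z scaleR_add_right ac_simps)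
  ultimately show ?thesis unfolding v using s by (simp only: right_diff_distrib mult.left_commute) simp
 qed
 also have "\<bar>\<dots>\<bar> \<le> (\<integral>u. \<bar>a \<bullet> X u\<bar> * b \<partial>N)"
 proof (rule order_trans[OF integral_abs_bound integral_mono])
  show "integrable N (\<lambda>u. \<bar>(a \<bullet> X u) * (g ((c *\<^sub>R y + s *\<^sub>R X u) + z) - e * g (c *\<^sub>R y + s *\<^sub>R X u))\<bar>)"
  proof (rule integrable_abs, unfold right_diff_distrib, rule B_integrable_diff)
   show "integrable N (\<lambda>u. (a \<bullet> X u) * g ((c *\<^sub>R y + s *\<^sub>R X u) + z))" using i[of "c *\<^sub>R y + z"] by (simp add: ac_simps)
   show "integrable N (\<lambda>u. (a \<bullet> X u) * (e * g (c *\<^sub>R y + s *\<^sub>R X u)))" using integrable_mult_right[OF i[of "c *\<^sub>R y"], of e] by (simp add: mult.left_commute)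
  qed
  show "integrable N (\<lambda>u. \<bar>a \<bullet> X u\<bar> * b)" using integrable_inner by simp
  show "\<bar>(a \<bullet> X u) * (g ((c *\<^sub>R y + s *\<^sub>R X u) + z) - e * g (c *\<^sub>R y + s *\<^sub>R X u))\<bar> \<le> \<bar>a \<bullet> X u\<bar> * b" for u
   unfolding abs_mult by (intro mult_left_mono h) simp
 qed
 also have "\<dots> = sqrt (2 / pi) * sqrt (Q a) * b" by (simp add: abs_moment_inner)
 \<comment> \<open>As \<open>C *v a\<close> is a unit vector, the variance of
   \<open>a \<bullet> X\<close> is a diagonal entry of the inverse of \<open>C\<close>.\<close>
 also have "\<dots> \<le> sqrt (2 / pi) * sqrt (mat_op_norm (matrix_inv C)) * b"
 proof -
  have "Q a = axis j 1 \<bullet> (matrix_inv C *v axis j 1)" unfolding Q_def Ca by (simp add: a_def inner_commute)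
  also have "\<dots> \<le> mat_op_norm (matrix_inv C)" using pos_def_inv(2)[OF C, of "axis j 1"] by (simp add: norm_axis_1)
  finally show ?thesis using b0 by (intro mult_right_mono mult_left_mono) auto
 qed
 finally show ?thesis using s by (simp add: abs_mult pos_le_divide_eq mult.commute)
qed

end

section \<open>Derivative bounds for the two classes of test functions\<close>

lemma derivative_bound:
 fixes f :: "real \<Rightarrow> real"
 assumes "(f has_real_derivative D) (at 0)" and b: "\<And>t. \<bar>f t - f 0\<bar> \<le> \<bar>t\<bar>"
 shows "\<bar>D\<bar> \<le> 1"
proof (rule tendsto_upperbound[OF tendsto_rabs[OF DERIV_D[OF assms(1)]]])
 show "\<forall>\<^sub>F h in at 0. \<bar>(f (0 + h) - f 0) / h\<bar> \<le> 1"
  unfolding eventually_at_filter using b by (auto intro!: always_eventually simp: abs_divide divide_le_eq)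
qed simp

lemma test_fun3D:
 fixes h :: "real^'m::finite \<Rightarrow> real"
 assumes h: "h \<in> test_fun3"
 shows "h differentiable (at x)" "partial i h differentiable (at x)" "continuous_on UNIV (partial j (partial i h))"
  "\<bar>partial j (partial i h) x\<bar> \<le> 1"
  "\<bar>partial j (partial i h) (x + d) - partial j (partial i h) x\<bar> \<le> (\<Sum>j\<in>UNIV. \<bar>d $ j\<bar>)"
proof -
 have C: "class_C (Suc (Suc (Suc 0))) h" using h by (simp add: test_fun3_def numeral_3_eq_3)
 then show "h differentiable (at x)" "partial i h differentiable (at x)" by (auto simp: differentiable_on_def)
 have dd: "partial j (partial i h) differentiable (at x)" for x i j using C by (auto simp: differentiable_on_def)
 then show "continuous_on UNIV (partial j (partial i h))"
  by (intro continuous_at_imp_continuous_on ballI differentiable_imp_continuous_within)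
 have sup: "\<bar>partials is h x\<bar> \<le> 1" if "deriv_sup_norm (length is) h \<le> 1" for "is" and x :: "real^'m"
 proof -
  have "ennreal \<bar>partials is h x\<bar> \<le> (SUP x. ennreal \<bar>partials is h x\<bar>)" by (rule SUP_upper) simp
  also have "\<dots> \<le> deriv_sup_norm (length is) h" unfolding deriv_sup_norm_def by (rule SUP_upper) simp
  finally have "ennreal \<bar>partials is h x\<bar> \<le> 1" using that by (rule order_trans)
  then show ?thesis by simp
 qed
 show "\<bar>partial j (partial i h) x\<bar> \<le> 1" using sup[of "[j, i]" x] h by (simp add: test_fun3_def numeral_2_eq_2)
 have "\<bar>partial k (partial j (partial i h)) x\<bar> \<le> 1" for k x
  using sup[of "[k, j, i]" x] h by (simp add: test_fun3_def numeral_3_eq_3)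
 from lipschitz_partial[OF dd this]
 show "\<bar>partial j (partial i h) (x + d) - partial j (partial i h) x\<bar> \<le> (\<Sum>j\<in>UNIV. \<bar>d $ j\<bar>)" by simp
qed

lemma test_fun2D:
 fixes h :: "real^'m::finite \<Rightarrow> real"
 assumes h: "h \<in> test_fun2"
 shows "h differentiable (at x)" "partial i h differentiable (at x)" "continuous_on UNIV (partial j (partial i h))"
  "\<bar>partial j (partial i h) x\<bar> \<le> 1" "\<bar>partial i h x\<bar> \<le> 1" "\<bar>partial i h (x + d) - partial i h x\<bar> \<le> norm d"
proof -
 have C: "class_C (Suc (Suc 0)) h" using h by (simp add: test_fun2_def numeral_2_eq_2)
 then show d: "h differentiable (at x)" "partial i h differentiable (at x)" "continuous_on UNIV (partial j (partial i h))" for x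
  by (auto simp: differentiable_on_def)
 \<comment> \<open>The gradient of \<open>partial i h\<close> is column \<open>i\<close> of the
   Hessian, so its Euclidean norm is at most the operator norm. This gives a Lipschitz bound in
   Euclidean norm, sharper than the one from single entries.\<close>
 define p where "p x = (\<chi> k. partial k (partial i h) x)" for x
 have p: "norm (p x) \<le> 1" for x
 proof -
  have "ennreal (mat_op_norm (Hess h x)) \<le> (SUP x. ennreal (mat_op_norm (Hess h x)))" by (rule SUP_upper) simp
  also have "\<dots> \<le> 1" using h by (simp add: test_fun2_def)
  finally have "ennreal (mat_op_norm (Hess h x)) \<le> ennreal 1" by simp
  then have H: "mat_op_norm (Hess h x) \<le> 1" by (subst (asm) ennreal_le_iff) auto
  have "p x = Hess h x *v axis i 1" by (simp add: p_def vec_eq_iff matrix_vector_mul_component Hess_def inner_axis)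
  then show ?thesis using mat_op_norm_bound[of "Hess h x" "axis i 1"] H by (simp add: norm_axis_1)
 qed
 show "\<bar>partial j (partial i h) x\<bar> \<le> 1" using order_trans[OF component_le_norm_cart[of "p x" j] p] by (simp add: p_def)
 show "\<bar>partial i h x\<bar> \<le> 1"
 proof (rule derivative_bound[OF has_real_derivative_partial[OF d(1)]])
  fix t
  have "\<bar>h (x + t *\<^sub>R axis i 1) - h x\<bar> \<le> norm ((x + t *\<^sub>R axis i 1) - x)" using h unfolding test_fun2_def by blast
  then show "\<bar>h (x + t *\<^sub>R axis i 1) - h (x + 0 *\<^sub>R axis i 1)\<bar> \<le> \<bar>t\<bar>" by (simp add: norm_axis_1)
 qed
 have "norm (partial i h (x + 1 *\<^sub>R d) - partial i h (x + 0 *\<^sub>R d)) \<le> norm d * norm (1 - 0 :: real)"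
 proof (rule field_differentiable_bound[where S=UNIV and f="\<lambda>r. partial i h (x + r *\<^sub>R d)"])
  show "((\<lambda>r. partial i h (x + r *\<^sub>R d)) has_field_derivative (\<Sum>k\<in>UNIV. d $ k * partial k (partial i h) (x + r *\<^sub>R d))) (at r within UNIV)" for r
   using has_derivative_along_line[OF d(2)] by simp
  have "(\<Sum>k\<in>UNIV. d $ k * partial k (partial i h) (x + r *\<^sub>R d)) = d \<bullet> p (x + r *\<^sub>R d)" for r by (simp add: inner_vec_def p_def)
  moreover have "\<bar>d \<bullet> p (x + r *\<^sub>R d)\<bar> \<le> norm d" for r
   using order_trans[OF Cauchy_Schwarz_ineq2 mult_left_mono[OF p norm_ge_zero]] by simp
  ultimately show "norm (\<Sum>k\<in>UNIV. d $ k * partial k (partial i h) (x + r *\<^sub>R d)) \<le> norm d" for r by simp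
 qed auto
 then show "\<bar>partial i h (x + d) - partial i h x\<bar> \<le> norm d" by simp
qed

lemma (in gaussian) smooth_lipschitz:
 assumes [measurable]: "g \<in> \<B> borel" and B: "\<And>x. \<bar>g x\<bar> \<le> B" and l: "\<And>x. \<bar>g (x + c *\<^sub>R d) - g x\<bar> \<le> b"
 shows "\<bar>smooth c s g (y + d) - smooth c s g y\<bar> \<le> b"
proof -
 have i: "integrable N (\<lambda>u. g (c *\<^sub>R y + s *\<^sub>R X u))" for y by (rule integrable_const_bound[where B=B]) (use B in auto)
 have "\<bar>smooth c s g (y + d) - smooth c s g y\<bar> = \<bar>\<integral>u. g (c *\<^sub>R (y + d) + s *\<^sub>R X u) - g (c *\<^sub>R y + s *\<^sub>R X u) \<partial>N\<bar>"
  unfolding smooth_def using i[of "y + d"] i[of y] by simp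
 also have "\<dots> \<le> (\<integral>u. \<bar>g (c *\<^sub>R (y + d) + s *\<^sub>R X u) - g (c *\<^sub>R y + s *\<^sub>R X u)\<bar> \<partial>N)" by (rule integral_abs_bound)
 also have "\<dots> \<le> b"
 proof (rule integral_le_const)
  show "AE u in N. \<bar>g (c *\<^sub>R (y + d) + s *\<^sub>R X u) - g (c *\<^sub>R y + s *\<^sub>R X u)\<bar> \<le> b"
   using l[of "c *\<^sub>R y + s *\<^sub>R X _"] by (simp add: scaleR_add_right ac_simps)
 qed (use i[of "y + d"] i[of y] in simp)
 finally show ?thesis .
qed

section \<open>Stein's method for a vector of Poisson functionals\<close>

locale stein_setting = poisson_space L P Y + G: gaussian N X C
 for L :: "'a measure" and P :: "'a measure measure" and Y and N :: "'v measure" and X :: "'v \<Rightarrow> real^'m::finite" and C +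
 fixes F :: "'m \<Rightarrow> 'a measure \<Rightarrow> real" and p q :: real and a2 a3 a4 :: "'m \<Rightarrow> 'm \<Rightarrow> real"
 assumes F: "\<And>i. dom_P (F i)" and F0: "\<And>i. (\<integral>m. F i m \<partial>P) = 0" and p: "1 \<le> p" "p \<le> 2" and q: "1 \<le> q" "q \<le> 2"
  and a2: "\<And>i j. 0 \<le> a2 i j" "\<And>i j. d22 p (F i) (F j) \<le> ennreal (a2 i j powr p)"
  and a3: "\<And>i j. 0 \<le> a3 i j" "\<And>i j. d12 p (F i) (F j) \<le> ennreal (a3 i j powr p)"
  and a4: "\<And>i j. 0 \<le> a4 i j" "\<And>i j. (\<integral>\<^sup>+x. \<M> P (q + 1) (\<D> x (F i)) *
     epow (\<integral>\<^sup>+m. epow (ennreal \<bar>\<D> x (F j) m\<bar>) (q + 1) \<partial>P) (1 - 1 / (q + 1)) \<partial>L) \<le> ennreal (a4 i j)"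
begin

definition V :: "'a measure \<Rightarrow> real^'m" where "V m = (\<chi> j. F j m)"

text \<open>Real-valued stand-in for the sum of the first three quantities: \<open>a2\<close> and
  \<open>a3\<close> play the part of the \<open>p\<close>-th roots of the double integrals, and the
  covariances are plain product moments because the functionals are centred.\<close>

definition \<zeta> :: real where
 "\<zeta> = (\<Sum>i\<in>UNIV. \<Sum>j\<in>UNIV. \<bar>C $ i $ j - (\<integral>m. F i m * F j m \<partial>P)\<bar>)
   + 2 powr (2 / p - 1) * (\<Sum>i\<in>UNIV. \<Sum>j\<in>UNIV. a2 i j) + 2 powr (2 / p) * (\<Sum>i\<in>UNIV. \<Sum>j\<in>UNIV. a3 i j)"

definition \<zeta>4 :: real where "\<zeta>4 = real CARD('m) powr (q - 1) * (\<Sum>i\<in>UNIV. \<Sum>j\<in>UNIV. a4 i j)"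

sublocale PN: pair_prob_space P N ..

lemma V_measurable: "V \<in> \<F> L"
proof (subst borel_measurable_euclidean_space, rule ballI)
 fix b :: "real^'m" assume "b \<in> Basis"
 then obtain j where "b = axis j 1" by (auto simp: Basis_vec_def)
 then show "(\<lambda>m. V m \<bullet> b) \<in> \<F> L" using F[of j] by (simp add: V_def inner_axis dom_P_def)
qed

lemma V_PN [measurable]: "(\<lambda>z. V (fst z)) \<in> \<B> (P \<Otimes>\<^sub>M N)"
 using V_measurable by (intro m_comp[OF measurable_fst]) simp

text \<open>An approximate integration by parts for \<open>V\<close>, the Poisson counterpart of the
  Gaussian one. Linearising the add-one cost of \<open>u (V m)\<close> with gradient
  \<open>v\<close> produces carre-du-champ terms weighted by \<open>v j\<close>;
  \<open>weighted_carre\<close> compares them with \<open>E v j\<close> times a covariance, and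
  \<open>k\<close> measures the linearisation error.\<close>

lemma stein_covariance:
 fixes u :: "real^'m \<Rightarrow> real" and v :: "'m \<Rightarrow> real^'m \<Rightarrow> real"
 assumes u [measurable]: "u \<in> \<B> borel" and v [measurable]: "\<And>j. v j \<in> \<B> borel"
  and vK: "\<And>j y. \<bar>v j y\<bar> \<le> K"
  and lip: "\<And>y d. \<bar>u (y + d) - u y\<bar> \<le> K' * (\<Sum>j\<in>UNIV. \<bar>d $ j\<bar>)"
  and rem: "\<And>y d. \<bar>u (y + d) - u y - (\<Sum>j\<in>UNIV. d $ j * v j y)\<bar> \<le> k * (\<Sum>j\<in>UNIV. \<bar>d $ j\<bar>) powr q"
  and k: "0 \<le> k"
 shows "\<bar>(\<Sum>j\<in>UNIV. C $ j $ i * (\<integral>m. v j (V m) \<partial>P)) - (\<integral>m. F i m * u (V m) \<partial>P)\<bar> \<le>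
  K * (\<Sum>j\<in>UNIV. \<bar>C $ j $ i - (\<integral>m. F j m * F i m \<partial>P)\<bar> + 2 powr (2 / p - 1) * (a3 i j + a3 j i + a2 j i))
   + k * (real CARD('m) powr (q - 1) * (\<Sum>j\<in>UNIV. a4 i j))"
proof -
 define H where "H m = u (V m)" for m
 define D where "D x m = (\<Sum>j\<in>UNIV. \<bar>\<D> x (F j) m\<bar>)" for x m
 define M where "M = real CARD('m)"
 have M0: "0 < M" by (simp add: M_def)
 have Fm [measurable]: "F j \<in> \<F> L" for j using F[of j] by (simp add: dom_P_def)
 have Fi: "integrable P (\<lambda>m. (F j m)\<^sup>2)" for j using F[of j] by (simp add: dom_P_def)
 note Vm [measurable] = V_measurable
 have Hm: "H \<in> \<F> L" unfolding H_def[abs_def] by measurable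
 have vm: "(\<lambda>m. v j (V m)) \<in> \<F> L" for j by measurable
 have K'0: "0 \<le> K'" using lip[of 0 "\<chi> j. 1"] M0 by (auto simp: M_def zero_le_mult_iff dest: order_trans[OF abs_ge_zero])
 have sq: "(\<Sum>j\<in>UNIV. \<bar>a j\<bar>)\<^sup>2 \<le> M * (\<Sum>j\<in>UNIV. (a j)\<^sup>2)" for a :: "'m \<Rightarrow> real"
  using power_mean[of "\<lambda>j. \<bar>a j\<bar>" 2] by (simp add: M_def powr_numeral sum_nonneg)
 have DH: "\<D> x H m = u (V m + (\<chi> j. \<D> x (F j) m)) - u (V m)" for x m
 proof -
  have "V (add_dirac m x) = V m + (\<chi> j. \<D> x (F j) m)" by (simp add: V_def add_one_cost_def vec_eq_iff)
  then show ?thesis by (simp add: add_one_cost_def[of x H] H_def)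
 qed
 have DHle: "\<bar>\<D> x H m\<bar> \<le> K' * D x m" for x m
  unfolding DH D_def using lip[of "V m" "\<chi> j. \<D> x (F j) m"] by simp
 have Dm: "(\<lambda>z. \<D> (fst z) (F j) (snd z)) \<in> \<B> (L \<Otimes>\<^sub>M P)" for j
  by (intro measurable_add_one_cost[OF Fm]) (simp_all cong: measurable_cong_sets add: setsP)
 have domH: "dom_P H"
  unfolding dom_P_def
 proof (intro conjI Hm)
  show "integrable P (\<lambda>m. (H m)\<^sup>2)"
  proof (rule B_integrable_bound)
   show "integrable P (\<lambda>m. 2 * (u 0)\<^sup>2 + 2 * K'\<^sup>2 * (M * (\<Sum>j\<in>UNIV. (F j m)\<^sup>2)))" using Fi by simp
   show "AE m in P. norm ((H m)\<^sup>2) \<le> norm (2 * (u 0)\<^sup>2 + 2 * K'\<^sup>2 * (M * (\<Sum>j\<in>UNIV. (F j m)\<^sup>2)))"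
   proof (rule AE_I2)
    fix m
    let ?S = "\<Sum>j\<in>UNIV. \<bar>F j m\<bar>"
    have h: "\<bar>H m - u 0\<bar> \<le> K' * ?S" using lip[of 0 "V m"] by (simp add: H_def V_def)
    have "(H m - u 0)\<^sup>2 \<le> (K' * ?S)\<^sup>2" using power_mono[OF h, of 2] by simp
    also have "\<dots> = K'\<^sup>2 * ?S\<^sup>2" by (simp add: power_mult_distrib)
    also have "\<dots> \<le> K'\<^sup>2 * (M * (\<Sum>j\<in>UNIV. (F j m)\<^sup>2))" by (intro mult_left_mono sq) simp
    finally have "(H m - u 0)\<^sup>2 \<le> K'\<^sup>2 * (M * (\<Sum>j\<in>UNIV. (F j m)\<^sup>2))" .
    moreover have "(H m)\<^sup>2 \<le> 2 * (u 0)\<^sup>2 + 2 * (H m - u 0)\<^sup>2"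
    proof -
     have "0 \<le> (H m - 2 * u 0)\<^sup>2" by simp
     then show ?thesis by (simp add: power2_eq_square algebra_simps)
    qed
    ultimately have "(H m)\<^sup>2 \<le> 2 * (u 0)\<^sup>2 + 2 * K'\<^sup>2 * (M * (\<Sum>j\<in>UNIV. (F j m)\<^sup>2))" by simp
    then show "norm ((H m)\<^sup>2) \<le> norm (2 * (u 0)\<^sup>2 + 2 * K'\<^sup>2 * (M * (\<Sum>j\<in>UNIV. (F j m)\<^sup>2)))" by simp
   qed
  qed (use Hm in simp)
  have "(\<integral>\<^sup>+x. (\<integral>\<^sup>+m. ennreal ((\<D> x H m)\<^sup>2) \<partial>P) \<partial>L)
   \<le> (\<integral>\<^sup>+x. (\<integral>\<^sup>+m. ennreal (K'\<^sup>2 * M) * (\<Sum>j\<in>UNIV. ennreal ((\<D> x (F j) m)\<^sup>2)) \<partial>P) \<partial>L)"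
  proof (intro nn_integral_mono)
   fix x m
   have "(\<D> x H m)\<^sup>2 \<le> (K' * D x m)\<^sup>2" using power_mono[OF DHle[of x m], of 2] by simp
   also have "\<dots> \<le> K'\<^sup>2 * (M * (\<Sum>j\<in>UNIV. (\<D> x (F j) m)\<^sup>2))"
    unfolding power_mult_distrib D_def by (intro mult_left_mono sq) simp
   finally show "ennreal ((\<D> x H m)\<^sup>2) \<le> ennreal (K'\<^sup>2 * M) * (\<Sum>j\<in>UNIV. ennreal ((\<D> x (F j) m)\<^sup>2))"
    using M0 by (simp add: sum_ennreal sum_nonneg ennreal_mult[symmetric] mult.assoc)
  qed
  also have "\<dots> = (\<integral>\<^sup>+z. ennreal (K'\<^sup>2 * M) * (\<Sum>j\<in>UNIV. ennreal ((\<D> (fst z) (F j) (snd z))\<^sup>2)) \<partial>(L \<Otimes>\<^sub>M P))"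
   by (subst P.nn_integral_fst[symmetric]) (use Dm in simp_all)
  also have "\<dots> = ennreal (K'\<^sup>2 * M) * (\<Sum>j\<in>UNIV. \<integral>\<^sup>+z. ennreal ((\<D> (fst z) (F j) (snd z))\<^sup>2) \<partial>(L \<Otimes>\<^sub>M P))"
   using Dm by (simp add: nn_integral_cmult nn_integral_sum del: sum_ennreal)
  also have "\<dots> = ennreal (K'\<^sup>2 * M) * (\<Sum>j\<in>UNIV. \<integral>\<^sup>+x. (\<integral>\<^sup>+m. ennreal ((\<D> x (F j) m)\<^sup>2) \<partial>P) \<partial>L)"
   using Dm by (subst P.nn_integral_fst[symmetric]) simp_all
  also have "\<dots> < \<infinity>" using F by (simp add: ennreal_mult_less_top dom_P_def)
  finally show "(\<integral>\<^sup>+x. (\<integral>\<^sup>+m. ennreal ((\<D> x H m)\<^sup>2) \<partial>P) \<partial>L) < \<infinity>" .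
 qed
 have vb: "bdd (\<lambda>m. v j (V m)) K" for j using vm vK by (simp add: bdd_def)
 define f where "f j z = v j (V (\<alpha> (snd z))) * (\<Gamma> (F j) (F i) z)" for j z
 define R where "R z = \<Gamma> H (F i) z - (\<Sum>j\<in>UNIV. f j z)" for z
 have fi: "integrable \<L> (f j)" and fI: "(\<integral>z. f j z \<partial>\<L>) = (\<integral>m. v j (V (\<alpha> m)) * carre (F j) (F i) m \<partial>mix L)" for j
  unfolding f_def using integrable_weighted[OF F[of j] F[of i] vb[of j]] by simp_all
 have Ri: "integrable \<L> R" unfolding R_def[abs_def] using fi dom_P_pair_integrable[OF domH F[of i]] by simp
 have "(\<integral>m. F i m * u (V m) \<partial>P) = (\<integral>m. H m * F i m \<partial>P) - (\<integral>m. H m \<partial>P) * (\<integral>m. F i m \<partial>P)"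
  by (simp add: F0 H_def mult.commute)
 also have "\<dots> = (\<integral>z. \<Gamma> H (F i) z \<partial>\<L>)"
  using domH F[of i] by (intro covariance_formula[OF _ _ _ _ dominated_dom_P[OF domH F]]) (auto simp: dom_P_def)
 also have "\<dots> = (\<integral>z. (\<Sum>j\<in>UNIV. f j z) + R z \<partial>\<L>)" by (simp add: R_def)
 also have "\<dots> = (\<Sum>j\<in>UNIV. \<integral>m. v j (V (\<alpha> m)) * carre (F j) (F i) m \<partial>mix L) + (\<integral>z. R z \<partial>\<L>)"
  using fi Ri by (simp add: fI)
 finally have main: "(\<integral>m. F i m * u (V m) \<partial>P) = (\<Sum>j\<in>UNIV. \<integral>m. v j (V (\<alpha> m)) * carre (F j) (F i) m \<partial>mix L) + (\<integral>z. R z \<partial>\<L>)" .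
 have t: "\<bar>C $ j $ i * (\<integral>m. v j (V m) \<partial>P) - (\<integral>m. v j (V (\<alpha> m)) * carre (F j) (F i) m \<partial>mix L)\<bar>
  \<le> K * (\<bar>C $ j $ i - (\<integral>m. F j m * F i m \<partial>P)\<bar> + 2 powr (2 / p - 1) * (a3 i j + a3 j i + a2 j i))" for j
 proof -
  define e \<Theta> where "e = (\<integral>m. v j (V m) \<partial>P)" and "\<Theta> = (\<integral>m. carre (F j) (F i) m \<partial>mix L)"
  have \<Theta>: "(\<integral>m. F j m * F i m \<partial>P) = \<Theta>" using covariance_carre[OF F[of j] F[of i]] F0 by (simp add: \<Theta>_def)
  have "\<bar>e\<bar> \<le> (\<integral>m. \<bar>v j (V m)\<bar> \<partial>P)" unfolding e_def by (rule integral_abs_bound)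
  also have "\<dots> \<le> K" using bdd_integrable[OF vb] vK by (intro P.integral_le_const integrable_abs) auto
  finally have "\<bar>e\<bar> * \<bar>C $ j $ i - \<Theta>\<bar> \<le> K * \<bar>C $ j $ i - \<Theta>\<bar>" by (intro mult_right_mono) auto
  \<comment> \<open>For the pair \<open>F j\<close>, \<open>F i\<close> the integral
    \<open>d21\<close> is \<open>d12\<close> of \<open>F i\<close>, \<open>F j\<close> with the
    factors exchanged. Hence \<open>a3\<close> enters with both orders of its indices.\<close>
  moreover have "\<bar>(\<integral>m. v j (V (\<alpha> m)) * carre (F j) (F i) m \<partial>mix L) - e * \<Theta>\<bar> \<le> K * (2 powr (2 / p - 1) * (a3 i j + a3 j i + a2 j i))"
   unfolding e_def \<Theta>_def using a3(2)[of i j] by (intro weighted_carre[OF F F vb p a3(1) _ a3 a2]) (simp add: mult.commute)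
  moreover have "\<bar>C $ j $ i * e - x\<bar> \<le> \<bar>e\<bar> * \<bar>C $ j $ i - \<Theta>\<bar> + \<bar>x - e * \<Theta>\<bar>" for x
  proof -
   have "C $ j $ i * e - x = e * (C $ j $ i - \<Theta>) - (x - e * \<Theta>)" by (simp add: algebra_simps)
   then show ?thesis using abs_triangle_ineq4[of "e * (C $ j $ i - \<Theta>)" "x - e * \<Theta>"] by (simp add: abs_mult)
  qed
  ultimately show ?thesis unfolding \<Theta> e_def[symmetric] distrib_left by (smt (verit))
 qed
 have mp: "(\<lambda>z. \<bar>\<D> (fst z) (F j) (\<alpha> (snd z))\<bar> powr q * \<bar>\<D> (fst z) (F i) (\<beta> (snd z))\<bar>) \<in> \<B> \<L>" for j
 proof -
  have [measurable]: "(\<lambda>z. \<D> (fst z) (F j) (\<alpha> (snd z))) \<in> \<B> \<L>"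
   "(\<lambda>z. \<D> (fst z) (F i) (\<beta> (snd z))) \<in> \<B> \<L>"
   by (intro measurable_add_one_cost[OF Fm] measurable_fst m_comp[OF measurable_snd \<alpha>] m_comp[OF measurable_snd \<beta>])+
  show ?thesis by measurable
 qed
 have Rle: "\<bar>R z\<bar> \<le> k * M powr (q - 1) * (\<Sum>j\<in>UNIV. \<bar>\<D> (fst z) (F j) (\<alpha> (snd z))\<bar> powr q * \<bar>\<D> (fst z) (F i) (\<beta> (snd z))\<bar>)" for z
 proof -
  define d g where "d = (\<chi> j. \<D> (fst z) (F j) (\<alpha> (snd z)))" and "g = \<D> (fst z) (F i) (\<beta> (snd z))"
  define y where "y = V (\<alpha> (snd z))"
  have "R z = (u (y + d) - u y - (\<Sum>j\<in>UNIV. d $ j * v j y)) * g"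
   by (simp add: R_def f_def DH d_def[symmetric] g_def[symmetric] y_def[symmetric] left_diff_distrib sum_distrib_right) (simp add: d_def mult.assoc mult.left_commute)
  then have "\<bar>R z\<bar> \<le> (k * (\<Sum>j\<in>UNIV. \<bar>d $ j\<bar>) powr q) * \<bar>g\<bar>"
   by (simp only: abs_mult) (intro mult_right_mono rem abs_ge_zero)
  also have "\<dots> \<le> (k * (M powr (q - 1) * (\<Sum>j\<in>UNIV. \<bar>d $ j\<bar> powr q))) * \<bar>g\<bar>"
   unfolding M_def using k q(1) by (intro mult_right_mono mult_left_mono power_mean) auto
  finally show ?thesis by (simp add: d_def g_def sum_distrib_right sum_distrib_left mult.assoc)
 qed
 have "ennreal \<bar>\<integral>z. R z \<partial>\<L>\<bar> \<le> (\<integral>\<^sup>+z. ennreal \<bar>R z\<bar> \<partial>\<L>)"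
  using integral_norm_bound_ennreal[OF Ri] by simp
 also have "\<dots> \<le> (\<integral>\<^sup>+z. ennreal (k * M powr (q - 1)) * (\<Sum>j\<in>UNIV. ennreal (\<bar>\<D> (fst z) (F j) (\<alpha> (snd z))\<bar> powr q * \<bar>\<D> (fst z) (F i) (\<beta> (snd z))\<bar>)) \<partial>\<L>)"
  using Rle k by (intro nn_integral_mono) (simp add: sum_ennreal ennreal_mult[symmetric] sum_nonneg)
 also have "\<dots> = ennreal (k * M powr (q - 1)) * (\<Sum>j\<in>UNIV. \<integral>\<^sup>+z. ennreal (\<bar>\<D> (fst z) (F j) (\<alpha> (snd z))\<bar> powr q * \<bar>\<D> (fst z) (F i) (\<beta> (snd z))\<bar>) \<partial>\<L>)"
  using mp by (simp add: nn_integral_cmult nn_integral_sum del: sum_ennreal)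
 also have "\<dots> \<le> ennreal (k * M powr (q - 1)) * (\<Sum>j\<in>UNIV. ennreal (a4 i j))"
  by (intro mult_left_mono sum_mono order_trans[OF mixed_moment[OF Fm Fm q(1)] a4(2)]) simp
 also have "\<dots> = ennreal (k * (M powr (q - 1) * (\<Sum>j\<in>UNIV. a4 i j)))"
  using k a4(1) by (simp add: sum_ennreal ennreal_mult[symmetric] sum_nonneg mult.assoc)
 finally have R: "\<bar>\<integral>z. R z \<partial>\<L>\<bar> \<le> k * (M powr (q - 1) * (\<Sum>j\<in>UNIV. a4 i j))"
  using k a4(1) by (simp add: sum_nonneg)
 have "(\<Sum>j\<in>UNIV. C $ j $ i * (\<integral>m. v j (V m) \<partial>P)) - (\<integral>m. F i m * u (V m) \<partial>P)
  = (\<Sum>j\<in>UNIV. C $ j $ i * (\<integral>m. v j (V m) \<partial>P) - (\<integral>m. v j (V (\<alpha> m)) * carre (F j) (F i) m \<partial>mix L)) - (\<integral>z. R z \<partial>\<L>)"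
  unfolding main by (simp add: sum_subtractf)
 also have "\<bar>\<dots>\<bar> \<le> (\<Sum>j\<in>UNIV. \<bar>C $ j $ i * (\<integral>m. v j (V m) \<partial>P) - (\<integral>m. v j (V (\<alpha> m)) * carre (F j) (F i) m \<partial>mix L)\<bar>) + \<bar>\<integral>z. R z \<partial>\<L>\<bar>"
  by (intro order_trans[OF abs_triangle_ineq4] add_mono sum_abs order_refl)
 also have "\<dots> \<le> (\<Sum>j\<in>UNIV. K * (\<bar>C $ j $ i - (\<integral>m. F j m * F i m \<partial>P)\<bar> + 2 powr (2 / p - 1) * (a3 i j + a3 j i + a2 j i))) + k * (M powr (q - 1) * (\<Sum>j\<in>UNIV. a4 i j))"
  by (intro add_mono sum_mono t R)
 finally show ?thesis by (simp add: sum_distrib_left M_def)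
qed

text \<open>A common integrable majorant: along the path a gradient of linear growth is multiplied
  by a linear expression in \<open>V\<close> and \<open>X\<close>, and both vectors have second
  moments.\<close>

definition W :: "'a measure \<times> 'v \<Rightarrow> real" where "W z = 1 + (norm (V (fst z)))\<^sup>2 + (norm (X (snd z)))\<^sup>2"

lemma W_integrable: "integrable (P \<Otimes>\<^sub>M N) W"
proof -
 have "(norm (V m))\<^sup>2 = (\<Sum>j\<in>UNIV. (F j m)\<^sup>2)" for m
  unfolding power2_norm_eq_inner by (simp add: inner_vec_def V_def power2_eq_square)
 then have i: "integrable P (\<lambda>m. (norm (V m))\<^sup>2)" using F by (simp add: dom_P_def)
 have "integrable (P \<Otimes>\<^sub>M N) (\<lambda>z. (norm (V (fst z)))\<^sup>2)"
  by (rule PN.Fubini_integrable) (use i in \<open>simp_all add: G.prob_space\<close>)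
 moreover have "integrable (P \<Otimes>\<^sub>M N) (\<lambda>z. (norm (X (snd z)))\<^sup>2)"
  by (rule PN.Fubini_integrable) (use G.integrable_norm in simp_all)
 ultimately show ?thesis unfolding W_def[abs_def] by simp
qed

lemma W_bound:
 assumes c: "\<bar>c\<bar> \<le> 1" "\<bar>s\<bar> \<le> 1" and k: "0 \<le> k" and v: "\<bar>v\<bar> \<le> k * (1 + norm (c *\<^sub>R V (fst z) + s *\<^sub>R X (snd z)))"
  and w: "\<bar>w\<bar> \<le> norm (V (fst z)) + norm (X (snd z))"
 shows "\<bar>v * w\<bar> \<le> 3 * k * W z"
proof -
 define a b where "a = norm (V (fst z))" and "b = norm (X (snd z))"
 have "norm (c *\<^sub>R V (fst z) + s *\<^sub>R X (snd z)) \<le> \<bar>c\<bar> * a + \<bar>s\<bar> * b"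
  unfolding a_def b_def using norm_triangle_ineq[of "c *\<^sub>R V (fst z)" "s *\<^sub>R X (snd z)"] by simp
 also have "\<dots> \<le> 1 * a + 1 * b" using c by (intro add_mono mult_right_mono) (auto simp: a_def b_def)
 finally have "\<bar>v\<bar> \<le> k * (1 + (a + b))" using v mult_left_mono[OF _ k, of "1 + norm (c *\<^sub>R V (fst z) + s *\<^sub>R X (snd z))" "1 + (a + b)"] by simp
 then have "\<bar>v * w\<bar> \<le> (k * (1 + (a + b))) * (a + b)"
  unfolding abs_mult using w k by (intro mult_mono) (auto simp: a_def b_def)
 also have "\<dots> = k * ((1 + (a + b)) * (a + b))" by (simp add: mult.assoc)
 also have "(1 + (a + b)) * (a + b) \<le> 3 * (1 + a\<^sup>2 + b\<^sup>2)"
 proof -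
  have "0 \<le> (a - b)\<^sup>2 + (a - 1 / 2)\<^sup>2 + (b - 1 / 2)\<^sup>2" by simp
  then show ?thesis by (simp add: power2_eq_square algebra_simps)
 qed
 finally show ?thesis using k by (simp add: W_def a_def b_def mult_left_mono mult.left_commute mult.assoc)
qed

text \<open>For \<open>g i = partial i h\<close> and \<open>c\<close>, \<open>s\<close> the cosine
  and sine of \<theta>, this is the derivative of the interpolation. Integrating out
  \<open>X\<close> leaves on the Gaussian side \<open>s\<close> times the expected smoothed
  gradient, contracted with \<open>C\<close>, and on the Poisson side \<open>s\<close> times a
  product moment with the smoothed function, whose gradient it is. The common factor
  \<open>s\<close> later cancels the singularity \<open>1 / s\<close> of the smoothing
  bounds.\<close>

lemma stein_bound:
 fixes g :: "'m \<Rightarrow> real^'m \<Rightarrow> real"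
 assumes g: "\<And>i x. g i differentiable (at x)" and B: "\<And>i j x. \<bar>partial j (g i) x\<bar> \<le> B"
  and m: "\<And>i j. partial j (g i) \<in> \<B> borel"
  and c: "0 \<le> c" "c \<le> 1" and s: "0 \<le> s" "s \<le> 1"
  and K1: "\<And>i j y. \<bar>G.smooth c s (partial j (g i)) y\<bar> \<le> K1"
  and K2: "\<And>i j y d. \<bar>G.smooth c s (partial j (g i)) (y + d) - G.smooth c s (partial j (g i)) y\<bar> \<le> K2 * (c * (\<Sum>j\<in>UNIV. \<bar>d $ j\<bar>))"
 shows "\<bar>\<integral>z. (\<Sum>i\<in>UNIV. (c * X (snd z) $ i - s * F i (fst z)) * g i (c *\<^sub>R V (fst z) + s *\<^sub>R X (snd z))) \<partial>(P \<Otimes>\<^sub>M N)\<bar>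
  \<le> s * (c * K1 * \<zeta> + ((2 - q) * (2 * (c * K1)) + (q - 1) * (c * (c * K2) / 2)) * \<zeta>4)"
proof -
 have gm [measurable]: "g i \<in> \<B> borel" for i using g by (rule G.differentiable_measurable)
 have B0: "0 \<le> B" using order_trans[OF abs_ge_zero B[of undefined undefined 0]] .
 let ?k = "\<lambda>i. \<bar>g i 0\<bar> + B * real CARD('m)"
 have gk: "\<bar>g i x\<bar> \<le> ?k i * (1 + norm x)" for i x using G.shifted_growth[OF g[of i] B, of 0 1 x] by simp
 let ?g = "\<lambda>i z. g i (c *\<^sub>R V (fst z) + s *\<^sub>R X (snd z))"
 have int: "integrable (P \<Otimes>\<^sub>M N) (\<lambda>z. ?g i z * w z)"
  if [measurable]: "w \<in> \<B> (P \<Otimes>\<^sub>M N)" and w: "\<And>z. \<bar>w z\<bar> \<le> norm (V (fst z)) + norm (X (snd z))" for i w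
 proof (rule B_integrable_bound)
  show "integrable (P \<Otimes>\<^sub>M N) (\<lambda>z. 3 * ?k i * W z)" using W_integrable by simp
  show "AE z in P \<Otimes>\<^sub>M N. norm (?g i z * w z) \<le> norm (3 * ?k i * W z)"
   unfolding real_norm_def
   by (intro AE_I2 order_trans[OF W_bound[OF _ _ _ gk w] abs_ge_self]) (use c s B0 in auto)
 qed measurable
 have Xm: "(\<lambda>z. X (snd z) $ i) \<in> \<B> (P \<Otimes>\<^sub>M N)" for i
 proof -
  have "(\<lambda>z. axis i 1 \<bullet> X (snd z)) \<in> \<B> (P \<Otimes>\<^sub>M N)" by measurable
  then show ?thesis by (simp only: inner_axis' inner_real_def mult_1)
 qed
 have Fm: "(\<lambda>z. F i (fst z)) \<in> \<B> (P \<Otimes>\<^sub>M N)" for i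
  using F[of i] by (intro m_comp[OF measurable_fst]) (simp add: dom_P_def)
 have Xb: "\<bar>X (snd z) $ i\<bar> \<le> norm (V (fst z)) + norm (X (snd z))" for i and z :: "'a measure \<times> 'v"
  using component_le_norm_cart[of "X (snd z)" i] norm_ge_zero[of "V (fst z)"] by linarith
 have Fb: "\<bar>F i (fst z)\<bar> \<le> norm (V (fst z)) + norm (X (snd z))" for i z
 proof -
  have "V (fst z) $ i = F i (fst z)" by (simp add: V_def)
  with component_le_norm_cart[of "V (fst z)" i] norm_ge_zero[of "X (snd z)"] show ?thesis by linarith
 qed
 note iX = int[OF Xm Xb] and iF = int[OF Fm Fb]
 let ?u = "\<lambda>i. G.smooth c s (g i)" and ?v = "\<lambda>i j y. c * G.smooth c s (partial j (g i)) y"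
 have X: "c * (\<integral>z. ?g i z * X (snd z) $ i \<partial>(P \<Otimes>\<^sub>M N)) = s * (\<Sum>j\<in>UNIV. C $ j $ i * (\<integral>m. ?v i j (V m) \<partial>P))" for i
 proof -
  have "(\<integral>z. ?g i z * X (snd z) $ i \<partial>(P \<Otimes>\<^sub>M N)) = (\<integral>m. (\<integral>u. (axis i 1 \<bullet> X u) * g i (c *\<^sub>R V m + s *\<^sub>R X u) \<partial>N) \<partial>P)"
   using PN.integral_fst'[OF iX[of i i]] by (simp add: inner_axis' mult.commute)
  also have "\<dots> = (\<integral>m. s * (\<Sum>j\<in>UNIV. C $ j $ i * G.smooth c s (partial j (g i)) (V m)) \<partial>P)"
   unfolding G.smooth_ibp[OF g B m] by (simp add: matrix_vector_mul_component inner_axis)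
  finally have e: "(\<integral>z. ?g i z * X (snd z) $ i \<partial>(P \<Otimes>\<^sub>M N)) = (\<integral>m. s * (\<Sum>j\<in>UNIV. C $ j $ i * G.smooth c s (partial j (g i)) (V m)) \<partial>P)" .
  have "integrable P (\<lambda>m. G.smooth c s (partial j (g i)) (V m))" for j
   by (rule P.integrable_const_bound[where B=K1])
    (use K1 m_comp[OF V_measurable G.smooth_measurable[OF m]] in auto)
  then show ?thesis unfolding e by (simp add: sum_distrib_left mult_ac)
 qed
 have U: "(\<integral>z. ?g i z * F i (fst z) \<partial>(P \<Otimes>\<^sub>M N)) = (\<integral>m. F i m * ?u i (V m) \<partial>P)" for i
  using PN.integral_fst'[OF iF[of i i]] by (simp add: G.smooth_def mult.commute)
 let ?\<kappa> = "(2 - q) * (2 * (c * K1)) + (q - 1) * (c * (c * K2) / 2)"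
 have K10: "0 \<le> K1" using order_trans[OF abs_ge_zero K1[of undefined undefined 0]] .
 have main: "\<bar>(\<Sum>j\<in>UNIV. C $ j $ i * (\<integral>m. ?v i j (V m) \<partial>P)) - (\<integral>m. F i m * ?u i (V m) \<partial>P)\<bar> \<le>
  (c * K1) * (\<Sum>j\<in>UNIV. \<bar>C $ j $ i - (\<integral>m. F j m * F i m \<partial>P)\<bar> + 2 powr (2 / p - 1) * (a3 i j + a3 j i + a2 j i))
   + ?\<kappa> * (real CARD('m) powr (q - 1) * (\<Sum>j\<in>UNIV. a4 i j))" for i
 proof -
  have v1: "\<bar>?v i j y\<bar> \<le> c * K1" for j y using mult_left_mono[OF K1 c(1)] c by (simp add: abs_mult)
  have v2: "\<bar>?v i j (y + d) - ?v i j y\<bar> \<le> c * (c * K2) * (\<Sum>j\<in>UNIV. \<bar>d $ j\<bar>)" for j y d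
   using mult_left_mono[OF K2[of j i y d] c(1)] c by (simp add: abs_mult right_diff_distrib[symmetric] mult_ac)
  note T = taylor_remainder[OF G.smooth_derivative[OF g[of i] B m] v1 v2 q]
  have \<kappa>0: "0 \<le> ?\<kappa>"
  proof -
   have "0 \<le> c * (c * K2) * real CARD('m)" using order_trans[OF abs_ge_zero v2[of undefined 0 "\<chi> j. 1"]] by simp
   then have "0 \<le> c * (c * K2)" by (simp add: zero_le_mult_iff[of _ "real CARD('m)"])
   then show ?thesis using q c K10 by simp
  qed
  show ?thesis
  proof (rule stein_covariance[OF _ _ v1 T \<kappa>0])
   show "?u i \<in> \<B> borel" by measurable
   show "?v i j \<in> \<B> borel" for j using G.smooth_measurable[OF m[of j i]] by simp
  qed
 qed
 define x y b where "x i = (\<Sum>j\<in>UNIV. C $ j $ i * (\<integral>m. ?v i j (V m) \<partial>P))" and "y i = (\<integral>m. F i m * ?u i (V m) \<partial>P)"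
  and "b i = (c * K1) * (\<Sum>j\<in>UNIV. \<bar>C $ j $ i - (\<integral>m. F j m * F i m \<partial>P)\<bar> + 2 powr (2 / p - 1) * (a3 i j + a3 j i + a2 j i))
   + ?\<kappa> * (real CARD('m) powr (q - 1) * (\<Sum>j\<in>UNIV. a4 i j))" for i
 have "(\<integral>z. (\<Sum>i\<in>UNIV. (c * X (snd z) $ i - s * F i (fst z)) * ?g i z) \<partial>(P \<Otimes>\<^sub>M N))
  = (\<integral>z. (\<Sum>i\<in>UNIV. c * (?g i z * X (snd z) $ i) - s * (?g i z * F i (fst z))) \<partial>(P \<Otimes>\<^sub>M N))"
  by (simp add: algebra_simps)
 also have "\<dots> = (\<Sum>i\<in>UNIV. c * (\<integral>z. ?g i z * X (snd z) $ i \<partial>(P \<Otimes>\<^sub>M N)) - s * (\<integral>z. ?g i z * F i (fst z) \<partial>(P \<Otimes>\<^sub>M N)))"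
  using iX iF by simp
 also have "\<dots> = (\<Sum>i\<in>UNIV. s * (x i - y i))" by (simp only: X U x_def y_def right_diff_distrib)
 finally have I: "(\<integral>z. (\<Sum>i\<in>UNIV. (c * X (snd z) $ i - s * F i (fst z)) * ?g i z) \<partial>(P \<Otimes>\<^sub>M N)) = (\<Sum>i\<in>UNIV. s * (x i - y i))" .
 have "\<bar>\<Sum>i\<in>UNIV. s * (x i - y i)\<bar> \<le> (\<Sum>i\<in>UNIV. s * b i)"
 proof (rule order_trans[OF sum_abs sum_mono])
  show "\<bar>s * (x i - y i)\<bar> \<le> s * b i" for i
   using mult_left_mono[OF main[of i, folded x_def y_def b_def] s(1)] s by (simp add: abs_mult)
 qed
 also have "(\<Sum>i\<in>UNIV. s * b i) = s * (c * K1 * \<zeta> + ?\<kappa> * \<zeta>4)"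
 proof -
  \<comment> \<open>The two orders of indices of \<open>a3\<close> contribute equal double sums,
    which doubles \<open>2 powr (2 / p - 1)\<close> to the factor of \<open>zeta3\<close>.\<close>
  have e: "2 powr (2 / p) = 2 * 2 powr (2 / p - 1)" using powr_add[of 2 1 "2 / p - 1"] by simp
  have "(\<Sum>i\<in>UNIV. \<Sum>j\<in>UNIV. \<bar>C $ j $ i - (\<integral>m. F j m * F i m \<partial>P)\<bar>) = (\<Sum>i\<in>UNIV. \<Sum>j\<in>UNIV. \<bar>C $ i $ j - (\<integral>m. F i m * F j m \<partial>P)\<bar>)"
   "(\<Sum>i\<in>UNIV. \<Sum>j\<in>UNIV. a3 j i) = (\<Sum>i\<in>UNIV. \<Sum>j\<in>UNIV. a3 i j)" "(\<Sum>i\<in>UNIV. \<Sum>j\<in>UNIV. a2 j i) = (\<Sum>i\<in>UNIV. \<Sum>j\<in>UNIV. a2 i j)"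
   by (rule sum.swap)+
  then have "\<zeta> = (\<Sum>i\<in>UNIV. \<Sum>j\<in>UNIV. \<bar>C $ j $ i - (\<integral>m. F j m * F i m \<partial>P)\<bar> + 2 powr (2 / p - 1) * (a3 i j + a3 j i + a2 j i))"
   unfolding \<zeta>_def e by (simp add: sum.distrib sum_distrib_left[symmetric] distrib_left)
  then show ?thesis unfolding \<zeta>4_def b_def by (simp only: sum_distrib_left[symmetric] sum.distrib)
 qed
 finally show ?thesis unfolding I .
qed


lemma interpolation:
 fixes h :: "real^'m \<Rightarrow> real"
 assumes h: "\<And>x. h differentiable (at x)" and g: "\<And>i x. partial i h differentiable (at x)"
  and B: "\<And>i j x. \<bar>partial j (partial i h) x\<bar> \<le> B"
  and b: "\<And>\<theta>. (b has_real_derivative b' \<theta>) (at \<theta>)"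
  and le: "\<And>\<theta>. 0 < \<theta> \<Longrightarrow> \<theta> < pi / 2 \<Longrightarrow>
   \<bar>\<integral>z. (\<Sum>i\<in>UNIV. (cos \<theta> * X (snd z) $ i - sin \<theta> * F i (fst z)) * partial i h (cos \<theta> *\<^sub>R V (fst z) + sin \<theta> *\<^sub>R X (snd z))) \<partial>(P \<Otimes>\<^sub>M N)\<bar> \<le> b' \<theta>"
 shows "\<bar>(\<integral>m. h (V m) \<partial>P) - (\<integral>u. h (X u) \<partial>N)\<bar> \<le> b (pi / 2) - b 0"
proof -
 have hm [measurable]: "h \<in> \<B> borel" using h by (rule G.differentiable_measurable)
 have B0: "0 \<le> B" using order_trans[OF abs_ge_zero B[of undefined undefined 0]] .
 define k where "k = (\<Sum>i\<in>UNIV. \<bar>partial i h 0\<bar> + B * real CARD('m))"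
 have k0: "0 \<le> k" unfolding k_def using B0 by (intro sum_nonneg) simp
 have gk: "\<bar>partial i h x\<bar> \<le> k * (1 + norm x)" for i x
 proof -
  have "\<bar>partial i h x\<bar> \<le> (\<bar>partial i h 0\<bar> + B * real CARD('m)) * (1 + norm x)" using G.shifted_growth[OF g[of i] B, of 0 1 x] by simp
  also have "\<dots> \<le> k * (1 + norm x)" unfolding k_def using B0 by (intro mult_right_mono member_le_sum) auto
  finally show ?thesis .
 qed
 let ?z = "\<lambda>\<theta> z. cos \<theta> *\<^sub>R V (fst z) + sin \<theta> *\<^sub>R X (snd z)"
 let ?D = "\<lambda>\<theta> z. \<Sum>i\<in>UNIV. (cos \<theta> * X (snd z) $ i - sin \<theta> * F i (fst z)) * partial i h (?z \<theta> z)"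
 have hgrow: "\<bar>h x - h 0\<bar> \<le> real CARD('m) * (k * (1 + norm x) * norm x)" for x
 proof -
  have "norm (h (0 + 1 *\<^sub>R x) - h (0 + 0 *\<^sub>R x)) \<le> (real CARD('m) * (k * (1 + norm x) * norm x)) * norm (1 - 0 :: real)"
  proof (rule field_differentiable_bound[where S="{0..1}" and f="\<lambda>r. h (0 + r *\<^sub>R x)"])
   fix r :: real assume r: "r \<in> {0..1}"
   show "((\<lambda>r. h (0 + r *\<^sub>R x)) has_field_derivative (\<Sum>j\<in>UNIV. x $ j * partial j h (0 + r *\<^sub>R x))) (at r within {0..1})"
    by (rule has_field_derivative_at_within[OF has_derivative_along_line[OF h]])
   have "\<bar>\<Sum>j\<in>UNIV. x $ j * partial j h (0 + r *\<^sub>R x)\<bar> \<le> (\<Sum>j\<in>(UNIV::'m set). k * (1 + norm x) * norm x)"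
   proof (rule order_trans[OF sum_abs sum_mono])
    fix j
    have "r * norm x \<le> 1 * norm x" using r by (intro mult_right_mono) auto
    then have "k * (1 + norm (r *\<^sub>R x)) \<le> k * (1 + norm x)" using r k0 by (intro mult_left_mono) auto
    with gk[of j "r *\<^sub>R x"] show "\<bar>x $ j * partial j h (0 + r *\<^sub>R x)\<bar> \<le> k * (1 + norm x) * norm x"
     using component_le_norm_cart[of x j] k0 by (subst mult.commute) (auto simp: abs_mult intro!: mult_mono)
   qed
   then show "norm (\<Sum>j\<in>UNIV. x $ j * partial j h (0 + r *\<^sub>R x)) \<le> real CARD('m) * (k * (1 + norm x) * norm x)" by simp
  qed auto
  then show ?thesis by simp
 qed
 have tri: "norm (?z \<theta> z) \<le> norm (V (fst z)) + norm (X (snd z))" "\<bar>cos \<theta> * X (snd z) $ i - sin \<theta> * F i (fst z)\<bar> \<le> norm (V (fst z)) + norm (X (snd z))" for \<theta> z i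
 proof -
  have *: "\<bar>cos \<theta>\<bar> * t \<le> t" "\<bar>sin \<theta>\<bar> * t \<le> t" if "0 \<le> t" for t using that by (auto intro!: mult_left_le_one_le)
  show "norm (?z \<theta> z) \<le> norm (V (fst z)) + norm (X (snd z))"
   using norm_triangle_ineq[of "cos \<theta> *\<^sub>R V (fst z)" "sin \<theta> *\<^sub>R X (snd z)"] *(1)[of "norm (V (fst z))"] *(2)[of "norm (X (snd z))"] by simp
  show "\<bar>cos \<theta> * X (snd z) $ i - sin \<theta> * F i (fst z)\<bar> \<le> norm (V (fst z)) + norm (X (snd z))"
   using abs_triangle_ineq4[of "cos \<theta> * X (snd z) $ i" "sin \<theta> * F i (fst z)"] *(1)[of "\<bar>X (snd z) $ i\<bar>"] *(2)[of "\<bar>F i (fst z)\<bar>"]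
    component_le_norm_cart[of "X (snd z)" i] component_le_norm_cart[of "V (fst z)" i] by (simp add: abs_mult V_def)
 qed
 have hi: "integrable (P \<Otimes>\<^sub>M N) (\<lambda>z. h (?z \<theta> z))" for \<theta>
 proof -
  have "integrable (P \<Otimes>\<^sub>M N) (\<lambda>z. h (?z \<theta> z) - h 0)"
  proof (rule B_integrable_bound)
   show "integrable (P \<Otimes>\<^sub>M N) (\<lambda>z. real CARD('m) * (3 * k * W z))" using W_integrable by simp
   show "AE z in P \<Otimes>\<^sub>M N. norm (h (?z \<theta> z) - h 0) \<le> norm (real CARD('m) * (3 * k * W z))"
   proof (rule AE_I2)
    fix z
    have "\<bar>(k * (1 + norm (?z \<theta> z))) * norm (?z \<theta> z)\<bar> \<le> 3 * k * W z"
     using k0 tri(1)[of \<theta> z] by (intro W_bound[where c="cos \<theta>" and s="sin \<theta>"]) auto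
    then have "real CARD('m) * (k * (1 + norm (?z \<theta> z)) * norm (?z \<theta> z)) \<le> real CARD('m) * (3 * k * W z)"
     by (intro mult_left_mono) auto
    then show "norm (h (?z \<theta> z) - h 0) \<le> norm (real CARD('m) * (3 * k * W z))"
     using hgrow[of "?z \<theta> z"] unfolding real_norm_def by (meson abs_ge_self order_trans)
   qed
  qed measurable
  from B_integrable_add[OF this, of "\<lambda>_. h 0"] show ?thesis by simp
 qed
 define G where "G \<theta> = (\<integral>z. h (?z \<theta> z) \<partial>(P \<Otimes>\<^sub>M N))" for \<theta>
 have G': "(G has_real_derivative (\<integral>z. ?D \<theta> z \<partial>(P \<Otimes>\<^sub>M N))) (at \<theta>)" for \<theta>
  unfolding G_def[abs_def]
 proof (rule has_real_derivative_integral(2)[where w="\<lambda>z. \<Sum>i\<in>(UNIV::'m set). 3 * k * W z"])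
  fix z \<theta>
  have "((\<lambda>\<theta>. ?z \<theta> z) has_derivative (\<lambda>t. t *\<^sub>R (cos \<theta> *\<^sub>R X (snd z) - sin \<theta> *\<^sub>R V (fst z)))) (at \<theta>)"
   by (auto intro!: derivative_eq_intros simp: algebra_simps)
  from has_derivative_compose[OF this has_derivative_partial[OF h]]
  show "((\<lambda>\<theta>. h (?z \<theta> z)) has_real_derivative ?D \<theta> z) (at \<theta>)"
   unfolding has_field_derivative_def by (rule has_derivative_eq_rhs) (simp add: fun_eq_iff sum_distrib_left V_def mult_ac)
  show "\<bar>?D \<theta> z\<bar> \<le> (\<Sum>i\<in>(UNIV::'m set). 3 * k * W z)"
   using k0 by (intro order_trans[OF sum_abs] sum_mono, subst mult.commute)
    (rule W_bound[where c="cos \<theta>" and s="sin \<theta>", OF _ _ _ gk tri(2)], auto)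
 qed (use hi W_integrable in auto)
 have mono: "\<sigma> * (G (pi / 2) - G 0) \<le> b (pi / 2) - b 0" if \<sigma>: "\<sigma> \<in> {1, -1}" for \<sigma> :: real
 proof -
  \<comment> \<open>Monotonicity of the difference replaces integration of the derivative of
    \<open>G\<close>, whose regularity in \<theta> need not be studied.\<close>
  define E where "E \<theta> = \<sigma> * G \<theta> - b \<theta>" for \<theta>
  have E': "(E has_real_derivative \<sigma> * (\<integral>z. ?D \<theta> z \<partial>(P \<Otimes>\<^sub>M N)) - b' \<theta>) (at \<theta>)" for \<theta>
   unfolding E_def[abs_def] by (auto intro!: derivative_eq_intros G' b)
  have "E (pi / 2) \<le> E 0"
  proof (rule DERIV_nonpos_imp_decreasing_open[where f=E])
   show "\<exists>y. (E has_real_derivative y) (at \<theta>) \<and> y \<le> 0" if "0 < \<theta>" "\<theta> < pi / 2" for \<theta>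
    using E'[of \<theta>] le[OF that] \<sigma> by (intro exI[of _ "\<sigma> * (\<integral>z. ?D \<theta> z \<partial>(P \<Otimes>\<^sub>M N)) - b' \<theta>"]) (auto simp: abs_le_iff)
   show "continuous_on {0..pi / 2} E" by (intro continuous_at_imp_continuous_on ballI DERIV_isCont[OF E'])
  qed simp
  then show ?thesis by (simp add: E_def algebra_simps)
 qed
 have "G 0 = (\<integral>m. h (V m) \<partial>P)" using PN.integral_fst'[OF hi[of 0]] by (simp add: G_def G.prob_space)
 moreover have "G (pi / 2) = (\<integral>u. h (X u) \<partial>N)" using PN.integral_snd[of "\<lambda>m u. h (X u)"] hi[of "pi / 2"] P.prob_space
  by (simp add: G_def case_prod_beta')
 ultimately show ?thesis using mono[of 1] mono[of "-1"] by (intro abs_leI) simp_all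
qed

lemma \<zeta>_nonneg: "0 \<le> \<zeta>" "0 \<le> \<zeta>4"
 unfolding \<zeta>_def \<zeta>4_def by (intro add_nonneg_nonneg mult_nonneg_nonneg sum_nonneg a2 a3 a4; simp)+

lemma test_fun3_bound:
 fixes h :: "real^'m \<Rightarrow> real"
 assumes h: "h \<in> test_fun3"
 shows "\<bar>(\<integral>m. h (V m) \<partial>P) - (\<integral>u. h (X u) \<partial>N)\<bar> \<le> \<zeta> / 2 + \<zeta>4"
proof -
 note t = test_fun3D[OF h]
 have m: "partial j (partial i h) \<in> \<B> borel" for i j using t(3) by (rule borel_measurable_continuous_onI)
 \<comment> \<open>The antiderivative of \<open>b'\<close>: sin cos, 2 sin cos and half of sin cos
   squared integrate over the quarter period to 1/2, 1 and 1/6. The coefficient of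
   \<open>\<zeta>4\<close> is therefore \<open>(2 - q) + (q - 1) / 6\<close>, at most 1.\<close>
 define b where "b \<theta> = (sin \<theta>)\<^sup>2 / 2 * \<zeta> + ((2 - q) * (sin \<theta>)\<^sup>2 - (q - 1) * (cos \<theta>) ^ 3 / 6) * \<zeta>4" for \<theta>
 define b' where "b' \<theta> = sin \<theta> * (cos \<theta> * 1 * \<zeta> + ((2 - q) * (2 * (cos \<theta> * 1)) + (q - 1) * (cos \<theta> * (cos \<theta> * 1) / 2)) * \<zeta>4)" for \<theta>
 have "\<bar>(\<integral>m. h (V m) \<partial>P) - (\<integral>u. h (X u) \<partial>N)\<bar> \<le> b (pi / 2) - b 0"
 proof (rule interpolation[OF t(1) t(2) t(4), where b'=b'])
  show "(b has_real_derivative b' \<theta>) (at \<theta>)" for \<theta>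
   unfolding b_def[abs_def] b'_def
   by (rule derivative_eq_intros refl | simp)+ (simp add: algebra_simps power2_eq_square)
  fix \<theta> :: real assume "0 < \<theta>" "\<theta> < pi / 2"
  then have c: "0 \<le> cos \<theta>" "cos \<theta> \<le> 1" "0 \<le> sin \<theta>" "sin \<theta> \<le> 1" by (auto intro!: cos_ge_zero sin_ge_zero)
  show "\<bar>\<integral>z. (\<Sum>i\<in>UNIV. (cos \<theta> * X (snd z) $ i - sin \<theta> * F i (fst z)) * partial i h (cos \<theta> *\<^sub>R V (fst z) + sin \<theta> *\<^sub>R X (snd z))) \<partial>(P \<Otimes>\<^sub>M N)\<bar> \<le> b' \<theta>"
   unfolding b'_def
  proof (rule stein_bound[OF t(2) t(4) m c])
   show "\<bar>G.smooth (cos \<theta>) (sin \<theta>) (partial j (partial i h)) y\<bar> \<le> 1" for i j y by (rule G.smooth_bound[OF m t(4)])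
   show "\<bar>G.smooth (cos \<theta>) (sin \<theta>) (partial j (partial i h)) (y + d) - G.smooth (cos \<theta>) (sin \<theta>) (partial j (partial i h)) y\<bar>
     \<le> 1 * (cos \<theta> * (\<Sum>j\<in>UNIV. \<bar>d $ j\<bar>))" for i j y d
   proof (rule G.smooth_lipschitz[OF m t(4)])
    show "\<bar>partial j (partial i h) (x + cos \<theta> *\<^sub>R d) - partial j (partial i h) x\<bar> \<le> 1 * (cos \<theta> * (\<Sum>j\<in>UNIV. \<bar>d $ j\<bar>))" for x
     using t(5)[of j i x "cos \<theta> *\<^sub>R d"] c by (simp add: abs_mult sum_distrib_left)
   qed
  qed
 qed
 also have "b (pi / 2) - b 0 = \<zeta> / 2 + ((2 - q) + (q - 1) / 6) * \<zeta>4" by (simp add: b_def algebra_simps)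
 also have "\<dots> \<le> \<zeta> / 2 + 1 * \<zeta>4"
 proof -
  have "(2 - q) + (q - 1) / 6 \<le> (2 - q) + (q - 1)" using q by (intro add_left_mono) (simp add: divide_le_eq)
  then have "(2 - q) + (q - 1) / 6 \<le> 1" by simp
  then show ?thesis using \<zeta>_nonneg by (intro add_left_mono mult_right_mono)
 qed
 finally show ?thesis by simp
qed

lemma test_fun2_bound:
 fixes h :: "real^'m \<Rightarrow> real"
 defines "n \<equiv> mat_op_norm (matrix_inv C)"
 assumes C: "pos_def C" and h: "h \<in> test_fun2"
 shows "\<bar>(\<integral>m. h (V m) \<partial>P) - (\<integral>u. h (X u) \<partial>N)\<bar> \<le> n * mat_op_norm C powr (1 / 2) * \<zeta>
  + max (2 * n * mat_op_norm C powr (1 / 2)) (sqrt (2 * pi) / 8 * n powr (3 / 2) * mat_op_norm C) * \<zeta>4"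
proof -
 note t = test_fun2D[OF h]
 have m: "partial j (partial i h) \<in> \<B> borel" for i j using t(3) by (rule borel_measurable_continuous_onI)
 define \<kappa> where "\<kappa> = sqrt (2 / pi) * sqrt n"
 \<comment> \<open>Here the factor \<open>s\<close> has cancelled: cos, 2 cos and half of cos
   squared integrate over the quarter period to 1, 2 and \<open>pi / 8\<close>, each multiplied by
   \<kappa>.\<close>
 define b where "b \<theta> = \<kappa> * (sin \<theta> * \<zeta> + ((2 - q) * (2 * sin \<theta>) + (q - 1) / 4 * (\<theta> + sin \<theta> * cos \<theta>)) * \<zeta>4)" for \<theta>
 define b' where "b' \<theta> = \<kappa> * (cos \<theta> * \<zeta> + ((2 - q) * (2 * cos \<theta>) + (q - 1) / 4 * (1 + (cos \<theta> * cos \<theta> - sin \<theta> * sin \<theta>))) * \<zeta>4)" for \<theta>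
 have "\<bar>(\<integral>m. h (V m) \<partial>P) - (\<integral>u. h (X u) \<partial>N)\<bar> \<le> b (pi / 2) - b 0"
 proof (rule interpolation[OF t(1) t(2) t(4), where b'=b'])
  show "(b has_real_derivative b' \<theta>) (at \<theta>)" for \<theta>
   unfolding b_def[abs_def] b'_def by (rule derivative_eq_intros refl | simp)+
  fix \<theta> :: real assume \<theta>: "0 < \<theta>" "\<theta> < pi / 2"
  define c s where "c = cos \<theta>" and "s = sin \<theta>"
  have s: "0 < s" unfolding s_def using \<theta> by (intro sin_gt_zero) auto
  have c: "0 \<le> c" "c \<le> 1" "0 \<le> s" "s \<le> 1" using \<theta> s by (auto intro!: cos_ge_zero simp: c_def s_def)
  have "\<bar>\<integral>z. (\<Sum>i\<in>UNIV. (c * X (snd z) $ i - s * F i (fst z)) * partial i h (c *\<^sub>R V (fst z) + s *\<^sub>R X (snd z))) \<partial>(P \<Otimes>\<^sub>M N)\<bar>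
   \<le> s * (c * (\<kappa> / s) * \<zeta> + ((2 - q) * (2 * (c * (\<kappa> / s))) + (q - 1) * (c * (c * (\<kappa> / s)) / 2)) * \<zeta>4)"
  proof (rule stein_bound[OF t(2) t(4) m c])
   note P = G.smooth_pos_def[OF C s refl t(2) t(4) m]
   show "\<bar>G.smooth c s (partial j (partial i h)) y\<bar> \<le> \<kappa> / s" for i j y
    using P[of i c 0 0 1 j y] t(5) by (simp add: \<kappa>_def n_def)
   show "\<bar>G.smooth c s (partial j (partial i h)) (y + d) - G.smooth c s (partial j (partial i h)) y\<bar>
     \<le> \<kappa> / s * (c * (\<Sum>j\<in>UNIV. \<bar>d $ j\<bar>))" for i j y d
   proof -
    have "\<bar>partial i h (x + c *\<^sub>R d) - 1 * partial i h x\<bar> \<le> c * (\<Sum>j\<in>UNIV. \<bar>d $ j\<bar>)" for x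
     using t(6)[of i x "c *\<^sub>R d"] mult_left_mono[OF norm_le_l1_cart[of d] c(1)] c by simp
    from P[OF this, of j y] show ?thesis by (simp add: \<kappa>_def n_def)
   qed
  qed
  also have "\<dots> = \<kappa> * (c * \<zeta> + ((2 - q) * (2 * c) + (q - 1) / 4 * (2 * (c * c))) * \<zeta>4)" using s by (simp add: field_simps)
  also have "2 * (c * c) = 1 + (c * c - s * s)" using sin_cos_squared_add[of \<theta>] by (simp add: c_def s_def power2_eq_square)
  finally show "\<bar>\<integral>z. (\<Sum>i\<in>UNIV. (cos \<theta> * X (snd z) $ i - sin \<theta> * F i (fst z)) * partial i h (cos \<theta> *\<^sub>R V (fst z) + sin \<theta> *\<^sub>R X (snd z))) \<partial>(P \<Otimes>\<^sub>M N)\<bar> \<le> b' \<theta>"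
   unfolding b'_def c_def s_def .
 qed
 also have "b (pi / 2) - b 0 = \<kappa> * \<zeta> + ((2 - q) * (2 * \<kappa>) + (q - 1) * (\<kappa> * pi / 8)) * \<zeta>4" by (simp add: b_def algebra_simps)
 also have "\<dots> \<le> n * mat_op_norm C powr (1 / 2) * \<zeta>
  + max (2 * n * mat_op_norm C powr (1 / 2)) (sqrt (2 * pi) / 8 * n powr (3 / 2) * mat_op_norm C) * \<zeta>4" (is "_ \<le> ?a * \<zeta> + max ?b ?c * \<zeta>4")
 proof -
  \<comment> \<open>Only \<kappa>, a multiple of \<open>sqrt n\<close>, has been obtained so far.
    The inequality \<open>1 \<le> n * M\<close> inflates \<open>sqrt n\<close> to
    \<open>n * sqrt M\<close> in one constant and to \<open>n powr (3 / 2) * M\<close> in the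
    other.\<close>
  define M where "M = mat_op_norm C"
  have n0: "0 \<le> n" "0 \<le> M" by (simp_all add: n_def M_def mat_op_norm_nonneg)
  have nM: "1 \<le> n * M" unfolding n_def M_def by (rule pos_def_inv(3)[OF C])
  have n1: "0 < n" using nM n0 by (cases "n = 0") auto
  have "sqrt n * 1 \<le> sqrt n * sqrt (n * M)" using nM n0 by (intro mult_left_mono) auto
  also have "\<dots> = n * sqrt M" using n0 by (simp add: real_sqrt_mult)
  finally have r: "sqrt n \<le> n * sqrt M" by simp
  have "sqrt (2 / pi) \<le> sqrt 1" using pi_ge_two by (intro real_sqrt_le_mono) simp
  then have "\<kappa> \<le> 1 * sqrt n" unfolding \<kappa>_def using n0 by (intro mult_right_mono) auto
  with r have \<kappa>1: "\<kappa> \<le> ?a" using n0 by (simp add: powr_half_sqrt M_def)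
  have "sqrt (2 / pi) * pi = sqrt (2 * pi)"
  proof -
   have "sqrt (2 / pi) * sqrt (pi * pi) = sqrt (2 / pi * (pi * pi))" by (rule real_sqrt_mult[symmetric])
   then show ?thesis by simp
  qed
  then have "\<kappa> * pi / 8 = sqrt (2 * pi) / 8 * sqrt n" unfolding \<kappa>_def by (simp add: mult_ac)
  also have "sqrt (2 * pi) / 8 * sqrt n \<le> sqrt (2 * pi) / 8 * sqrt n * (n * M)"
  proof -
   have "sqrt (2 * pi) / 8 * sqrt n * 1 \<le> sqrt (2 * pi) / 8 * sqrt n * (n * M)" using nM n0 by (intro mult_left_mono) auto
   then show ?thesis by (simp only: mult_1_right)
  qed
  also have "\<dots> = ?c"
  proof -
   have "n powr (3 / 2) = n * sqrt n" using powr_mult_base[OF n0(1), of "1 / 2"] n0 by (simp add: powr_half_sqrt)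
   then show ?thesis by (simp add: M_def mult_ac)
  qed
  finally have \<kappa>2: "\<kappa> * pi / 8 \<le> ?c" .
  \<comment> \<open>A convex combination with weights \<open>2 - q\<close> and \<open>q - 1\<close>;
    each endpoint is below its entry of the maximum, which explains the maximum and its independence
    of \<open>q\<close>.\<close>
  have "(2 - q) * (2 * \<kappa>) + (q - 1) * (\<kappa> * pi / 8) \<le> (2 - q) * max ?b ?c + (q - 1) * max ?b ?c"
   using q \<kappa>1 \<kappa>2 by (intro add_mono mult_left_mono) (auto intro: max.coboundedI1 max.coboundedI2)
  also have "\<dots> = max ?b ?c" by (simp add: algebra_simps)
  finally show ?thesis using \<kappa>1 \<zeta>_nonneg by (intro add_mono mult_right_mono)
 qed
 finally show ?thesis .
qed

end

section \<open>Transfer to the given Poisson measure and treatment of infinite values\<close>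

lemma epow_root:
 assumes "epow E (1 / p) < \<infinity>" "1 \<le> p"
 shows "E \<le> ennreal (enn2real (epow E (1 / p)) powr p)"
 using assms by (cases E) (auto simp: powr_powr)

theorem theorem1:
 fixes M :: "'w measure" and L :: "'a measure" and N :: "'v measure"
  and \<eta> :: "'w \<Rightarrow> 'a measure"
  and F :: "'m::finite \<Rightarrow> 'a measure \<Rightarrow> real"
  and C :: "real^'m^'m"
  and X :: "'v \<Rightarrow> real^'m"
  and p q :: real
 assumes "prob_space M" and "prob_space N"
  and "sigma_finite_measure L"
  and "poisson_measure M L \<eta>"
  and "\<And>i. L2_functional M L \<eta> (F i)"
  and "\<And>i. dom_D M L \<eta> (F i)"
  and "\<And>i. (\<integral>\<omega>. F i (\<eta> \<omega>) \<partial>M) = 0"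
  and "pos_semidef C"
  and "gaussian_vector N X C"
  and "p \<in> {1..2}" and "q \<in> {1..2}"
 shows "dist_d3 M (\<lambda>\<omega>. \<chi> i. F i (\<eta> \<omega>)) N X
      \<le> ennreal (1 / 2) * (zeta1 M \<eta> F C + zeta2 M L \<eta> F p + zeta3 M L \<eta> F p)
       + zeta4 M L \<eta> F q \<and>
     (pos_def C \<longrightarrow>
     dist_d2 M (\<lambda>\<omega>. \<chi> i. F i (\<eta> \<omega>)) N X
      \<le> ennreal (mat_op_norm (matrix_inv C) * mat_op_norm C powr (1 / 2))
        * (zeta1 M \<eta> F C + zeta2 M L \<eta> F p + zeta3 M L \<eta> F p)
       + ennreal (max (2 * mat_op_norm (matrix_inv C) * mat_op_norm C powr (1 / 2))
              (sqrt (2 * pi) / 8 * mat_op_norm (matrix_inv C) powr (3 / 2)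
               * mat_op_norm C))
        * zeta4 M L \<eta> F q)"
proof -
 interpret M: prob_space M by fact
 \<comment> \<open>All quantities of the theorem depend on \<eta> through its law only, so
   everything is moved to \<open>P\<close>, where the locale for Poisson laws applies.\<close>
 define P where "P = distr M (\<N> L) \<eta>"
 have \<eta> [measurable]: "\<eta> \<in> M \<rightarrow>\<^sub>M \<N> L" using assms(4) by (simp add: poisson_measure_def)
 have Fm: "F i \<in> \<F> L" for i using assms(5) by (simp add: L2_functional_def)
 have nn: "(\<integral>\<^sup>+m. f m \<partial>P) = (\<integral>\<^sup>+u. f (\<eta> u) \<partial>M)" if "f \<in> \<F> L" for f
  unfolding P_def using that by (subst nn_integral_distr[OF \<eta>]) auto
 have int: "(\<integral>m. f m \<partial>P) = (\<integral>u. f (\<eta> u) \<partial>M)" if "f \<in> \<F> L" for f :: "'a measure \<Rightarrow> real"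
  unfolding P_def using that by (rule integral_distr[OF \<eta>])
 obtain Y where Y: "\<And>k. Y k \<in> sets L" "incseq Y" "(\<Union>k. Y k) = space L" "\<And>k. emeasure L (Y k) < \<infinity>"
  using exhaustion_exists[OF assms(3)] by metis
 interpret poisson_space L P Y
  by (intro poisson_space.intro assms(3) poisson_space_axioms.intro Y)
   (unfold P_def, rule pois_law_distr[OF assms(1,4)])
 interpret G: gaussian N X C by (intro gaussian.intro gaussian_axioms.intro assms(2,8,9))
 have Dm: "\<D> x (F i) \<in> \<F> L"
  "y \<in> space L \<Longrightarrow> \<D>\<^sub>2 x y (F i) \<in> \<F> L" if "x \<in> space L" for x y i
  using that by (auto intro!: measurable_add_one_cost[OF Fm] measurable_add_one_cost2[OF Fm])
 have dom: "dom_P (F i)" for i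
  unfolding dom_P_def
 proof (intro conjI Fm)
  show "integrable P (\<lambda>m. (F i m)\<^sup>2)"
   using assms(5)[of i] Fm[of i] nn[of "\<lambda>m. ennreal ((F i m)\<^sup>2)"]
   by (intro integrableI_bounded) (auto simp: L2_functional_def)
  have "(\<integral>\<^sup>+x. (\<integral>\<^sup>+m. ennreal ((\<D> x (F i) m)\<^sup>2) \<partial>P) \<partial>L) = (\<integral>\<^sup>+x. (\<integral>\<^sup>+u. ennreal ((\<D> x (F i) (\<eta> u))\<^sup>2) \<partial>M) \<partial>L)"
  proof (rule nn_integral_cong)
   fix x assume x: "x \<in> space L"
   show "(\<integral>\<^sup>+m. ennreal ((\<D> x (F i) m)\<^sup>2) \<partial>P) = (\<integral>\<^sup>+u. ennreal ((\<D> x (F i) (\<eta> u))\<^sup>2) \<partial>M)"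
    using Dm(1)[OF x, of i] by (intro nn) auto
  qed
  then show "(\<integral>\<^sup>+x. (\<integral>\<^sup>+m. ennreal ((\<D> x (F i) m)\<^sup>2) \<partial>P) \<partial>L) < \<infinity>"
   using assms(6)[of i] by (simp add: dom_D_def)
 qed
 have moment: "abs_moment M r (\<lambda>u. Z (\<eta> u)) = (\<integral>\<^sup>+m. epow (ennreal \<bar>Z m\<bar>) r \<partial>P)"
  if Z: "Z \<in> \<F> L" for Z r
 proof -
  have "(\<lambda>m. epow (ennreal \<bar>Z m\<bar>) r) \<in> \<F> L"
   by (rule m_comp[OF _ measurable_epow]) (use Z in simp)
  from nn[OF this] show ?thesis by (simp add: abs_moment_eq del: epow_ennreal)
 qed
 then have fm: "epow (abs_moment M r (\<lambda>u. Z (\<eta> u))) (1 / r) = \<M> P r Z"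
  if "Z \<in> \<F> L" for Z r
  using that by (simp only: field_moment_def)
 define E2 where "E2 i j = d22 p (F i) (F j)" for i j
 define E3 where "E3 i j = d12 p (F i) (F j)" for i j
 define E4 where "E4 i j = (\<integral>\<^sup>+x. \<M> P (q + 1) (\<D> x (F i)) *
   epow (\<integral>\<^sup>+m. epow (ennreal \<bar>\<D> x (F j) m\<bar>) (q + 1) \<partial>P) (1 - 1 / (q + 1)) \<partial>L)" for i j
 have z2: "zeta2 M L \<eta> F p = ennreal (2 powr (2 / p - 1)) * (\<Sum>i\<in>UNIV. \<Sum>j\<in>UNIV. epow (E2 i j) (1 / p))"
  unfolding zeta2_def E2_def
  by (intro arg_cong2[where f="(*)"] refl sum.cong arg_cong2[where f=epow] nn_integral_cong) (simp only: fm Dm)+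
 have z3: "zeta3 M L \<eta> F p = ennreal (2 powr (2 / p)) * (\<Sum>i\<in>UNIV. \<Sum>j\<in>UNIV. epow (E3 i j) (1 / p))"
  unfolding zeta3_def E3_def
  by (intro arg_cong2[where f="(*)"] refl sum.cong arg_cong2[where f=epow] nn_integral_cong) (simp only: fm Dm)+
 have z4: "zeta4 M L \<eta> F q = ennreal (real CARD('m) powr (q - 1)) * (\<Sum>i\<in>UNIV. \<Sum>j\<in>UNIV. E4 i j)"
  unfolding zeta4_def E4_def
  by (intro arg_cong2[where f="(*)"] refl sum.cong nn_integral_cong) ((simp only: fm Dm | simp only: moment Dm)+)
 define \<zeta>' where "\<zeta>' = zeta1 M \<eta> F C + zeta2 M L \<eta> F p + zeta3 M L \<eta> F p"
 have pq: "1 \<le> p" "p \<le> 2" "1 \<le> q" "q \<le> 2" using assms(10,11) by auto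
 \<comment> \<open>Shared by both distances. If one of the quantities is infinite, positivity of
   \<open>A\<close> and \<open>B\<close> makes the right side infinite; otherwise all summands are
   finite and the real estimate in \<open>stein_setting\<close> applies.\<close>
 have bound: "ennreal \<bar>(\<integral>u. h (\<chi> i. F i (\<eta> u)) \<partial>M) - (\<integral>u. h (X u) \<partial>N)\<bar> \<le> ennreal A * \<zeta>' + ennreal B * zeta4 M L \<eta> F q"
  if A: "0 < A" and B: "0 < B" and h: "\<And>x. h differentiable (at x)"
   and b: "\<And>a2 a3 a4. stein_setting L P Y N X C F p q a2 a3 a4 \<Longrightarrow>
    \<bar>(\<integral>m. h (\<chi> i. F i m) \<partial>P) - (\<integral>u. h (X u) \<partial>N)\<bar> \<le> A * stein_setting.\<zeta> P C F p a2 a3 + B * stein_setting.\<zeta>4 q a4"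
  for A B and h :: "real^'m \<Rightarrow> real"
 proof (cases "\<zeta>' < \<infinity> \<and> zeta4 M L \<eta> F q < \<infinity>")
  case False
  then show ?thesis using A B by (auto simp: not_less top_unique ennreal_mult_top)
 next
  case True
  have fin: "epow (E2 i j) (1 / p) < \<infinity>" "epow (E3 i j) (1 / p) < \<infinity>" "E4 i j < \<infinity>" for i j
  proof -
   have *: "f i j < \<infinity>" if "ennreal r * (\<Sum>i\<in>UNIV. \<Sum>j\<in>UNIV. f i j) < \<infinity>" "0 < r" for r and f :: "'m \<Rightarrow> 'm \<Rightarrow> ennreal"
   proof -
    have "f i j \<le> (\<Sum>j\<in>UNIV. f i j)" by (rule member_le_sum) auto
    also have "\<dots> \<le> (\<Sum>i\<in>UNIV. \<Sum>j\<in>UNIV. f i j)" by (rule member_le_sum[where f="\<lambda>i. \<Sum>j\<in>UNIV. f i j"]) auto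
    also have "\<dots> < \<infinity>" using that by (auto simp: ennreal_mult_less_top)
    finally show ?thesis .
   qed
   have "zeta2 M L \<eta> F p < \<infinity>" "zeta3 M L \<eta> F p < \<infinity>" using True by (simp_all add: \<zeta>'_def)
   with True show "epow (E2 i j) (1 / p) < \<infinity>" "epow (E3 i j) (1 / p) < \<infinity>" "E4 i j < \<infinity>"
    unfolding z2 z3 z4 using *[of "2 powr (2 / p - 1)" "\<lambda>i j. epow (E2 i j) (1 / p)"]
     *[of "2 powr (2 / p)" "\<lambda>i j. epow (E3 i j) (1 / p)"] *[of "real CARD('m) powr (q - 1)" E4] by simp_all
  qed
  \<comment> \<open>The roots themselves are chosen as real bounds, so that \<zeta> and
    \<open>\<zeta>4\<close> of the locale agree exactly with the extended quantities.\<close>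
  define a2 a3 a4 where "a2 i j = enn2real (epow (E2 i j) (1 / p))" and "a3 i j = enn2real (epow (E3 i j) (1 / p))" and "a4 i j = enn2real (E4 i j)" for i j
  interpret S: stein_setting L P Y N X C F p q a2 a3 a4
  proof (intro stein_setting.intro stein_setting_axioms.intro poisson_space_axioms G.gaussian_axioms pq dom)
   show "(\<integral>m. F i m \<partial>P) = 0" for i using int[OF Fm, of i] assms(7)[of i] by simp
  qed (use fin epow_root[OF fin(1) pq(1)] epow_root[OF fin(2) pq(1)] in
    \<open>simp_all add: a2_def a3_def a4_def E2_def[symmetric] E3_def[symmetric] E4_def[symmetric] enn2real_nonneg del: epow_ennreal\<close>)
  have a: "epow (E2 i j) (1 / p) = ennreal (a2 i j)" "epow (E3 i j) (1 / p) = ennreal (a3 i j)" "E4 i j = ennreal (a4 i j)" for i j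
   using fin[of i j] by (simp_all add: a2_def a3_def a4_def)
  have sum: "(\<Sum>i\<in>UNIV. \<Sum>j\<in>UNIV. ennreal (f i j)) = ennreal (\<Sum>i\<in>UNIV. \<Sum>j\<in>UNIV. f i j)" if "\<And>i j. 0 \<le> f i j" for f :: "'m \<Rightarrow> 'm \<Rightarrow> real"
   using that by (simp add: sum_nonneg)
  have "covariance M (\<lambda>u. F i (\<eta> u)) (\<lambda>u. F j (\<eta> u)) = (\<integral>m. F i m * F j m \<partial>P)" for i j
   using int[of "\<lambda>m. F i m * F j m"] Fm by (simp add: covariance_def assms(7))
  then have "\<zeta>' = ennreal S.\<zeta>"
   unfolding \<zeta>'_def S.\<zeta>_def zeta1_def z2 z3 a
   by (simp only: sum[OF S.a2(1)] sum[OF S.a3(1)] sum[OF abs_ge_zero])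
    (simp add: ennreal_mult[symmetric] ennreal_plus[symmetric] sum_nonneg S.a2(1) S.a3(1) del: ennreal_plus)
  moreover have "zeta4 M L \<eta> F q = ennreal S.\<zeta>4"
   unfolding z4 a S.\<zeta>4_def by (simp only: sum[OF S.a4(1)]) (simp add: ennreal_mult[symmetric] sum_nonneg S.a4(1))
  moreover have "(\<integral>m. h (\<chi> i. F i m) \<partial>P) = (\<integral>u. h (\<chi> i. F i (\<eta> u)) \<partial>M)"
   using m_comp[OF S.V_measurable G.differentiable_measurable[OF h]] by (intro int) (simp add: S.V_def)
  ultimately show ?thesis
   using b[OF S.stein_setting_axioms] A B S.\<zeta>_nonneg by (simp add: ennreal_mult[symmetric] ennreal_plus[symmetric] del: ennreal_plus)
 qed
 show ?thesis
  unfolding dist_d3_def dist_d2_def \<zeta>'_def[symmetric]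
 proof (intro conjI impI SUP_least)
  fix h :: "real^'m \<Rightarrow> real" assume h: "h \<in> test_fun3"
  have "ennreal \<bar>(\<integral>u. h (\<chi> i. F i (\<eta> u)) \<partial>M) - (\<integral>u. h (X u) \<partial>N)\<bar> \<le> ennreal (1 / 2) * \<zeta>' + ennreal 1 * zeta4 M L \<eta> F q"
  proof (rule bound)
   fix a2 a3 a4 assume "stein_setting L P Y N X C F p q a2 a3 a4"
   then interpret S: stein_setting L P Y N X C F p q a2 a3 a4 .
   show "\<bar>(\<integral>m. h (\<chi> i. F i m) \<partial>P) - (\<integral>u. h (X u) \<partial>N)\<bar> \<le> 1 / 2 * S.\<zeta> + 1 * S.\<zeta>4"
    using S.test_fun3_bound[OF h] by (simp add: S.V_def)
  qed (use test_fun3D[OF h] in auto)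
  then show "ennreal \<bar>(\<integral>u. h (\<chi> i. F i (\<eta> u)) \<partial>M) - (\<integral>u. h (X u) \<partial>N)\<bar> \<le> ennreal (1 / 2) * \<zeta>' + zeta4 M L \<eta> F q" by simp
 next
  fix h :: "real^'m \<Rightarrow> real" assume C: "pos_def C" and h: "h \<in> test_fun2"
  \<comment> \<open>Strict positivity of the constants is what \<open>bound\<close> asks for: with a
    zero factor an infinite quantity would be lost.\<close>
  have "0 < mat_op_norm (matrix_inv C) * mat_op_norm C" using pos_def_inv(3)[OF C] by simp
  then have n: "0 < mat_op_norm (matrix_inv C)" "0 < mat_op_norm C"
   using mat_op_norm_nonneg[of C] mat_op_norm_nonneg[of "matrix_inv C"] by (auto simp: zero_less_mult_iff)
  show "ennreal \<bar>(\<integral>u. h (\<chi> i. F i (\<eta> u)) \<partial>M) - (\<integral>u. h (X u) \<partial>N)\<bar> \<le>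
    ennreal (mat_op_norm (matrix_inv C) * mat_op_norm C powr (1 / 2)) * \<zeta>'
       + ennreal (max (2 * mat_op_norm (matrix_inv C) * mat_op_norm C powr (1 / 2))
              (sqrt (2 * pi) / 8 * mat_op_norm (matrix_inv C) powr (3 / 2)
               * mat_op_norm C))
        * zeta4 M L \<eta> F q"
  proof (rule bound)
   fix a2 a3 a4 assume "stein_setting L P Y N X C F p q a2 a3 a4"
   then interpret S: stein_setting L P Y N X C F p q a2 a3 a4 .
   show "\<bar>(\<integral>m. h (\<chi> i. F i m) \<partial>P) - (\<integral>u. h (X u) \<partial>N)\<bar> \<le>
    mat_op_norm (matrix_inv C) * mat_op_norm C powr (1 / 2) * S.\<zeta> +
    max (2 * mat_op_norm (matrix_inv C) * mat_op_norm C powr (1 / 2)) (sqrt (2 * pi) / 8 * mat_op_norm (matrix_inv C) powr (3 / 2) * mat_op_norm C) * S.\<zeta>4"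
    using S.test_fun2_bound[OF C h] by (simp add: S.V_def)
  qed (use n test_fun2D[OF h] in \<open>auto simp: less_max_iff_disj\<close>)
 qed
qed

end
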